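(* There exists $\delta>0$ such that the following holds. Let $(v_1(0),v_2(0))$ be odd functions of $r\in\mathbb{R}$ satisfying $$\int_{\mathbb{R}} \left(v_2^2(0)+v_{1,r}^2(0)+\frac{v_1^2(0)}{1+r^2}\right)(1+r^2)^{1/2}\,dr<\delta ,$$ and let $(v_1(t),v_2(t))$ be the corresponding solution, for $t\ge 0$, of $$\dot v_1=v_2,\qquad \dot v_2=v_{1,rr}+\frac{r}{1+r^2}v_{1,r}+\frac{f'(H)}{1+r^2}v_1+\frac{N(v_1)}{1+r^2},\qquad r\in\mathbb{R}.$$ Then for any $R>0$ $$\lim_{t\to\infty}\int_{-R}^{R}\left(v_2^2(t)+v_{1,r}^2(t)+v_1^2(t)\right)dr=0,$$ and $$\lim_{t\to\infty}\int_{\mathbb{R}}\frac{\min\{1,|r|^{-1}\}}{(1+r^2)^{1/2}}\,v_1^2(t)\,dr=0 .$$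
   Context: Here $f(u)=2u(1-u^2)$, $H(r)=\frac{r}{\sqrt{1+r^2}}$, and $N(v)=f(H+v)-f(H)-f'(H)v=-6Hv^2-2v^3$. A dot denotes $\partial_t$ and a subscript $r$ denotes $\partial_r$. The function $H$ (the kink) is a stationary solution of $u_{tt}=u_{rr}+\frac{r}{1+r^2}u_r+\frac{f(u)}{1+r^2}$, and the system for $(v_1,v_2)$ is this equation written for $u=H+v_1$, $u_t=v_2$. Solutions are understood in the energy space, i.e. continuous in $t\ge 0$ with values in the space of pairs $(v_1,v_2)$ of odd functions of $r$ with finite norm squared $\int_{\mathbb{R}} \left(v_2^2+v_{1,r}^2+\frac{v_1^2}{1+r^2}\right)(1+r^2)^{1/2}\,dr$. *)

theory Defs
  imports "HOL-Analysis.Analysis"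
begin

definition nonlin :: "real \<Rightarrow> real" where
  "nonlin u = 2 * u * (1 - u^2)"

definition kink :: "real \<Rightarrow> real" where
  "kink r = r / sqrt (1 + r^2)"

definition remainder :: "real \<Rightarrow> real \<Rightarrow> real" where
  "remainder r v = nonlin (kink r + v) - nonlin (kink r) - deriv nonlin (kink r) * v"

lemma deriv_nonlin: "deriv nonlin u = 2 - 6 * u^2"
  unfolding nonlin_def
  by (rule DERIV_imp_deriv) (auto intro!: derivative_eq_intros simp: power2_eq_square algebra_simps)

lemma remainder_eq: "remainder r v = - 6 * kink r * v^2 - 2 * v^3"
  by (simp add: remainder_def deriv_nonlin nonlin_def algebra_simps power2_eq_square power3_eq_cube)

definition test_function :: "(real \<Rightarrow> real) \<Rightarrow> bool" where
  "test_function \<phi> \<longleftrightarrow> \<phi> C1_differentiable_on UNIV \<and> compact (closure {r. \<phi> r \<noteq> 0})"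

definition locally_integrable :: "(real \<Rightarrow> real) \<Rightarrow> bool" where
  "locally_integrable u \<longleftrightarrow> (\<forall>a b. set_integrable lborel {a..b} u)"

definition has_weak_derivative :: "(real \<Rightarrow> real) \<Rightarrow> (real \<Rightarrow> real) \<Rightarrow> bool" where
  "has_weak_derivative u g \<longleftrightarrow>
     locally_integrable u \<and> locally_integrable g \<and>
     (\<forall>\<phi>. test_function \<phi> \<longrightarrow>
        (LINT r|lborel. u r * deriv \<phi> r) = - (LINT r|lborel. g r * \<phi> r))"

text \<open>The weak derivative is unique only up to null sets; \<open>weak_deriv\<close> picks a
  representative and is used under integrals only.\<close>

definition weak_deriv :: "(real \<Rightarrow> real) \<Rightarrow> real \<Rightarrow> real" where
  "weak_deriv u = (SOME g. has_weak_derivative u g)"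

definition energy_density :: "(real \<Rightarrow> real) \<Rightarrow> (real \<Rightarrow> real) \<Rightarrow> real \<Rightarrow> real" where
  "energy_density u w r =
     ((w r)^2 + (weak_deriv u r)^2 + (u r)^2 / (1 + r^2)) * sqrt (1 + r^2)"

definition energy_norm_sq :: "(real \<Rightarrow> real) \<Rightarrow> (real \<Rightarrow> real) \<Rightarrow> real" where
  "energy_norm_sq u w = (LINT r|lborel. energy_density u w r)"

text \<open>Elements of the energy space are classes modulo null sets, given here by Borel
  representatives; oddness is accordingly required almost everywhere.\<close>

definition energy_space :: "((real \<Rightarrow> real) \<times> (real \<Rightarrow> real)) set" where
  "energy_space = {(u, w).
     u \<in> borel_measurable borel \<and> w \<in> borel_measurable borel \<and>
     (AE r in lborel. u (- r) = - u r) \<and> (AE r in lborel. w (- r) = - w r) \<and>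
     (\<exists>g. has_weak_derivative u g) \<and>
     integrable lborel (energy_density u w)}"

text \<open>A solution is a curve on \<open>t \<ge> 0\<close>, continuous with values in the energy space, along which
  both equations hold in the weak sense: at every time, after pairing with every test function in
  \<open>r\<close> and moving one derivative of \<open>v\<^sub>1\<^sub>,\<^sub>r\<^sub>r\<close> onto it. The time argument comes
  first; values at negative times are irrelevant.\<close>

definition energy_solution :: "(real \<Rightarrow> real \<Rightarrow> real) \<Rightarrow> (real \<Rightarrow> real \<Rightarrow> real) \<Rightarrow> bool" where
  "energy_solution v1 v2 \<longleftrightarrow>
     (\<forall>t\<ge>0. (v1 t, v2 t) \<in> energy_space) \<and>
     (\<forall>t\<ge>0. ((\<lambda>s. energy_norm_sq (\<lambda>r. v1 s r - v1 t r) (\<lambda>r. v2 s r - v2 t r)) \<longlongrightarrow> 0)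
               (at t within {0..})) \<and>
     (\<forall>t\<ge>0. \<forall>\<phi>. test_function \<phi> \<longrightarrow>
        ((\<lambda>s. LINT r|lborel. v1 s r * \<phi> r) has_real_derivative
           (LINT r|lborel. v2 t r * \<phi> r)) (at t within {0..}) \<and>
        ((\<lambda>s. LINT r|lborel. v2 s r * \<phi> r) has_real_derivative
           (LINT r|lborel.
              - weak_deriv (v1 t) r * deriv \<phi> r
              + (r / (1 + r^2) * weak_deriv (v1 t) r
                 + deriv nonlin (kink r) / (1 + r^2) * v1 t r
                 + remainder r (v1 t r) / (1 + r^2)) * \<phi> r)) (at t within {0..}))"

end

theory Submission
  imports Defs
begin

text \<open>
  The energy is conserved, and because \<open>v\<close> is odd it controls the weighted norm: on each half line \<open>v\<close>
  vanishes at the origin, which removes the unstable direction. Hence small data stay uniformly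
  small, in particular in the supremum norm. The virial functional with multiplier
  \<open>-r v\<^sub>r - v/2\<close> is bounded by the norm, and its time derivative dominates the locally weighted
  \<open>v\<^sub>r\<close> and \<open>v\<close> norms; a small multiple of the functional with multiplier \<open>v/(1+r\<^sup>2)\<close> adds
  the \<open>v\<^sub>t\<close> norm. So the local energy with weight \<open>1/(1+r\<^sup>2)\<close> is integrable in time, and as it is also
  Lipschitz in time it tends to zero; the tails are controlled by the weighted norm.

  As the equations hold only weakly in space, all identities are first
  established for the solution mollified in \<open>r\<close> and for compactly supported weights, and then passed to the limit.
\<close>

section \<open>Square integrable functions and mollification\<close>

text \<open>Multiplied by \<open>jb\<close>, that is sqrt (1 + r^2), the linear part becomes the
  divergence (\<open>jb\<close> v_r)_r plus a potential term, which fixes the weights of the energy.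
  The norm gives v_r the weight \<open>jb\<close> and v the weight 1 / \<open>jb\<close>; their
  product is 1, so v^2, vanishing at the origin, is bounded by an integral of 2 |v v_r| without
  loss. Smallness is thus pointwise, and the cubic and quartic terms can be handled inside
  one-dimensional inequalities. Neither the energy density nor the virial density is pointwise
  nonnegative, because f'(H) is positive near r = 0. Both become so after subtracting the total
  derivative of m v^2 (for the virial also of multiples of v^3 and v^4) with explicit multipliers on
  r \<ge> 0: the boundary terms vanish at 0 and at infinity, and what remains is a discriminant
  condition, a polynomial inequality in one variable. The fractions 1/200, 1/400, 1/500 are slack in
  these inequalities. Some weights grow like \<open>jb\<close>, the most that the norm controls, so
  removing the spatial cutoff needs cutoffs whose derivatives are O(1 / \<open>jb\<close>) uniformly
  in the scale.\<close>

definition sqint :: "(real \<Rightarrow> real) \<Rightarrow> bool" where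
  "sqint f \<longleftrightarrow> f \<in> borel_measurable borel \<and> integrable lborel (\<lambda>x. (f x)\<^sup>2)"

definition norm2 :: "(real \<Rightarrow> real) \<Rightarrow> real" where
  "norm2 f = sqrt (LINT x|lborel. (f x)\<^sup>2)"

lemma sqint_measurable [measurable_dest]: "sqint f \<Longrightarrow> f \<in> borel_measurable borel"
  by (simp add: sqint_def)

lemma sqint_integrable: "sqint f \<Longrightarrow> integrable lborel (\<lambda>x. (f x)\<^sup>2)"
  by (simp add: sqint_def)

lemma sqint_bound:
  assumes "sqint f" "h \<in> borel_measurable borel" "AE x in lborel. \<bar>h x\<bar> \<le> C * \<bar>f x\<bar>"
  shows "sqint h"
  unfolding sqint_def
proof (intro conjI)
  show "integrable lborel (\<lambda>x. (h x)\<^sup>2)"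
  proof (rule Bochner_Integration.integrable_bound)
    show "integrable lborel (\<lambda>x. C\<^sup>2 * (f x)\<^sup>2)" using sqint_integrable[OF assms(1)] by simp
    show "AE x in lborel. norm ((h x)\<^sup>2) \<le> norm (C\<^sup>2 * (f x)\<^sup>2)"
      using assms(3)
    proof eventually_elim
      case (elim x)
      then have "\<bar>h x\<bar>\<^sup>2 \<le> (C * \<bar>f x\<bar>)\<^sup>2" by (intro power_mono) auto
      then show ?case by (simp add: power_mult_distrib)
    qed
  qed (use assms(2) in measurable)
qed (use assms in auto)

lemma sqint_mult:
  assumes "sqint f" "sqint h"
  shows "integrable lborel (\<lambda>x. f x * h x)"
proof (rule Bochner_Integration.integrable_bound)
  show "integrable lborel (\<lambda>x. (f x)\<^sup>2 + (h x)\<^sup>2)"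
    using assms by (auto simp: sqint_def)
  show "(\<lambda>x. f x * h x) \<in> borel_measurable lborel" using assms by (simp add: sqint_measurable)
  have "\<bar>a * b\<bar> \<le> a\<^sup>2 + b\<^sup>2" for a b :: real
  proof -
    have "2 * \<bar>a * b\<bar> \<le> a\<^sup>2 + b\<^sup>2" using sum_squares_bound[of "\<bar>a\<bar>" "\<bar>b\<bar>"] by (simp add: abs_mult)
    then show ?thesis using abs_ge_zero[of "a * b"] by linarith
  qed
  then show "AE x in lborel. norm (f x * h x) \<le> norm ((f x)\<^sup>2 + (h x)\<^sup>2)" by simp
qed

lemma sqint_add: "sqint f \<Longrightarrow> sqint h \<Longrightarrow> sqint (\<lambda>x. f x + h x)"
  using sqint_mult[of f h] unfolding sqint_def by (auto simp: power2_sum mult.assoc)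

lemma sqint_cmult: "sqint f \<Longrightarrow> sqint (\<lambda>x. c * f x)"
  unfolding sqint_def by (auto simp: power_mult_distrib)

lemma sqint_diff: "sqint f \<Longrightarrow> sqint h \<Longrightarrow> sqint (\<lambda>x. f x - h x)"
  using sqint_add[of f "\<lambda>x. (-1) * h x"] sqint_cmult[of h "-1"] by simp

lemma sqint_bdd_mult:
  assumes "sqint f" "\<omega> \<in> borel_measurable borel" "\<And>x. \<bar>\<omega> x\<bar> \<le> B"
  shows "sqint (\<lambda>x. \<omega> x * f x)"
  by (rule sqint_bound[OF assms(1), of _ B])
     (use assms in \<open>auto simp: abs_mult intro!: mult_right_mono sqint_measurable\<close>)

lemma norm2_nonneg [simp]: "0 \<le> norm2 f" by (simp add: norm2_def)

lemma norm2_sq: "(norm2 f)\<^sup>2 = (LINT x|lborel. (f x)\<^sup>2)"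
  by (simp add: norm2_def)

lemma norm2_mono:
  assumes "sqint f" "h \<in> borel_measurable borel" "AE x in lborel. \<bar>h x\<bar> \<le> C * \<bar>f x\<bar>" "C \<ge> 0"
  shows "norm2 h \<le> C * norm2 f"
proof -
  have "(LINT x|lborel. (h x)\<^sup>2) \<le> (LINT x|lborel. C\<^sup>2 * (f x)\<^sup>2)"
  proof (rule integral_mono_AE)
    show "AE x in lborel. (h x)\<^sup>2 \<le> C\<^sup>2 * (f x)\<^sup>2"
      using assms(3)
    proof eventually_elim
      case (elim x)
      then have "\<bar>h x\<bar>\<^sup>2 \<le> (C * \<bar>f x\<bar>)\<^sup>2" by (intro power_mono) auto
      then show ?case by (simp add: power_mult_distrib)
    qed
  qed (use sqint_integrable[OF sqint_bound[OF assms(1-3)]] sqint_integrable[OF assms(1)] in auto)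
  then have "norm2 h \<le> sqrt (C\<^sup>2 * (LINT x|lborel. (f x)\<^sup>2))"
    unfolding norm2_def by (intro real_sqrt_le_mono) simp
  then show ?thesis using \<open>C \<ge> 0\<close> by (simp add: norm2_def real_sqrt_mult)
qed

lemma norm2_CS:
  assumes "sqint f" "sqint h"
  shows "\<bar>LINT x|lborel. f x * h x\<bar> \<le> norm2 f * norm2 h"
proof -
  define A B C where "A = (LINT x|lborel. (f x)\<^sup>2)" and "B = (LINT x|lborel. f x * h x)"
    and "C = (LINT x|lborel. (h x)\<^sup>2)"
  note i = sqint_integrable[OF assms(1)] sqint_integrable[OF assms(2)] sqint_mult[OF assms]
  \<comment> \<open>A quadratic in \<open>t\<close> that never becomes negative;
    \<open>B\<^sup>2 \<le> A * C\<close> is its discriminant condition. If \<open>C = 0\<close> and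
    \<open>B\<close> were nonzero, the value \<open>t = (A + 1) / (2 * B)\<close> would make it
    -1.\<close>
  have pos: "0 \<le> A - 2 * t * B + t\<^sup>2 * C" for t
  proof -
    have "0 \<le> (LINT x|lborel. (f x - t * h x)\<^sup>2)" by simp
    also have "(\<lambda>x. (f x - t * h x)\<^sup>2) = (\<lambda>x. ((f x)\<^sup>2 - 2 * t * (f x * h x)) + t\<^sup>2 * (h x)\<^sup>2)"
      by (simp add: power2_diff power_mult_distrib algebra_simps)
    also have "(LINT x|lborel. ((f x)\<^sup>2 - 2 * t * (f x * h x)) + t\<^sup>2 * (h x)\<^sup>2) = A - 2 * t * B + t\<^sup>2 * C"
      using i by (simp add: A_def B_def C_def)
    finally show ?thesis .
  qed
  have AC: "A \<ge> 0" "C \<ge> 0" by (auto simp: A_def C_def)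
  have "B\<^sup>2 \<le> A * C"
  proof (cases "C = 0")
    case True
    have "B = 0"
    proof (rule ccontr)
      assume "B \<noteq> 0"
      then show False using pos[of "(A + 1) / (2 * B)"] True by simp
    qed
    then show ?thesis using True by simp
  next
    case False
    then have "C > 0" using AC by simp
    have "0 \<le> A - B\<^sup>2 / C"
      using pos[of "B / C"] False by (simp add: power2_eq_square power_divide)
    then show ?thesis using \<open>C > 0\<close> by (simp add: field_simps)
  qed
  then have "sqrt (B\<^sup>2) \<le> sqrt (A * C)" by (rule real_sqrt_le_mono)
  then show ?thesis by (simp add: real_sqrt_mult norm2_def A_def B_def C_def)
qed

lemma norm2_triangle:
  assumes "sqint f" "sqint h"
  shows "norm2 (\<lambda>x. f x + h x) \<le> norm2 f + norm2 h"
proof -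
  note i = sqint_integrable[OF assms(1)] sqint_integrable[OF assms(2)] sqint_mult[OF assms]
  have "(\<lambda>x. (f x + h x)\<^sup>2) = (\<lambda>x. ((f x)\<^sup>2 + 2 * (f x * h x)) + (h x)\<^sup>2)"
    by (simp add: power2_sum algebra_simps)
  then have "(norm2 (\<lambda>x. f x + h x))\<^sup>2 = (norm2 f)\<^sup>2 + 2 * (LINT x|lborel. f x * h x) + (norm2 h)\<^sup>2"
    using i by (simp add: norm2_sq)
  also have "\<dots> \<le> (norm2 f + norm2 h)\<^sup>2"
    using norm2_CS[OF assms] by (simp add: power2_sum)
  finally show ?thesis by (rule power2_le_imp_le) simp
qed

lemma norm2_triangle_diff:
  assumes "sqint f" "sqint g" "sqint h"
  shows "norm2 (\<lambda>x. f x - h x) \<le> norm2 (\<lambda>x. f x - g x) + norm2 (\<lambda>x. g x - h x)"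
  using norm2_triangle[OF sqint_diff[OF assms(1,2)] sqint_diff[OF assms(2,3)]] by simp

lemma norm2_minus: "norm2 (\<lambda>x. f x - h x) = norm2 (\<lambda>x. h x - f x)"
  by (simp add: norm2_def power2_commute)

lemma norm2_tendsto_iff:
  "((\<lambda>n. norm2 (f n)) \<longlongrightarrow> 0) F \<longleftrightarrow> ((\<lambda>n. LINT x|lborel. (f n x)\<^sup>2) \<longlongrightarrow> 0) F"
proof
  assume "((\<lambda>n. norm2 (f n)) \<longlongrightarrow> 0) F"
  from tendsto_power[OF this, of 2] show "((\<lambda>n. LINT x|lborel. (f n x)\<^sup>2) \<longlongrightarrow> 0) F"
    by (simp add: norm2_sq)
next
  assume "((\<lambda>n. LINT x|lborel. (f n x)\<^sup>2) \<longlongrightarrow> 0) F"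
  from tendsto_real_sqrt[OF this] show "((\<lambda>n. norm2 (f n)) \<longlongrightarrow> 0) F"
    by (simp add: norm2_def)
qed

text \<open>Telescoping f h - f0 h0 = (f - f0) h + f0 (h - h0) and Cauchy-Schwarz, with the norm of
  h bounded by its distance to h0 plus the norm of h0. Quadratic quantities pass to the limit under
  mollification through this.\<close>

lemma norm2_prod_tendsto:
  assumes fn: "\<And>n. sqint (f n)" and hn: "\<And>n. sqint (h n)" and f: "sqint f0" and h: "sqint h0"
    and "((\<lambda>n. norm2 (\<lambda>x. f n x - f0 x)) \<longlongrightarrow> 0) F"
    and "((\<lambda>n. norm2 (\<lambda>x. h n x - h0 x)) \<longlongrightarrow> 0) F"
  shows "((\<lambda>n. LINT x|lborel. f n x * h n x) \<longlongrightarrow> (LINT x|lborel. f0 x * h0 x)) F"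
proof -
  have "((\<lambda>n. norm2 (\<lambda>x. f n x - f0 x) * (norm2 (\<lambda>x. h n x - h0 x) + norm2 h0)
       + norm2 f0 * norm2 (\<lambda>x. h n x - h0 x)) \<longlongrightarrow> 0 * (0 + norm2 h0) + norm2 f0 * 0) F"
    by (intro tendsto_intros assms)
  then have lim: "((\<lambda>n. norm2 (\<lambda>x. f n x - f0 x) * (norm2 (\<lambda>x. h n x - h0 x) + norm2 h0)
       + norm2 f0 * norm2 (\<lambda>x. h n x - h0 x)) \<longlongrightarrow> 0) F" by simp
  have bd: "\<bar>(LINT x|lborel. f n x * h n x) - (LINT x|lborel. f0 x * h0 x)\<bar>
    \<le> norm2 (\<lambda>x. f n x - f0 x) * (norm2 (\<lambda>x. h n x - h0 x) + norm2 h0)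
       + norm2 f0 * norm2 (\<lambda>x. h n x - h0 x)" for n
  proof -
    note d = sqint_diff[OF fn[of n] f] sqint_diff[OF hn[of n] h]
    have "norm2 (h n) \<le> norm2 (\<lambda>x. h n x - h0 x) + norm2 h0"
      using norm2_triangle[OF d(2) h] by simp
    then have 1: "\<bar>LINT x|lborel. (f n x - f0 x) * h n x\<bar>
       \<le> norm2 (\<lambda>x. f n x - f0 x) * (norm2 (\<lambda>x. h n x - h0 x) + norm2 h0)"
      by (intro order_trans[OF norm2_CS[OF d(1) hn[of n]]] mult_left_mono) auto
    have 2: "\<bar>LINT x|lborel. f0 x * (h n x - h0 x)\<bar> \<le> norm2 f0 * norm2 (\<lambda>x. h n x - h0 x)"
      by (rule norm2_CS[OF f d(2)])
    have "(LINT x|lborel. f n x * h n x) - (LINT x|lborel. f0 x * h0 x)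
       = (LINT x|lborel. (f n x - f0 x) * h n x) + (LINT x|lborel. f0 x * (h n x - h0 x))"
      using sqint_mult[OF fn[of n] hn[of n]] sqint_mult[OF f h] sqint_mult[OF f hn[of n]]
      by (simp add: algebra_simps)
    then show ?thesis using 1 2 by linarith
  qed
  have "((\<lambda>n. (LINT x|lborel. f n x * h n x) - (LINT x|lborel. f0 x * h0 x)) \<longlongrightarrow> 0) F"
  proof (rule metric_tendsto_imp_tendsto[OF lim], intro always_eventually allI)
    fix n
    show "dist ((LINT x|lborel. f n x * h n x) - (LINT x|lborel. f0 x * h0 x)) 0
       \<le> dist (norm2 (\<lambda>x. f n x - f0 x) * (norm2 (\<lambda>x. h n x - h0 x) + norm2 h0)
       + norm2 f0 * norm2 (\<lambda>x. h n x - h0 x)) 0"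
      using bd[of n] unfolding dist_real_def by linarith
  qed
  then show ?thesis by (simp add: LIM_zero_iff)
qed

lemma norm2_dominated_tendsto:
  fixes f :: "nat \<Rightarrow> real \<Rightarrow> real"
  assumes [measurable]: "\<And>n. f n \<in> borel_measurable borel" "f0 \<in> borel_measurable borel"
    and "sqint h" "AE x in lborel. (\<lambda>n. f n x) \<longlonglongrightarrow> f0 x"
    and b: "\<And>n. AE x in lborel. \<bar>f n x - f0 x\<bar> \<le> \<bar>h x\<bar>"
  shows "(\<lambda>n. norm2 (\<lambda>x. f n x - f0 x)) \<longlonglongrightarrow> 0"
proof -
  have "(\<lambda>n. LINT x|lborel. (f n x - f0 x)\<^sup>2) \<longlonglongrightarrow> (LINT x::real|lborel. (0::real))"
  proof (rule integral_dominated_convergence)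
    show "integrable lborel (\<lambda>x. (h x)\<^sup>2)" by (rule sqint_integrable[OF assms(3)])
    show "AE x in lborel. (\<lambda>n. (f n x - f0 x)\<^sup>2) \<longlonglongrightarrow> 0"
      using assms(4)
    proof eventually_elim
      case (elim x)
      have "(\<lambda>n. (f n x - f0 x)\<^sup>2) \<longlonglongrightarrow> (f0 x - f0 x)\<^sup>2" by (intro tendsto_intros elim)
      then show ?case by simp
    qed
    fix n show "AE x in lborel. norm ((f n x - f0 x)\<^sup>2) \<le> (h x)\<^sup>2"
      using b[of n] by eventually_elim (simp add: abs_le_square_iff[symmetric])
  qed auto
  then show ?thesis by (simp add: norm2_tendsto_iff)
qed

lemma sqint_bounded_support:
  assumes "f \<in> borel_measurable borel" "\<And>x. \<bar>f x\<bar> \<le> B" "\<And>x. \<bar>x\<bar> > L \<Longrightarrow> f x = 0"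
  shows "sqint f"
proof -
  have i: "integrable lborel (indicat_real {-L..L})"
    using emeasure_lborel_Icc_eq[of "-L" L] by (auto simp: integrable_indicator_iff)
  have "sqint (indicat_real {-L..L})"
  proof -
    have "(\<lambda>x. (indicat_real {-L..L} x)\<^sup>2) = indicat_real {-L..L}" by (auto simp: indicator_def)
    then show ?thesis unfolding sqint_def using i by simp
  qed
  then show ?thesis
  proof (rule sqint_bound[of _ _ B])
    show "AE x in lborel. \<bar>f x\<bar> \<le> B * \<bar>indicat_real {-L..L} x\<bar>"
    proof (rule AE_I2)
      fix x show "\<bar>f x\<bar> \<le> B * \<bar>indicat_real {-L..L} x\<bar>"
        using assms(2)[of x] assms(3)[of x] by (cases "\<bar>x\<bar> > L") (auto simp: indicator_def abs_le_iff)
    qed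
  qed (rule assms(1))
qed

text \<open>Density of the continuous functions of bounded support in L^2. Truncation in height and
  support reduces the claim to a bounded function that vanishes outside a bounded interval.\<close>

lemma sqint_approx_continuous:
  assumes "sqint f" "\<epsilon> > 0"
  obtains g L where "continuous_on UNIV g" "\<And>x. \<bar>x\<bar> > L \<Longrightarrow> g x = 0" "sqint g"
    "norm2 (\<lambda>x. f x - g x) < \<epsilon>"
proof -
  have fm [measurable]: "f \<in> borel_measurable borel" using assms by (simp add: sqint_def)
  define fm where "fm m x = indicat_real {-real m..real m} x * max (- real m) (min (real m) (f x))" for m :: nat and x
  have [measurable]: "fm m \<in> borel_measurable borel" for m unfolding fm_def by measurable
  have "(\<lambda>m. norm2 (\<lambda>x. fm m x - f x)) \<longlonglongrightarrow> 0"
  proof (rule norm2_dominated_tendsto[OF _ _ assms(1)])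
    show "AE x in lborel. (\<lambda>m. fm m x) \<longlonglongrightarrow> f x"
    proof (intro AE_I2 tendsto_eventually)
      fix x
      obtain K :: nat where K: "K \<ge> \<bar>x\<bar> + \<bar>f x\<bar>" using real_arch_simple by blast
      then have "fm m x = f x" if "m \<ge> K" for m
      proof -
        have "real m \<ge> \<bar>x\<bar> + \<bar>f x\<bar>" using that K by linarith
        then show ?thesis by (auto simp: fm_def indicator_def)
      qed
      then show "\<forall>\<^sub>F m in sequentially. fm m x = f x" using eventually_at_top_linorder by blast
    qed
  qed (auto simp: fm_def indicator_def intro!: AE_I2)
  then have "\<forall>\<^sub>F m in sequentially. norm2 (\<lambda>x. fm m x - f x) < \<epsilon> / 2"
    using assms(2) by (intro order_tendstoD(2)) auto
  then obtain m where m: "norm2 (\<lambda>x. fm m x - f x) < \<epsilon> / 2"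
    using eventually_happens'[OF sequentially_bot] by blast
  define M where "M = real m"
  have M: "M \<ge> 0" "\<bar>fm m x\<bar> \<le> M" "\<bar>x\<bar> > M \<Longrightarrow> fm m x = 0" for x
    by (auto simp: fm_def M_def indicator_def)
  \<comment> \<open>Lebesgue measurability yields continuous functions that converge almost
    everywhere but have no common bound. Clamping to [-M, M] and multiplying by the plateau function
    \<open>c\<close> restores a common bound and support, so that dominated convergence
    applies.\<close>
  have "fm m \<in> borel_measurable (lebesgue_on UNIV)"
    by (simp add: lebesgue_on_UNIV_eq measurable_completion)
  then have "(fm m) measurable_on UNIV"
    by (simp add: measurable_on_iff_borel_measurable)
  then obtain N g where N: "negligible N" and g: "\<And>n. continuous_on UNIV (g n)"
      and lim: "\<And>x. x \<notin> N \<Longrightarrow> (\<lambda>n. g n x) \<longlonglongrightarrow> fm m x"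
    unfolding measurable_on_def by (auto simp: fun_eq_iff)
  define c where "c x = max 0 (min 1 (M + 1 - \<bar>x\<bar>))" for x
  define gn where "gn n x = c x * max (- M) (min M (g n x))" for n x
  have cgn: "continuous_on UNIV (gn n)" for n
    unfolding gn_def c_def by (intro continuous_intros g)
  then have [measurable]: "gn n \<in> borel_measurable borel" for n
    by (rule borel_measurable_continuous_onI)
  have c: "0 \<le> c x" "c x \<le> 1" "\<bar>x\<bar> > M + 1 \<Longrightarrow> c x = 0" "\<bar>x\<bar> \<le> M \<Longrightarrow> c x = 1" for x by (auto simp: c_def)
  have bgn: "\<bar>gn n x\<bar> \<le> M" for n x
  proof -
    have "\<bar>max (- M) (min M (g n x))\<bar> \<le> M" using M(1) by auto
    then have "c x * \<bar>max (- M) (min M (g n x))\<bar> \<le> 1 * M" using c[of x] by (intro mult_mono) auto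
    then show ?thesis using c(1)[of x] by (simp add: gn_def abs_mult)
  qed
  have sgn: "\<bar>x\<bar> > M + 1 \<Longrightarrow> gn n x = 0" for n x by (simp add: gn_def c)
  have sq: "sqint (gn n)" for n
    by (rule sqint_bounded_support[OF _ bgn sgn]) auto
  have sqm: "sqint (fm m)"
    by (rule sqint_bounded_support[OF _ M(2) M(3)]) auto
  have AEN: "AE x in lborel. x \<notin> N"
  proof -
    have "AE x in lebesgue. x \<notin> N" using N unfolding eventually_ae_filter_negligible by auto
    then show ?thesis by (simp add: AE_completion_iff)
  qed
  have "(\<lambda>n. norm2 (\<lambda>x. gn n x - fm m x)) \<longlonglongrightarrow> 0"
  proof (rule norm2_dominated_tendsto)
    show "sqint (\<lambda>x. 2 * M * indicat_real {-(M+1)..M+1} x)"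
      by (rule sqint_bounded_support[of _ "2 * M" "M + 1"]) (auto simp: indicator_def M)
    show "AE x in lborel. (\<lambda>n. gn n x) \<longlonglongrightarrow> fm m x"
      using AEN
    proof eventually_elim
      case (elim x)
      have "(\<lambda>n. gn n x) \<longlonglongrightarrow> c x * max (- M) (min M (fm m x))"
        unfolding gn_def by (intro tendsto_intros lim elim)
      also have "c x * max (- M) (min M (fm m x)) = fm m x"
        using M(1) M(2)[of x] M(3)[of x] c(4)[of x] by (cases "\<bar>x\<bar> \<le> M") auto
      finally show ?case .
    qed
    show "AE x in lborel. \<bar>gn n x - fm m x\<bar> \<le> \<bar>2 * M * indicator {- (M + 1)..M + 1} x\<bar>" for n
    proof (rule AE_I2)
      fix x show "\<bar>gn n x - fm m x\<bar> \<le> \<bar>2 * M * indicator {- (M + 1)..M + 1} x\<bar>"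
        using bgn[of n x] M(2)[of x] M(3)[of x] sgn[of x n] M(1) by (auto simp: indicator_def)
    qed
  qed auto
  then have "\<forall>\<^sub>F n in sequentially. norm2 (\<lambda>x. gn n x - fm m x) < \<epsilon> / 2"
    using assms(2) by (intro order_tendstoD(2)) auto
  then obtain n where n: "norm2 (\<lambda>x. gn n x - fm m x) < \<epsilon> / 2"
    using eventually_happens'[OF sequentially_bot] by blast
  have "norm2 (\<lambda>x. f x - gn n x) \<le> norm2 (\<lambda>x. f x - fm m x) + norm2 (\<lambda>x. fm m x - gn n x)"
    by (rule norm2_triangle_diff[OF assms(1) sqm sq])
  also have "\<dots> < \<epsilon>" using m n norm2_minus[of f "fm m"] norm2_minus[of "fm m" "gn n"] by linarith
  finally show thesis using that[OF cgn sgn sq] by blast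
qed

section \<open>Local square integrability and convolution with compactly supported kernels\<close>

definition conv :: "(real \<Rightarrow> real) \<Rightarrow> (real \<Rightarrow> real) \<Rightarrow> real \<Rightarrow> real" where
  "conv k f x = (LINT y|lborel. f y * k (x - y))"

text \<open>The energy norm controls \<open>v\<close> only with the weight 1 / \<open>jb\<close>, so
  \<open>v\<close> itself need not be square integrable on the line; the first half of the argument
  works on compact intervals.\<close>

definition locsq :: "(real \<Rightarrow> real) \<Rightarrow> bool" where
  "locsq f \<longleftrightarrow> f \<in> borel_measurable borel \<and> (\<forall>L. sqint (\<lambda>x. indicator {-L..L} x * f x))"

definition locnorm :: "real \<Rightarrow> (real \<Rightarrow> real) \<Rightarrow> real" where
  "locnorm L f = norm2 (\<lambda>x. indicator {-L..L} x * f x)"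

lemma locsq_measurable [measurable_dest]: "locsq f \<Longrightarrow> f \<in> borel_measurable borel"
  by (simp add: locsq_def)

lemma locsq_sqint: "locsq f \<Longrightarrow> sqint (\<lambda>x. indicator {-L..L} x * f x)"
  by (simp add: locsq_def)

lemma locnorm_nonneg [simp]: "0 \<le> locnorm L f" by (simp add: locnorm_def)

lemma sqint_imp_locsq: "sqint f \<Longrightarrow> locsq f"
  unfolding locsq_def using sqint_bdd_mult[of f "indicator {-L..L}" 1 for L]
  by (auto simp: sqint_measurable)

lemma locsq_diff: "locsq f \<Longrightarrow> locsq h \<Longrightarrow> locsq (\<lambda>x. f x - h x)"
  unfolding locsq_def using sqint_diff by (auto simp: right_diff_distrib)

lemma locsq_add: "locsq f \<Longrightarrow> locsq h \<Longrightarrow> locsq (\<lambda>x. f x + h x)"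
  unfolding locsq_def using sqint_add by (auto simp: distrib_left)

lemma locsq_continuous:
  assumes "continuous_on UNIV f" shows "locsq f"
  unfolding locsq_def
proof (intro conjI allI)
  show [measurable]: "f \<in> borel_measurable borel" using assms by (rule borel_measurable_continuous_onI)
  fix L :: real
  have "compact (f ` {-L..L})"
    by (intro compact_continuous_image continuous_on_subset[OF assms]) auto
  then obtain B where B: "\<forall>y\<in>f ` {-L..L}. \<bar>y\<bar> \<le> B" using compact_imp_bounded bounded_iff by (metis real_norm_def)
  show "sqint (\<lambda>x. indicator {-L..L} x * f x)"
    by (rule sqint_bounded_support[of _ "max B 0" L]) (use B in \<open>auto simp: indicator_def intro: max.coboundedI1\<close>)
qed

lemma locsq_bdd_mult:
  assumes "locsq f" "continuous_on UNIV \<omega>"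
  shows "locsq (\<lambda>x. \<omega> x * f x)"
  unfolding locsq_def
proof (intro conjI allI)
  have [measurable]: "\<omega> \<in> borel_measurable borel" using assms(2) by (rule borel_measurable_continuous_onI)
  have [measurable]: "f \<in> borel_measurable borel" using assms(1) by (simp add: locsq_def)
  show "(\<lambda>x. \<omega> x * f x) \<in> borel_measurable borel" by measurable
  fix L :: real
  have "compact (\<omega> ` {-L..L})"
    by (intro compact_continuous_image continuous_on_subset[OF assms(2)]) auto
  then obtain B where B: "\<forall>y\<in>\<omega> ` {-L..L}. \<bar>y\<bar> \<le> B" using compact_imp_bounded bounded_iff by (metis real_norm_def)
  have "sqint (\<lambda>x. (indicator {-L..L} x * \<omega> x) * (indicator {-L..L} x * f x))"
    by (rule sqint_bdd_mult[OF locsq_sqint[OF assms(1)], of _ "max B 0"])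
       (use B in \<open>auto simp: indicator_def intro: max.coboundedI1\<close>)
  then show "sqint (\<lambda>x. indicator {-L..L} x * (\<omega> x * f x))"
    by (rule back_subst[of sqint]) (auto simp: indicator_def)
qed

lemma locsq_mult_integrable:
  assumes "locsq f" "locsq h" shows "set_integrable lborel {a..b} (\<lambda>x. f x * h x)"
proof -
  define L where "L = max \<bar>a\<bar> \<bar>b\<bar>"
  have "set_integrable lborel {-L..L} (\<lambda>x. f x * h x)"
    using sqint_mult[OF locsq_sqint[OF assms(1), of L] locsq_sqint[OF assms(2), of L]]
    unfolding set_integrable_def
    by (rule back_subst[of "integrable lborel"]) (auto simp: indicator_def)
  then show ?thesis by (rule set_integrable_subset) (auto simp: L_def)
qed

lemma locsq_integrable: "locsq f \<Longrightarrow> set_integrable lborel {a..b} f"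
  using locsq_mult_integrable[of f "\<lambda>_. 1"] locsq_continuous[of "\<lambda>_. 1"] by simp

lemma locsq_support_integrable:
  assumes "locsq f" "continuous_on UNIV k" "\<And>x. \<bar>x\<bar> > L \<Longrightarrow> k x = 0"
  shows "integrable lborel (\<lambda>x. f x * k x)"
proof -
  have "set_integrable lborel {-L..L} (\<lambda>x. f x * k x)"
    by (rule locsq_mult_integrable[OF assms(1) locsq_continuous[OF assms(2)]])
  then show ?thesis unfolding set_integrable_def
    by (rule back_subst[of "integrable lborel"]) (use assms(3) in \<open>force simp: indicator_def\<close>)
qed

lemma locnorm_mono: assumes "locsq f" "L \<le> M" shows "locnorm L f \<le> locnorm M f"
proof -
  have "norm2 (\<lambda>x. indicator {-L..L} x * f x) \<le> 1 * norm2 (\<lambda>x. indicator {-M..M} x * f x)"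
    by (rule norm2_mono[OF locsq_sqint[OF assms(1)]])
       (use assms locsq_sqint[OF assms(1)] in \<open>auto simp: indicator_def intro!: AE_I2 sqint_measurable\<close>)
  then show ?thesis by (simp add: locnorm_def)
qed

lemma bounded_of_support:
  assumes "continuous_on UNIV k" "\<And>z::real. \<bar>z\<bar> > L \<Longrightarrow> k z = (0::real)"
  obtains B where "B \<ge> 0" "\<And>z. \<bar>k z\<bar> \<le> B"
proof -
  have "compact (k ` {-L..L})"
    by (intro compact_continuous_image continuous_on_subset[OF assms(1)]) auto
  then obtain B where B: "\<forall>y\<in>k ` {-L..L}. \<bar>y\<bar> \<le> B" using compact_imp_bounded bounded_iff by (metis real_norm_def)
  have "\<bar>k z\<bar> \<le> max B 0" for z
  proof (cases "\<bar>z\<bar> > L")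
    case False
    then have "z \<in> {-L..L}" by auto
    then have "\<bar>k z\<bar> \<le> B" using B by blast
    then show ?thesis by simp
  qed (use assms(2)[of z] in simp)
  then show thesis using that[of "max B 0"] by simp
qed

lemma conv_integrable:
  assumes "locsq f" "continuous_on UNIV k" "\<And>z. \<bar>z\<bar> > 1 \<Longrightarrow> k z = 0"
  shows "integrable lborel (\<lambda>y. f y * k (x - y))"
proof (rule locsq_support_integrable[OF assms(1), where L="\<bar>x\<bar> + 1"])
  show "continuous_on UNIV (\<lambda>y. k (x - y))"
    by (intro continuous_on_compose2[OF assms(2)] continuous_intros) auto
qed (use assms(3) in auto)

lemma conv_diff:
  assumes "locsq f" "locsq h" "continuous_on UNIV k" "\<And>z. \<bar>z\<bar> > 1 \<Longrightarrow> k z = 0"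
  shows "conv k (\<lambda>x. f x - h x) x = conv k f x - conv k h x"
  unfolding conv_def using conv_integrable[OF assms(1,3,4)] conv_integrable[OF assms(2,3,4)]
  by (simp add: left_diff_distrib)

text \<open>Kernels are supported in [-1, 1], so only values within distance 1 of \<open>x\<close>
  enter. This is the origin of the enlarged radius \<open>L + 1\<close> in the local
  estimates.\<close>

lemma conv_local:
  assumes "\<And>z. \<bar>z\<bar> > 1 \<Longrightarrow> k z = 0" "\<bar>x\<bar> \<le> L"
  shows "conv k f x = conv k (\<lambda>y. indicator {-(L+1)..L+1} y * f y) x"
  unfolding conv_def
proof (rule Bochner_Integration.integral_cong[OF refl])
  fix y
  show "f y * k (x - y) = indicator {- (L + 1)..L + 1} y * f y * k (x - y)"
    using assms(1)[of "x - y"] assms(2) by (cases "\<bar>x - y\<bar> > 1") (auto simp: indicator_def)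
qed

lemma integral_reflect_shift:
  fixes k :: "real \<Rightarrow> real"
  shows "(LINT y|lborel. k (x - y)) = (LINT y|lborel. k y)"
  using lborel_integral_real_affine[of "-1" "\<lambda>y. k y" x] by simp

lemma sqint_reflect_shift:
  assumes "sqint k" shows "sqint (\<lambda>y. k (x - y))" "norm2 (\<lambda>y. k (x - y)) = norm2 k"
proof -
  have [measurable]: "k \<in> borel_measurable borel" using assms by (rule sqint_measurable)
  show "sqint (\<lambda>y. k (x - y))"
    unfolding sqint_def
    using lborel_integrable_real_affine[OF sqint_integrable[OF assms], of "-1" x] by simp
  show "norm2 (\<lambda>y. k (x - y)) = norm2 k"
    unfolding norm2_def using integral_reflect_shift[of "\<lambda>y. (k y)\<^sup>2" x] by simp
qed

lemma conv_bound:
  assumes "locsq f" "continuous_on UNIV k" "\<And>z. \<bar>z\<bar> > 1 \<Longrightarrow> k z = 0" "\<bar>x\<bar> \<le> L"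
  shows "\<bar>conv k f x\<bar> \<le> locnorm (L + 1) f * norm2 k"
proof -
  obtain B where B: "B \<ge> 0" "\<And>z. \<bar>k z\<bar> \<le> B" using bounded_of_support[OF assms(2,3)] by metis
  have k: "sqint k"
    by (rule sqint_bounded_support[OF borel_measurable_continuous_onI[OF assms(2)] B(2) assms(3)])
  have "conv k f x = conv k (\<lambda>y. indicator {-(L+1)..L+1} y * f y) x"
    by (rule conv_local) (use assms(3,4) in auto)
  also have "\<bar>\<dots>\<bar> \<le> locnorm (L + 1) f * norm2 k"
    using norm2_CS[OF locsq_sqint[OF assms(1), of "L+1"] sqint_reflect_shift(1)[OF k, of x]]
    by (simp add: sqint_reflect_shift(2)[OF k] locnorm_def conv_def)
  finally show ?thesis .
qed

text \<open>Dominated convergence along sequences: by the mean value theorem the difference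
  quotients of the kernel are bounded by the supremum of \<open>k'\<close>, and they vanish for |y|
  > K + 1 as long as \<open>x\<close> and the sequence stay in [-K, K].\<close>

lemma conv_has_real_derivative:
  assumes f: "locsq f"
    and k: "\<And>z. (k has_real_derivative k' z) (at z)" "continuous_on UNIV k'"
    and s: "\<And>z. \<bar>z\<bar> > 1 \<Longrightarrow> k z = 0" "\<And>z. \<bar>z\<bar> > 1 \<Longrightarrow> k' z = 0"
  shows "(conv k f has_real_derivative conv k' f x) (at x)"
proof -
  have kc: "continuous_on UNIV k" using k(1) by (meson DERIV_isCont continuous_at_imp_continuous_on)
  obtain B where B: "B \<ge> 0" "\<And>z. \<bar>k' z\<bar> \<le> B" using bounded_of_support[OF k(2) s(2)] by metis
  have lip: "\<bar>k a - k b\<bar> \<le> B * \<bar>a - b\<bar>" for a b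
  proof -
    have "norm (k a - k b) \<le> B * norm (a - b)"
      by (rule field_differentiable_bound[of UNIV k k']) (use k B in auto)
    then show ?thesis by simp
  qed
  have [measurable]: "f \<in> borel_measurable borel" using f by (simp add: locsq_def)
  have [measurable]: "k \<in> borel_measurable borel" "k' \<in> borel_measurable borel"
    using kc k(2) by (auto intro: borel_measurable_continuous_onI)
  have "((\<lambda>y. (conv k f y - conv k f x) / (y - x)) \<longlongrightarrow> conv k' f x) (at x)"
    unfolding tendsto_at_iff_sequentially
  proof (intro allI impI)
    fix X assume X: "\<forall>i. X i \<in> UNIV - {x}" "X \<longlonglongrightarrow> x"
    from X(2) have "Bseq X" by (intro convergent_imp_Bseq convergentI)
    then obtain K where K: "\<And>n. \<bar>X n\<bar> \<le> K" by (auto simp: Bseq_def)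
    have Kx: "\<bar>x\<bar> \<le> K"
      by (rule LIMSEQ_le_const2[OF tendsto_rabs[OF X(2)]]) (use K in auto)
    have eq: "(conv k f (X i) - conv k f x) / (X i - x)
        = (LINT y|lborel. f y * ((k (X i - y) - k (x - y)) / (X i - x)))" for i
    proof -
      have "conv k f (X i) - conv k f x = (LINT y|lborel. f y * k (X i - y) - f y * k (x - y))"
        unfolding conv_def using conv_integrable[OF f kc s(1)] by simp
      then show ?thesis by (simp add: right_diff_distrib flip: integral_divide_zero)
    qed
    have "(\<lambda>i. LINT y|lborel. f y * ((k (X i - y) - k (x - y)) / (X i - x)))
      \<longlonglongrightarrow> (LINT y|lborel. f y * k' (x - y))"
    proof (rule integral_dominated_convergence)
      show "integrable lborel (\<lambda>y. B * \<bar>indicator {-(K+1)..K+1} y * f y\<bar>)"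
        using locsq_integrable[OF f, of "-(K+1)" "K+1"] unfolding set_integrable_def by simp
      show "AE y in lborel. (\<lambda>i. f y * ((k (X i - y) - k (x - y)) / (X i - x))) \<longlonglongrightarrow> f y * k' (x - y)"
      proof (intro AE_I2 tendsto_intros)
        fix y
        have "((\<lambda>u. k (u - y)) has_real_derivative k' (x - y)) (at x)"
          using DERIV_shift[of k "k' (x - y)" x "-y"] k(1)[of "x - y"] by simp
        then have "((\<lambda>u. (k (u - y) - k (x - y)) / (u - x)) \<longlongrightarrow> k' (x - y)) (at x)"
          by (simp add: has_field_derivative_iff)
        then show "(\<lambda>i. (k (X i - y) - k (x - y)) / (X i - x)) \<longlonglongrightarrow> k' (x - y)"
          using X unfolding tendsto_at_iff_sequentially by (auto simp: comp_def)
      qed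
      show "AE y in lborel. norm (f y * ((k (X i - y) - k (x - y)) / (X i - x)))
         \<le> B * \<bar>indicator {-(K+1)..K+1} y * f y\<bar>" for i
      proof (rule AE_I2)
        fix y
        have ne: "X i - x \<noteq> 0" using X(1) by auto
        show "norm (f y * ((k (X i - y) - k (x - y)) / (X i - x))) \<le> B * \<bar>indicator {-(K+1)..K+1} y * f y\<bar>"
        proof (cases "\<bar>y\<bar> > K + 1")
          case True
          then have "k (X i - y) = 0" "k (x - y) = 0" using s(1) K[of i] Kx by auto
          then show ?thesis using B by simp
        next
          case False
          have "\<bar>(k (X i - y) - k (x - y)) / (X i - x)\<bar> \<le> B"
            using lip[of "X i - y" "x - y"] ne by (simp add: divide_le_eq)
          then have "\<bar>f y\<bar> * \<bar>(k (X i - y) - k (x - y)) / (X i - x)\<bar> \<le> \<bar>f y\<bar> * B"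
            by (intro mult_left_mono) auto
          then show ?thesis using False by (auto simp: abs_mult indicator_def mult.commute)
        qed
      qed
    qed auto
    then show "((\<lambda>y. (conv k f y - conv k f x) / (y - x)) \<circ> X) \<longlonglongrightarrow> conv k' f x"
      unfolding comp_def eq unfolding conv_def by simp
  qed
  then show ?thesis by (simp add: has_field_derivative_iff)
qed

text \<open>Differentiation under an integral over \<open>x\<close> later asks for joint continuity.
  The dependence on time is controlled by \<open>conv_bound\<close> uniformly for \<open>x\<close>
  in a bounded set, the dependence on \<open>x\<close> by differentiability at the fixed time
  \<open>t\<close>.\<close>

lemma conv_continuous_on:
  assumes f: "\<And>t. t \<in> T \<Longrightarrow> locsq (f t)"
    and cont: "\<And>t L. t \<in> T \<Longrightarrow> ((\<lambda>s. locnorm L (\<lambda>x. f s x - f t x)) \<longlongrightarrow> 0) (at t within T)"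
    and k: "\<And>z. (k has_real_derivative k' z) (at z)" "continuous_on UNIV k'"
    and s: "\<And>z. \<bar>z\<bar> > 1 \<Longrightarrow> k z = 0" "\<And>z. \<bar>z\<bar> > 1 \<Longrightarrow> k' z = 0"
  shows "continuous_on (T \<times> S) (\<lambda>(t :: real, x). conv k (f t) x)"
  unfolding continuous_on_def
proof
  have kc: "continuous_on UNIV k" using k(1) by (meson DERIV_isCont continuous_at_imp_continuous_on)
  fix p assume "p \<in> T \<times> S"
  then obtain t x where p: "p = (t, x)" "t \<in> T" "x \<in> S" by auto
  let ?F = "at p within T \<times> S"
  have fst0: "(fst \<longlongrightarrow> t) ?F" using tendsto_fst[OF tendsto_ident_at[of p "T \<times> S"]] p by simp
  have snd0: "(snd \<longlongrightarrow> x) ?F" using tendsto_snd[OF tendsto_ident_at[of p "T \<times> S"]] p by simp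
  have inT: "\<forall>\<^sub>F q in ?F. fst q \<in> T" by (auto simp: eventually_at_filter mem_Times_iff intro!: always_eventually)
  let ?n = "\<lambda>s. locnorm (\<bar>x\<bar> + 1 + 1) (\<lambda>x. f s x - f t x)"
  \<comment> \<open>A pair near (t, x) and different from it may still have first component
    \<open>t\<close>, a value that the punctured limit \<open>cont\<close> ignores; there the
    difference vanishes.\<close>
  have n0: "?n t = 0" by (simp add: locnorm_def norm2_def)
  have 1: "((\<lambda>q. ?n (fst q)) \<longlongrightarrow> 0) ?F"
  proof (rule tendstoI)
    fix e :: real assume "e > 0"
    then have "\<forall>\<^sub>F s in at t within T. dist (?n s) 0 < e" using tendstoD[OF cont[OF p(2)]] by blast
    then obtain U where U: "open U" "t \<in> U" "\<And>s. s \<in> U \<Longrightarrow> s \<noteq> t \<Longrightarrow> s \<in> T \<Longrightarrow> dist (?n s) 0 < e"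
      unfolding eventually_at_topological by blast
    have "\<forall>\<^sub>F q in ?F. fst q \<in> U" using topological_tendstoD[OF fst0 U(1,2)] .
    then show "\<forall>\<^sub>F q in ?F. dist (?n (fst q)) 0 < e"
      using inT
    proof eventually_elim
      case (elim q)
      then show ?case using U(3)[of "fst q"] n0 \<open>e > 0\<close> by (cases "fst q = t") auto
    qed
  qed
  have isc: "isCont (conv k (f t)) x"
    using conv_has_real_derivative[OF f[OF p(2)] k s] DERIV_isCont by blast
  have 2: "((\<lambda>q. conv k (f t) (snd q)) \<longlongrightarrow> conv k (f t) x) ?F"
    by (rule isCont_tendsto_compose[OF isc snd0])
  have bnd: "\<forall>\<^sub>F q in ?F. \<bar>snd q\<bar> < \<bar>x\<bar> + 1"
    using order_tendstoD(2)[OF tendsto_rabs[OF snd0], of "\<bar>x\<bar> + 1"] by simp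
  have 3: "((\<lambda>q. conv k (f (fst q)) (snd q) - conv k (f t) (snd q)) \<longlongrightarrow> 0) ?F"
  proof (rule metric_tendsto_imp_tendsto)
    show "((\<lambda>q. ?n (fst q) * norm2 k) \<longlongrightarrow> 0) ?F"
      using tendsto_mult_right[OF 1, of "norm2 k"] by simp
    show "\<forall>\<^sub>F q in ?F. dist (conv k (f (fst q)) (snd q) - conv k (f t) (snd q)) 0
        \<le> dist (?n (fst q) * norm2 k) 0"
      using inT bnd
    proof eventually_elim
      case (elim q)
      have "\<bar>conv k (\<lambda>x. f (fst q) x - f t x) (snd q)\<bar> \<le> ?n (fst q) * norm2 k"
        by (rule conv_bound[OF locsq_diff[OF f[OF elim(1)] f[OF p(2)]] kc s(1)]) (use elim in auto)
      then show ?case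
        by (simp add: conv_diff[OF f[OF elim(1)] f[OF p(2)] kc s(1)] dist_real_def)
    qed
  qed
  from tendsto_add[OF 3 2] show "((\<lambda>(t, x). conv k (f t) x) \<longlongrightarrow> (case p of (t, x) \<Rightarrow> conv k (f t) x)) ?F"
    by (simp add: p case_prod_beta')
qed

text \<open>Young's inequality for a probability density: write \<open>k\<close> as the product of
  two square roots, apply Cauchy-Schwarz in \<open>y\<close> with total mass 1, and exchange the
  order of integration.\<close>

lemma conv_contraction:
  assumes f: "sqint f" and k: "continuous_on UNIV k" "\<And>z. \<bar>z\<bar> > 1 \<Longrightarrow> k z = 0"
    and k0: "\<And>z. k z \<ge> 0" and k1: "(LINT z|lborel. k z) = 1"
    and c: "conv k f \<in> borel_measurable borel"
  shows "sqint (conv k f)" "norm2 (conv k f) \<le> norm2 f"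
proof -
  note [measurable] = sqint_measurable[OF f] borel_measurable_continuous_onI[OF k(1)] c
  obtain B where B: "B \<ge> 0" "\<And>z. \<bar>k z\<bar> \<le> B" using bounded_of_support[OF k] by metis
  have sk: "sqint (\<lambda>y. sqrt (k y))"
    by (rule sqint_bounded_support[of _ "sqrt B" 1]) (use k k0 B in \<open>auto\<close>)
  have ki: "integrable lborel k" using sqint_integrable[OF sk] k0 by simp
  have kis: "integrable lborel (\<lambda>y. k (x - y))" "integrable lborel (\<lambda>y. k (y - x))" for x
    using lborel_integrable_real_affine[OF ki, of "-1" x] lborel_integrable_real_affine[OF ki, of 1 "-x"] by auto
  have k1': "(LINT x|lborel. k (x - y)) = 1" for y
    using lborel_integral_real_affine[of 1 k "-y"] k1 by simp
  have pt: "(conv k f x)\<^sup>2 \<le> (LINT y|lborel. (f y)\<^sup>2 * k (x - y))" for x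
  proof -
    have s1: "sqint (\<lambda>y. sqrt (k (x - y)) * f y)"
      by (rule sqint_bdd_mult[OF f, of _ "sqrt B"]) (use k0 B in auto)
    have s2: "sqint (\<lambda>y. sqrt (k (x - y)))" by (rule sqint_reflect_shift(1)[OF sk])
    have "\<bar>conv k f x\<bar> \<le> norm2 (\<lambda>y. sqrt (k (x - y)) * f y) * norm2 (\<lambda>y. sqrt (k (x - y)))"
      using norm2_CS[OF s1 s2] k0 by (simp add: conv_def mult_ac)
    moreover have "norm2 (\<lambda>y. sqrt (k (x - y))) = 1"
      using k0 k1 by (simp add: norm2_def integral_reflect_shift)
    ultimately have "\<bar>conv k f x\<bar>\<^sup>2 \<le> (norm2 (\<lambda>y. sqrt (k (x - y)) * f y))\<^sup>2"
      by (intro power_mono) auto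
    then show ?thesis using k0 by (simp add: norm2_sq power_mult_distrib mult.commute)
  qed
  let ?F = "\<lambda>(y, x). (f y)\<^sup>2 * k (x - y)"
  have F: "integrable (lborel \<Otimes>\<^sub>M lborel) ?F"
  proof (rule lborel_pair.Fubini_integrable)
    show "integrable lborel (\<lambda>y. LINT x|lborel. norm (?F (y, x)))"
      using sqint_integrable[OF f] k0 k1' by (simp add: abs_mult)
    show "AE y in lborel. integrable lborel (\<lambda>x. ?F (y, x))"
      using kis by auto
  qed measurable
  have F2: "integrable lborel (\<lambda>x. LINT y|lborel. ?F (y, x))"
    by (rule lborel_pair.integrable_snd[where f="\<lambda>y x. ?F (y, x)"]) (use F in simp)
  have "(LINT x|lborel. LINT y|lborel. ?F (y, x)) = (LINT y|lborel. LINT x|lborel. ?F (y, x))"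
    by (rule lborel_pair.Fubini_integral[where f="\<lambda>y x. ?F (y, x)"]) (use F in simp)
  also have "\<dots> = (LINT y|lborel. (f y)\<^sup>2)" using k1' by simp
  finally have eq: "(LINT x|lborel. LINT y|lborel. (f y)\<^sup>2 * k (x - y)) = (LINT y|lborel. (f y)\<^sup>2)" by simp
  have F2': "integrable lborel (\<lambda>x. LINT y|lborel. (f y)\<^sup>2 * k (x - y))" using F2 by simp
  have I: "integrable lborel (\<lambda>x. (conv k f x)\<^sup>2)"
    by (rule Bochner_Integration.integrable_bound[OF F2']) (use pt in \<open>auto intro!: AE_I2 intro: order_trans[OF _ abs_ge_self]\<close>)
  then show "sqint (conv k f)" by (simp add: sqint_def)
  have "(LINT x|lborel. (conv k f x)\<^sup>2) \<le> (LINT x|lborel. LINT y|lborel. (f y)\<^sup>2 * k (x - y))"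
    by (rule integral_mono[OF I F2' pt])
  then show "norm2 (conv k f) \<le> norm2 f" unfolding norm2_def eq by (rule real_sqrt_le_mono)
qed

text \<open>At the origin the difference quotient is at most |h|^n, which tends to 0 because n \<ge>
  1. Powers of truncated polynomials thus provide all bumps and cutoffs explicitly.\<close>

lemma max_power_has_real_derivative:
  assumes "n \<ge> 1"
  shows "((\<lambda>y::real. max 0 y ^ Suc n) has_real_derivative real (Suc n) * max 0 y ^ n) (at y)"
proof -
  consider "y < 0" | "y > 0" | "y = 0" by linarith
  then show ?thesis
  proof cases
    case 1
    have "((\<lambda>y::real. 0) has_real_derivative real (Suc n) * max 0 y ^ n) (at y)"
      using 1 assms by (auto simp: max_def power_0_left)
    then show ?thesis
      by (rule has_field_derivative_transform_within_open[of _ _ _ "{..<0}"]) (use 1 in \<open>auto simp: max_def\<close>)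
  next
    case 2
    have "((\<lambda>y::real. y ^ Suc n) has_real_derivative real (Suc n) * max 0 y ^ n) (at y)"
      using 2 DERIV_pow[of "Suc n" y UNIV] by (auto simp: max_def)
    then show ?thesis
      by (rule has_field_derivative_transform_within_open[of _ _ _ "{0<..}"]) (use 2 in \<open>auto simp: max_def\<close>)
  next
    case 3
    have "((\<lambda>h::real. max 0 h ^ Suc n / h) \<longlongrightarrow> 0) (at 0)"
    proof (rule metric_tendsto_imp_tendsto)
      have "((\<lambda>h::real. \<bar>h\<bar> ^ n) \<longlongrightarrow> \<bar>0\<bar> ^ n) (at 0)" by (intro tendsto_intros)
      then show "((\<lambda>h::real. \<bar>h\<bar> ^ n) \<longlongrightarrow> 0) (at 0)" using assms by (simp add: power_0_left)
      show "\<forall>\<^sub>F x in at 0. dist (max 0 x ^ Suc n / x) 0 \<le> dist (\<bar>x\<bar> ^ n) (0::real)"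
        by (rule always_eventually) (auto simp: max_def)
    qed
    then show ?thesis using 3 assms by (simp add: has_field_derivative_iff power_0_left)
  qed
qed

text \<open>The cube makes \<open>bump\<close> twice continuously differentiable, so that the derivative of the mollifier
  is still a test function.\<close>

definition bump :: "real \<Rightarrow> real" where "bump z = max 0 (1 - z\<^sup>2) ^ 3"
definition bump1 :: "real \<Rightarrow> real" where "bump1 z = - 6 * z * max 0 (1 - z\<^sup>2) ^ 2"
definition bump2 :: "real \<Rightarrow> real" where
  "bump2 z = - 6 * max 0 (1 - z\<^sup>2) ^ 2 + 24 * z\<^sup>2 * max 0 (1 - z\<^sup>2)"

lemma bump_deriv: "(bump has_real_derivative bump1 z) (at z)" "(bump1 has_real_derivative bump2 z) (at z)"
proof -
  have i: "((\<lambda>z. 1 - z\<^sup>2) has_real_derivative - 2 * z) (at z)" for z :: real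
    by (auto intro!: derivative_eq_intros)
  have a: "((\<lambda>z. max 0 (1 - z\<^sup>2) ^ Suc 2) has_real_derivative real (Suc 2) * max 0 (1 - z\<^sup>2) ^ 2 * (- 2 * z)) (at z)"
    by (rule DERIV_chain2[OF max_power_has_real_derivative i]) simp
  then show "(bump has_real_derivative bump1 z) (at z)"
    unfolding bump_def[abs_def] bump1_def by (simp add: mult_ac eval_nat_numeral)
  have b: "((\<lambda>z. max 0 (1 - z\<^sup>2) ^ Suc 1) has_real_derivative real (Suc 1) * max 0 (1 - z\<^sup>2) ^ 1 * (- 2 * z)) (at z)"
    by (rule DERIV_chain2[OF max_power_has_real_derivative i]) simp
  have c: "((\<lambda>z::real. - 6 * z) has_real_derivative - 6) (at z)" by (auto intro!: derivative_eq_intros)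
  show "(bump1 has_real_derivative bump2 z) (at z)"
    using DERIV_mult[OF c b] unfolding bump1_def[abs_def] bump2_def
    by (simp add: mult_ac eval_nat_numeral)
qed

lemma bump_support: "\<bar>z\<bar> > 1 \<Longrightarrow> bump z = 0" "\<bar>z\<bar> > 1 \<Longrightarrow> bump1 z = 0" "\<bar>z\<bar> > 1 \<Longrightarrow> bump2 z = 0"
proof -
  have "max 0 (1 - z\<^sup>2) = 0" if "\<bar>z\<bar> > 1"
  proof -
    have "1 < \<bar>z\<bar>\<^sup>2" using that by (rule one_less_power) simp
    then show ?thesis by simp
  qed
  then show "\<bar>z\<bar> > 1 \<Longrightarrow> bump z = 0" "\<bar>z\<bar> > 1 \<Longrightarrow> bump1 z = 0" "\<bar>z\<bar> > 1 \<Longrightarrow> bump2 z = 0"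
    by (auto simp: bump_def bump1_def bump2_def)
qed

lemma bump_continuous: "continuous_on UNIV bump" "continuous_on UNIV bump1" "continuous_on UNIV bump2"
  unfolding bump_def bump1_def bump2_def by (intro continuous_intros)+

lemma bump_nonneg: "0 \<le> bump z" by (simp add: bump_def)

lemma bump_integrable: "integrable lborel bump"
  using locsq_support_integrable[OF locsq_continuous bump_continuous(1) bump_support(1), of "\<lambda>_. 1"] by simp

lemma bump_integral_pos: "(LINT z|lborel. bump z) > 0"
proof -
  \<comment> \<open>On [-1/2, 1/2] the base 1 - z^2 is at least 3/4, whose cube is 27/64.\<close>
  have "(LINT z::real|lborel. 27/64 * indicat_real {-1/2..1/2} z) \<le> (LINT z|lborel. bump z)"
  proof (rule integral_mono)
    show "integrable lborel (\<lambda>z::real. 27 / 64 * indicat_real {- 1 / 2..1 / 2} z)"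
      using emeasure_lborel_Icc_eq[of "-1/2" "1/2"] by (auto simp: integrable_indicator_iff)
    fix z :: real
    show "27/64 * indicat_real {-1/2..1/2} z \<le> bump z"
    proof (cases "z \<in> {-1/2..1/2}")
      case True
      then have "z\<^sup>2 \<le> (1/2)\<^sup>2" by (intro power2_le_iff_abs_le[THEN iffD2]) auto
      then have "(3/4) ^ 3 \<le> (max 0 (1 - z\<^sup>2)) ^ 3" by (intro power_mono) (auto simp: power2_eq_square)
      then show ?thesis using True by (simp add: bump_def eval_nat_numeral)
    qed (simp add: bump_nonneg)
  qed (rule bump_integrable)
  then show ?thesis by simp
qed

section \<open>The approximate identity\<close>

definition moll :: "nat \<Rightarrow> real \<Rightarrow> real" where
  "moll n z = real (Suc n) * bump (real (Suc n) * z) / (LINT z|lborel. bump z)"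
definition moll1 :: "nat \<Rightarrow> real \<Rightarrow> real" where
  "moll1 n z = real (Suc n) ^ 2 * bump1 (real (Suc n) * z) / (LINT z|lborel. bump z)"
definition moll2 :: "nat \<Rightarrow> real \<Rightarrow> real" where
  "moll2 n z = real (Suc n) ^ 3 * bump2 (real (Suc n) * z) / (LINT z|lborel. bump z)"

lemma moll_deriv: "(moll n has_real_derivative moll1 n z) (at z)" "(moll1 n has_real_derivative moll2 n z) (at z)"
proof -
  have i: "((\<lambda>z. real (Suc n) * z) has_real_derivative real (Suc n)) (at z)" by (auto intro!: derivative_eq_intros)
  show "(moll n has_real_derivative moll1 n z) (at z)"
    using DERIV_cdivide[OF DERIV_cmult[OF DERIV_chain2[OF bump_deriv(1) i], of "real (Suc n)"]]
    unfolding moll_def[abs_def] moll1_def by (simp add: mult_ac power2_eq_square)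
  show "(moll1 n has_real_derivative moll2 n z) (at z)"
    using DERIV_cdivide[OF DERIV_cmult[OF DERIV_chain2[OF bump_deriv(2) i], of "real (Suc n) ^ 2"]]
    unfolding moll1_def[abs_def] moll2_def by (simp add: mult_ac power2_eq_square power3_eq_cube)
qed

lemma moll_continuous: "continuous_on UNIV (moll n)" "continuous_on UNIV (moll1 n)" "continuous_on UNIV (moll2 n)"
  unfolding moll_def moll1_def moll2_def
  by (intro continuous_intros continuous_on_compose2[OF bump_continuous(1)] continuous_on_compose2[OF bump_continuous(2)]
      continuous_on_compose2[OF bump_continuous(3)]; use bump_integral_pos in force)+

lemma moll_support':
  assumes "\<bar>z\<bar> > 1 / real (Suc n)" shows "moll n z = 0" "moll1 n z = 0" "moll2 n z = 0"
proof -
  have "\<bar>real (Suc n) * z\<bar> > 1" using assms by (simp add: abs_mult field_simps)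
  then show "moll n z = 0" "moll1 n z = 0" "moll2 n z = 0"
    using bump_support[of "real (Suc n) * z"] by (auto simp: moll_def moll1_def moll2_def)
qed

lemma moll_support:
  assumes "\<bar>z\<bar> > 1" shows "moll n z = 0" "moll1 n z = 0" "moll2 n z = 0"
proof -
  have "1 / real (Suc n) \<le> 1" by simp
  then have "\<bar>z\<bar> > 1 / real (Suc n)" using assms by linarith
  then show "moll n z = 0" "moll1 n z = 0" "moll2 n z = 0" using moll_support' by auto
qed

lemma moll_nonneg: "0 \<le> moll n z"
  unfolding moll_def using bump_nonneg bump_integral_pos by (intro divide_nonneg_pos mult_nonneg_nonneg) auto

lemma moll_integral: "(LINT z|lborel. moll n z) = 1"
proof -
  define c where "c = (LINT z|lborel. bump z)"
  have eq: "c = real (Suc n) * (LINT z|lborel. bump (real (Suc n) * z))"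
    using lborel_integral_real_affine[of "real (Suc n)" bump 0] by (simp add: c_def)
  have "(LINT z|lborel. moll n z) = real (Suc n) * (LINT z|lborel. bump (real (Suc n) * z)) / c"
    unfolding moll_def c_def[symmetric] by (simp only: integral_divide_zero integral_mult_right_zero)
  then have "(LINT z|lborel. moll n z) = c / c" using eq by metis
  then show ?thesis using bump_integral_pos by (simp add: c_def)
qed

lemma conv_moll_deriv:
  assumes "locsq f"
  shows "(conv (moll n) f has_real_derivative conv (moll1 n) f x) (at x)"
    "(conv (moll1 n) f has_real_derivative conv (moll2 n) f x) (at x)"
  by (rule conv_has_real_derivative[OF assms]; use moll_deriv moll_support moll_continuous in blast)+

lemma conv_moll_continuous:
  assumes "locsq f" shows "continuous_on S (conv (moll n) f)" "continuous_on S (conv (moll1 n) f)"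
  using conv_moll_deriv[OF assms] by (meson DERIV_isCont continuous_at_imp_continuous_on)+

text \<open>A mollified value is an average of values of \<open>f\<close> within distance 1/(n+1).
  Used with \<open>c\<close> equal to \<open>f x\<close> for convergence at points of continuity,
  and with \<open>c\<close> equal to 0 for supremum bounds and supports.\<close>

lemma conv_moll_close:
  assumes f: "locsq f" and e: "\<And>y. \<bar>y - x\<bar> \<le> 1 / real (Suc n) \<Longrightarrow> \<bar>f y - c\<bar> \<le> e"
  shows "\<bar>conv (moll n) f x - c\<bar> \<le> e"
proof -
  have i: "integrable lborel (\<lambda>y. f y * moll n (x - y))"
    by (rule conv_integrable[OF f moll_continuous(1) moll_support(1)])
  have "integrable lborel (\<lambda>y. 1 * moll n (x - y))"
    by (rule conv_integrable[OF locsq_continuous moll_continuous(1) moll_support(1)]) auto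
  then have j: "integrable lborel (\<lambda>y. moll n (x - y))" by simp
  have m1: "(LINT y|lborel. moll n (x - y)) = 1" by (simp add: integral_reflect_shift moll_integral)
  have "conv (moll n) f x - c = (LINT y|lborel. f y * moll n (x - y) - c * moll n (x - y))"
    unfolding conv_def using i j m1 by simp
  also have "\<bar>\<dots>\<bar> \<le> (LINT y|lborel. \<bar>f y * moll n (x - y) - c * moll n (x - y)\<bar>)"
    by (rule integral_abs_bound)
  also have "\<dots> \<le> (LINT y|lborel. e * moll n (x - y))"
  proof (rule integral_mono)
    fix y
    have "\<bar>f y * moll n (x - y) - c * moll n (x - y)\<bar> = \<bar>f y - c\<bar> * moll n (x - y)"
      using moll_nonneg[of n "x - y"] by (simp add: abs_mult flip: left_diff_distrib)
    also have "\<dots> \<le> e * moll n (x - y)"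
    proof (cases "\<bar>y - x\<bar> \<le> 1 / real (Suc n)")
      case True
      then show ?thesis using e moll_nonneg by (intro mult_right_mono) auto
    next
      case False
      then have "moll n (x - y) = 0" by (intro moll_support') (simp add: abs_minus_commute)
      then show ?thesis by simp
    qed
    finally show "\<bar>f y * moll n (x - y) - c * moll n (x - y)\<bar> \<le> e * moll n (x - y)" .
  qed (use i j in auto)
  also have "\<dots> = e" using m1 by simp
  finally show ?thesis .
qed

lemma conv_moll_pointwise:
  assumes "locsq f" "isCont f x"
  shows "(\<lambda>n. conv (moll n) f x) \<longlonglongrightarrow> f x"
proof (rule LIMSEQ_I)
  fix r :: real assume "r > 0"
  then obtain d where d: "d > 0" "\<And>y. \<bar>y - x\<bar> < d \<Longrightarrow> \<bar>f y - f x\<bar> < r / 2"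
    using assms(2) unfolding continuous_at_eps_delta dist_real_def by (meson half_gt_zero)
  obtain N where N: "1 / real (Suc N) < d" using nat_approx_posE[OF d(1)] by blast
  have "norm (conv (moll n) f x - f x) < r" if "n \<ge> N" for n
  proof -
    have "1 / real (Suc n) \<le> 1 / real (Suc N)" using that by (intro divide_left_mono) auto
    then have "\<bar>conv (moll n) f x - f x\<bar> \<le> r / 2"
      using d N by (intro conv_moll_close[OF assms(1)]) (smt (verit))
    then show ?thesis using \<open>r > 0\<close> by simp
  qed
  then show "\<exists>no. \<forall>n\<ge>no. norm (conv (moll n) f x - f x) < r" by blast
qed

lemma conv_moll_contraction:
  assumes "sqint f" shows "sqint (conv (moll n) f)" "norm2 (conv (moll n) f) \<le> norm2 f"
  by (rule conv_contraction[OF assms moll_continuous(1) moll_support(1) moll_nonneg moll_integral];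
      use conv_moll_continuous[OF sqint_imp_locsq[OF assms]] in \<open>auto intro: borel_measurable_continuous_onI\<close>)+

text \<open>Three-epsilon argument: by contraction it suffices to treat a continuous
  \<open>g\<close> of bounded support, for which convergence is pointwise and the error is dominated
  by 2 B on [-(L+1), L+1].\<close>

lemma conv_moll_tendsto:
  assumes f: "sqint f"
  shows "(\<lambda>n. norm2 (\<lambda>x. conv (moll n) f x - f x)) \<longlonglongrightarrow> 0"
proof (rule LIMSEQ_I)
  fix r :: real assume "r > 0"
  then obtain g L where g: "continuous_on UNIV g" "\<And>x. \<bar>x\<bar> > L \<Longrightarrow> g x = 0" "sqint g"
    "norm2 (\<lambda>x. f x - g x) < r / 3" using sqint_approx_continuous[OF f, of "r / 3"] by (metis divide_pos_pos zero_less_numeral)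
  obtain B where B: "B \<ge> 0" "\<And>z. \<bar>g z\<bar> \<le> B" using bounded_of_support[OF g(1,2)] by metis
  have gl: "locsq g" by (rule sqint_imp_locsq[OF g(3)])
  have "(\<lambda>n. norm2 (\<lambda>x. conv (moll n) g x - g x)) \<longlonglongrightarrow> 0"
  proof (rule norm2_dominated_tendsto)
    show "conv (moll n) g \<in> borel_measurable borel" for n
      by (rule sqint_measurable[OF conv_moll_contraction(1)[OF g(3)]])
    show "g \<in> borel_measurable borel" by (rule sqint_measurable[OF g(3)])
    show "sqint (\<lambda>x. 2 * B * indicat_real {-(L+1)..L+1} x)"
      by (rule sqint_bounded_support[of _ "2 * B" "L + 1"]) (use B in \<open>auto simp: indicator_def\<close>)
    show "AE x in lborel. (\<lambda>n. conv (moll n) g x) \<longlonglongrightarrow> g x"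
      using g(1) conv_moll_pointwise[OF gl] by (auto simp: continuous_on_eq_continuous_at)
    show "AE x in lborel. \<bar>conv (moll n) g x - g x\<bar> \<le> \<bar>2 * B * indicat_real {-(L+1)..L+1} x\<bar>" for n
    proof (rule AE_I2)
      fix x
      have 1: "\<bar>conv (moll n) g x - 0\<bar> \<le> B" by (rule conv_moll_close[OF gl]) (use B in auto)
      have 2: "conv (moll n) g x = 0" if "\<bar>x\<bar> > L + 1"
      proof -
        have "1 / real (Suc n) \<le> 1" by simp
        then have "\<bar>conv (moll n) g x - 0\<bar> \<le> 0"
          by (intro conv_moll_close[OF gl]) (use g(2) that in \<open>smt (verit)\<close>)
        then show ?thesis by simp
      qed
      show "\<bar>conv (moll n) g x - g x\<bar> \<le> \<bar>2 * B * indicat_real {-(L+1)..L+1} x\<bar>"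
        using 1 2 g(2)[of x] B(1) B(2)[of x] by (cases "\<bar>x\<bar> > L + 1") (auto simp: indicator_def)
    qed
  qed
  then have "\<forall>\<^sub>F n in sequentially. norm2 (\<lambda>x. conv (moll n) g x - g x) < r / 3"
    using \<open>r > 0\<close> by (intro order_tendstoD(2)) auto
  then obtain N where N: "\<And>n. n \<ge> N \<Longrightarrow> norm2 (\<lambda>x. conv (moll n) g x - g x) < r / 3"
    unfolding eventually_sequentially by blast
  have "norm2 (\<lambda>x. conv (moll n) f x - f x) < r" if "n \<ge> N" for n
  proof -
    note fl = sqint_imp_locsq[OF f] and cf = conv_moll_contraction(1)[OF f, of n]
      and cg = conv_moll_contraction(1)[OF g(3), of n]
    have "norm2 (\<lambda>x. conv (moll n) f x - f x)
       \<le> norm2 (\<lambda>x. conv (moll n) f x - conv (moll n) g x) + norm2 (\<lambda>x. conv (moll n) g x - f x)"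
      by (rule norm2_triangle_diff[OF cf cg f])
    also have "(\<lambda>x. conv (moll n) f x - conv (moll n) g x) = conv (moll n) (\<lambda>x. f x - g x)"
      using conv_diff[OF fl gl moll_continuous(1) moll_support(1)] by auto
    also have "norm2 (conv (moll n) (\<lambda>x. f x - g x)) \<le> norm2 (\<lambda>x. f x - g x)"
      by (rule conv_moll_contraction(2)[OF sqint_diff[OF f g(3)]])
    also have "norm2 (\<lambda>x. conv (moll n) g x - f x) \<le> norm2 (\<lambda>x. conv (moll n) g x - g x) + norm2 (\<lambda>x. g x - f x)"
      by (rule norm2_triangle_diff[OF cg g(3) f])
    finally show ?thesis using N[OF that] g(4) norm2_minus[of f g] by linarith
  qed
  then show "\<exists>no. \<forall>n\<ge>no. norm (norm2 (\<lambda>x. conv (moll n) f x - f x) - 0) < r" by auto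
qed

lemma conv_moll_locnorm_le:
  assumes "locsq f" shows "locnorm L (conv (moll n) f) \<le> locnorm (L + 1) f"
proof -
  let ?f = "\<lambda>y. indicator {-(L+1)..L+1} y * f y"
  have eq: "(\<lambda>x. indicator {-L..L} x * conv (moll n) f x) = (\<lambda>x. indicator {-L..L} x * conv (moll n) ?f x)"
  proof
    fix x show "indicator {-L..L} x * conv (moll n) f x = indicator {-L..L} x * conv (moll n) ?f x"
      using conv_local[of "moll n" x L f] moll_support(1)[of _ n] by (auto simp: indicator_def abs_le_iff)
  qed
  note s = conv_moll_contraction[OF locsq_sqint[OF assms, of "L+1"], of n]
  have "norm2 (\<lambda>x. indicator {-L..L} x * conv (moll n) ?f x) \<le> 1 * norm2 (conv (moll n) ?f)"
    by (rule norm2_mono[OF s(1)]) (use sqint_measurable[OF s(1)] in \<open>auto simp: indicator_def\<close>)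
  then show ?thesis unfolding locnorm_def eq using s(2) by simp
qed

lemma conv_moll_locnorm_tendsto:
  assumes "locsq f"
  shows "(\<lambda>n. locnorm L (\<lambda>x. conv (moll n) f x - f x)) \<longlonglongrightarrow> 0"
proof -
  let ?f = "\<lambda>y. indicator {-(L+1)..L+1} y * f y"
  have sf: "sqint ?f" by (rule locsq_sqint[OF assms])
  have eq: "(\<lambda>x. indicator {-L..L} x * (conv (moll n) f x - f x))
      = (\<lambda>x. indicator {-L..L} x * (conv (moll n) ?f x - ?f x))" for n
  proof
    fix x show "indicator {-L..L} x * (conv (moll n) f x - f x) = indicator {-L..L} x * (conv (moll n) ?f x - ?f x)"
      using conv_local[of "moll n" x L f] moll_support(1)[of _ n] by (auto simp: indicator_def abs_le_iff)
  qed
  show ?thesis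
  proof (rule metric_tendsto_imp_tendsto[OF conv_moll_tendsto[OF sf]], intro always_eventually allI)
    fix n
    have s: "sqint (\<lambda>x. conv (moll n) ?f x - ?f x)"
      by (rule sqint_diff[OF conv_moll_contraction(1)[OF sf] sf])
    have "norm2 (\<lambda>x. indicator {-L..L} x * (conv (moll n) ?f x - ?f x)) \<le> 1 * norm2 (\<lambda>x. conv (moll n) ?f x - ?f x)"
      by (rule norm2_mono[OF s]) (use sqint_measurable[OF s] in \<open>auto simp: indicator_def\<close>)
    then show "dist (locnorm L (\<lambda>x. conv (moll n) f x - f x)) 0 \<le> dist (norm2 (\<lambda>x. conv (moll n) ?f x - ?f x)) 0"
      unfolding locnorm_def eq by (simp add: dist_real_def)
  qed
qed

section \<open>Weak derivatives and primitives\<close>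

lemma test_functionI:
  assumes "\<And>x. (\<phi> has_real_derivative \<phi>' x) (at x)" "continuous_on UNIV \<phi>'" "\<And>x. \<bar>x\<bar> > L \<Longrightarrow> \<phi> x = 0"
  shows "test_function \<phi>" "deriv \<phi> = \<phi>'"
proof -
  have "{r. \<phi> r \<noteq> 0} \<subseteq> {-L..L}" using assms(3) by force
  then have "bounded {r. \<phi> r \<noteq> 0}" by (rule bounded_subset[rotated]) simp
  then show "test_function \<phi>"
    unfolding test_function_def C1_differentiable_on_def using assms(1,2)
    by (auto simp: compact_closure simp flip: has_real_derivative_iff_has_vector_derivative)
  show "deriv \<phi> = \<phi>'" using assms(1) by (auto intro: DERIV_imp_deriv)
qed

text \<open>The derivative \<open>moll1\<close> must be a test function as well: the time derivative
  of the mollified space derivative is found by testing the equation for \<open>v\<close> with it.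
  The minus signs come from differentiating in \<open>y\<close> a function of x - y.\<close>

lemma test_function_moll:
  "test_function (\<lambda>y. moll n (x - y))" "deriv (\<lambda>y. moll n (x - y)) = (\<lambda>y. - moll1 n (x - y))"
  "test_function (\<lambda>y. moll1 n (x - y))" "deriv (\<lambda>y. moll1 n (x - y)) = (\<lambda>y. - moll2 n (x - y))"
proof -
  have i: "((\<lambda>y. x - y) has_real_derivative -1) (at y)" for y by (auto intro!: derivative_eq_intros)
  have d: "((\<lambda>y. moll n (x - y)) has_real_derivative - moll1 n (x - y)) (at y)"
     "((\<lambda>y. moll1 n (x - y)) has_real_derivative - moll2 n (x - y)) (at y)" for y
    using DERIV_chain2[OF moll_deriv(1) i] DERIV_chain2[OF moll_deriv(2) i] by simp_all
  have c: "continuous_on UNIV (\<lambda>y. - moll1 n (x - y))" "continuous_on UNIV (\<lambda>y. - moll2 n (x - y))"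
    by (intro continuous_intros continuous_on_compose2[OF moll_continuous(2)] continuous_on_compose2[OF moll_continuous(3)]; simp)+
  have s: "moll n (x - y) = 0" "moll1 n (x - y) = 0" if "\<bar>y\<bar> > \<bar>x\<bar> + 1" for y
    using moll_support[of "x - y" n] that by auto
  show "test_function (\<lambda>y. moll n (x - y))" "deriv (\<lambda>y. moll n (x - y)) = (\<lambda>y. - moll1 n (x - y))"
    by (rule test_functionI[OF d(1) c(1) s(1)]; assumption)+
  show "test_function (\<lambda>y. moll1 n (x - y))" "deriv (\<lambda>y. moll1 n (x - y)) = (\<lambda>y. - moll2 n (x - y))"
    by (rule test_functionI[OF d(2) c(2) s(2)]; assumption)+
qed

lemma test_function_deriv:
  assumes "test_function \<phi>"
  obtains L where "\<And>x. (\<phi> has_real_derivative deriv \<phi> x) (at x)" "continuous_on UNIV (deriv \<phi>)"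
    "continuous_on UNIV \<phi>" "\<And>x. \<bar>x\<bar> > L \<Longrightarrow> \<phi> x = 0" "\<And>x. \<bar>x\<bar> > L \<Longrightarrow> deriv \<phi> x = 0"
proof -
  obtain D where D: "\<And>x. (\<phi> has_real_derivative D x) (at x)" "continuous_on UNIV D"
    using assms unfolding test_function_def C1_differentiable_on_def
    by (auto simp flip: has_real_derivative_iff_has_vector_derivative)
  have eq: "deriv \<phi> = D" using D(1) by (auto intro: DERIV_imp_deriv)
  have "bounded {r. \<phi> r \<noteq> 0}"
    using assms unfolding test_function_def by (meson bounded_subset closure_subset compact_imp_bounded)
  then obtain L where L: "\<And>x. \<phi> x \<noteq> 0 \<Longrightarrow> \<bar>x\<bar> \<le> L" unfolding bounded_iff by auto
  have z: "\<phi> x = 0" if "\<bar>x\<bar> > L" for x using L[of x] that by force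
  have "D x = 0" if "\<bar>x\<bar> > L" for x
  proof -
    have "((\<lambda>_. 0) has_real_derivative D x) (at x)"
    proof (rule has_field_derivative_transform_within_open[OF D(1)])
      show "open {y :: real. \<bar>y\<bar> > L}" by (intro open_Collect_less continuous_intros)
    qed (use that z in auto)
    then show ?thesis using DERIV_unique DERIV_const by metis
  qed
  moreover have "continuous_on UNIV \<phi>" using D(1) by (meson DERIV_isCont continuous_at_imp_continuous_on)
  ultimately show thesis using that[of L] D z eq by simp
qed

text \<open>Integrability over an interval only yields measurability of the truncated function;
  \<open>u\<close> is the pointwise limit of its truncations.\<close>

lemma locally_integrable_measurable:
  assumes "locally_integrable u" shows "u \<in> borel_measurable borel"
proof (rule borel_measurable_LIMSEQ_real)
  show "(\<lambda>x. indicator {- real n..real n} x *\<^sub>R u x) \<in> borel_measurable borel" for n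
    using assms borel_measurable_integrable[of lborel "\<lambda>x. indicator {- real n..real n} x *\<^sub>R u x"]
    unfolding locally_integrable_def set_integrable_def by simp
  fix x
  obtain N :: nat where "\<bar>x\<bar> \<le> real N" using real_arch_simple by blast
  then have "\<forall>\<^sub>F n in sequentially. indicator {- real n..real n} x *\<^sub>R u x = u x"
    unfolding eventually_sequentially by (intro exI[of _ N]) (auto simp: indicator_def)
  then show "(\<lambda>n. indicator {- real n..real n} x *\<^sub>R u x) \<longlonglongrightarrow> u x" by (rule tendsto_eventually)
qed

text \<open>Lebesgue differentiation: outside a null set \<open>f x\<close> is the limit of averages
  over [x, x + h], all of which are 0.\<close>

lemma AE_zero_of_interval_integrals:
  fixes f :: "real \<Rightarrow> real"
  assumes "locally_integrable f" "\<And>a b. a < b \<Longrightarrow> (LINT x:{a..b}|lborel. f x) = 0"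
  shows "AE x in lborel. f x = 0"
proof -
  have i: "f integrable_on {a..b}" "integral {a..b} f = (LINT x:{a..b}|lborel. f x)" for a b
    using set_borel_integral_eq_integral[of "{a..b}" f] assms(1) by (auto simp: locally_integrable_def)
  obtain N where N: "negligible N" "\<And>x e. x \<notin> N \<Longrightarrow> 0 < e \<Longrightarrow>
     \<exists>d>0. \<forall>h. 0 < h \<and> h < d \<longrightarrow> norm (integral (cbox x (x + h *\<^sub>R One)) f /\<^sub>R h ^ DIM(real) - f x) < e"
    using integrable_ccontinuous_explicit[of f] i(1) by (metis box_real(2))
  have "f x = 0" if xN: "x \<notin> N" for x
  proof (rule ccontr)
    assume "f x \<noteq> 0"
    then have fx: "\<bar>f x\<bar> > 0" by simp
    obtain d where d: "d > 0" "\<forall>h. 0 < h \<and> h < d \<longrightarrow>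
       norm (integral (cbox x (x + h *\<^sub>R One)) f /\<^sub>R h ^ DIM(real) - f x) < \<bar>f x\<bar>"
      using N(2)[OF xN fx] by blast
    have "integral {x..x + d/2} f = 0" using i(2) assms(2)[of x "x + d/2"] d(1) by simp
    then show False using d(2)[rule_format, of "d/2"] d(1) by simp
  qed
  then have "{x. f x \<noteq> 0} \<subseteq> N" by auto
  then have "AE x in lebesgue. f x = 0" unfolding eventually_ae_filter_negligible using N(1) by auto
  then show ?thesis by (simp add: AE_completion_iff)
qed

text \<open>The fundamental lemma of the calculus of variations. The indicator of (a, b) is
  approximated by C1 functions built from \<open>Q\<close>, the square of a truncated parabola that
  is positive exactly on (a, b).\<close>

lemma AE_zero_of_test_functions:
  assumes "locally_integrable f" "\<And>\<phi>. test_function \<phi> \<Longrightarrow> (LINT x|lborel. f x * \<phi> x) = 0"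
  shows "AE x in lborel. f x = 0"
proof (rule AE_zero_of_interval_integrals[OF assms(1)])
  fix a b :: real assume "a < b"
  have [measurable]: "f \<in> borel_measurable borel" by (rule locally_integrable_measurable[OF assms(1)])
  define Q where "Q x = max 0 ((x - a) * (b - x)) ^ 2" for x
  define Q' where "Q' x = 2 * max 0 ((x - a) * (b - x)) * (a + b - 2 * x)" for x
  have Q: "(Q has_real_derivative Q' x) (at x)" for x
  proof -
    have i: "((\<lambda>x. (x - a) * (b - x)) has_real_derivative (a + b - 2 * x)) (at x)"
      by (auto intro!: derivative_eq_intros)
    have "((\<lambda>x. max 0 ((x - a) * (b - x)) ^ Suc 1) has_real_derivative
        real (Suc 1) * max 0 ((x - a) * (b - x)) ^ 1 * (a + b - 2 * x)) (at x)"
      by (rule DERIV_chain2[OF max_power_has_real_derivative i]) simp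
    then show ?thesis unfolding Q_def[abs_def] Q'_def by (simp add: eval_nat_numeral)
  qed
  have Qp: "Q x \<ge> 0" for x by (simp add: Q_def)
  have Q'c: "continuous_on UNIV Q'" unfolding Q'_def by (intro continuous_intros)
  have Qc: "continuous_on UNIV Q" unfolding Q_def by (intro continuous_intros)
  have Q0: "Q x = 0" if "x \<notin> {a<..<b}" for x
  proof -
    have "(x - a) * (b - x) \<le> 0" using that \<open>a < b\<close> by (cases "x \<le> a") (auto simp: mult_le_0_iff)
    then show ?thesis by (simp add: Q_def)
  qed
  have Q1: "Q x > 0" if "x \<in> {a<..<b}" for x
    using that by (auto simp: Q_def max_def not_le)
  \<comment> \<open>A saturation of n Q: it is 0 outside (a, b), tends to 1 inside, and stays
    between 0 and 1, so the integrals against it converge to the integral over the open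
    interval.\<close>
  define \<phi> where "\<phi> n x = real n * Q x / (1 + real n * Q x)" for n x
  define \<phi>' where "\<phi>' n x = real n * Q' x / (1 + real n * Q x) ^ 2" for n x
  have pos: "1 + real n * Q x > 0" for n x using Qp[of x] by (simp add: add_pos_nonneg)
  then have ne: "1 + real n * Q x \<noteq> 0" for n x by (metis less_irrefl)
  have test: "test_function (\<phi> n)" for n
  proof (rule test_functionI(1)[where L="\<bar>a\<bar> + \<bar>b\<bar>"])
    show "(\<phi> n has_real_derivative \<phi>' n x) (at x)" for x
      unfolding \<phi>_def[abs_def] \<phi>'_def
      by (rule derivative_eq_intros Q refl ne)+ (use ne in \<open>simp add: field_simps power2_eq_square\<close>)
    show "continuous_on UNIV (\<phi>' n)" unfolding \<phi>'_def
      by (intro continuous_intros continuous_on_compose2[OF Q'c] continuous_on_compose2[OF Qc]) (use ne in auto)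
    show "\<phi> n x = 0" if "\<bar>x\<bar> > \<bar>a\<bar> + \<bar>b\<bar>" for x
    proof -
      have "x \<notin> {a<..<b}" using that by auto
      then show ?thesis using Q0[of x] by (simp add: \<phi>_def)
    qed
  qed
  have [measurable]: "\<phi> n \<in> borel_measurable borel" for n
    using test_function_deriv[OF test[of n]] borel_measurable_continuous_onI by metis
  have "(\<lambda>n. LINT x|lborel. f x * \<phi> n x) \<longlonglongrightarrow> (LINT x|lborel. indicator {a<..<b} x * f x)"
  proof (rule integral_dominated_convergence)
    show "integrable lborel (\<lambda>x. \<bar>indicator {a..b} x * f x\<bar>)"
      using assms(1) by (auto simp: locally_integrable_def set_integrable_def)
    show "AE x in lborel. (\<lambda>n. f x * \<phi> n x) \<longlonglongrightarrow> indicator {a<..<b} x * f x"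
    proof (rule AE_I2)
      fix x
      have "(\<lambda>n. \<phi> n x) \<longlonglongrightarrow> indicator {a<..<b} x"
      proof (cases "x \<in> {a<..<b}")
        case True
        have "filterlim (\<lambda>n. 1 + Q x * real n) at_top sequentially"
          by (rule filterlim_tendsto_add_at_top[OF tendsto_const
                filterlim_tendsto_pos_mult_at_top[OF tendsto_const Q1[OF True] filterlim_real_sequentially]])
        then have "(\<lambda>n. 1 - inverse (1 + Q x * real n)) \<longlonglongrightarrow> 1 - 0"
          by (rule tendsto_diff[OF tendsto_const tendsto_inverse_0_at_top])
        moreover have "1 - inverse (1 + Q x * real n) = \<phi> n x" for n
          using ne[of n x] by (simp add: \<phi>_def field_simps)
        ultimately show ?thesis using True by simp
      next
        case False
        then show ?thesis using Q0[OF False] by (simp add: \<phi>_def)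
      qed
      then have "(\<lambda>n. \<phi> n x * f x) \<longlonglongrightarrow> indicator {a<..<b} x * f x" by (rule tendsto_mult_right)
      then show "(\<lambda>n. f x * \<phi> n x) \<longlonglongrightarrow> indicator {a<..<b} x * f x"
        by (rule Lim_transform_eventually) (auto simp: mult.commute)
    qed
    show "AE x in lborel. norm (f x * \<phi> n x) \<le> \<bar>indicator {a..b} x * f x\<bar>" for n
    proof (rule AE_I2)
      fix x
      have "\<bar>\<phi> n x\<bar> \<le> 1" using pos[of n x] Qp[of x] by (simp add: \<phi>_def)
      then have "\<bar>f x\<bar> * \<bar>\<phi> n x\<bar> \<le> \<bar>f x\<bar> * 1" by (intro mult_left_mono) auto
      then show "norm (f x * \<phi> n x) \<le> \<bar>indicator {a..b} x * f x\<bar>"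
        using Q0[of x] by (cases "x \<in> {a..b}") (auto simp: abs_mult \<phi>_def)
    qed
  qed measurable
  then have "(LINT x|lborel. indicator {a<..<b} x * f x) = 0"
    using assms(2)[OF test] by (simp add: LIMSEQ_const_iff)
  also have "(LINT x|lborel. indicator {a<..<b} x * f x) = (LINT x:{a..b}|lborel. f x)"
    unfolding set_lebesgue_integral_def
  proof (rule integral_cong_AE)
    have "AE x in lborel. x \<noteq> a" "AE x in lborel. x \<noteq> b" by (rule AE_lborel_singleton)+
    then show "AE x in lborel. indicator {a<..<b} x * f x = indicator {a..b} x *\<^sub>R f x"
      by eventually_elim (auto simp: indicator_def)
  qed measurable
  finally show "(LINT x:{a..b}|lborel. f x) = 0" .
qed

text \<open>The integrated form of v' = g, suited to a \<open>g\<close> that is only locally square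
  integrable. It singles out the continuous representative of a class with weak derivative
  \<open>g\<close>, for which pointwise values such as v(0) make sense.\<close>

definition primitive :: "(real \<Rightarrow> real) \<Rightarrow> (real \<Rightarrow> real) \<Rightarrow> bool" where
  "primitive v g \<longleftrightarrow> (\<forall>a b. a \<le> b \<longrightarrow> (g has_integral (v b - v a)) {a..b})"

lemma locsq_mult_integrable_on:
  assumes "locsq f" "locsq h"
  shows "(\<lambda>x. f x * h x) integrable_on {a..b}"
    "integral {a..b} (\<lambda>x. f x * h x) = (LINT x|lborel. (indicator {a..b} x * f x) * (indicator {a..b} x * h x))"
proof -
  note i = set_borel_integral_eq_integral[OF locsq_mult_integrable[OF assms, of a b]]
  show "(\<lambda>x. f x * h x) integrable_on {a..b}" by (rule i(1))
  have "(\<lambda>x. indicator {a..b} x *\<^sub>R (f x * h x)) = (\<lambda>x. (indicator {a..b} x * f x) * (indicator {a..b} x * h x))"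
    by (auto simp: indicator_def)
  then show "integral {a..b} (\<lambda>x. f x * h x) = (LINT x|lborel. (indicator {a..b} x * f x) * (indicator {a..b} x * h x))"
    using i(2) by (simp add: set_lebesgue_integral_def)
qed

lemma locsq_integrable_on: "locsq f \<Longrightarrow> f integrable_on {a..b}"
  using locsq_mult_integrable_on(1)[of f "\<lambda>_. 1"] locsq_continuous[of "\<lambda>_. 1"] by simp

lemma sqint_Icc: assumes "locsq f" shows "sqint (\<lambda>x. indicator {a..b} x * f x)"
proof -
  have "sqint (\<lambda>x. indicator {a..b} x * (indicator {-max \<bar>a\<bar> \<bar>b\<bar>..max \<bar>a\<bar> \<bar>b\<bar>} x * f x))"
    by (rule sqint_bdd_mult[OF locsq_sqint[OF assms], of _ 1]) auto
  then show ?thesis by (rule back_subst[of sqint]) (auto simp: indicator_def fun_eq_iff)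
qed

lemma norm2_indicator: "a \<le> b \<Longrightarrow> norm2 (indicat_real {a..b}) = sqrt (b - a)"
proof -
  assume "a \<le> b"
  have "(\<lambda>x. (indicat_real {a..b} x)\<^sup>2) = indicat_real {a..b}" by (auto simp: indicator_def)
  then show ?thesis using \<open>a \<le> b\<close> by (simp add: norm2_def)
qed

lemma integral_le_locnorm:
  assumes "locsq f" "-L \<le> a" "a \<le> b" "b \<le> L"
  shows "\<bar>integral {a..b} f\<bar> \<le> sqrt (b - a) * locnorm L f"
proof -
  have s: "sqint (\<lambda>x. indicator {a..b} x * 1)" by (rule sqint_Icc[OF locsq_continuous]) auto
  have "integral {a..b} f = integral {a..b} (\<lambda>x. 1 * f x)" by simp
  also have "\<dots> = (LINT x|lborel. (indicator {a..b} x * 1) * (indicator {a..b} x * f x))"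
    by (rule locsq_mult_integrable_on(2)[OF locsq_continuous assms(1)]) auto
  also have "\<bar>\<dots>\<bar> \<le> norm2 (\<lambda>x. indicator {a..b} x * 1) * norm2 (\<lambda>x. indicator {a..b} x * f x)"
    by (rule norm2_CS[OF s sqint_Icc[OF assms(1)]])
  also have "\<dots> \<le> sqrt (b - a) * locnorm L f"
  proof (intro mult_mono)
    have "norm2 (\<lambda>x. indicator {a..b} x * f x) \<le> 1 * norm2 (\<lambda>x. indicator {-L..L} x * f x)"
      by (rule norm2_mono[OF locsq_sqint[OF assms(1)]])
         (use assms sqint_measurable[OF sqint_Icc[OF assms(1)]] in \<open>auto simp: indicator_def\<close>)
    then show "norm2 (\<lambda>x. indicator {a..b} x * f x) \<le> locnorm L f" by (simp add: locnorm_def)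
  qed (use assms norm2_indicator in auto)
  finally show ?thesis .
qed

lemma primitive_diff_bound:
  assumes "primitive v g" "locsq g" "\<bar>x\<bar> \<le> L" "\<bar>y\<bar> \<le> L"
  shows "\<bar>v y - v x\<bar> \<le> sqrt \<bar>y - x\<bar> * locnorm L g"
proof (cases "x \<le> y")
  case True
  then have "v y - v x = integral {x..y} g" using assms(1) unfolding primitive_def by (metis integral_unique)
  then show ?thesis using integral_le_locnorm[OF assms(2), of L x y] assms(3,4) True by auto
next
  case False
  then have "v x - v y = integral {y..x} g" using assms(1) unfolding primitive_def by (metis integral_unique nle_le)
  then show ?thesis using integral_le_locnorm[OF assms(2), of L y x] assms(3,4) False by (auto simp: abs_minus_commute)
qed

lemma primitive_continuous:
  assumes "primitive v g" "locsq g" shows "continuous_on S v"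
proof -
  have "isCont v x" for x
    unfolding isCont_def
  proof (rule LIM_zero_cancel, rule metric_tendsto_imp_tendsto)
    have "((\<lambda>y. sqrt \<bar>y - x\<bar> * locnorm (\<bar>x\<bar> + 1) g) \<longlongrightarrow> sqrt \<bar>x - x\<bar> * locnorm (\<bar>x\<bar> + 1) g) (at x)"
      by (intro tendsto_intros)
    then show "((\<lambda>y. sqrt \<bar>y - x\<bar> * locnorm (\<bar>x\<bar> + 1) g) \<longlongrightarrow> 0) (at x)" by simp
    have "((\<lambda>y. \<bar>y\<bar>) \<longlongrightarrow> \<bar>x\<bar>) (at x)" by (intro tendsto_intros)
    then have "\<forall>\<^sub>F y in at x. \<bar>y\<bar> < \<bar>x\<bar> + 1" by (rule order_tendstoD) simp
    then show "\<forall>\<^sub>F y in at x. dist (v y - v x) 0 \<le> dist (sqrt \<bar>y - x\<bar> * locnorm (\<bar>x\<bar> + 1) g) 0"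
    proof eventually_elim
      case (elim y)
      then show ?case using primitive_diff_bound[OF assms, of x "\<bar>x\<bar> + 1" y] by (simp add: dist_real_def)
    qed
  qed
  then show ?thesis by (simp add: continuous_at_imp_continuous_on)
qed

text \<open>The difference of the two integrals is the oriented integral from 0 to \<open>x\<close>:
  an integral over an empty or degenerate interval is 0, so at most one of the two
  contributes.\<close>

lemma primitive_exists:
  assumes "locsq g"
  shows "primitive (\<lambda>x. c + (integral {0..x} g - integral {x..0} g)) g"
  unfolding primitive_def
proof (intro allI impI)
  fix a b :: real assume ab: "a \<le> b"
  note i = locsq_integrable_on[OF assms] and comb = Henstock_Kurzweil_Integration.integral_combine
  have z: "integral {x..y} g = 0" if "y \<le> x" for x y
    using that by (cases "x = y") auto
  have eq: "integral {a..b} g = (integral {0..b} g - integral {b..0} g) - (integral {0..a} g - integral {a..0} g)"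
  proof -
    consider "0 \<le> a" | "a \<le> 0" "0 \<le> b" | "b \<le> 0" by linarith
    then show ?thesis
    proof cases
      case 1 then show ?thesis using comb[OF 1 ab i] z[of 0 a] z[of 0 b] ab by simp
    next
      case 2 then show ?thesis using comb[OF 2 i] z[of a 0] z[of 0 b] by simp
    next
      case 3 then show ?thesis using comb[OF ab 3 i] z[of a 0] z[of b 0] ab by simp
    qed
  qed
  show "(g has_integral c + (integral {0..b} g - integral {b..0} g) - (c + (integral {0..a} g - integral {a..0} g))) {a..b}"
    unfolding add_diff_cancel_left eq[symmetric] by (rule integrable_integral[OF i])
qed

lemma locnorm_triangle:
  assumes "locsq f" "locsq h" shows "locnorm L (\<lambda>x. f x + h x) \<le> locnorm L f + locnorm L h"
  unfolding locnorm_def using norm2_triangle[OF locsq_sqint[OF assms(1)] locsq_sqint[OF assms(2)]]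
  by (simp add: distrib_left)

lemma locnorm_triangle_diff:
  assumes "locsq f" "locsq g" "locsq h"
  shows "locnorm L (\<lambda>x. f x - h x) \<le> locnorm L (\<lambda>x. f x - g x) + locnorm L (\<lambda>x. g x - h x)"
  using locnorm_triangle[OF locsq_diff[OF assms(1,2)] locsq_diff[OF assms(2,3)]] by simp

lemma locnorm_minus: "locnorm L (\<lambda>x. f x - h x) = locnorm L (\<lambda>x. h x - f x)"
  unfolding locnorm_def using norm2_minus by (simp add: right_diff_distrib)

lemma locnorm_sup_bound:
  assumes "f \<in> borel_measurable borel" "\<And>x. \<bar>x\<bar> \<le> L \<Longrightarrow> \<bar>f x\<bar> \<le> e" "0 \<le> L" "0 \<le> e"
  shows "locnorm L f \<le> e * sqrt (2 * L)"
proof -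
  have "norm2 (\<lambda>x. indicator {-L..L} x * f x) \<le> e * norm2 (indicat_real {-L..L})"
  proof (rule norm2_mono)
    show "sqint (indicat_real {-L..L})"
      using sqint_Icc[OF locsq_continuous[of "\<lambda>_. 1"], of "-L" L] by simp
    show "AE x in lborel. \<bar>indicator {-L..L} x * f x\<bar> \<le> e * \<bar>indicat_real {-L..L} x\<bar>"
      using assms(2) by (auto simp: indicator_def abs_le_iff)
  qed (use assms in auto)
  also have "norm2 (indicat_real {-L..L}) = sqrt (2 * L)" using norm2_indicator[of "-L" L] assms by simp
  finally show ?thesis by (simp add: locnorm_def)
qed

lemma locnorm_zero_AE:
  assumes "locsq f" "\<And>L. L \<ge> 0 \<Longrightarrow> locnorm L f = 0"
  shows "AE x in lborel. f x = 0"
proof -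
  have "AE x in lborel. \<forall>n::nat. indicator {-real n..real n} x * f x = 0"
  proof (subst AE_all_countable, intro allI)
    fix n :: nat
    have "(LINT x|lborel. (indicator {-real n..real n} x * f x)\<^sup>2) = 0"
      using assms(2)[of "real n"] by (simp add: locnorm_def norm2_def)
    then have "AE x in lborel. (indicator {-real n..real n} x * f x)\<^sup>2 = 0"
      using integral_nonneg_eq_0_iff_AE[OF sqint_integrable[OF locsq_sqint[OF assms(1)]]] by simp
    then show "AE x in lborel. indicator {-real n..real n} x * f x = 0" by simp
  qed
  then show ?thesis
  proof eventually_elim
    case (elim x)
    obtain N :: nat where N: "\<bar>x\<bar> \<le> real N" using real_arch_simple by blast
    then show ?case using elim[rule_format, of N] by (auto simp: indicator_def abs_le_iff)
  qed
qed

text \<open>The mollification of \<open>u\<close> is smooth with derivative the mollification of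
  \<open>g\<close>; hence it differs from the primitive \<open>v0\<close> by nearly the constant
  \<open>c n\<close>, its value at 0, uniformly on bounded sets. These constants converge, and the
  limit identifies \<open>u\<close> with \<open>v0\<close> plus a constant almost
  everywhere.\<close>

lemma weak_derivative_primitive:
  assumes wd: "has_weak_derivative u g" and u: "locsq u" and g: "locsq g"
  obtains v where "primitive v g" "AE x in lborel. u x = v x"
proof -
  define v0 where "v0 = (\<lambda>x. 0 + (integral {0..x} g - integral {x..0} g))"
  have v0: "primitive v0 g" unfolding v0_def by (rule primitive_exists[OF g])
  have v0c: "continuous_on UNIV v0" by (rule primitive_continuous[OF v0 g])
  have v00: "v0 0 = 0" by (simp add: v0_def)
  let ?U = "\<lambda>n. conv (moll n) u" and ?G = "\<lambda>n. conv (moll n) g"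
  have der: "(?U n has_real_derivative ?G n x) (at x)" for n x
  proof -
    have "(LINT y|lborel. u y * deriv (\<lambda>y. moll n (x - y)) y) = - (LINT y|lborel. g y * moll n (x - y))"
      using wd test_function_moll(1) unfolding has_weak_derivative_def by blast
    then have "conv (moll1 n) u x = conv (moll n) g x"
      unfolding test_function_moll(2) conv_def by simp
    then show ?thesis using conv_moll_deriv(1)[OF u, of n x] by simp
  qed
  have Gc: "continuous_on S (?G n)" "continuous_on S (?U n)" for n S
    by (rule conv_moll_continuous[OF g] conv_moll_continuous[OF u])+
  have pU: "primitive (?U n) (?G n)" for n
    unfolding primitive_def
    by (intro allI impI fundamental_theorem_of_calculus)
       (auto simp flip: has_real_derivative_iff_has_vector_derivative intro: has_field_derivative_at_within der)
  have pd: "primitive (\<lambda>x. ?U n x - v0 x) (\<lambda>x. ?G n x - g x)" for n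
    unfolding primitive_def
  proof (intro allI impI)
    fix a b :: real assume "a \<le> b"
    have "((\<lambda>x. ?G n x - g x) has_integral (?U n b - ?U n a) - (v0 b - v0 a)) {a..b}"
      using pU v0 \<open>a \<le> b\<close> unfolding primitive_def by (intro has_integral_diff) auto
    then show "((\<lambda>x. ?G n x - g x) has_integral ?U n b - v0 b - (?U n a - v0 a)) {a..b}"
      by (simp add: algebra_simps)
  qed
  have lG: "locsq (?G n)" "locsq (?U n)" "locsq v0" for n
    using Gc v0c by (auto intro: locsq_continuous)
  define c where "c n = ?U n 0" for n
  let ?d = "\<lambda>L n. sqrt L * locnorm L (\<lambda>x. ?G n x - g x)"
  have dU: "\<bar>?U n x - (v0 x + c n)\<bar> \<le> ?d L n" if "\<bar>x\<bar> \<le> L" for n x L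
  proof -
    have "\<bar>(?U n x - v0 x) - (?U n 0 - v0 0)\<bar> \<le> sqrt \<bar>x - 0\<bar> * locnorm L (\<lambda>x. ?G n x - g x)"
      by (rule primitive_diff_bound[OF pd locsq_diff[OF lG(1) g]]) (use that in auto)
    also have "\<dots> \<le> ?d L n" using that by (intro mult_right_mono) auto
    finally show ?thesis by (simp add: v00 c_def algebra_simps)
  qed
  have lc: "locsq (\<lambda>x. v0 x + k)" for k by (intro locsq_continuous continuous_intros v0c)
  have lu: "locsq (\<lambda>x. u x - (v0 x + k))" for k by (rule locsq_diff[OF u lc])
  have e0: "(\<lambda>n. locnorm L (\<lambda>x. u x - (v0 x + c n))) \<longlonglongrightarrow> 0" if L: "L \<ge> 0" for L
  proof (rule metric_tendsto_imp_tendsto, rule_tac [2] always_eventually, rule_tac [2] allI)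
    show "(\<lambda>n. locnorm L (\<lambda>x. ?U n x - u x) + ?d L n * sqrt (2 * L)) \<longlonglongrightarrow> 0"
      using tendsto_add[OF conv_moll_locnorm_tendsto[OF u] tendsto_mult_right[OF tendsto_mult_left[OF conv_moll_locnorm_tendsto[OF g]]]]
      by simp
    fix n
    have "locnorm L (\<lambda>x. u x - (v0 x + c n)) \<le> locnorm L (\<lambda>x. u x - ?U n x) + locnorm L (\<lambda>x. ?U n x - (v0 x + c n))"
      by (rule locnorm_triangle_diff[OF u lG(2) lc])
    also have "locnorm L (\<lambda>x. ?U n x - (v0 x + c n)) \<le> ?d L n * sqrt (2 * L)"
      by (rule locnorm_sup_bound) (use dU L locsq_measurable[OF locsq_diff[OF lG(2) lc]] in auto)
    finally show "dist (locnorm L (\<lambda>x. u x - (v0 x + c n))) 0 \<le> dist (locnorm L (\<lambda>x. ?U n x - u x) + ?d L n * sqrt (2 * L)) 0"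
      using L by (simp add: dist_real_def locnorm_minus[of L u])
  qed
  \<comment> \<open>The mean of \<open>u - v0\<close> over [0, 1] is the only possible limit of
    \<open>c\<close>, since \<open>u - v0 - c n\<close> tends to 0 in the local norm. The summand 0
    gives the integrand the shape in \<open>lu\<close>.\<close>
  define k where "k = integral {0..1} (\<lambda>x. u x - (v0 x + 0))"
  have ck: "c \<longlonglongrightarrow> k"
  proof (rule LIM_zero_cancel, rule metric_tendsto_imp_tendsto[OF e0[of 1]])
    have "dist (c n - k) 0 \<le> dist (locnorm 1 (\<lambda>x. u x - (v0 x + c n))) 0" for n
    proof -
      have "integral {0..1} (\<lambda>x. (u x - (v0 x + 0)) - c n) = k - c n"
        unfolding k_def by (subst integral_diff[OF locsq_integrable_on[OF lu]]) auto
      then have "k - c n = integral {0..1} (\<lambda>x. u x - (v0 x + c n))"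
        by (simp add: algebra_simps)
      also have "\<bar>\<dots>\<bar> \<le> sqrt (1 - 0) * locnorm 1 (\<lambda>x. u x - (v0 x + c n))"
        by (rule integral_le_locnorm[OF lu]) auto
      finally show ?thesis by (simp add: dist_real_def abs_minus_commute)
    qed
    then show "\<forall>\<^sub>F n in sequentially. dist (c n - k) 0 \<le> dist (locnorm 1 (\<lambda>x. u x - (v0 x + c n))) 0"
      by simp
  qed simp
  have "locnorm L (\<lambda>x. u x - (v0 x + k)) = 0" if L: "L \<ge> 0" for L
  proof -
    have "(\<lambda>n. locnorm L (\<lambda>x. u x - (v0 x + c n)) + \<bar>c n - k\<bar> * sqrt (2 * L)) \<longlonglongrightarrow> 0 + \<bar>k - k\<bar> * sqrt (2 * L)"
      by (intro tendsto_intros e0 ck L)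
    moreover have "locnorm L (\<lambda>x. u x - (v0 x + k)) \<le> locnorm L (\<lambda>x. u x - (v0 x + c n)) + \<bar>c n - k\<bar> * sqrt (2 * L)" for n
    proof -
      have "locnorm L (\<lambda>x. u x - (v0 x + k)) \<le> locnorm L (\<lambda>x. u x - (v0 x + c n)) + locnorm L (\<lambda>x. (v0 x + c n) - (v0 x + k))"
        by (rule locnorm_triangle_diff[OF u lc lc])
      also have "locnorm L (\<lambda>x. (v0 x + c n) - (v0 x + k)) \<le> \<bar>c n - k\<bar> * sqrt (2 * L)"
        by (rule locnorm_sup_bound) (use L in auto)
      finally show ?thesis by simp
    qed
    ultimately have "locnorm L (\<lambda>x. u x - (v0 x + k)) \<le> 0 + \<bar>k - k\<bar> * sqrt (2 * L)"
      by (intro LIMSEQ_le_const) auto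
    then show ?thesis by (simp add: order_antisym)
  qed
  then have "AE x in lborel. u x - (v0 x + k) = 0" by (rule locnorm_zero_AE[OF lu])
  then have "AE x in lborel. u x = k + (integral {0..x} g - integral {x..0} g)"
    by eventually_elim (simp add: v0_def)
  then show thesis using that[OF primitive_exists[OF g]] by blast
qed

lemma sqint_Icc_dominated_tendsto:
  fixes f :: "nat \<Rightarrow> real \<Rightarrow> real"
  assumes "\<And>k. continuous_on {a..b} (f k)" "continuous_on {a..b} f0"
    and lim: "\<And>x. x \<in> {a..b} \<Longrightarrow> (\<lambda>k. f k x) \<longlonglongrightarrow> f0 x"
    and B: "\<And>k x. x \<in> {a..b} \<Longrightarrow> \<bar>f k x - f0 x\<bar> \<le> B"
  shows "(\<lambda>k. norm2 (\<lambda>x. indicator {a..b} x * f k x - indicator {a..b} x * f0 x)) \<longlonglongrightarrow> 0"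
proof (rule norm2_dominated_tendsto)
  show "(\<lambda>x. indicator {a..b} x * f k x) \<in> borel_measurable borel" for k
    using borel_measurable_continuous_on_indicator[OF _ assms(1)[of k]] by simp
  show "(\<lambda>x. indicator {a..b} x * f0 x) \<in> borel_measurable borel"
    using borel_measurable_continuous_on_indicator[OF _ assms(2)] by simp
  show "sqint (\<lambda>x. indicator {a..b} x * B)" by (rule sqint_Icc[OF locsq_continuous]) simp
  show "AE x in lborel. (\<lambda>k. indicator {a..b} x * f k x) \<longlonglongrightarrow> indicator {a..b} x * f0 x"
    using lim by (auto simp: indicator_def)
  show "AE x in lborel. \<bar>indicator {a..b} x * f k x - indicator {a..b} x * f0 x\<bar> \<le> \<bar>indicator {a..b} x * B\<bar>" for k
    using B[of _ k] by (auto simp: indicator_def intro!: AE_I2 intro: order_trans[OF _ abs_ge_self])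
qed

lemma sqint_Icc_continuous:
  assumes "continuous_on {a..b} f" shows "sqint (\<lambda>x. indicator {a..b} x * f x)"
proof -
  obtain B where B: "\<forall>y\<in>f ` {a..b}. \<bar>y\<bar> \<le> B"
    using compact_continuous_image[OF assms compact_Icc] compact_imp_bounded bounded_iff by (metis real_norm_def)
  have "sqint (\<lambda>x. indicator {a..b} x * max B 0)" by (rule sqint_Icc[OF locsq_continuous]) simp
  then show ?thesis
  proof (rule sqint_bound[where C=1])
    show "(\<lambda>x. indicator {a..b} x * f x) \<in> borel_measurable borel"
      using borel_measurable_continuous_on_indicator[OF _ assms] by simp
    show "AE x in lborel. \<bar>indicator {a..b} x * f x\<bar> \<le> 1 * \<bar>indicator {a..b} x * max B 0\<bar>"
    proof (rule AE_I2)
      fix x show "\<bar>indicator {a..b} x * f x\<bar> \<le> 1 * \<bar>indicator {a..b} x * max B 0\<bar>"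
        using B by (cases "x \<in> {a..b}") (auto intro: max.coboundedI1)
    qed
  qed
qed

lemma LINT_Icc_has_integral:
  assumes "integrable lborel (\<lambda>x. indicat_real {a..b} x * f x)"
  shows "(f has_integral (LINT x|lborel. indicator {a..b} x * f x)) {a..b}"
proof -
  have s: "set_integrable lborel {a..b} f" using assms by (simp add: set_integrable_def)
  show ?thesis
    using set_borel_integral_eq_integral[OF s] by (simp add: has_integral_iff set_lebesgue_integral_def)
qed

text \<open>The product rule for m v^n when v has only a locally square integrable derivative. The
  approximations \<open>w k\<close> are primitives of the mollified \<open>g\<close> starting from
  \<open>v a\<close>: their derivatives are exact and they converge to \<open>v\<close> uniformly on
  the interval, so the classical identity passes to the limit.\<close>

lemma primitive_power_has_integral:
  assumes pv: "primitive v g" and g: "locsq g" and ab: "a \<le> b"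
    and m: "\<And>x. x \<in> {a..b} \<Longrightarrow> (m has_real_derivative m' x) (at x)" "continuous_on {a..b} m'"
  shows "((\<lambda>x. m' x * v x ^ n + real n * m x * v x ^ (n - 1) * g x) has_integral
     (m b * v b ^ n - m a * v a ^ n)) {a..b}"
proof -
  let ?G = "\<lambda>k. conv (moll k) g" and ?I = "indicat_real {a..b}"
  define L where "L = max \<bar>a\<bar> \<bar>b\<bar>"
  have L: "-L \<le> a" "b \<le> L" by (auto simp: L_def)
  have vc: "continuous_on S v" for S by (rule primitive_continuous[OF pv g])
  have mc: "continuous_on {a..b} m" using m(1) by (meson DERIV_isCont continuous_at_imp_continuous_on)
  have Gc: "continuous_on S (?G k)" for k S by (rule conv_moll_continuous[OF g])
  have lG: "locsq (?G k)" for k by (rule locsq_continuous[OF Gc])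
  define w where "w k x = v a + integral {a..x} (?G k)" for k x
  have w: "(w k has_real_derivative ?G k x) (at x within {a..b})" if "x \<in> {a..b}" for k x
    unfolding w_def[abs_def] using integral_has_real_derivative[OF Gc that] by (auto intro!: derivative_eq_intros)
  have wc: "continuous_on {a..b} (w k)" for k
    using w by (meson continuous_on_eq_continuous_within DERIV_continuous)
  let ?d = "\<lambda>k. sqrt (b - a) * locnorm L (\<lambda>x. ?G k x - g x)"
  have d0: "?d \<longlonglongrightarrow> 0" using tendsto_mult_left[OF conv_moll_locnorm_tendsto[OF g]] by simp
  have wv: "\<bar>w k x - v x\<bar> \<le> ?d k" if "x \<in> {a..b}" for k x
  proof -
    have "v x - v a = integral {a..x} g" using pv that unfolding primitive_def by (metis atLeastAtMost_iff integral_unique)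
    then have "w k x - v x = integral {a..x} (\<lambda>x. ?G k x - g x)"
      unfolding w_def by (subst integral_diff[OF locsq_integrable_on[OF lG] locsq_integrable_on[OF g]]) simp
    also have "\<bar>\<dots>\<bar> \<le> sqrt (x - a) * locnorm L (\<lambda>x. ?G k x - g x)"
      by (rule integral_le_locnorm[OF locsq_diff[OF lG g]]) (use that L in auto)
    also have "\<dots> \<le> ?d k" using that by (intro mult_right_mono) auto
    finally show ?thesis .
  qed
  have lim: "(\<lambda>k. w k x) \<longlonglongrightarrow> v x" if "x \<in> {a..b}" for x
    by (rule LIM_zero_cancel, rule metric_tendsto_imp_tendsto[OF d0])
       (use wv[OF that] in \<open>auto simp: dist_real_def intro!: always_eventually intro: order_trans[OF _ abs_ge_self]\<close>)
  obtain D where D: "\<And>k. \<bar>?d k\<bar> \<le> D" using convergent_imp_Bseq[OF convergentI[OF d0]] by (auto simp: Bseq_def)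
  obtain V where V: "\<And>x. x \<in> {a..b} \<Longrightarrow> \<bar>v x\<bar> \<le> V"
    using compact_continuous_image[OF vc[of "{a..b}"] compact_Icc] compact_imp_bounded bounded_iff
    by (metis imageI real_norm_def)
  define K where "K = max V 0 + max D 0"
  have K: "K \<ge> 0" "\<And>x. x \<in> {a..b} \<Longrightarrow> \<bar>v x\<bar> \<le> K" "\<And>k x. x \<in> {a..b} \<Longrightarrow> \<bar>w k x\<bar> \<le> K"
  proof -
    show "K \<ge> 0" by (simp add: K_def)
    fix x assume x: "x \<in> {a..b}"
    show "\<bar>v x\<bar> \<le> K" using V[OF x] by (simp add: K_def)
    fix k show "\<bar>w k x\<bar> \<le> K" using V[OF x] wv[OF x, of k] D[of k] by (simp add: K_def)
  qed
  obtain M where M: "\<And>x. x \<in> {a..b} \<Longrightarrow> \<bar>m x\<bar> \<le> M" "\<And>x. x \<in> {a..b} \<Longrightarrow> \<bar>m' x\<bar> \<le> M" "M \<ge> 0"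
  proof -
    obtain M1 where "\<And>x. x \<in> {a..b} \<Longrightarrow> \<bar>m x\<bar> \<le> M1"
      using compact_continuous_image[OF mc compact_Icc] compact_imp_bounded bounded_iff by (metis imageI real_norm_def)
    moreover obtain M2 where "\<And>x. x \<in> {a..b} \<Longrightarrow> \<bar>m' x\<bar> \<le> M2"
      using compact_continuous_image[OF m(2) compact_Icc] compact_imp_bounded bounded_iff by (metis imageI real_norm_def)
    ultimately show thesis using that[of "max 0 (max M1 M2)"] by fastforce
  qed
  have T: "(\<lambda>k. norm2 (\<lambda>x. ?I x * (q x * w k x ^ j) - ?I x * (q x * v x ^ j))) \<longlonglongrightarrow> 0"
    if q: "continuous_on {a..b} q" "\<And>x. x \<in> {a..b} \<Longrightarrow> \<bar>q x\<bar> \<le> Q" for q j Q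
  proof (rule sqint_Icc_dominated_tendsto)
    fix k x assume x: "x \<in> {a..b}"
    have "\<bar>q x\<bar> * \<bar>w k x\<bar> ^ j \<le> Q * K ^ j" "\<bar>q x\<bar> * \<bar>v x\<bar> ^ j \<le> Q * K ^ j"
      using q(2)[OF x] K(1) K(2)[OF x] K(3)[OF x, of k] by (auto intro!: mult_mono power_mono intro: order_trans[OF abs_ge_zero])
    then show "\<bar>q x * w k x ^ j - q x * v x ^ j\<bar> \<le> 2 * (Q * K ^ j)"
      by (intro order_trans[OF abs_triangle_ineq4]) (simp add: abs_mult power_abs)
  qed (auto intro!: continuous_intros q wc vc tendsto_intros lim)
  have S: "sqint (\<lambda>x. ?I x * (q x * w k x ^ j))" "sqint (\<lambda>x. ?I x * (q x * v x ^ j))"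
    if "continuous_on {a..b} q" for q k j
    by (intro sqint_Icc_continuous continuous_intros that wc vc)+
  have nm: "continuous_on {a..b} (\<lambda>x. real n * m x)" "\<And>x. x \<in> {a..b} \<Longrightarrow> \<bar>real n * m x\<bar> \<le> real n * M"
    using M by (auto intro!: continuous_intros mc mult_left_mono simp: abs_mult)
  have SI: "sqint (\<lambda>x. ?I x * 1)" by (rule sqint_Icc_continuous) simp
  have gT: "(\<lambda>k. norm2 (\<lambda>x. ?I x * ?G k x - ?I x * g x)) \<longlonglongrightarrow> 0"
  proof (rule metric_tendsto_imp_tendsto[OF conv_moll_locnorm_tendsto[OF g, of L]], intro always_eventually allI)
    fix k
    have "norm2 (\<lambda>x. ?I x * (?G k x - g x)) \<le> 1 * norm2 (\<lambda>x. indicator {-L..L} x * (?G k x - g x))"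
      by (rule norm2_mono[OF locsq_sqint[OF locsq_diff[OF lG g]]])
         (use L sqint_measurable[OF sqint_Icc[OF locsq_diff[OF lG g]]] in \<open>auto simp: indicator_def\<close>)
    then show "dist (norm2 (\<lambda>x. ?I x * ?G k x - ?I x * g x)) 0 \<le> dist (locnorm L (\<lambda>x. ?G k x - g x)) 0"
      by (simp add: dist_real_def locnorm_def right_diff_distrib)
  qed
  \<comment> \<open>Both summands are written as L^2 products, the one without \<open>g\<close> by
    means of a factor 1, so that \<open>norm2_prod_tendsto\<close> applies to each.\<close>
  let ?J = "\<lambda>w G. (LINT x|lborel. (?I x * (m' x * w x ^ n)) * (?I x * 1))
       + (LINT x|lborel. (?I x * (real n * m x * w x ^ (n - 1))) * (?I x * G x))"
  have JT: "(\<lambda>k. ?J (w k) (?G k)) \<longlonglongrightarrow> ?J v g"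
    by (intro tendsto_add norm2_prod_tendsto S SI sqint_Icc[OF lG] sqint_Icc[OF g] T[OF m(2) M(2)] T[OF nm] gT m(2) nm(1))
       (simp_all add: norm2_def)
  have JI: "((\<lambda>x. m' x * u x ^ n + real n * m x * u x ^ (n - 1) * G x) has_integral ?J u G) {a..b}"
    if "sqint (\<lambda>x. ?I x * (m' x * u x ^ n))" "sqint (\<lambda>x. ?I x * (real n * m x * u x ^ (n - 1)))" "locsq G" for u G
  proof (rule has_integral_add)
    have 1: "(\<lambda>x. (?I x * (m' x * u x ^ n)) * (?I x * 1)) = (\<lambda>x. ?I x * (m' x * u x ^ n))"
      "(\<lambda>x. (?I x * (real n * m x * u x ^ (n - 1))) * (?I x * G x)) = (\<lambda>x. ?I x * (real n * m x * u x ^ (n - 1) * G x))"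
      by (auto simp: indicator_def)
    show "((\<lambda>x. m' x * u x ^ n) has_integral (LINT x|lborel. (?I x * (m' x * u x ^ n)) * (?I x * 1))) {a..b}"
      using sqint_mult[OF that(1) SI] unfolding 1 by (rule LINT_Icc_has_integral)
    show "((\<lambda>x. real n * m x * u x ^ (n - 1) * G x) has_integral
       (LINT x|lborel. (?I x * (real n * m x * u x ^ (n - 1))) * (?I x * G x))) {a..b}"
      using sqint_mult[OF that(2) sqint_Icc[OF that(3), of a b]] unfolding 1 by (rule LINT_Icc_has_integral)
  qed
  have JW: "?J (w k) (?G k) = m b * w k b ^ n - m a * w k a ^ n" for k
  proof (rule has_integral_unique[OF JI[OF S(1)[OF m(2)] S(1)[OF nm(1)] lG]])
    show "((\<lambda>x. m' x * w k x ^ n + real n * m x * w k x ^ (n - 1) * ?G k x) has_integral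
       m b * w k b ^ n - m a * w k a ^ n) {a..b}"
    proof (rule fundamental_theorem_of_calculus[OF ab])
      fix x assume x: "x \<in> {a..b}"
      have "((\<lambda>x. m x * w k x ^ n) has_real_derivative
         m' x * w k x ^ n + (real n * w k x ^ (n - 1) * ?G k x) * m x) (at x within {a..b})"
        using DERIV_mult[OF has_field_derivative_at_within[OF m(1)[OF x]] DERIV_power[OF w[OF x, of k], of n]]
        by (simp add: mult_ac)
      then show "((\<lambda>x. m x * w k x ^ n) has_vector_derivative
         m' x * w k x ^ n + real n * m x * w k x ^ (n - 1) * ?G k x) (at x within {a..b})"
        by (simp add: has_real_derivative_iff_has_vector_derivative mult_ac)
    qed
  qed
  have "(\<lambda>k. m b * w k b ^ n - m a * w k a ^ n) \<longlonglongrightarrow> m b * v b ^ n - m a * v a ^ n"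
    using ab by (intro tendsto_intros lim) auto
  then have "?J v g = m b * v b ^ n - m a * v a ^ n"
    using LIMSEQ_unique[OF JT] unfolding JW by simp
  then show ?thesis using JI[OF S(2)[OF m(2)] S(2)[OF nm(1)] g] by simp
qed

section \<open>Quadratic identities for weak solutions\<close>

text \<open>A Henstock-Kurzweil integral over a compact interval, the form in which the fundamental
  theorem of calculus and the Leibniz rule apply; \<open>ip_eq_LINT\<close> gives access to the L^2
  estimates.\<close>

definition ip :: "real \<Rightarrow> (real \<Rightarrow> real) \<Rightarrow> (real \<Rightarrow> real) \<Rightarrow> (real \<Rightarrow> real) \<Rightarrow> real" where
  "ip L \<omega> f h = integral {-L..L} (\<lambda>x. \<omega> x * f x * h x)"

lemma ip_eq_LINT:
  assumes "continuous_on UNIV \<omega>" "locsq f" "locsq h"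
  shows "ip L \<omega> f h = (LINT x|lborel. (\<omega> x * (indicator {-L..L} x * f x)) * (indicator {-L..L} x * h x))"
  unfolding ip_def locsq_mult_integrable_on(2)[OF locsq_bdd_mult[OF assms(2,1)] assms(3)]
  by (simp add: mult_ac)

lemma ip_eq_LINT_support:
  assumes "continuous_on UNIV \<omega>" "locsq f" "locsq h" "\<And>x. \<bar>x\<bar> \<ge> L \<Longrightarrow> \<omega> x = 0"
  shows "ip L \<omega> f h = (LINT x|lborel. \<omega> x * f x * h x)"
  unfolding ip_eq_LINT[OF assms(1-3)]
  by (rule Bochner_Integration.integral_cong) (use assms(4) in \<open>force simp: indicator_def\<close>)+

lemma continuous_bounded_Icc:
  assumes "continuous_on UNIV (\<omega> :: real \<Rightarrow> real)"
  obtains B where "B \<ge> 0" "\<And>x. x \<in> {a..b} \<Longrightarrow> \<bar>\<omega> x\<bar> \<le> B"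
proof -
  obtain B where B: "\<forall>y\<in>\<omega> ` {a..b}. \<bar>y\<bar> \<le> B"
    using compact_continuous_image[OF continuous_on_subset[OF assms subset_UNIV] compact_Icc] compact_imp_bounded bounded_iff
    by (metis real_norm_def)
  show thesis by (rule that[of "max B 0"]) (use B in \<open>auto intro: max.coboundedI1\<close>)
qed

lemma sqint_weight:
  assumes "continuous_on UNIV \<omega>" "locsq f"
  shows "sqint (\<lambda>x. \<omega> x * (indicator {-L..L} x * f x))"
  using locsq_sqint[OF locsq_bdd_mult[OF assms(2,1)], of L] by (simp add: mult_ac)

lemma norm2_weight_le:
  assumes "locsq f" "\<And>x. x \<in> {-L..L} \<Longrightarrow> \<bar>\<omega> x\<bar> \<le> B" "continuous_on UNIV \<omega>" "B \<ge> 0"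
  shows "norm2 (\<lambda>x. \<omega> x * (indicator {-L..L} x * f x)) \<le> B * locnorm L f"
  unfolding locnorm_def
proof (rule norm2_mono[OF locsq_sqint[OF assms(1)] sqint_measurable[OF sqint_weight[OF assms(3,1)]] _ assms(4)])
  show "AE x in lborel. \<bar>\<omega> x * (indicator {-L..L} x * f x)\<bar> \<le> B * \<bar>indicator {-L..L} x * f x\<bar>"
    using assms(2) by (auto simp: indicator_def abs_mult intro!: AE_I2 mult_right_mono)
qed

lemma ip_bound:
  assumes "continuous_on UNIV \<omega>" "locsq f" "locsq h" "\<And>x. x \<in> {-L..L} \<Longrightarrow> \<bar>\<omega> x\<bar> \<le> B" "B \<ge> 0"
  shows "\<bar>ip L \<omega> f h\<bar> \<le> B * locnorm L f * locnorm L h"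
proof -
  have "\<bar>ip L \<omega> f h\<bar> \<le> norm2 (\<lambda>x. \<omega> x * (indicator {-L..L} x * f x)) * locnorm L h"
    unfolding ip_eq_LINT[OF assms(1-3)] locnorm_def
    by (rule norm2_CS[OF sqint_weight[OF assms(1,2)] locsq_sqint[OF assms(3)]])
  also have "\<dots> \<le> B * locnorm L f * locnorm L h"
    by (intro mult_right_mono norm2_weight_le assms locnorm_nonneg)
  finally show ?thesis .
qed

lemma ip_tendsto:
  assumes \<omega>: "continuous_on UNIV \<omega>" and f: "\<And>n. locsq (f n)" "locsq f0" and h: "\<And>n. locsq (h n)" "locsq h0"
    and ft: "((\<lambda>n. locnorm L (\<lambda>x. f n x - f0 x)) \<longlongrightarrow> 0) F"
    and ht: "((\<lambda>n. locnorm L (\<lambda>x. h n x - h0 x)) \<longlongrightarrow> 0) F"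
  shows "((\<lambda>n. ip L \<omega> (f n) (h n)) \<longlongrightarrow> ip L \<omega> f0 h0) F"
proof -
  obtain B where B: "B \<ge> 0" "\<And>x. x \<in> {-L..L} \<Longrightarrow> \<bar>\<omega> x\<bar> \<le> B"
    using continuous_bounded_Icc[OF \<omega>, of "-L" L] by blast
  have 1: "((\<lambda>n. norm2 (\<lambda>x. \<omega> x * (indicator {-L..L} x * f n x) - \<omega> x * (indicator {-L..L} x * f0 x))) \<longlongrightarrow> 0) F"
  proof (rule metric_tendsto_imp_tendsto)
    show "((\<lambda>n. B * locnorm L (\<lambda>x. f n x - f0 x)) \<longlongrightarrow> 0) F" using tendsto_mult_left[OF ft, of B] by simp
    have "norm2 (\<lambda>x. \<omega> x * (indicator {-L..L} x * f n x) - \<omega> x * (indicator {-L..L} x * f0 x))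
       \<le> B * locnorm L (\<lambda>x. f n x - f0 x)" for n
      using norm2_weight_le[OF locsq_diff[OF f(1) f(2)] B(2) \<omega> B(1), of L n] by (simp add: algebra_simps)
    then show "\<forall>\<^sub>F n in F. dist (norm2 (\<lambda>x. \<omega> x * (indicator {-L..L} x * f n x) - \<omega> x * (indicator {-L..L} x * f0 x))) 0
       \<le> dist (B * locnorm L (\<lambda>x. f n x - f0 x)) 0"
      using B(1) by (simp add: dist_real_def)
  qed
  have 2: "((\<lambda>n. norm2 (\<lambda>x. indicator {-L..L} x * h n x - indicator {-L..L} x * h0 x)) \<longlongrightarrow> 0) F"
    using ht by (simp add: locnorm_def right_diff_distrib)
  show ?thesis
    unfolding ip_eq_LINT[OF \<omega> f(1) h(1)] ip_eq_LINT[OF \<omega> f(2) h(2)]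
    by (rule norm2_prod_tendsto[OF sqint_weight[OF \<omega> f(1)] locsq_sqint[OF h(1)] sqint_weight[OF \<omega> f(2)] locsq_sqint[OF h(2)] 1 2])
qed

text \<open>The reason for keeping every identity integrated in time: the limits in the
  mollification and in the cutoff then only need integrands that are bounded and converge for each
  fixed time, with no uniformity in \<open>t\<close>.\<close>

lemma has_integral_limit:
  fixes D :: "nat \<Rightarrow> real \<Rightarrow> real"
  assumes D: "\<And>n. (D n has_integral F n) {a..b}" and B: "\<And>n t. t \<in> {a..b} \<Longrightarrow> \<bar>D n t\<bar> \<le> C"
    and lim: "\<And>t. t \<in> {a..b} \<Longrightarrow> (\<lambda>n. D n t) \<longlonglongrightarrow> D0 t" and F: "F \<longlonglongrightarrow> F0"
  shows "(D0 has_integral F0) {a..b}"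
proof -
  have i: "D n integrable_on {a..b}" for n using D by blast
  have c: "(\<lambda>_. C) integrable_on {a..b}" by (rule integrable_const_ivl)
  note dc = dominated_convergence[where f=D and g=D0 and h="\<lambda>_. C" and S="{a..b}", OF i c]
  have "D0 integrable_on {a..b}" by (rule dc(1)) (use B lim in auto)
  moreover have "(\<lambda>n. integral {a..b} (D n)) \<longlonglongrightarrow> integral {a..b} D0" by (rule dc(2)) (use B lim in auto)
  moreover have "integral {a..b} (D n) = F n" for n using D by blast
  ultimately show ?thesis using LIMSEQ_unique[OF _ F] by (auto simp: has_integral_iff)
qed

text \<open>The flat wave equation V_tt = V_xx + G in weak form, with \<open>g\<close> for V_x and
  \<open>w\<close> for V_t. The first-order term, the potential and the nonlinearity are all placed
  in the source \<open>G\<close>, of which only local L^2 continuity in time is used here.\<close>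

locale wave =
  fixes V g w G :: "real \<Rightarrow> real \<Rightarrow> real"
  assumes V: "\<And>t. t \<ge> 0 \<Longrightarrow> locsq (V t)" and g: "\<And>t. t \<ge> 0 \<Longrightarrow> locsq (g t)"
    and w: "\<And>t. t \<ge> 0 \<Longrightarrow> locsq (w t)" and G: "\<And>t. t \<ge> 0 \<Longrightarrow> locsq (G t)"
    and Vc: "\<And>t L. t \<ge> 0 \<Longrightarrow> ((\<lambda>s. locnorm L (\<lambda>x. V s x - V t x)) \<longlongrightarrow> 0) (at t within {0..})"
    and gc: "\<And>t L. t \<ge> 0 \<Longrightarrow> ((\<lambda>s. locnorm L (\<lambda>x. g s x - g t x)) \<longlongrightarrow> 0) (at t within {0..})"
    and wc: "\<And>t L. t \<ge> 0 \<Longrightarrow> ((\<lambda>s. locnorm L (\<lambda>x. w s x - w t x)) \<longlongrightarrow> 0) (at t within {0..})"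
    and Gc: "\<And>t L. t \<ge> 0 \<Longrightarrow> ((\<lambda>s. locnorm L (\<lambda>x. G s x - G t x)) \<longlongrightarrow> 0) (at t within {0..})"
    and prim: "\<And>t. t \<ge> 0 \<Longrightarrow> primitive (V t) (g t)"
    and V_bounded: "\<And>T L. \<exists>B. \<forall>t\<in>{0..T}. \<forall>x\<in>{-L..L}. \<bar>V t x\<bar> \<le> B"
    and eq1: "\<And>t \<phi>. t \<ge> 0 \<Longrightarrow> test_function \<phi> \<Longrightarrow>
      ((\<lambda>s. LINT x|lborel. V s x * \<phi> x) has_real_derivative (LINT x|lborel. w t x * \<phi> x)) (at t within {0..})"
    and eq2: "\<And>t \<phi>. t \<ge> 0 \<Longrightarrow> test_function \<phi> \<Longrightarrow>
      ((\<lambda>s. LINT x|lborel. w s x * \<phi> x) has_real_derivative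
        (LINT x|lborel. - g t x * deriv \<phi> x + G t x * \<phi> x)) (at t within {0..})"
begin

text \<open>Integration by parts against the translated kernel. The interval is chosen so that the
  kernel vanishes at both ends.\<close>

lemma weak_deriv_moll:
  assumes t: "t \<ge> 0"
  shows "conv (moll1 n) (V t) x = conv (moll n) (g t) x"
proof -
  define L where "L = \<bar>x\<bar> + 1"
  have i: "((\<lambda>y. x - y) has_real_derivative -1) (at y)" for y by (auto intro!: derivative_eq_intros)
  have d: "((\<lambda>y. moll n (x - y)) has_real_derivative - moll1 n (x - y)) (at y)" for y
    using DERIV_chain2[OF moll_deriv(1) i] by simp
  have c: "continuous_on UNIV (\<lambda>y. moll n (x - y))" "continuous_on UNIV (\<lambda>y. moll1 n (x - y))"
    by (intro continuous_on_compose2[OF moll_continuous(1)] continuous_on_compose2[OF moll_continuous(2)] continuous_intros; simp)+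
  have z: "moll n (x - y) = 0" "moll1 n (x - y) = 0" if "\<bar>y\<bar> \<ge> L" for y
  proof -
    \<comment> \<open>\<open>moll_support\<close> covers |z| > 1 only. The case |z| = 1 is needed as
      well, because one end of [-L, L] is at distance exactly 1 from \<open>x\<close>.\<close>
    have *: "moll n z = 0 \<and> moll1 n z = 0" if "\<bar>z\<bar> \<ge> 1" for z
    proof (cases "\<bar>z\<bar> > 1")
      case False
      then have "\<bar>real (Suc n) * z\<bar> \<ge> 1" using that by (simp add: abs_mult)
      then have "(real (Suc n) * z)\<^sup>2 \<ge> 1" by (metis abs_le_square_iff abs_one one_power2)
      then have "bump (real (Suc n) * z) = 0" "bump1 (real (Suc n) * z) = 0" by (simp_all add: bump_def bump1_def)
      then show ?thesis by (simp add: moll_def moll1_def)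
    qed (use moll_support in auto)
    have "\<bar>x - y\<bar> \<ge> 1" using that by (simp add: L_def)
    then show "moll n (x - y) = 0" "moll1 n (x - y) = 0" using * by auto
  qed
  have "((\<lambda>y. - moll1 n (x - y) * V t y ^ 1 + real 1 * moll n (x - y) * V t y ^ (1 - 1) * g t y) has_integral
     (moll n (x - L) * V t L ^ 1 - moll n (x - (-L)) * V t (-L) ^ 1)) {-L..L}"
    by (rule primitive_power_has_integral[OF prim[OF t] g[OF t]])
       (use d c in \<open>auto simp: L_def intro!: continuous_intros continuous_on_subset[OF c(2)]\<close>)
  then have "((\<lambda>y. moll n (x - y) * g t y - moll1 n (x - y) * V t y) has_integral 0) {-L..L}"
    using z(1)[of L] z(1)[of "-L"] by (simp add: L_def)
  then have 0: "integral {-L..L} (\<lambda>y. moll n (x - y) * g t y - moll1 n (x - y) * V t y) = 0" by blast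
  have 1: "(LINT y|lborel. (\<lambda>_. 1) y * k (x - y) * f y) = ip L (\<lambda>y. k (x - y)) (\<lambda>_. 1) f"
    if "locsq f" "continuous_on UNIV (\<lambda>y. k (x - y))" "\<And>y. \<bar>y\<bar> \<ge> L \<Longrightarrow> k (x - y) = 0" for f k
    by (subst ip_eq_LINT_support[OF that(2) locsq_continuous that(1,3)]) auto
  have "conv (moll n) (g t) x - conv (moll1 n) (V t) x = 
     integral {-L..L} (\<lambda>y. moll n (x - y) * g t y) - integral {-L..L} (\<lambda>y. moll1 n (x - y) * V t y)"
    using 1[OF g[OF t] c(1) z(1)] 1[OF V[OF t] c(2) z(2)] by (simp add: conv_def ip_def mult.commute)
  also have "\<dots> = 0"
    using 0 integral_diff[of "\<lambda>y. moll n (x - y) * g t y" "{-L..L}" "\<lambda>y. moll1 n (x - y) * V t y"]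
      locsq_mult_integrable_on(1)[OF locsq_continuous[OF c(1)] g[OF t]] locsq_mult_integrable_on(1)[OF locsq_continuous[OF c(2)] V[OF t]] by simp
  finally show ?thesis by simp
qed

lemma moll_Ux:
  assumes "t \<ge> 0" shows "(conv (moll n) (V t) has_real_derivative conv (moll n) (g t) x) (at x)"
  using conv_moll_deriv(1)[OF V[OF assms], of n x] weak_deriv_moll[OF assms] by simp

lemma moll_Ut:
  assumes "t \<ge> 0"
  shows "((\<lambda>s. conv (moll n) (V s) x) has_real_derivative conv (moll n) (w t) x) (at t within {0..})"
  using eq1[OF assms test_function_moll(1)] by (simp add: conv_def)

text \<open>There is no equation for the time derivative of \<open>g\<close>. Rewriting the
  mollified \<open>g\<close> as \<open>moll1\<close> applied to \<open>V\<close> produces one from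
  \<open>eq1\<close>.\<close>

lemma moll_At:
  assumes "t \<ge> 0"
  shows "((\<lambda>s. conv (moll n) (g s) x) has_real_derivative conv (moll1 n) (w t) x) (at t within {0..})"
proof -
  have "((\<lambda>s. conv (moll1 n) (V s) x) has_real_derivative conv (moll1 n) (w t) x) (at t within {0..})"
    using eq1[OF assms test_function_moll(3)] by (simp add: conv_def)
  then show ?thesis
    by (rule has_field_derivative_transform_within[where d=1]) (use assms weak_deriv_moll in auto)
qed

lemma moll_Wt:
  assumes "t \<ge> 0"
  shows "((\<lambda>s. conv (moll n) (w s) x) has_real_derivative conv (moll1 n) (g t) x + conv (moll n) (G t) x) (at t within {0..})"
proof -
  have "integrable lborel (\<lambda>y. g t y * moll1 n (x - y))" "integrable lborel (\<lambda>y. G t y * moll n (x - y))"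
    by (rule conv_integrable[OF g[OF assms] moll_continuous(2) moll_support(2)]
        conv_integrable[OF G[OF assms] moll_continuous(1) moll_support(1)]; assumption)+
  then show ?thesis
    using eq2[OF assms test_function_moll(1)[of n x]] unfolding test_function_moll(2) by (simp add: conv_def)
qed

lemma moll_joint:
  "continuous_on ({0..} \<times> S) (\<lambda>(t, x). conv (moll n) (V t) x)"
  "continuous_on ({0..} \<times> S) (\<lambda>(t, x). conv (moll n) (g t) x)"
  "continuous_on ({0..} \<times> S) (\<lambda>(t, x). conv (moll n) (w t) x)"
  "continuous_on ({0..} \<times> S) (\<lambda>(t, x). conv (moll n) (G t) x)"
  "continuous_on ({0..} \<times> S) (\<lambda>(t, x). conv (moll1 n) (g t) x)"
  "continuous_on ({0..} \<times> S) (\<lambda>(t, x). conv (moll1 n) (w t) x)"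
proof -
  note 0 = conv_continuous_on[where T="{0..}" and k="moll n" and k'="moll1 n", OF _ _ moll_deriv(1) moll_continuous(2) moll_support(1) moll_support(2)]
  note 1 = conv_continuous_on[where T="{0..}" and k="moll1 n" and k'="moll2 n", OF _ _ moll_deriv(2) moll_continuous(3) moll_support(2) moll_support(3)]
  show "continuous_on ({0..} \<times> S) (\<lambda>(t, x). conv (moll n) (V t) x)" by (rule 0) (use V Vc in auto)
  show "continuous_on ({0..} \<times> S) (\<lambda>(t, x). conv (moll n) (g t) x)" by (rule 0) (use g gc in auto)
  show "continuous_on ({0..} \<times> S) (\<lambda>(t, x). conv (moll n) (w t) x)" by (rule 0) (use w wc in auto)
  show "continuous_on ({0..} \<times> S) (\<lambda>(t, x). conv (moll n) (G t) x)" by (rule 0) (use G Gc in auto)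
  show "continuous_on ({0..} \<times> S) (\<lambda>(t, x). conv (moll1 n) (g t) x)" by (rule 1) (use g gc in auto)
  show "continuous_on ({0..} \<times> S) (\<lambda>(t, x). conv (moll1 n) (w t) x)" by (rule 1) (use w wc in auto)
qed

lemma locnorm_bounded:
  fixes f :: "real \<Rightarrow> real \<Rightarrow> real"
  assumes f: "\<And>t. t \<ge> 0 \<Longrightarrow> locsq (f t)"
    and fc: "\<And>t. t \<ge> 0 \<Longrightarrow> ((\<lambda>s. locnorm L (\<lambda>x. f s x - f t x)) \<longlongrightarrow> 0) (at t within {0..})"
    and a: "0 \<le> a"
  obtains M where "M \<ge> 0" "\<And>t. t \<in> {a..b} \<Longrightarrow> locnorm L (f t) \<le> M"
proof -
  have "continuous_on {0..} (\<lambda>t. locnorm L (f t))"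
    unfolding continuous_on_def
  proof
    fix t :: real assume "t \<in> {0..}"
    then have t: "t \<ge> 0" by simp
    show "((\<lambda>t. locnorm L (f t)) \<longlongrightarrow> locnorm L (f t)) (at t within {0..})"
    proof (rule LIM_zero_cancel, rule metric_tendsto_imp_tendsto[OF fc[OF t]])
      have "dist (locnorm L (f s) - locnorm L (f t)) 0 \<le> dist (locnorm L (\<lambda>x. f s x - f t x)) 0" if "s \<ge> 0" for s
      proof -
        have "locnorm L (f s) \<le> locnorm L (\<lambda>x. f s x - f t x) + locnorm L (f t)"
          using locnorm_triangle[OF locsq_diff[OF f[OF that] f[OF t]] f[OF t]] by simp
        moreover have "locnorm L (f t) \<le> locnorm L (\<lambda>x. f t x - f s x) + locnorm L (f s)"
          using locnorm_triangle[OF locsq_diff[OF f[OF t] f[OF that]] f[OF that]] by simp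
        ultimately show ?thesis using locnorm_minus[of L "f t" "f s"] by (simp add: dist_real_def)
      qed
      then show "\<forall>\<^sub>F s in at t within {0..}. dist (locnorm L (f s) - locnorm L (f t)) 0 \<le> dist (locnorm L (\<lambda>x. f s x - f t x)) 0"
        by (auto simp: eventually_at_filter intro!: always_eventually)
    qed
  qed
  then have "continuous_on {a..b} (\<lambda>t. locnorm L (f t))" by (rule continuous_on_subset) (use a in auto)
  then obtain B where "\<forall>y\<in>(\<lambda>t. locnorm L (f t)) ` {a..b}. \<bar>y\<bar> \<le> B"
    using compact_continuous_image[OF _ compact_Icc] compact_imp_bounded bounded_iff by (metis real_norm_def)
  then show thesis using that[of "max B 0"] by (fastforce intro: max.coboundedI1)
qed

text \<open>\<open>quad_flow_on\<close> is the formal time derivative of \<open>quad_form_on\<close> along \<open>u\<^sub>t = v\<close>, \<open>a\<^sub>t = v\<^sub>x\<close>,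
  \<open>v\<^sub>t = a\<^sub>x + k\<close> after integrating by parts; primed weights stand for the derivatives.\<close>

definition quad_form_on :: "real \<Rightarrow> (real \<Rightarrow> real) \<Rightarrow> (real \<Rightarrow> real) \<Rightarrow> (real \<Rightarrow> real) \<Rightarrow>
    (real \<Rightarrow> real) \<Rightarrow> (real \<Rightarrow> real) \<Rightarrow> (real \<Rightarrow> real) \<Rightarrow> real" where
  "quad_form_on L \<alpha> \<beta> \<gamma> u a v = (ip L \<alpha> v v + ip L \<alpha> a a) / 2 + ip L \<beta> v a + ip L \<gamma> v u"

definition quad_flow_on :: "real \<Rightarrow> (real \<Rightarrow> real) \<Rightarrow> (real \<Rightarrow> real) \<Rightarrow> (real \<Rightarrow> real) \<Rightarrow> (real \<Rightarrow> real) \<Rightarrow> (real \<Rightarrow> real) \<Rightarrow>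
    (real \<Rightarrow> real) \<Rightarrow> (real \<Rightarrow> real) \<Rightarrow> (real \<Rightarrow> real) \<Rightarrow> (real \<Rightarrow> real) \<Rightarrow> (real \<Rightarrow> real) \<Rightarrow> real" where
  "quad_flow_on L \<alpha> \<alpha>' \<beta> \<beta>' \<gamma> \<gamma>' u a v k = ip L \<alpha> v k - ip L \<alpha>' v a - (ip L \<beta>' v v + ip L \<beta>' a a) / 2 + ip L \<beta> a k
     + ip L \<gamma> v v - ip L \<gamma> a a - ip L \<gamma>' u a + ip L \<gamma> u k"

text \<open>After mollification the equations hold pointwise with continuous terms, so the form may
  be differentiated under the integral. The resulting density \<open>qt\<close> and the density of
  the flow differ by an exact derivative in \<open>x\<close>, whose integral is 0 since the weights
  vanish at both ends.\<close>

lemma mollified_identity: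
  fixes n :: nat
  assumes \<alpha>: "\<And>x. (\<alpha> has_real_derivative \<alpha>' x) (at x)" "continuous_on UNIV \<alpha>'" "\<And>x. \<bar>x\<bar> \<ge> L \<Longrightarrow> \<alpha> x = 0"
    and \<beta>: "\<And>x. (\<beta> has_real_derivative \<beta>' x) (at x)" "continuous_on UNIV \<beta>'" "\<And>x. \<bar>x\<bar> \<ge> L \<Longrightarrow> \<beta> x = 0"
    and \<gamma>: "\<And>x. (\<gamma> has_real_derivative \<gamma>' x) (at x)" "continuous_on UNIV \<gamma>'" "\<And>x. \<bar>x\<bar> \<ge> L \<Longrightarrow> \<gamma> x = 0"
    and L: "0 \<le> L" and ab: "0 \<le> a" "a \<le> b"
  defines "M \<equiv> conv (moll n)"
  shows "((\<lambda>t. quad_flow_on L \<alpha> \<alpha>' \<beta> \<beta>' \<gamma> \<gamma>' (M (V t)) (M (g t)) (M (w t)) (M (G t))) has_integral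
     (quad_form_on L \<alpha> \<beta> \<gamma> (M (V b)) (M (g b)) (M (w b)) - quad_form_on L \<alpha> \<beta> \<gamma> (M (V a)) (M (g a)) (M (w a)))) {a..b}"
proof -
  let ?U = "\<lambda>t. M (V t)" and ?A = "\<lambda>t. M (g t)" and ?W = "\<lambda>t. M (w t)" and ?K = "\<lambda>t. M (G t)"
  let ?A1 = "\<lambda>t. conv (moll1 n) (g t)" and ?W1 = "\<lambda>t. conv (moll1 n) (w t)"
  have \<alpha>c: "continuous_on S \<alpha>" "continuous_on S \<beta>" "continuous_on S \<gamma>" for S
    using \<alpha>(1) \<beta>(1) \<gamma>(1) by (meson DERIV_isCont continuous_at_imp_continuous_on)+
  note \<alpha>c' = continuous_on_subset[OF \<alpha>(2) subset_UNIV] continuous_on_subset[OF \<beta>(2) subset_UNIV] continuous_on_subset[OF \<gamma>(2) subset_UNIV]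
  have Mc: "continuous_on S (?U t)" "continuous_on S (?A t)" "continuous_on S (?W t)" "continuous_on S (?K t)"
      "continuous_on S (?A1 t)" "continuous_on S (?W1 t)" if "t \<ge> 0" for t S
    unfolding M_def using conv_moll_continuous[OF V[OF that]] conv_moll_continuous[OF g[OF that]]
      conv_moll_continuous[OF w[OF that]] conv_moll_continuous[OF G[OF that]] by auto
  define q where "q t x = \<alpha> x * (1 / 2) * (?W t x * ?W t x + ?A t x * ?A t x) + \<beta> x * ?W t x * ?A t x + \<gamma> x * ?W t x * ?U t x" for t x
  define qt where "qt t x = \<alpha> x * (?W t x * (?A1 t x + ?K t x) + ?A t x * ?W1 t x)
     + \<beta> x * ((?A1 t x + ?K t x) * ?A t x + ?W t x * ?W1 t x) + \<gamma> x * ((?A1 t x + ?K t x) * ?U t x + ?W t x * ?W t x)" for t x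
  \<comment> \<open>The derivative in \<open>x\<close> of \<alpha> w a + \<beta> (w^2 + a^2)/2 +
    \<gamma> a u. Subtracting it from \<open>qt\<close> removes every derivative of \<open>w\<close>
    and \<open>a\<close>, which is what survives when the mollification is removed.\<close>
  define qx where "qx t x = (\<alpha>' x * (?W t x * ?A t x) + \<alpha> x * (?W1 t x * ?A t x + ?W t x * ?A1 t x))
     + (\<beta>' x * (1 / 2) * (?W t x * ?W t x + ?A t x * ?A t x) + \<beta> x * (?W t x * ?W1 t x + ?A t x * ?A1 t x))
     + (\<gamma>' x * (?A t x * ?U t x) + \<gamma> x * (?A1 t x * ?U t x + (?A t x)\<^sup>2))" for t x
  have qc: "continuous_on S (q t)" "continuous_on S (qt t)" "continuous_on S (qx t)" if "t \<ge> 0" for t S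
    unfolding q_def qt_def qx_def by (intro continuous_intros \<alpha>c \<alpha>c' Mc that; simp)+
  have qi: "q t integrable_on {-L..L}" "qt t integrable_on {-L..L}" "qx t integrable_on {-L..L}" if "t \<ge> 0" for t
    using qc[OF that] by (auto intro: integrable_continuous_real)
  have qd: "((\<lambda>s. q s x) has_real_derivative qt t x) (at t within {0..})" if "t \<ge> 0" for t x
    unfolding q_def qt_def M_def
    by (rule DERIV_cong, (rule DERIV_add DERIV_mult moll_Ut[OF that] moll_At[OF that] moll_Wt[OF that] DERIV_const)+)
       (simp add: algebra_simps)
  have lei: "((\<lambda>t. integral (cbox (-L) L) (q t)) has_real_derivative integral (cbox (-L) L) (qt t)) (at t within {0..})" if "t \<ge> 0" for t
  proof (rule leibniz_rule_field_derivative)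
    have p2: "continuous_on ({0..} \<times> S) (\<lambda>(t :: real, x). f x)" if "continuous_on UNIV f" for f :: "real \<Rightarrow> real" and S
      unfolding case_prod_beta' by (rule continuous_on_compose2[OF that]) (auto intro!: continuous_intros)
    have sp: "continuous_on X (\<lambda>p. f (fst p) (snd p))" if "continuous_on X (\<lambda>(t, x). f t x)" for f :: "real \<Rightarrow> real \<Rightarrow> real" and X
      using that by (simp add: case_prod_beta')
    show "continuous_on ({0..} \<times> cbox (-L) L) (\<lambda>(t, x). qt t x)"
      unfolding qt_def M_def case_prod_beta'
      by (intro continuous_intros sp[OF moll_joint(1)] sp[OF moll_joint(2)] sp[OF moll_joint(3)] sp[OF moll_joint(4)]
         sp[OF moll_joint(5)] sp[OF moll_joint(6)] sp[OF p2[OF \<alpha>c(1)]] sp[OF p2[OF \<alpha>c(2)]] sp[OF p2[OF \<alpha>c(3)]])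
  qed (use qd qi that in \<open>auto simp: box_real\<close>)
  have x0: "integral {-L..L} (qx t) = 0" if "t \<ge> 0" for t
  proof -
    have "(qx t has_integral (\<alpha> L * (?W t L * ?A t L) + \<beta> L * ((1 / 2) * (?W t L * ?W t L + ?A t L * ?A t L)) + \<gamma> L * (?A t L * ?U t L))
       - (\<alpha> (-L) * (?W t (-L) * ?A t (-L)) + \<beta> (-L) * ((1 / 2) * (?W t (-L) * ?W t (-L) + ?A t (-L) * ?A t (-L))) + \<gamma> (-L) * (?A t (-L) * ?U t (-L)))) {-L..L}"
    proof (rule fundamental_theorem_of_calculus)
      fix x
      have d: "(?U t has_real_derivative ?A t x) (at x)" "(?A t has_real_derivative ?A1 t x) (at x)"
        "(?W t has_real_derivative ?W1 t x) (at x)"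
        unfolding M_def using moll_Ux[OF that] conv_moll_deriv(1)[OF g[OF that]] conv_moll_deriv(1)[OF w[OF that]] by auto
      have "((\<lambda>x. \<alpha> x * (?W t x * ?A t x) + \<beta> x * ((1 / 2) * (?W t x * ?W t x + ?A t x * ?A t x)) + \<gamma> x * (?A t x * ?U t x)) has_real_derivative qx t x) (at x)"
        unfolding qx_def
        by (rule DERIV_cong, (rule DERIV_add DERIV_mult \<alpha>(1) \<beta>(1) \<gamma>(1) d DERIV_const)+)
           (simp add: algebra_simps power2_eq_square)
      then show "((\<lambda>x. \<alpha> x * (?W t x * ?A t x) + \<beta> x * ((1 / 2) * (?W t x * ?W t x + ?A t x * ?A t x)) + \<gamma> x * (?A t x * ?U t x)) has_vector_derivative qx t x) (at x within {-L..L})"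
        by (simp add: has_real_derivative_iff_has_vector_derivative has_vector_derivative_at_within)
    qed (use L in auto)
    then show ?thesis using \<alpha>(3)[of L] \<alpha>(3)[of "-L"] \<beta>(3)[of L] \<beta>(3)[of "-L"] \<gamma>(3)[of L] \<gamma>(3)[of "-L"] L by (simp add: integral_unique)
  qed
  have ii: "(\<lambda>x. \<omega> x * f x * h x) integrable_on {-L..L}"
    if "continuous_on {-L..L} \<omega>" "continuous_on {-L..L} f" "continuous_on {-L..L} h" for \<omega> f h :: "real \<Rightarrow> real"
    by (intro integrable_continuous_real continuous_intros that)
  have Q: "integral {-L..L} (q t) = quad_form_on L \<alpha> \<beta> \<gamma> (?U t) (?A t) (?W t)" if "t \<ge> 0" for t
  proof -
    have "((\<lambda>x. (\<alpha> x * ?W t x * ?W t x + \<alpha> x * ?A t x * ?A t x) / 2 + \<beta> x * ?W t x * ?A t x + \<gamma> x * ?W t x * ?U t x)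
      has_integral quad_form_on L \<alpha> \<beta> \<gamma> (?U t) (?A t) (?W t)) {-L..L}"
      unfolding quad_form_on_def ip_def
      by (intro has_integral_add has_integral_diff has_integral_divide integrable_integral[OF ii] \<alpha>c Mc that)
    moreover have "(\<lambda>x. (\<alpha> x * ?W t x * ?W t x + \<alpha> x * ?A t x * ?A t x) / 2 + \<beta> x * ?W t x * ?A t x + \<gamma> x * ?W t x * ?U t x) = q t"
      unfolding q_def by (auto simp: algebra_simps)
    ultimately have "(q t has_integral quad_form_on L \<alpha> \<beta> \<gamma> (?U t) (?A t) (?W t)) {-L..L}" by simp
    then show ?thesis by blast
  qed
  have D: "integral {-L..L} (qt t) = quad_flow_on L \<alpha> \<alpha>' \<beta> \<beta>' \<gamma> \<gamma>' (?U t) (?A t) (?W t) (?K t)" if "t \<ge> 0" for t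
  proof -
    note I = integrable_integral[OF ii]
    have "((\<lambda>x. \<alpha> x * ?W t x * ?K t x - \<alpha>' x * ?W t x * ?A t x - (\<beta>' x * ?W t x * ?W t x + \<beta>' x * ?A t x * ?A t x) / 2
        + \<beta> x * ?A t x * ?K t x + \<gamma> x * ?W t x * ?W t x - \<gamma> x * ?A t x * ?A t x - \<gamma>' x * ?U t x * ?A t x + \<gamma> x * ?U t x * ?K t x)
      has_integral quad_flow_on L \<alpha> \<alpha>' \<beta> \<beta>' \<gamma> \<gamma>' (?U t) (?A t) (?W t) (?K t)) {-L..L}"
      unfolding quad_flow_on_def ip_def
      by (intro has_integral_add has_integral_diff has_integral_divide I \<alpha>c \<alpha>c' Mc that)
    moreover have "(\<lambda>x. \<alpha> x * ?W t x * ?K t x - \<alpha>' x * ?W t x * ?A t x - (\<beta>' x * ?W t x * ?W t x + \<beta>' x * ?A t x * ?A t x) / 2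
        + \<beta> x * ?A t x * ?K t x + \<gamma> x * ?W t x * ?W t x - \<gamma> x * ?A t x * ?A t x - \<gamma>' x * ?U t x * ?A t x + \<gamma> x * ?U t x * ?K t x)
       = (\<lambda>x. qt t x - qx t x)"
      unfolding qt_def qx_def by (auto simp: algebra_simps add_divide_distrib power2_eq_square)
    ultimately have "integral {-L..L} (\<lambda>x. qt t x - qx t x) = quad_flow_on L \<alpha> \<alpha>' \<beta> \<beta>' \<gamma> \<gamma>' (?U t) (?A t) (?W t) (?K t)"
      by (metis integral_unique)
    then show ?thesis using integral_diff[OF qi(2)[OF that] qi(3)[OF that]] x0[OF that] by simp
  qed
  have "((\<lambda>t. integral {-L..L} (qt t)) has_integral integral {-L..L} (q b) - integral {-L..L} (q a)) {a..b}"
  proof (rule fundamental_theorem_of_calculus[OF ab(2)])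
    fix t assume t: "t \<in> {a..b}"
    have "((\<lambda>t. integral {-L..L} (q t)) has_real_derivative integral {-L..L} (qt t)) (at t within {a..b})"
      using lei[of t] t ab by (auto intro: DERIV_subset simp: box_real)
    then show "((\<lambda>t. integral {-L..L} (q t)) has_vector_derivative integral {-L..L} (qt t)) (at t within {a..b})"
      by (simp add: has_real_derivative_iff_has_vector_derivative)
  qed
  moreover have "integral {-L..L} (qt t) = quad_flow_on L \<alpha> \<alpha>' \<beta> \<beta>' \<gamma> \<gamma>' (?U t) (?A t) (?W t) (?K t)" if "t \<in> {a..b}" for t
    using D[of t] that ab by auto
  ultimately show ?thesis
    using Q[of a] Q[of b] ab by (auto intro: has_integral_eq[rotated])
qed

text \<open>The sum has the shape of \<open>quad_flow_on\<close> and of \<open>quad_flow\<close>, so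
  that bounds on their nine terms give the dominating constant.\<close>

lemma abs_sum_bound:
  fixes C1 :: real
  assumes "\<bar>x1\<bar> \<le> C1" "\<bar>x2\<bar> \<le> C2" "\<bar>x3\<bar> \<le> C3" "\<bar>x4\<bar> \<le> C4" "\<bar>x5\<bar> \<le> C5" "\<bar>x6\<bar> \<le> C6" "\<bar>x7\<bar> \<le> C7"
    "\<bar>x8\<bar> \<le> C8" "\<bar>x9\<bar> \<le> C9"
  shows "\<bar>x1 - x2 - (x3 + x4) / 2 + x5 + x6 - x7 - x8 + x9\<bar> \<le> C1 + C2 + (C3 + C4) / 2 + C5 + C6 + C7 + C8 + C9"
proof -
  note u = assms[THEN abs_le_D1] and l = assms[THEN abs_le_D2]
  show ?thesis
  proof (rule abs_leI)
    show "x1 - x2 - (x3 + x4) / 2 + x5 + x6 - x7 - x8 + x9 \<le> C1 + C2 + (C3 + C4) / 2 + C5 + C6 + C7 + C8 + C9"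
      using u(1) l(2-4) u(5,6) l(7,8) u(9) by argo
    show "- (x1 - x2 - (x3 + x4) / 2 + x5 + x6 - x7 - x8 + x9) \<le> C1 + C2 + (C3 + C4) / 2 + C5 + C6 + C7 + C8 + C9"
      using l(1) u(2-4) l(5,6) u(7,8) l(9) by argo
  qed
qed

text \<open>Every term is a product \<open>ip\<close>. Such products converge when the mollification
  is removed, and contraction bounds them uniformly in \<open>n\<close> and \<open>t\<close> by
  norms on [-(L+1), L+1].\<close>

lemma local_identity:
  assumes \<alpha>: "\<And>x. (\<alpha> has_real_derivative \<alpha>' x) (at x)" "continuous_on UNIV \<alpha>'" "\<And>x. \<bar>x\<bar> \<ge> L \<Longrightarrow> \<alpha> x = 0"
    and \<beta>: "\<And>x. (\<beta> has_real_derivative \<beta>' x) (at x)" "continuous_on UNIV \<beta>'" "\<And>x. \<bar>x\<bar> \<ge> L \<Longrightarrow> \<beta> x = 0"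
    and \<gamma>: "\<And>x. (\<gamma> has_real_derivative \<gamma>' x) (at x)" "continuous_on UNIV \<gamma>'" "\<And>x. \<bar>x\<bar> \<ge> L \<Longrightarrow> \<gamma> x = 0"
    and L: "0 \<le> L" and ab: "0 \<le> a" "a \<le> b"
  shows "((\<lambda>t. quad_flow_on L \<alpha> \<alpha>' \<beta> \<beta>' \<gamma> \<gamma>' (V t) (g t) (w t) (G t)) has_integral
     (quad_form_on L \<alpha> \<beta> \<gamma> (V b) (g b) (w b) - quad_form_on L \<alpha> \<beta> \<gamma> (V a) (g a) (w a))) {a..b}"
proof -
  let ?M = "\<lambda>n. conv (moll n)"
  have c: "continuous_on UNIV \<alpha>" "continuous_on UNIV \<beta>" "continuous_on UNIV \<gamma>"
    using \<alpha>(1) \<beta>(1) \<gamma>(1) by (meson DERIV_isCont continuous_at_imp_continuous_on)+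
  have lM: "locsq (?M n f)" if "locsq f" for n f by (rule locsq_continuous[OF conv_moll_continuous(1)[OF that]])
  have T: "(\<lambda>n. ip L \<omega> (?M n f) (?M n h)) \<longlonglongrightarrow> ip L \<omega> f h" if "continuous_on UNIV \<omega>" "locsq f" "locsq h" for \<omega> f h
    by (rule ip_tendsto[OF that(1) lM[OF that(2)] that(2) lM[OF that(3)] that(3)])
       (rule conv_moll_locnorm_tendsto that)+
  have bd: "\<exists>C. \<forall>n. \<forall>t\<in>{a..b}. \<bar>ip L \<omega> (?M n (f t)) (?M n (h t))\<bar> \<le> C"
    if \<omega>: "continuous_on UNIV \<omega>" and f: "\<And>t. t \<ge> 0 \<Longrightarrow> locsq (f t)" "\<And>t L. t \<ge> 0 \<Longrightarrow> ((\<lambda>s. locnorm L (\<lambda>x. f s x - f t x)) \<longlongrightarrow> 0) (at t within {0..})"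
      and h: "\<And>t. t \<ge> 0 \<Longrightarrow> locsq (h t)" "\<And>t L. t \<ge> 0 \<Longrightarrow> ((\<lambda>s. locnorm L (\<lambda>x. h s x - h t x)) \<longlongrightarrow> 0) (at t within {0..})"
    for \<omega> and f h :: "real \<Rightarrow> real \<Rightarrow> real"
  proof -
    obtain B where B: "B \<ge> 0" "\<And>x. x \<in> {-L..L} \<Longrightarrow> \<bar>\<omega> x\<bar> \<le> B" using continuous_bounded_Icc[OF \<omega>] by blast
    obtain M1 where M1: "M1 \<ge> 0" "\<And>t. t \<in> {a..b} \<Longrightarrow> locnorm (L+1) (f t) \<le> M1" using locnorm_bounded[OF f ab(1)] by blast
    obtain M2 where M2: "M2 \<ge> 0" "\<And>t. t \<in> {a..b} \<Longrightarrow> locnorm (L+1) (h t) \<le> M2" using locnorm_bounded[OF h ab(1)] by blast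
    have "\<bar>ip L \<omega> (?M n (f t)) (?M n (h t))\<bar> \<le> B * M1 * M2" if t: "t \<in> {a..b}" for n t
    proof -
      have t0: "t \<ge> 0" using t ab by auto
      have "\<bar>ip L \<omega> (?M n (f t)) (?M n (h t))\<bar> \<le> B * locnorm L (?M n (f t)) * locnorm L (?M n (h t))"
        by (rule ip_bound[OF \<omega> lM[OF f(1)[OF t0]] lM[OF h(1)[OF t0]] B(2,1)])
      also have "\<dots> \<le> B * M1 * M2"
        using B(1) M1(1) order_trans[OF conv_moll_locnorm_le[OF f(1)[OF t0]] M1(2)[OF t]]
          order_trans[OF conv_moll_locnorm_le[OF h(1)[OF t0]] M2(2)[OF t]]
        by (intro mult_mono) auto
      finally show ?thesis .
    qed
    then show ?thesis by blast
  qed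
  obtain C1 where C1: "\<And>n t. t \<in> {a..b} \<Longrightarrow> \<bar>ip L \<alpha> (?M n (w t)) (?M n (G t))\<bar> \<le> C1" using bd[OF c(1) w wc G Gc] by blast
  obtain C2 where C2: "\<And>n t. t \<in> {a..b} \<Longrightarrow> \<bar>ip L \<alpha>' (?M n (w t)) (?M n (g t))\<bar> \<le> C2" using bd[OF \<alpha>(2) w wc g gc] by blast
  obtain C3 where C3: "\<And>n t. t \<in> {a..b} \<Longrightarrow> \<bar>ip L \<beta>' (?M n (w t)) (?M n (w t))\<bar> \<le> C3" using bd[OF \<beta>(2) w wc w wc] by blast
  obtain C4 where C4: "\<And>n t. t \<in> {a..b} \<Longrightarrow> \<bar>ip L \<beta>' (?M n (g t)) (?M n (g t))\<bar> \<le> C4" using bd[OF \<beta>(2) g gc g gc] by blast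
  obtain C5 where C5: "\<And>n t. t \<in> {a..b} \<Longrightarrow> \<bar>ip L \<beta> (?M n (g t)) (?M n (G t))\<bar> \<le> C5" using bd[OF c(2) g gc G Gc] by blast
  obtain C6 where C6: "\<And>n t. t \<in> {a..b} \<Longrightarrow> \<bar>ip L \<gamma> (?M n (w t)) (?M n (w t))\<bar> \<le> C6" using bd[OF c(3) w wc w wc] by blast
  obtain C7 where C7: "\<And>n t. t \<in> {a..b} \<Longrightarrow> \<bar>ip L \<gamma> (?M n (g t)) (?M n (g t))\<bar> \<le> C7" using bd[OF c(3) g gc g gc] by blast
  obtain C8 where C8: "\<And>n t. t \<in> {a..b} \<Longrightarrow> \<bar>ip L \<gamma>' (?M n (V t)) (?M n (g t))\<bar> \<le> C8" using bd[OF \<gamma>(2) V Vc g gc] by blast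
  obtain C9 where C9: "\<And>n t. t \<in> {a..b} \<Longrightarrow> \<bar>ip L \<gamma> (?M n (V t)) (?M n (G t))\<bar> \<le> C9" using bd[OF c(3) V Vc G Gc] by blast
  show ?thesis
  proof (rule has_integral_limit[OF mollified_identity[OF \<alpha> \<beta> \<gamma> L ab]])
    fix n t assume t: "t \<in> {a..b}"
    show "\<bar>quad_flow_on L \<alpha> \<alpha>' \<beta> \<beta>' \<gamma> \<gamma>' (?M n (V t)) (?M n (g t)) (?M n (w t)) (?M n (G t))\<bar>
      \<le> C1 + C2 + (C3 + C4) / 2 + C5 + C6 + C7 + C8 + C9"
      unfolding quad_flow_on_def by (rule abs_sum_bound; rule C1[OF t] C2[OF t] C3[OF t] C4[OF t] C5[OF t] C6[OF t] C7[OF t] C8[OF t] C9[OF t])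
  next
    fix t assume t: "t \<in> {a..b}"
    then have t0: "t \<ge> 0" using ab by auto
    show "(\<lambda>n. quad_flow_on L \<alpha> \<alpha>' \<beta> \<beta>' \<gamma> \<gamma>' (?M n (V t)) (?M n (g t)) (?M n (w t)) (?M n (G t))) \<longlonglongrightarrow> quad_flow_on L \<alpha> \<alpha>' \<beta> \<beta>' \<gamma> \<gamma>' (V t) (g t) (w t) (G t)"
      unfolding quad_flow_on_def by (intro tendsto_add tendsto_diff tendsto_divide tendsto_const T c \<alpha>(2) \<beta>(2) \<gamma>(2) V g w G t0) simp
  next
    have b0: "b \<ge> 0" using ab by auto
    show "(\<lambda>n. quad_form_on L \<alpha> \<beta> \<gamma> (?M n (V b)) (?M n (g b)) (?M n (w b)) - quad_form_on L \<alpha> \<beta> \<gamma> (?M n (V a)) (?M n (g a)) (?M n (w a)))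
      \<longlonglongrightarrow> quad_form_on L \<alpha> \<beta> \<gamma> (V b) (g b) (w b) - quad_form_on L \<alpha> \<beta> \<gamma> (V a) (g a) (w a)"
      unfolding quad_form_on_def by (intro tendsto_add tendsto_diff tendsto_divide tendsto_const T c V g w ab(1) b0) simp_all
  qed
qed

text \<open>Covers the potential part of the energy, which contains cubic and quartic terms and so
  is not a quadratic form. The pointwise bound on \<open>V\<close> supplies the domination of the
  powers.\<close>

lemma local_power_identity:
  assumes \<kappa>: "continuous_on UNIV \<kappa>" and L: "0 \<le> L" and ab: "0 \<le> a" "a \<le> b" and k: "k \<ge> 1"
  shows "((\<lambda>t. integral {-L..L} (\<lambda>x. real k * \<kappa> x * V t x ^ (k - 1) * w t x)) has_integral
     (integral {-L..L} (\<lambda>x. \<kappa> x * V b x ^ k) - integral {-L..L} (\<lambda>x. \<kappa> x * V a x ^ k))) {a..b}"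
proof -
  let ?M = "\<lambda>n. conv (moll n)" and ?I = "indicat_real {-L..L}"
  have \<kappa>c: "continuous_on S \<kappa>" for S by (rule continuous_on_subset[OF \<kappa>]) simp
  have Vcont: "continuous_on S (V t)" if "t \<ge> 0" for t S by (rule primitive_continuous[OF prim[OF that] g[OF that]])
  have Uc: "continuous_on S (?M n (V t))" and Wc: "continuous_on S (?M n (w t))" if "t \<ge> 0" for n t S
    using conv_moll_continuous(1)[OF V[OF that]] conv_moll_continuous(1)[OF w[OF that]] by auto
  \<comment> \<open>The bound is taken on the interval enlarged by 1, since a mollified value on
    [-L, L] averages values up to distance 1.\<close>
  obtain B where B: "\<And>t x. t \<in> {0..b} \<Longrightarrow> x \<in> {-(L+1)..L+1} \<Longrightarrow> \<bar>V t x\<bar> \<le> B" using V_bounded by blast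
  have B0: "B \<ge> 0" using B[of 0 0] L ab by (auto intro: order_trans[OF abs_ge_zero])
  have UB: "\<bar>?M n (V t) x\<bar> \<le> B" if "t \<in> {0..b}" "x \<in> {-L..L}" for n t x
  proof -
    have le: "1 / real (Suc n) \<le> 1" by simp
    have "\<bar>?M n (V t) x - 0\<bar> \<le> B"
    proof (rule conv_moll_close[OF V])
      fix y assume "\<bar>y - x\<bar> \<le> 1 / real (Suc n)"
      then have "\<bar>y - x\<bar> \<le> 1" using le by linarith
      then have "y \<in> {-(L+1)..L+1}" using that(2) by (auto simp: abs_le_iff)
      then show "\<bar>V t y - 0\<bar> \<le> B" using B[OF that(1)] by auto
    qed (use that in auto)
    then show ?thesis by simp
  qed
  have Ulim: "(\<lambda>n. ?M n (V t) x) \<longlonglongrightarrow> V t x" if "t \<ge> 0" for t x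
    by (rule conv_moll_pointwise[OF V[OF that]]) (use Vcont[OF that, of UNIV] in \<open>simp add: continuous_on_eq_continuous_at\<close>)
  have tends: "(\<lambda>n. norm2 (\<lambda>x. ?I x * (c x * ?M n (V t) x ^ j) - ?I x * (c x * V t x ^ j))) \<longlonglongrightarrow> 0"
    if t: "t \<in> {0..b}" and c: "continuous_on UNIV c" for t j c
  proof -
    obtain K where K: "K \<ge> 0" "\<And>x. x \<in> {-L..L} \<Longrightarrow> \<bar>c x\<bar> \<le> K" using continuous_bounded_Icc[OF c] by blast
    have cc: "continuous_on S c" for S by (rule continuous_on_subset[OF c]) simp
    have t0: "t \<ge> 0" using t by simp
    show ?thesis
    proof (rule sqint_Icc_dominated_tendsto)
      fix n x assume x: "x \<in> {-L..L}"
      have "\<bar>c x\<bar> * \<bar>?M n (V t) x\<bar> ^ j \<le> K * B ^ j" "\<bar>c x\<bar> * \<bar>V t x\<bar> ^ j \<le> K * B ^ j"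
        using K(1) K(2)[OF x] UB[OF t x, of n] B[OF t, of x] x by (auto intro!: mult_mono power_mono)
      then show "\<bar>c x * ?M n (V t) x ^ j - c x * V t x ^ j\<bar> \<le> 2 * (K * B ^ j)"
        by (intro order_trans[OF abs_triangle_ineq4]) (simp add: abs_mult power_abs)
    qed (auto intro!: continuous_intros cc Uc[OF t0] Vcont[OF t0] tendsto_intros Ulim[OF t0])
  qed
  have sq: "sqint (\<lambda>x. ?I x * (c x * ?M n (V t) x ^ j))" "sqint (\<lambda>x. ?I x * (c x * V t x ^ j))"
    if "t \<ge> 0" "continuous_on UNIV c" for t j c n
    by (intro sqint_Icc_continuous continuous_intros continuous_on_subset[OF that(2)] Uc Vcont that(1) subset_UNIV)+
  have sI: "sqint (\<lambda>x. ?I x * 1)" by (rule sqint_Icc_continuous) simp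
  have lM: "locsq (?M n (w t))" if "t \<ge> 0" for n t by (rule locsq_continuous[OF Wc[OF that]])
  define f where "f c j U h = (LINT x|lborel. (?I x * (c x * U x ^ j)) * (?I x * h x))"
    for c :: "real \<Rightarrow> real" and j :: nat and U h :: "real \<Rightarrow> real"
  have fHK: "integral {-L..L} (\<lambda>x. c x * U x ^ j * h x) = f c j U h"
    if "continuous_on UNIV c" "continuous_on UNIV U" "locsq h" for c j U h
    unfolding f_def by (rule locsq_mult_integrable_on(2)[OF locsq_continuous that(3)]) (intro continuous_intros that)
  have fT: "(\<lambda>n. f c j (?M n (V t)) (h n)) \<longlonglongrightarrow> f c j (V t) h0"
    if "t \<in> {0..b}" "continuous_on UNIV c" "\<And>n. sqint (\<lambda>x. ?I x * h n x)" "sqint (\<lambda>x. ?I x * h0 x)"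
      "(\<lambda>n. norm2 (\<lambda>x. ?I x * h n x - ?I x * h0 x)) \<longlonglongrightarrow> 0" for c j t h h0
    unfolding f_def using that by (intro norm2_prod_tendsto sq tends) auto
  define nk where "nk x = real k * \<kappa> x" for x
  have nk: "continuous_on S nk" for S unfolding nk_def by (intro continuous_intros \<kappa>c)
  have moll: "((\<lambda>t. f nk (k - 1) (?M n (V t)) (?M n (w t))) has_integral
      f \<kappa> k (?M n (V b)) (\<lambda>_. 1) - f \<kappa> k (?M n (V a)) (\<lambda>_. 1)) {a..b}" for n
  proof -
    let ?q = "\<lambda>t x. \<kappa> x * ?M n (V t) x ^ k * 1" and ?qt = "\<lambda>t x. nk x * ?M n (V t) x ^ (k - 1) * ?M n (w t) x"
    have lei: "((\<lambda>t. integral (cbox (-L) L) (?q t)) has_real_derivative integral (cbox (-L) L) (?qt t)) (at t within {0..})" if "t \<ge> 0" for t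
    proof (rule leibniz_rule_field_derivative)
      have p2: "continuous_on ({0..} \<times> S) (\<lambda>p. f (snd p))" if "continuous_on UNIV f" for f :: "real \<Rightarrow> real" and S :: "real set"
        by (rule continuous_on_compose2[OF that]) (auto intro!: continuous_intros)
      have sp: "continuous_on X (\<lambda>p. f (fst p) (snd p))" if "continuous_on X (\<lambda>(t, x). f t x)" for f :: "real \<Rightarrow> real \<Rightarrow> real" and X
        using that by (simp add: case_prod_beta')
      show "continuous_on ({0..} \<times> cbox (-L) L) (\<lambda>(t, x). ?qt t x)"
        unfolding case_prod_beta' by (intro continuous_intros sp[OF moll_joint(1)] sp[OF moll_joint(3)] p2[OF nk])
      fix t x :: real assume "t \<in> {0..}"
      then have t: "t \<ge> 0" by simp
      show "((\<lambda>t. ?q t x) has_real_derivative ?qt t x) (at t within {0..})"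
        by (rule DERIV_cong, (rule DERIV_mult DERIV_power moll_Ut[OF t] DERIV_const)+) (simp add: nk_def)
      show "?q t integrable_on cbox (-L) L"
        by (intro integrable_continuous continuous_intros \<kappa>c Uc t)
    qed (use that in auto)
    have "((\<lambda>t. integral {-L..L} (?qt t)) has_integral integral {-L..L} (?q b) - integral {-L..L} (?q a)) {a..b}"
    proof (rule fundamental_theorem_of_calculus[OF ab(2)])
      fix t assume t: "t \<in> {a..b}"
      have "((\<lambda>t. integral {-L..L} (?q t)) has_real_derivative integral {-L..L} (?qt t)) (at t within {a..b})"
        using lei[of t] t ab by (auto intro: DERIV_subset simp: box_real)
      then show "((\<lambda>t. integral {-L..L} (?q t)) has_vector_derivative integral {-L..L} (?qt t)) (at t within {a..b})"
        by (simp add: has_real_derivative_iff_has_vector_derivative)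
    qed
    moreover have "integral {-L..L} (?q t) = f \<kappa> k (?M n (V t)) (\<lambda>_. 1)" if "t \<ge> 0" for t
      by (rule fHK[OF \<kappa> Uc[OF that] locsq_continuous]) simp
    moreover have "integral {-L..L} (?qt t) = f nk (k - 1) (?M n (V t)) (?M n (w t))" if "t \<ge> 0" for t
      by (rule fHK[OF nk Uc[OF that] lM[OF that]])
    ultimately show ?thesis using ab by (auto intro: has_integral_eq[rotated])
  qed
  obtain Mw where Mw: "Mw \<ge> 0" "\<And>t. t \<in> {a..b} \<Longrightarrow> locnorm (L+1) (w t) \<le> Mw" using locnorm_bounded[OF w wc ab(1)] by blast
  obtain K where K: "K \<ge> 0" "\<And>x. x \<in> {-L..L} \<Longrightarrow> \<bar>nk x\<bar> \<le> K" using continuous_bounded_Icc[OF nk] by blast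
  have main: "((\<lambda>t. f nk (k - 1) (V t) (w t)) has_integral f \<kappa> k (V b) (\<lambda>_. 1) - f \<kappa> k (V a) (\<lambda>_. 1)) {a..b}"
  proof (rule has_integral_limit[OF moll])
    fix n t assume t: "t \<in> {a..b}"
    have t0: "t \<ge> 0" "t \<in> {0..b}" using t ab by auto
    have "\<bar>f nk (k - 1) (?M n (V t)) (?M n (w t))\<bar> \<le> norm2 (\<lambda>x. ?I x * (nk x * ?M n (V t) x ^ (k - 1))) * norm2 (\<lambda>x. ?I x * ?M n (w t) x)"
      unfolding f_def by (rule norm2_CS[OF sq(1)[OF t0(1) nk] sqint_Icc[OF lM[OF t0(1)]]])
    also have "\<dots> \<le> (K * B ^ (k - 1) * sqrt (2 * L)) * Mw"
    proof (intro mult_mono)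
      have "norm2 (\<lambda>x. ?I x * (nk x * ?M n (V t) x ^ (k - 1))) \<le> (K * B ^ (k - 1)) * norm2 (\<lambda>x. ?I x * 1)"
      proof (rule norm2_mono[OF sI sqint_measurable[OF sq(1)[OF t0(1) nk]]])
        show "AE x in lborel. \<bar>?I x * (nk x * ?M n (V t) x ^ (k - 1))\<bar> \<le> K * B ^ (k - 1) * \<bar>?I x * 1\<bar>"
        proof (rule AE_I2)
          fix x show "\<bar>?I x * (nk x * ?M n (V t) x ^ (k - 1))\<bar> \<le> K * B ^ (k - 1) * \<bar>?I x * 1\<bar>"
            using K(2)[of x] K(1) UB[OF t0(2), of x n] B0
            by (cases "x \<in> {-L..L}") (auto simp: abs_mult power_abs intro!: mult_mono power_mono)
        qed
      qed (use K B0 in simp)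
      then show "norm2 (\<lambda>x. ?I x * (nk x * ?M n (V t) x ^ (k - 1))) \<le> K * B ^ (k - 1) * sqrt (2 * L)"
        using norm2_indicator[of "-L" L] L by simp
      show "norm2 (\<lambda>x. ?I x * ?M n (w t) x) \<le> Mw"
        using conv_moll_locnorm_le[OF w[OF t0(1)], of L n] Mw(2)[OF t] by (simp add: locnorm_def)
    qed (use K B0 L in auto)
    finally show "\<bar>f nk (k - 1) (?M n (V t)) (?M n (w t))\<bar> \<le> (K * B ^ (k - 1) * sqrt (2 * L)) * Mw" .
  next
    fix t assume t: "t \<in> {a..b}"
    have t0: "t \<ge> 0" "t \<in> {0..b}" using t ab by auto
    show "(\<lambda>n. f nk (k - 1) (?M n (V t)) (?M n (w t))) \<longlonglongrightarrow> f nk (k - 1) (V t) (w t)"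
      by (rule fT[OF t0(2) nk sqint_Icc[OF lM[OF t0(1)]] sqint_Icc[OF w[OF t0(1)]]])
         (use conv_moll_locnorm_tendsto[OF w[OF t0(1)], of L] in \<open>simp add: locnorm_def right_diff_distrib\<close>)
  next
    have "(\<lambda>n. norm2 (\<lambda>x. ?I x * 1 - ?I x * 1)) \<longlonglongrightarrow> 0" by (simp add: norm2_def)
    then show "(\<lambda>n. f \<kappa> k (?M n (V b)) (\<lambda>_. 1) - f \<kappa> k (?M n (V a)) (\<lambda>_. 1)) \<longlonglongrightarrow> f \<kappa> k (V b) (\<lambda>_. 1) - f \<kappa> k (V a) (\<lambda>_. 1)"
      using ab by (intro tendsto_diff fT \<kappa> sI) auto
  qed
  have e1: "integral {-L..L} (\<lambda>x. \<kappa> x * V t x ^ k) = f \<kappa> k (V t) (\<lambda>_. 1)" if "t \<ge> 0" for t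
    using fHK[OF \<kappa> Vcont[OF that] locsq_continuous, of "\<lambda>_. 1" k] by simp
  have e2: "integral {-L..L} (\<lambda>x. real k * \<kappa> x * V t x ^ (k - 1) * w t x) = f nk (k - 1) (V t) (w t)" if "t \<ge> 0" for t
    using fHK[OF nk Vcont[OF that] w[OF that], of "k - 1"] by (simp add: nk_def)
  show ?thesis using main e1[of a] e1[of b] e2 ab by (auto intro: has_integral_eq[rotated])
qed

end

section \<open>Noncompact weights\<close>

text \<open>The Japanese bracket. It is also the density that puts the linear operator into
  divergence form: the logarithmic derivative of \<open>jb\<close> is r / (1 + r^2), the coefficient
  of the first-order term.\<close>

definition jb :: "real \<Rightarrow> real" where "jb x = sqrt (1 + x\<^sup>2)"

lemma jb_ge1: "jb x \<ge> 1" by (simp add: jb_def)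
lemma jb_pos: "jb x > 0" using jb_ge1[of x] by linarith
lemma jb_sq: "(jb x)\<^sup>2 = 1 + x\<^sup>2" by (simp add: jb_def)
lemma jb_ge_abs: "\<bar>x\<bar> \<le> jb x" by (simp add: jb_def real_le_rsqrt)
lemma jb_continuous [continuous_intros]: "continuous_on S jb" unfolding jb_def by (intro continuous_intros)
lemma jb_measurable [measurable]: "jb \<in> borel_measurable borel"
  by (rule borel_measurable_continuous_onI) (rule jb_continuous)
lemma jb_deriv: "(jb has_real_derivative x / jb x) (at x)"
proof -
  have "1 + x\<^sup>2 > 0" by (simp add: add_pos_nonneg)
  then show ?thesis unfolding jb_def[abs_def] by (auto intro!: derivative_eq_intros simp: field_simps)
qed

definition cutoff :: "nat \<Rightarrow> real \<Rightarrow> real" where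
  "cutoff n x = max 0 (1 - x\<^sup>2 / (real (Suc n))\<^sup>2) ^ 2"
definition cutoff' :: "nat \<Rightarrow> real \<Rightarrow> real" where
  "cutoff' n x = 2 * max 0 (1 - x\<^sup>2 / (real (Suc n))\<^sup>2) * (- 2 * x / (real (Suc n))\<^sup>2)"

lemma cutoff_deriv: "(cutoff n has_real_derivative cutoff' n x) (at x)"
proof -
  define s where "s = (real (Suc n))\<^sup>2"
  have i: "((\<lambda>x. 1 - x\<^sup>2 / s) has_real_derivative - 2 * x / s) (at x)"
    by (rule DERIV_cong, (rule DERIV_diff DERIV_const DERIV_cdivide DERIV_pow)+) simp
  have "((\<lambda>x. max 0 (1 - x\<^sup>2 / s) ^ Suc 1) has_real_derivative
      real (Suc 1) * max 0 (1 - x\<^sup>2 / s) ^ 1 * (- 2 * x / s)) (at x)"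
    by (rule DERIV_chain2[OF max_power_has_real_derivative i]) simp
  then show ?thesis unfolding cutoff_def[abs_def] cutoff'_def s_def[symmetric] by (simp add: numeral_2_eq_2)
qed

lemma cutoff_continuous: "continuous_on S (cutoff n)" "continuous_on S (cutoff' n)"
  unfolding cutoff_def cutoff'_def by (intro continuous_intros; simp)+

lemma cutoff_support: assumes "\<bar>x\<bar> \<ge> real (Suc n)" shows "cutoff n x = 0" "cutoff' n x = 0"
proof -
  have "(real (Suc n))\<^sup>2 \<le> x\<^sup>2" using power_mono[OF assms, of 2] by (simp del: of_nat_Suc)
  then have "1 \<le> x\<^sup>2 / (real (Suc n))\<^sup>2" by (simp add: le_divide_eq del: of_nat_Suc)
  then have "max 0 (1 - x\<^sup>2 / (real (Suc n))\<^sup>2) = 0" by simp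
  then show "cutoff n x = 0" "cutoff' n x = 0" unfolding cutoff_def cutoff'_def by (simp_all del: of_nat_Suc)
qed

text \<open>Where the cutoff is active, \<open>jb x\<close> is at most 2 s for s = n + 1, so |x|
  \<open>jb x\<close> / s^2 is at most 2. The cutoff derivative is therefore O(1 /
  \<open>jb\<close>) uniformly in \<open>n\<close>, which compensates weights that grow like
  \<open>jb\<close>.\<close>

lemma cutoff_bounds: "\<bar>cutoff n x\<bar> \<le> 1" "\<bar>cutoff' n x\<bar> * jb x \<le> 8"
proof -
  define s where "s = real (Suc n)"
  define m where "m = max 0 (1 - x\<^sup>2 / s\<^sup>2)"
  have m: "0 \<le> m" "m \<le> 1" by (auto simp: m_def)
  then show "\<bar>cutoff n x\<bar> \<le> 1" unfolding cutoff_def s_def[symmetric] m_def[symmetric] by (simp add: power_le_one)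
  have s: "s \<ge> 1" by (simp add: s_def)
  show "\<bar>cutoff' n x\<bar> * jb x \<le> 8"
  proof (cases "\<bar>x\<bar> \<ge> s")
    case False
    have "jb x \<le> 1 + \<bar>x\<bar>" unfolding jb_def by (rule real_le_lsqrt) (auto simp: power2_sum)
    then have "jb x \<le> 2 * s" using False s by linarith
    then have "\<bar>x\<bar> * jb x \<le> s * (2 * s)" using False jb_pos[of x] by (intro mult_mono) auto
    then have q: "\<bar>x\<bar> * jb x / s\<^sup>2 \<le> 2" using s by (simp add: divide_le_eq power2_eq_square)
    have "\<bar>cutoff' n x\<bar> * jb x = m * (4 * (\<bar>x\<bar> * jb x / s\<^sup>2))"
      unfolding cutoff'_def s_def[symmetric] m_def[symmetric] using m by (simp add: abs_mult)
    also have "\<dots> \<le> 1 * 8" using m q jb_pos[of x] by (intro mult_mono) auto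
    finally show ?thesis by simp
  qed (use cutoff_support(2)[of n x] in \<open>simp add: s_def del: of_nat_Suc\<close>)
qed

lemma cutoff_tendsto: "(\<lambda>n. cutoff n x) \<longlonglongrightarrow> 1" "(\<lambda>n. cutoff' n x) \<longlonglongrightarrow> 0"
proof -
  have i: "(\<lambda>n. inverse ((real (Suc n))\<^sup>2)) \<longlonglongrightarrow> 0"
    using tendsto_power[OF LIMSEQ_inverse_real_of_nat, of 2] by (simp add: power_inverse del: of_nat_Suc)
  have "(\<lambda>n. max 0 (1 - x\<^sup>2 * inverse ((real (Suc n))\<^sup>2)) ^ 2) \<longlonglongrightarrow> max 0 (1 - x\<^sup>2 * 0) ^ 2"
    by (intro tendsto_intros i)
  then show "(\<lambda>n. cutoff n x) \<longlonglongrightarrow> 1" by (simp add: cutoff_def divide_inverse del: of_nat_Suc)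
  have "(\<lambda>n. 2 * max 0 (1 - x\<^sup>2 * inverse ((real (Suc n))\<^sup>2)) * (- 2 * x * inverse ((real (Suc n))\<^sup>2)))
     \<longlonglongrightarrow> 2 * max 0 (1 - x\<^sup>2 * 0) * (- 2 * x * 0)"
    by (intro tendsto_intros i)
  then show "(\<lambda>n. cutoff' n x) \<longlonglongrightarrow> 0" by (simp add: cutoff'_def divide_inverse del: of_nat_Suc)
qed

definition pair :: "(real \<Rightarrow> real) \<Rightarrow> (real \<Rightarrow> real) \<Rightarrow> (real \<Rightarrow> real) \<Rightarrow> real" where
  "pair \<omega> f h = (LINT x|lborel. \<omega> x * f x * h x)"

text \<open>Cauchy-Schwarz for r1 f and r2 h: a weight is admissible as soon as it is dominated by
  the product of \<open>r1\<close> and \<open>r2\<close>.\<close>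

lemma weighted_sqint_integrable:
  assumes "f \<in> borel_measurable borel" "h \<in> borel_measurable borel" "\<omega> \<in> borel_measurable borel"
    and sf: "sqint (\<lambda>x. r1 x * f x)" and sh: "sqint (\<lambda>x. r2 x * h x)"
    and pos: "\<And>x. r1 x > 0" "\<And>x. r2 x > 0" and B: "\<And>x. \<bar>\<omega> x\<bar> \<le> B * (r1 x * r2 x)"
  shows "integrable lborel (\<lambda>x. \<omega> x * f x * h x)"
    "\<bar>pair \<omega> f h\<bar> \<le> B * (norm2 (\<lambda>x. r1 x * f x) * norm2 (\<lambda>x. r2 x * h x))"
proof -
  note [measurable] = assms(1-3)
  have B0: "B \<ge> 0"
  proof -
    have "0 \<le> B * (r1 0 * r2 0)" using order_trans[OF abs_ge_zero B[of 0]] .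
    then show ?thesis using mult_pos_pos[OF pos[of 0]] by (simp add: zero_le_mult_iff)
  qed
  have sf': "sqint (\<lambda>x. \<bar>r1 x * f x\<bar>)" and sh': "sqint (\<lambda>x. \<bar>r2 x * h x\<bar>)"
    using sf sh by (auto simp: sqint_def)
  have n: "norm2 (\<lambda>x. \<bar>u x\<bar>) = norm2 u" for u by (simp add: norm2_def)
  have dom: "integrable lborel (\<lambda>x. B * (\<bar>r1 x * f x\<bar> * \<bar>r2 x * h x\<bar>))" using sqint_mult[OF sf' sh'] by simp
  have le: "\<bar>\<omega> x * f x * h x\<bar> \<le> B * (\<bar>r1 x * f x\<bar> * \<bar>r2 x * h x\<bar>)" for x
  proof -
    have "\<bar>\<omega> x\<bar> * (\<bar>f x\<bar> * \<bar>h x\<bar>) \<le> (B * (r1 x * r2 x)) * (\<bar>f x\<bar> * \<bar>h x\<bar>)"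
      using B by (intro mult_right_mono) auto
    then show ?thesis using pos[of x] by (simp add: abs_mult mult_ac)
  qed
  show i: "integrable lborel (\<lambda>x. \<omega> x * f x * h x)"
    by (rule Bochner_Integration.integrable_bound[OF dom]) (use le in \<open>auto intro!: AE_I2 intro: order_trans[OF _ abs_ge_self]\<close>)
  have "\<bar>pair \<omega> f h\<bar> \<le> (LINT x|lborel. \<bar>\<omega> x * f x * h x\<bar>)" unfolding pair_def by (rule integral_abs_bound)
  also have "\<dots> \<le> (LINT x|lborel. B * (\<bar>r1 x * f x\<bar> * \<bar>r2 x * h x\<bar>))"
    by (rule integral_mono[OF _ dom le]) (use i in simp)
  also have "\<dots> = B * (LINT x|lborel. \<bar>r1 x * f x\<bar> * \<bar>r2 x * h x\<bar>)" by simp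
  also have "\<dots> \<le> B * (norm2 (\<lambda>x. r1 x * f x) * norm2 (\<lambda>x. r2 x * h x))"
    using norm2_CS[OF sf' sh'] B0 unfolding n by (intro mult_left_mono) auto
  finally show "\<bar>pair \<omega> f h\<bar> \<le> B * (norm2 (\<lambda>x. r1 x * f x) * norm2 (\<lambda>x. r2 x * h x))" .
qed

lemma pair_tendsto:
  fixes \<omega> :: "nat \<Rightarrow> real \<Rightarrow> real"
  assumes m: "f \<in> borel_measurable borel" "h \<in> borel_measurable borel" "\<And>n. \<omega> n \<in> borel_measurable borel" "\<omega>0 \<in> borel_measurable borel"
    and sf: "sqint (\<lambda>x. r1 x * f x)" and sh: "sqint (\<lambda>x. r2 x * h x)"
    and pos: "\<And>x. r1 x > 0" "\<And>x. r2 x > 0" and B: "\<And>n x. \<bar>\<omega> n x\<bar> \<le> B * (r1 x * r2 x)"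
    and lim: "\<And>x. (\<lambda>n. \<omega> n x) \<longlonglongrightarrow> \<omega>0 x"
  shows "(\<lambda>n. pair (\<omega> n) f h) \<longlonglongrightarrow> pair \<omega>0 f h"
  unfolding pair_def
proof (rule integral_dominated_convergence)
  note [measurable] = m
  have sf': "sqint (\<lambda>x. \<bar>r1 x * f x\<bar>)" and sh': "sqint (\<lambda>x. \<bar>r2 x * h x\<bar>)"
    using sf sh by (auto simp: sqint_def)
  show "integrable lborel (\<lambda>x. B * (\<bar>r1 x * f x\<bar> * \<bar>r2 x * h x\<bar>))" using sqint_mult[OF sf' sh'] by simp
  show "AE x in lborel. norm (\<omega> n x * f x * h x) \<le> B * (\<bar>r1 x * f x\<bar> * \<bar>r2 x * h x\<bar>)" for n
  proof (rule AE_I2)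
    fix x
    have "\<bar>\<omega> n x\<bar> * (\<bar>f x\<bar> * \<bar>h x\<bar>) \<le> (B * (r1 x * r2 x)) * (\<bar>f x\<bar> * \<bar>h x\<bar>)"
      using B by (intro mult_right_mono) auto
    then show "norm (\<omega> n x * f x * h x) \<le> B * (\<bar>r1 x * f x\<bar> * \<bar>r2 x * h x\<bar>)"
      using pos[of x] by (simp add: abs_mult mult_ac)
  qed
  show "AE x in lborel. (\<lambda>n. \<omega> n x * f x * h x) \<longlonglongrightarrow> \<omega>0 x * f x * h x"
    by (intro AE_I2 tendsto_intros lim)
  show "(\<lambda>x. \<omega>0 x * f x * h x) \<in> borel_measurable lborel" "(\<lambda>x. \<omega> n x * f x * h x) \<in> borel_measurable lborel" for n
    using m by simp_all
qed

text \<open>Factors that make v_t and v_r (\<open>rw\<close>), v (\<open>rv\<close>) and the source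
  (\<open>rG\<close>) square integrable. The source gains jb^(3/2) because it carries a factor 1 /
  jb^2, and its first-order term is of size v_r / \<open>jb\<close>. The products in
  \<open>r_prod\<close> decide how fast the weight of each pairing may grow.\<close>

definition rw :: "real \<Rightarrow> real" where "rw x = sqrt (jb x)"
definition rv :: "real \<Rightarrow> real" where "rv x = 1 / sqrt (jb x)"
definition rG :: "real \<Rightarrow> real" where "rG x = jb x * sqrt (jb x)"

lemma r_pos: "rw x > 0" "rv x > 0" "rG x > 0"
  using jb_pos by (auto simp: rw_def rv_def rG_def)

lemma r_prod: "rw x * rw x = jb x" "rw x * rG x = (jb x)\<^sup>2" "rv x * rw x = 1" "rw x * rv x = 1" "rv x * rG x = jb x" "rv x * rv x = 1 / jb x"
  using jb_pos[of x] by (auto simp: rw_def rv_def rG_def power2_eq_square field_simps)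

lemma r_continuous [continuous_intros]: "continuous_on S rw" "continuous_on S rv" "continuous_on S rG"
  unfolding rw_def rv_def rG_def using jb_pos by (auto intro!: continuous_intros simp: less_imp_neq[symmetric])

definition quad_form :: "(real \<Rightarrow> real) \<Rightarrow> (real \<Rightarrow> real) \<Rightarrow> (real \<Rightarrow> real) \<Rightarrow>
    (real \<Rightarrow> real) \<Rightarrow> (real \<Rightarrow> real) \<Rightarrow> (real \<Rightarrow> real) \<Rightarrow> real" where
  "quad_form \<alpha> \<beta> \<gamma> u a v = (pair \<alpha> v v + pair \<alpha> a a) / 2 + pair \<beta> v a + pair \<gamma> v u"

definition quad_flow :: "(real \<Rightarrow> real) \<Rightarrow> (real \<Rightarrow> real) \<Rightarrow> (real \<Rightarrow> real) \<Rightarrow> (real \<Rightarrow> real) \<Rightarrow> (real \<Rightarrow> real) \<Rightarrow>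
    (real \<Rightarrow> real) \<Rightarrow> (real \<Rightarrow> real) \<Rightarrow> (real \<Rightarrow> real) \<Rightarrow> (real \<Rightarrow> real) \<Rightarrow> (real \<Rightarrow> real) \<Rightarrow> real" where
  "quad_flow \<alpha> \<alpha>' \<beta> \<beta>' \<gamma> \<gamma>' u a v k = pair \<alpha> v k - pair \<alpha>' v a - (pair \<beta>' v v + pair \<beta>' a a) / 2 + pair \<beta> a k
     + pair \<gamma> v v - pair \<gamma> a a - pair \<gamma>' u a + pair \<gamma> u k"

text \<open>Adds weighted norms that are bounded on bounded time intervals. Bounds are the right
  notion here: the cutoff is removed at each fixed time, and dominated convergence in time needs
  nothing more.\<close>

locale energy_wave = wave +
  assumes sw: "\<And>t. t \<ge> 0 \<Longrightarrow> sqint (\<lambda>x. rw x * w t x)" and sg: "\<And>t. t \<ge> 0 \<Longrightarrow> sqint (\<lambda>x. rw x * g t x)"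
    and sV: "\<And>t. t \<ge> 0 \<Longrightarrow> sqint (\<lambda>x. rv x * V t x)" and sG: "\<And>t. t \<ge> 0 \<Longrightarrow> sqint (\<lambda>x. rG x * G t x)"
    and bw: "\<And>T. \<exists>M. \<forall>t\<in>{0..T}. norm2 (\<lambda>x. rw x * w t x) \<le> M"
    and bg: "\<And>T. \<exists>M. \<forall>t\<in>{0..T}. norm2 (\<lambda>x. rw x * g t x) \<le> M"
    and bV: "\<And>T. \<exists>M. \<forall>t\<in>{0..T}. norm2 (\<lambda>x. rv x * V t x) \<le> M"
    and bG: "\<And>T. \<exists>M. \<forall>t\<in>{0..T}. norm2 (\<lambda>x. rG x * G t x) \<le> M"
    and bV': "\<And>T. \<exists>M. \<forall>t\<in>{0..T}. \<forall>x. \<bar>V t x\<bar> \<le> M"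
begin

lemma pair_bounded:
  assumes "\<And>t. t \<ge> 0 \<Longrightarrow> locsq (f t)" "\<And>t. t \<ge> 0 \<Longrightarrow> locsq (h t)" "\<And>n. \<omega> n \<in> borel_measurable borel"
    and "\<And>t. t \<ge> 0 \<Longrightarrow> sqint (\<lambda>x. r1 x * f t x)" "\<And>t. t \<ge> 0 \<Longrightarrow> sqint (\<lambda>x. r2 x * h t x)"
    and "\<And>x. r1 x > 0" "\<And>x. r2 x > 0" and B: "\<And>n x. \<bar>\<omega> n x\<bar> \<le> B * (r1 x * r2 x)" and "0 \<le> B"
    and bf: "\<And>T. \<exists>M. \<forall>t\<in>{0..T}. norm2 (\<lambda>x. r1 x * f t x) \<le> M"
    and bh: "\<And>T. \<exists>M. \<forall>t\<in>{0..T}. norm2 (\<lambda>x. r2 x * h t x) \<le> M"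
  shows "\<exists>C. \<forall>n :: nat. \<forall>t\<in>{0..T}. \<bar>pair (\<omega> n) (f t) (h t)\<bar> \<le> C"
proof -
  obtain M1 where M1: "\<And>t. t \<in> {0..T} \<Longrightarrow> norm2 (\<lambda>x. r1 x * f t x) \<le> M1" using bf by blast
  obtain M2 where M2: "\<And>t. t \<in> {0..T} \<Longrightarrow> norm2 (\<lambda>x. r2 x * h t x) \<le> M2" using bh by blast
  have "\<bar>pair (\<omega> n) (f t) (h t)\<bar> \<le> B * (M1 * M2)" if t: "t \<in> {0..T}" for n t
  proof -
    have t0: "t \<ge> 0" using t by simp
    have "\<bar>pair (\<omega> n) (f t) (h t)\<bar> \<le> B * (norm2 (\<lambda>x. r1 x * f t x) * norm2 (\<lambda>x. r2 x * h t x))"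
      by (rule weighted_sqint_integrable(2)[OF locsq_measurable[OF assms(1)[OF t0]] locsq_measurable[OF assms(2)[OF t0]]
            assms(3) assms(4)[OF t0] assms(5)[OF t0] assms(6,7) B])
    also have "\<dots> \<le> B * (M1 * M2)"
      using M1[OF t] M2[OF t] \<open>0 \<le> B\<close> order_trans[OF norm2_nonneg M1[OF t]]
      by (intro mult_left_mono mult_mono) auto
    finally show ?thesis .
  qed
  then show ?thesis by blast
qed

text \<open>The local identity for weights multiplied by \<open>cutoff n\<close>. Differentiating
  the cutoff produces error weights that are bounded by a multiple of \<open>C\<close> and tend to 0
  pointwise, so they disappear by dominated convergence. The weights \<alpha> and \<beta> pair
  \<open>w\<close> and \<open>g\<close> and may grow like \<open>jb\<close>; \<gamma> pairs with
  \<open>V\<close> and has to be bounded.\<close>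

lemma global_identity:
  assumes \<alpha>: "\<And>x. (\<alpha> has_real_derivative \<alpha>' x) (at x)" "continuous_on UNIV \<alpha>'" "\<And>x. \<bar>\<alpha> x\<bar> \<le> C * jb x" "\<And>x. \<bar>\<alpha>' x\<bar> \<le> C"
    and \<beta>: "\<And>x. (\<beta> has_real_derivative \<beta>' x) (at x)" "continuous_on UNIV \<beta>'" "\<And>x. \<bar>\<beta> x\<bar> \<le> C * jb x" "\<And>x. \<bar>\<beta>' x\<bar> \<le> C"
    and \<gamma>: "\<And>x. (\<gamma> has_real_derivative \<gamma>' x) (at x)" "continuous_on UNIV \<gamma>'" "\<And>x. \<bar>\<gamma> x\<bar> \<le> C" "\<And>x. \<bar>\<gamma>' x\<bar> \<le> C"
    and ab: "0 \<le> a" "a \<le> b"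
  shows "((\<lambda>t. quad_flow \<alpha> \<alpha>' \<beta> \<beta>' \<gamma> \<gamma>' (V t) (g t) (w t) (G t)) has_integral
     (quad_form \<alpha> \<beta> \<gamma> (V b) (g b) (w b) - quad_form \<alpha> \<beta> \<gamma> (V a) (g a) (w a))) {a..b}"
proof -
  have C0: "C \<ge> 0" using order_trans[OF abs_ge_zero \<gamma>(3)[of 0]] .
  have c: "continuous_on UNIV \<alpha>" "continuous_on UNIV \<beta>" "continuous_on UNIV \<gamma>"
    using \<alpha>(1) \<beta>(1) \<gamma>(1) by (meson DERIV_isCont continuous_at_imp_continuous_on)+
  define D where "D \<omega> \<omega>' n x = cutoff n x * \<omega>' x + cutoff' n x * \<omega> x" for \<omega> \<omega>' :: "real \<Rightarrow> real" and n x
  define P where "P \<omega> n x = cutoff n x * \<omega> x" for \<omega> :: "real \<Rightarrow> real" and n x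
  have Pd: "(P \<omega> n has_real_derivative D \<omega> \<omega>' n x) (at x)" if "\<And>x. (\<omega> has_real_derivative \<omega>' x) (at x)" for \<omega> \<omega>' n x
    unfolding P_def[abs_def] D_def using DERIV_mult[OF cutoff_deriv that, of n] by (simp add: mult_ac add.commute)
  have Pc: "continuous_on S (P \<omega> n)" if "continuous_on UNIV \<omega>" for S \<omega> n
    unfolding P_def by (intro continuous_intros cutoff_continuous continuous_on_subset[OF that]) simp
  have Dc: "continuous_on S (D \<omega> \<omega>' n)" if "continuous_on UNIV \<omega>" "continuous_on UNIV \<omega>'" for S \<omega> \<omega>' n
    unfolding D_def by (intro continuous_intros cutoff_continuous continuous_on_subset[OF that(1)] continuous_on_subset[OF that(2)]; simp)
  have Ps: "\<bar>x\<bar> \<ge> real (Suc n) \<Longrightarrow> P \<omega> n x = 0" "\<bar>x\<bar> \<ge> real (Suc n) \<Longrightarrow> D \<omega> \<omega>' n x = 0" for \<omega> \<omega>' n x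
    using cutoff_support[of n x] by (auto simp: P_def D_def simp del: of_nat_Suc)
  have Pb: "\<bar>P \<omega> n x\<bar> \<le> \<bar>\<omega> x\<bar>" for \<omega> n x
    unfolding P_def abs_mult using cutoff_bounds(1)[of n x] by (intro mult_left_le_one_le) auto
  have Pl: "(\<lambda>n. P \<omega> n x) \<longlonglongrightarrow> \<omega> x" "(\<lambda>n. D \<omega> \<omega>' n x) \<longlonglongrightarrow> \<omega>' x" for \<omega> \<omega>' x
  proof -
    have "(\<lambda>n. cutoff n x * \<omega> x) \<longlonglongrightarrow> 1 * \<omega> x" by (intro tendsto_intros cutoff_tendsto)
    then show "(\<lambda>n. P \<omega> n x) \<longlonglongrightarrow> \<omega> x" by (simp add: P_def)
    have "(\<lambda>n. cutoff n x * \<omega>' x + cutoff' n x * \<omega> x) \<longlonglongrightarrow> 1 * \<omega>' x + 0 * \<omega> x" by (intro tendsto_intros cutoff_tendsto)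
    then show "(\<lambda>n. D \<omega> \<omega>' n x) \<longlonglongrightarrow> \<omega>' x" by (simp add: D_def)
  qed
  \<comment> \<open>The constant 9 is 1 for the cut-off derivative of the weight plus 8 from
    \<open>cutoff_bounds\<close>.\<close>
  have Db: "\<bar>D \<omega> \<omega>' n x\<bar> \<le> 9 * C" if "\<bar>\<omega> x\<bar> \<le> C * jb x" "\<bar>\<omega>' x\<bar> \<le> C" for \<omega> \<omega>' n x
  proof -
    have "\<bar>cutoff n x * \<omega>' x\<bar> \<le> 1 * C" unfolding abs_mult using cutoff_bounds(1) that C0 by (intro mult_mono) auto
    moreover have "\<bar>cutoff' n x\<bar> * \<bar>\<omega> x\<bar> \<le> \<bar>cutoff' n x\<bar> * (C * jb x)" using that by (intro mult_left_mono) auto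
    moreover have "\<bar>cutoff' n x\<bar> * (C * jb x) \<le> 8 * C"
      using mult_right_mono[OF cutoff_bounds(2)[of n x] C0] by (simp add: mult_ac)
    ultimately show ?thesis unfolding D_def using abs_triangle_ineq[of "cutoff n x * \<omega>' x" "cutoff' n x * \<omega> x"]
      by (simp add: abs_mult)
  qed
  have jb1: "C \<le> C * jb x" "C \<le> C * (jb x)\<^sup>2" "C * jb x \<le> C * (jb x)\<^sup>2" "9 * C \<le> 9 * C * jb x" for x
    using jb_ge1[of x] C0 by (auto simp: power2_eq_square mult_le_cancel_left1 intro: order_trans mult_mono)
  have \<gamma>jb: "\<bar>\<gamma> x\<bar> \<le> C * jb x" for x using \<gamma>(3) jb1(1) order_trans by blast
  have ids: "((\<lambda>t. quad_flow_on (real (Suc n)) (P \<alpha> n) (D \<alpha> \<alpha>' n) (P \<beta> n) (D \<beta> \<beta>' n) (P \<gamma> n) (D \<gamma> \<gamma>' n) (V t) (g t) (w t) (G t)) has_integral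
     (quad_form_on (real (Suc n)) (P \<alpha> n) (P \<beta> n) (P \<gamma> n) (V b) (g b) (w b) - quad_form_on (real (Suc n)) (P \<alpha> n) (P \<beta> n) (P \<gamma> n) (V a) (g a) (w a))) {a..b}" for n
    by (rule local_identity) (use Pd[OF \<alpha>(1)] Pd[OF \<beta>(1)] Pd[OF \<gamma>(1)] Dc[OF c(1) \<alpha>(2)] Dc[OF c(2) \<beta>(2)] Dc[OF c(3) \<gamma>(2)] Ps ab in auto)
  have QQ: "quad_form_on (real (Suc n)) (P \<alpha> n) (P \<beta> n) (P \<gamma> n) (V t) (g t) (w t) = quad_form (P \<alpha> n) (P \<beta> n) (P \<gamma> n) (V t) (g t) (w t)" if t: "t \<ge> 0" for n t
    unfolding quad_form_on_def quad_form_def pair_def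
    by (simp only: ip_eq_LINT_support[OF Pc[OF c(1)] _ _ Ps(1)] ip_eq_LINT_support[OF Pc[OF c(2)] _ _ Ps(1)] ip_eq_LINT_support[OF Pc[OF c(3)] _ _ Ps(1)] V[OF t] g[OF t] w[OF t])
  have DD: "quad_flow_on (real (Suc n)) (P \<alpha> n) (D \<alpha> \<alpha>' n) (P \<beta> n) (D \<beta> \<beta>' n) (P \<gamma> n) (D \<gamma> \<gamma>' n) (V t) (g t) (w t) (G t)
     = quad_flow (P \<alpha> n) (D \<alpha> \<alpha>' n) (P \<beta> n) (D \<beta> \<beta>' n) (P \<gamma> n) (D \<gamma> \<gamma>' n) (V t) (g t) (w t) (G t)" if t: "t \<ge> 0" for n t
    unfolding quad_flow_on_def quad_flow_def pair_def
    by (simp only: ip_eq_LINT_support[OF Pc[OF c(1)] _ _ Ps(1)] ip_eq_LINT_support[OF Pc[OF c(2)] _ _ Ps(1)] ip_eq_LINT_support[OF Pc[OF c(3)] _ _ Ps(1)]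
       ip_eq_LINT_support[OF Dc[OF c(1) \<alpha>(2)] _ _ Ps(2)] ip_eq_LINT_support[OF Dc[OF c(2) \<beta>(2)] _ _ Ps(2)] ip_eq_LINT_support[OF Dc[OF c(3) \<gamma>(2)] _ _ Ps(2)]
       V[OF t] g[OF t] w[OF t] G[OF t])
  have meas: "P \<omega> n \<in> borel_measurable borel" "\<omega> \<in> borel_measurable borel" if "continuous_on UNIV \<omega>" for \<omega> n
    using Pc[OF that] that by (auto intro: borel_measurable_continuous_onI)
  have measD: "D \<omega> \<omega>' n \<in> borel_measurable borel" if "continuous_on UNIV \<omega>" "continuous_on UNIV \<omega>'" for \<omega> \<omega>' n
    using Dc[OF that] by (auto intro: borel_measurable_continuous_onI)
  have w1: "\<bar>P \<alpha> n x\<bar> \<le> C * (rw x * rw x)" "\<bar>P \<beta> n x\<bar> \<le> C * (rw x * rw x)" "\<bar>P \<alpha> n x\<bar> \<le> C * (rw x * rG x)"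
      "\<bar>P \<beta> n x\<bar> \<le> C * (rw x * rG x)" "\<bar>P \<gamma> n x\<bar> \<le> C * (rw x * rw x)" "\<bar>P \<gamma> n x\<bar> \<le> C * (rv x * rG x)" "\<bar>P \<gamma> n x\<bar> \<le> C * (rw x * rv x)"
      "\<bar>D \<alpha> \<alpha>' n x\<bar> \<le> 9 * C * (rw x * rw x)" "\<bar>D \<beta> \<beta>' n x\<bar> \<le> 9 * C * (rw x * rw x)" "\<bar>D \<gamma> \<gamma>' n x\<bar> \<le> 9 * C * (rv x * rw x)" for n x
    unfolding r_prod using \<alpha>(3)[of x] \<beta>(3)[of x] \<gamma>(3)[of x] Pb[of \<alpha> n x] Pb[of \<beta> n x] Pb[of \<gamma> n x] jb1[of x]
      Db[of \<alpha> x \<alpha>' n, OF \<alpha>(3) \<alpha>(4)] Db[of \<beta> x \<beta>' n, OF \<beta>(3) \<beta>(4)] Db[of \<gamma> x \<gamma>' n, OF \<gamma>jb \<gamma>(4)] by linarith+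
  have T: "(\<lambda>n. pair (P \<alpha> n) (w t) (w t)) \<longlonglongrightarrow> pair \<alpha> (w t) (w t)" "(\<lambda>n. pair (P \<alpha> n) (g t) (g t)) \<longlonglongrightarrow> pair \<alpha> (g t) (g t)"
     "(\<lambda>n. pair (P \<beta> n) (w t) (g t)) \<longlonglongrightarrow> pair \<beta> (w t) (g t)" "(\<lambda>n. pair (P \<gamma> n) (w t) (V t)) \<longlonglongrightarrow> pair \<gamma> (w t) (V t)"
     "(\<lambda>n. pair (P \<alpha> n) (w t) (G t)) \<longlonglongrightarrow> pair \<alpha> (w t) (G t)" "(\<lambda>n. pair (D \<alpha> \<alpha>' n) (w t) (g t)) \<longlonglongrightarrow> pair \<alpha>' (w t) (g t)"
     "(\<lambda>n. pair (D \<beta> \<beta>' n) (w t) (w t)) \<longlonglongrightarrow> pair \<beta>' (w t) (w t)" "(\<lambda>n. pair (D \<beta> \<beta>' n) (g t) (g t)) \<longlonglongrightarrow> pair \<beta>' (g t) (g t)"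
     "(\<lambda>n. pair (P \<beta> n) (g t) (G t)) \<longlonglongrightarrow> pair \<beta> (g t) (G t)" "(\<lambda>n. pair (P \<gamma> n) (w t) (w t)) \<longlonglongrightarrow> pair \<gamma> (w t) (w t)"
     "(\<lambda>n. pair (P \<gamma> n) (g t) (g t)) \<longlonglongrightarrow> pair \<gamma> (g t) (g t)" "(\<lambda>n. pair (D \<gamma> \<gamma>' n) (V t) (g t)) \<longlonglongrightarrow> pair \<gamma>' (V t) (g t)"
     "(\<lambda>n. pair (P \<gamma> n) (V t) (G t)) \<longlonglongrightarrow> pair \<gamma> (V t) (G t)" if t: "t \<ge> 0" for t
  proof -
    note vm = locsq_measurable[OF w[OF t]] locsq_measurable[OF g[OF t]] locsq_measurable[OF V[OF t]] locsq_measurable[OF G[OF t]]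
    note sq = sw[OF t] sg[OF t] sV[OF t] sG[OF t]
    show "(\<lambda>n. pair (P \<alpha> n) (w t) (w t)) \<longlonglongrightarrow> pair \<alpha> (w t) (w t)"
      by (rule pair_tendsto[OF vm(1) vm(1) meas[OF c(1)] sq(1) sq(1) r_pos(1) r_pos(1) w1(1) Pl(1)])
    show "(\<lambda>n. pair (P \<alpha> n) (g t) (g t)) \<longlonglongrightarrow> pair \<alpha> (g t) (g t)"
      by (rule pair_tendsto[OF vm(2) vm(2) meas[OF c(1)] sq(2) sq(2) r_pos(1) r_pos(1) w1(1) Pl(1)])
    show "(\<lambda>n. pair (P \<beta> n) (w t) (g t)) \<longlonglongrightarrow> pair \<beta> (w t) (g t)"
      by (rule pair_tendsto[OF vm(1) vm(2) meas[OF c(2)] sq(1) sq(2) r_pos(1) r_pos(1) w1(2) Pl(1)])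
    show "(\<lambda>n. pair (P \<gamma> n) (w t) (V t)) \<longlonglongrightarrow> pair \<gamma> (w t) (V t)"
      by (rule pair_tendsto[OF vm(1) vm(3) meas[OF c(3)] sq(1) sq(3) r_pos(1) r_pos(2) w1(7) Pl(1)])
    show "(\<lambda>n. pair (P \<alpha> n) (w t) (G t)) \<longlonglongrightarrow> pair \<alpha> (w t) (G t)"
      by (rule pair_tendsto[OF vm(1) vm(4) meas[OF c(1)] sq(1) sq(4) r_pos(1) r_pos(3) w1(3) Pl(1)])
    show "(\<lambda>n. pair (D \<alpha> \<alpha>' n) (w t) (g t)) \<longlonglongrightarrow> pair \<alpha>' (w t) (g t)"
      by (rule pair_tendsto[OF vm(1) vm(2) measD[OF c(1) \<alpha>(2)] meas(2)[OF \<alpha>(2)] sq(1) sq(2) r_pos(1) r_pos(1) w1(8) Pl(2)])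
    show "(\<lambda>n. pair (D \<beta> \<beta>' n) (w t) (w t)) \<longlonglongrightarrow> pair \<beta>' (w t) (w t)"
      by (rule pair_tendsto[OF vm(1) vm(1) measD[OF c(2) \<beta>(2)] meas(2)[OF \<beta>(2)] sq(1) sq(1) r_pos(1) r_pos(1) w1(9) Pl(2)])
    show "(\<lambda>n. pair (D \<beta> \<beta>' n) (g t) (g t)) \<longlonglongrightarrow> pair \<beta>' (g t) (g t)"
      by (rule pair_tendsto[OF vm(2) vm(2) measD[OF c(2) \<beta>(2)] meas(2)[OF \<beta>(2)] sq(2) sq(2) r_pos(1) r_pos(1) w1(9) Pl(2)])
    show "(\<lambda>n. pair (P \<beta> n) (g t) (G t)) \<longlonglongrightarrow> pair \<beta> (g t) (G t)"
      by (rule pair_tendsto[OF vm(2) vm(4) meas[OF c(2)] sq(2) sq(4) r_pos(1) r_pos(3) w1(4) Pl(1)])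
    show "(\<lambda>n. pair (P \<gamma> n) (w t) (w t)) \<longlonglongrightarrow> pair \<gamma> (w t) (w t)"
      by (rule pair_tendsto[OF vm(1) vm(1) meas[OF c(3)] sq(1) sq(1) r_pos(1) r_pos(1) w1(5) Pl(1)])
    show "(\<lambda>n. pair (P \<gamma> n) (g t) (g t)) \<longlonglongrightarrow> pair \<gamma> (g t) (g t)"
      by (rule pair_tendsto[OF vm(2) vm(2) meas[OF c(3)] sq(2) sq(2) r_pos(1) r_pos(1) w1(5) Pl(1)])
    show "(\<lambda>n. pair (D \<gamma> \<gamma>' n) (V t) (g t)) \<longlonglongrightarrow> pair \<gamma>' (V t) (g t)"
      by (rule pair_tendsto[OF vm(3) vm(2) measD[OF c(3) \<gamma>(2)] meas(2)[OF \<gamma>(2)] sq(3) sq(2) r_pos(2) r_pos(1) w1(10) Pl(2)])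
    show "(\<lambda>n. pair (P \<gamma> n) (V t) (G t)) \<longlonglongrightarrow> pair \<gamma> (V t) (G t)"
      by (rule pair_tendsto[OF vm(3) vm(4) meas[OF c(3)] sq(3) sq(4) r_pos(2) r_pos(3) w1(6) Pl(1)])
  qed
  have C9: "0 \<le> 9 * C" using C0 by simp
  have "\<exists>C. \<forall>n. \<forall>t\<in>{0..b}. \<bar>pair (P \<alpha> n) (w t) (G t)\<bar> \<le> C"
    by (rule pair_bounded[where \<omega>="P \<alpha>" and ?r1.0=rw and ?r2.0=rG and B="C"])
       (rule w G meas(1)[OF c(1)] sw sG r_pos(1) r_pos(3) w1(3) C0 bw bG, assumption?)+
  then obtain C1 where C1: "\<And>n t. t \<in> {0..b} \<Longrightarrow> \<bar>pair (P \<alpha> n) (w t) (G t)\<bar> \<le> C1" by blast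
  have "\<exists>C. \<forall>n. \<forall>t\<in>{0..b}. \<bar>pair (D \<alpha> \<alpha>' n) (w t) (g t)\<bar> \<le> C"
    by (rule pair_bounded[where \<omega>="D \<alpha> \<alpha>'" and ?r1.0=rw and ?r2.0=rw and B="9 * C"])
       (rule w g measD[OF c(1) \<alpha>(2)] sw sg r_pos(1) r_pos(1) w1(8) C9 bw bg, assumption?)+
  then obtain C2 where C2: "\<And>n t. t \<in> {0..b} \<Longrightarrow> \<bar>pair (D \<alpha> \<alpha>' n) (w t) (g t)\<bar> \<le> C2" by blast
  have "\<exists>C. \<forall>n. \<forall>t\<in>{0..b}. \<bar>pair (D \<beta> \<beta>' n) (w t) (w t)\<bar> \<le> C"
    by (rule pair_bounded[where \<omega>="D \<beta> \<beta>'" and ?r1.0=rw and ?r2.0=rw and B="9 * C"])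
       (rule w w measD[OF c(2) \<beta>(2)] sw sw r_pos(1) r_pos(1) w1(9) C9 bw bw, assumption?)+
  then obtain C3 where C3: "\<And>n t. t \<in> {0..b} \<Longrightarrow> \<bar>pair (D \<beta> \<beta>' n) (w t) (w t)\<bar> \<le> C3" by blast
  have "\<exists>C. \<forall>n. \<forall>t\<in>{0..b}. \<bar>pair (D \<beta> \<beta>' n) (g t) (g t)\<bar> \<le> C"
    by (rule pair_bounded[where \<omega>="D \<beta> \<beta>'" and ?r1.0=rw and ?r2.0=rw and B="9 * C"])
       (rule g g measD[OF c(2) \<beta>(2)] sg sg r_pos(1) r_pos(1) w1(9) C9 bg bg, assumption?)+
  then obtain C4 where C4: "\<And>n t. t \<in> {0..b} \<Longrightarrow> \<bar>pair (D \<beta> \<beta>' n) (g t) (g t)\<bar> \<le> C4" by blast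
  have "\<exists>C. \<forall>n. \<forall>t\<in>{0..b}. \<bar>pair (P \<beta> n) (g t) (G t)\<bar> \<le> C"
    by (rule pair_bounded[where \<omega>="P \<beta>" and ?r1.0=rw and ?r2.0=rG and B="C"])
       (rule g G meas(1)[OF c(2)] sg sG r_pos(1) r_pos(3) w1(4) C0 bg bG, assumption?)+
  then obtain C5 where C5: "\<And>n t. t \<in> {0..b} \<Longrightarrow> \<bar>pair (P \<beta> n) (g t) (G t)\<bar> \<le> C5" by blast
  have "\<exists>C. \<forall>n. \<forall>t\<in>{0..b}. \<bar>pair (P \<gamma> n) (w t) (w t)\<bar> \<le> C"
    by (rule pair_bounded[where \<omega>="P \<gamma>" and ?r1.0=rw and ?r2.0=rw and B="C"])
       (rule w w meas(1)[OF c(3)] sw sw r_pos(1) r_pos(1) w1(5) C0 bw bw, assumption?)+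
  then obtain C6 where C6: "\<And>n t. t \<in> {0..b} \<Longrightarrow> \<bar>pair (P \<gamma> n) (w t) (w t)\<bar> \<le> C6" by blast
  have "\<exists>C. \<forall>n. \<forall>t\<in>{0..b}. \<bar>pair (P \<gamma> n) (g t) (g t)\<bar> \<le> C"
    by (rule pair_bounded[where \<omega>="P \<gamma>" and ?r1.0=rw and ?r2.0=rw and B="C"])
       (rule g g meas(1)[OF c(3)] sg sg r_pos(1) r_pos(1) w1(5) C0 bg bg, assumption?)+
  then obtain C7 where C7: "\<And>n t. t \<in> {0..b} \<Longrightarrow> \<bar>pair (P \<gamma> n) (g t) (g t)\<bar> \<le> C7" by blast
  have "\<exists>C. \<forall>n. \<forall>t\<in>{0..b}. \<bar>pair (D \<gamma> \<gamma>' n) (V t) (g t)\<bar> \<le> C"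
    by (rule pair_bounded[where \<omega>="D \<gamma> \<gamma>'" and ?r1.0=rv and ?r2.0=rw and B="9 * C"])
       (rule V g measD[OF c(3) \<gamma>(2)] sV sg r_pos(2) r_pos(1) w1(10) C9 bV bg, assumption?)+
  then obtain C8 where C8: "\<And>n t. t \<in> {0..b} \<Longrightarrow> \<bar>pair (D \<gamma> \<gamma>' n) (V t) (g t)\<bar> \<le> C8" by blast
  have "\<exists>C. \<forall>n. \<forall>t\<in>{0..b}. \<bar>pair (P \<gamma> n) (V t) (G t)\<bar> \<le> C"
    by (rule pair_bounded[where \<omega>="P \<gamma>" and ?r1.0=rv and ?r2.0=rG and B="C"])
       (rule V G meas(1)[OF c(3)] sV sG r_pos(2) r_pos(3) w1(6) C0 bV bG, assumption?)+
  then obtain C9 where C9: "\<And>n t. t \<in> {0..b} \<Longrightarrow> \<bar>pair (P \<gamma> n) (V t) (G t)\<bar> \<le> C9" by blast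
  show ?thesis
  proof (rule has_integral_limit[OF ids])
    fix n t assume "t \<in> {a..b}"
    then have t: "t \<in> {0..b}" "t \<ge> 0" using ab by auto
    show "\<bar>quad_flow_on (real (Suc n)) (P \<alpha> n) (D \<alpha> \<alpha>' n) (P \<beta> n) (D \<beta> \<beta>' n) (P \<gamma> n) (D \<gamma> \<gamma>' n) (V t) (g t) (w t) (G t)\<bar>
      \<le> C1 + C2 + (C3 + C4) / 2 + C5 + C6 + C7 + C8 + C9"
      unfolding DD[OF t(2)] quad_flow_def
      by (rule abs_sum_bound; rule C1[OF t(1)] C2[OF t(1)] C3[OF t(1)] C4[OF t(1)] C5[OF t(1)] C6[OF t(1)] C7[OF t(1)] C8[OF t(1)] C9[OF t(1)])
  next
    fix t assume "t \<in> {a..b}"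
    then have t: "t \<ge> 0" using ab by auto
    show "(\<lambda>n. quad_flow_on (real (Suc n)) (P \<alpha> n) (D \<alpha> \<alpha>' n) (P \<beta> n) (D \<beta> \<beta>' n) (P \<gamma> n) (D \<gamma> \<gamma>' n) (V t) (g t) (w t) (G t))
       \<longlonglongrightarrow> quad_flow \<alpha> \<alpha>' \<beta> \<beta>' \<gamma> \<gamma>' (V t) (g t) (w t) (G t)"
      unfolding DD[OF t] quad_flow_def by (intro tendsto_add tendsto_diff tendsto_divide tendsto_const T[OF t]) simp
  next
    have b: "b \<ge> 0" using ab by simp
    show "(\<lambda>n. quad_form_on (real (Suc n)) (P \<alpha> n) (P \<beta> n) (P \<gamma> n) (V b) (g b) (w b) - quad_form_on (real (Suc n)) (P \<alpha> n) (P \<beta> n) (P \<gamma> n) (V a) (g a) (w a))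
      \<longlonglongrightarrow> quad_form \<alpha> \<beta> \<gamma> (V b) (g b) (w b) - quad_form \<alpha> \<beta> \<gamma> (V a) (g a) (w a)"
      unfolding QQ[OF b] QQ[OF ab(1)] quad_form_def by (intro tendsto_add tendsto_diff tendsto_divide tendsto_const T[OF b] T[OF ab(1)]) simp_all
  qed
qed

text \<open>The exponent k + 2 is split: two factors of \<open>V\<close> enter the pairing and use
  the weight 1 / \<open>jb\<close>, while the other k are absorbed into the weight through the
  supremum bound.\<close>

lemma global_power_identity:
  assumes \<kappa>: "continuous_on UNIV \<kappa>" "\<And>x. \<bar>\<kappa> x\<bar> \<le> C / jb x" and ab: "0 \<le> a" "a \<le> b"
  shows "((\<lambda>t. pair (\<lambda>x. real (Suc (Suc k)) * \<kappa> x * V t x ^ k) (V t) (w t)) has_integral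
     (pair (\<lambda>x. \<kappa> x * V b x ^ k) (V b) (V b) - pair (\<lambda>x. \<kappa> x * V a x ^ k) (V a) (V a))) {a..b}"
proof -
  define N where "N = real (Suc (Suc k))"
  have N: "N \<ge> 0" by (simp add: N_def)
  have C0: "C \<ge> 0" using order_trans[OF abs_ge_zero \<kappa>(2)[of 0]] jb_pos[of 0] by (simp add: zero_le_divide_iff)
  obtain M where M': "\<And>t x. t \<in> {0..b} \<Longrightarrow> \<bar>V t x\<bar> \<le> M" using bV' by blast
  define B where "B = max M 0"
  have B: "B \<ge> 0" "\<And>t x. t \<in> {0..b} \<Longrightarrow> \<bar>V t x\<bar> \<le> B" using M' by (auto simp: B_def intro: max.coboundedI1)
  have Vcont: "continuous_on S (V t)" if "t \<ge> 0" for t S by (rule primitive_continuous[OF prim[OF that] g[OF that]])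
  have \<kappa>c: "continuous_on S \<kappa>" for S by (rule continuous_on_subset[OF \<kappa>(1)]) simp
  let ?P = "\<lambda>n x. cutoff n x * \<kappa> x"
  have Pc: "continuous_on S (?P n)" for S n by (intro continuous_intros cutoff_continuous \<kappa>c)
  have cc: "continuous_on UNIV (\<lambda>x. c * ?P n x * V t x ^ k)" if "t \<ge> 0" for t c n
    by (intro continuous_intros cutoff_continuous \<kappa>c Vcont that)
  have Ps: "c * ?P n x * y = 0" if "\<bar>x\<bar> \<ge> real (Suc n)" for c y n x using cutoff_support(1)[OF that] by simp
  have ids: "((\<lambda>t. integral {-real (Suc n)..real (Suc n)} (\<lambda>x. real (Suc (Suc k)) * ?P n x * V t x ^ (Suc (Suc k) - 1) * w t x)) has_integral
     (integral {-real (Suc n)..real (Suc n)} (\<lambda>x. ?P n x * V b x ^ Suc (Suc k)) - integral {-real (Suc n)..real (Suc n)} (\<lambda>x. ?P n x * V a x ^ Suc (Suc k)))) {a..b}" for n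
    by (rule local_power_identity[OF Pc]) (use ab in auto)
  have e1: "integral {-real (Suc n)..real (Suc n)} (\<lambda>x. ?P n x * V t x ^ Suc (Suc k)) = pair (\<lambda>x. 1 * ?P n x * V t x ^ k) (V t) (V t)" if t: "t \<ge> 0" for n t
    using ip_eq_LINT_support[where L="real (Suc n)", OF cc[OF t, of 1 n] V[OF t] V[OF t] Ps] by (simp add: ip_def pair_def mult_ac)
  have e2: "integral {-real (Suc n)..real (Suc n)} (\<lambda>x. real (Suc (Suc k)) * ?P n x * V t x ^ (Suc (Suc k) - 1) * w t x) = pair (\<lambda>x. N * ?P n x * V t x ^ k) (V t) (w t)" if t: "t \<ge> 0" for n t
    using ip_eq_LINT_support[where L="real (Suc n)", OF cc[OF t, of N n] V[OF t] w[OF t] Ps] by (simp add: ip_def pair_def mult_ac N_def)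
  have bd: "\<bar>c * ?P n x * V t x ^ k\<bar> \<le> (c * C * B ^ k) / jb x" if "t \<in> {0..b}" "c \<ge> 0" for c n x t
  proof -
    have "\<bar>cutoff n x\<bar> * \<bar>\<kappa> x\<bar> \<le> 1 * (C / jb x)" using cutoff_bounds(1) \<kappa>(2) by (intro mult_mono) auto
    then have "c * (\<bar>cutoff n x\<bar> * \<bar>\<kappa> x\<bar>) \<le> c * (1 * (C / jb x))" by (rule mult_left_mono) (rule that(2))
    moreover have "\<bar>V t x\<bar> ^ k \<le> B ^ k" using B that by (intro power_mono) auto
    ultimately have "c * (\<bar>cutoff n x\<bar> * \<bar>\<kappa> x\<bar>) * \<bar>V t x\<bar> ^ k \<le> c * (1 * (C / jb x)) * B ^ k"
      by (rule mult_mono) (use that C0 jb_pos[of x] in auto)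
    then show ?thesis using that by (simp add: abs_mult power_abs mult_ac)
  qed
  have bdv: "\<bar>c * ?P n x * V t x ^ k\<bar> \<le> (c * C * B ^ k) * (rv x * rv x)" if "t \<in> {0..b}" "c \<ge> 0" for c n x t
    using bd[OF that] by (simp add: r_prod)
  have bdw: "\<bar>c * ?P n x * V t x ^ k\<bar> \<le> (c * C * B ^ k) * (rv x * rw x)" if "t \<in> {0..b}" "c \<ge> 0" for c n x t
  proof -
    have "(c * C * B ^ k) / jb x \<le> (c * C * B ^ k) / 1"
      using that C0 B(1) jb_ge1[of x] by (intro divide_left_mono) auto
    then show ?thesis using bd[OF that, of n x] by (simp add: r_prod)
  qed
  have lim: "(\<lambda>n. c * ?P n x * V t x ^ k) \<longlonglongrightarrow> c * \<kappa> x * V t x ^ k" for c x t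
  proof -
    have "(\<lambda>n. c * ?P n x * V t x ^ k) \<longlonglongrightarrow> c * (1 * \<kappa> x) * V t x ^ k" by (intro tendsto_intros cutoff_tendsto)
    then show ?thesis by simp
  qed
  have meas: "(\<lambda>x. c * ?P n x * V t x ^ k) \<in> borel_measurable borel" "(\<lambda>x. c * \<kappa> x * V t x ^ k) \<in> borel_measurable borel" if "t \<ge> 0" for c n t
    by (rule borel_measurable_continuous_onI, intro continuous_intros cutoff_continuous \<kappa>c Vcont that)+
  have T1: "(\<lambda>n. pair (\<lambda>x. 1 * ?P n x * V t x ^ k) (V t) (V t)) \<longlonglongrightarrow> pair (\<lambda>x. 1 * \<kappa> x * V t x ^ k) (V t) (V t)" if t: "t \<in> {0..b}" for t
  proof -
    have t0: "t \<ge> 0" using t by simp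
    show ?thesis
      by (rule pair_tendsto[OF locsq_measurable[OF V[OF t0]] locsq_measurable[OF V[OF t0]] meas[OF t0] sV[OF t0] sV[OF t0] r_pos(2) r_pos(2) bdv[OF t] lim]) simp
  qed
  have T2: "(\<lambda>n. pair (\<lambda>x. N * ?P n x * V t x ^ k) (V t) (w t)) \<longlonglongrightarrow> pair (\<lambda>x. N * \<kappa> x * V t x ^ k) (V t) (w t)" if t: "t \<in> {0..b}" for t
  proof -
    have t0: "t \<ge> 0" using t by simp
    show ?thesis
      by (rule pair_tendsto[OF locsq_measurable[OF V[OF t0]] locsq_measurable[OF w[OF t0]] meas[OF t0] sV[OF t0] sw[OF t0] r_pos(2) r_pos(1) bdw[OF t N] lim])
  qed
  obtain M1 where M1: "\<And>t. t \<in> {0..b} \<Longrightarrow> norm2 (\<lambda>x. rv x * V t x) \<le> M1" using bV by blast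
  obtain M2 where M2: "\<And>t. t \<in> {0..b} \<Longrightarrow> norm2 (\<lambda>x. rw x * w t x) \<le> M2" using bw by blast
  have main: "((\<lambda>t. pair (\<lambda>x. N * \<kappa> x * V t x ^ k) (V t) (w t)) has_integral
     (pair (\<lambda>x. 1 * \<kappa> x * V b x ^ k) (V b) (V b) - pair (\<lambda>x. 1 * \<kappa> x * V a x ^ k) (V a) (V a))) {a..b}"
  proof (rule has_integral_limit[OF ids])
    fix n t assume "t \<in> {a..b}"
    then have t: "t \<in> {0..b}" "t \<ge> 0" using ab by auto
    have "\<bar>pair (\<lambda>x. N * ?P n x * V t x ^ k) (V t) (w t)\<bar> \<le> (N * C * B ^ k) * (norm2 (\<lambda>x. rv x * V t x) * norm2 (\<lambda>x. rw x * w t x))"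
      by (rule weighted_sqint_integrable(2)[OF locsq_measurable[OF V[OF t(2)]] locsq_measurable[OF w[OF t(2)]] meas(1)[OF t(2)]
          sV[OF t(2)] sw[OF t(2)] r_pos(2) r_pos(1) bdw[OF t(1) N]])
    also have "\<dots> \<le> (N * C * B ^ k) * (M1 * M2)"
      using M1[OF t(1)] M2[OF t(1)] order_trans[OF norm2_nonneg M1[OF t(1)]] N C0 B(1)
      by (intro mult_left_mono mult_mono) auto
    finally show "\<bar>integral {-real (Suc n)..real (Suc n)} (\<lambda>x. real (Suc (Suc k)) * ?P n x * V t x ^ (Suc (Suc k) - 1) * w t x)\<bar> \<le> (N * C * B ^ k) * (M1 * M2)"
      unfolding e2[OF t(2)] .
  next
    fix t assume "t \<in> {a..b}"
    then have t: "t \<in> {0..b}" "t \<ge> 0" using ab by auto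
    show "(\<lambda>n. integral {-real (Suc n)..real (Suc n)} (\<lambda>x. real (Suc (Suc k)) * ?P n x * V t x ^ (Suc (Suc k) - 1) * w t x)) \<longlonglongrightarrow> pair (\<lambda>x. N * \<kappa> x * V t x ^ k) (V t) (w t)"
      unfolding e2[OF t(2)] by (rule T2[OF t(1)])
  next
    have b: "b \<ge> 0" using ab by simp
    show "(\<lambda>n. integral {-real (Suc n)..real (Suc n)} (\<lambda>x. ?P n x * V b x ^ Suc (Suc k)) - integral {-real (Suc n)..real (Suc n)} (\<lambda>x. ?P n x * V a x ^ Suc (Suc k)))
      \<longlonglongrightarrow> pair (\<lambda>x. 1 * \<kappa> x * V b x ^ k) (V b) (V b) - pair (\<lambda>x. 1 * \<kappa> x * V a x ^ k) (V a) (V a)"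
      unfolding e1[OF b] e1[OF ab(1)] by (intro tendsto_diff T1) (use ab in auto)
  qed
  then show ?thesis by (simp add: N_def)
qed

end

section \<open>Coercivity and virial estimates\<close>

lemma integrable_Icc_tendsto:
  assumes "integrable lborel (f :: real \<Rightarrow> real)"
  shows "(\<lambda>n. integral {0..real n} f) \<longlonglongrightarrow> (LINT x|lborel. indicator {0..} x * f x)"
proof -
  have [measurable]: "f \<in> borel_measurable borel" using borel_measurable_integrable[OF assms] by simp
  have "integral {0..real n} f = (LINT x|lborel. indicator {0..real n} x * f x)" for n
    by (rule integral_unique, rule LINT_Icc_has_integral, rule integrable_real_mult_indicator[OF _ assms, of "{0..real n}", unfolded mult.commute[of "f _"]]) simp
  moreover have "(\<lambda>n. LINT x|lborel. indicator {0..real n} x * f x) \<longlonglongrightarrow> (LINT x|lborel. indicator {0..} x * f x)"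
  proof (rule integral_dominated_convergence)
    show "integrable lborel (\<lambda>x. \<bar>f x\<bar>)" using assms by simp
    show "AE x in lborel. (\<lambda>n. indicator {0..real n} x * f x) \<longlonglongrightarrow> indicator {0..} x * f x"
    proof (intro AE_I2 tendsto_eventually)
      fix x
      obtain N :: nat where "x \<le> real N" using real_arch_simple by blast
      then show "\<forall>\<^sub>F n in sequentially. indicator {0..real n} x * f x = indicator {0..} x * f x"
        unfolding eventually_sequentially by (intro exI[of _ N]) (auto simp: indicator_def)
    qed
  qed (auto simp: indicator_def)
  ultimately show ?thesis by simp
qed

text \<open>The left-hand side of the pointwise inequality is the total derivative of
  \<open>m2 v\<^sup>2 + m3 v\<^sup>3 + m4 v\<^sup>4\<close>, which vanishes at \<open>0\<close> and at infinity.\<close>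

lemma half_line_nonneg:
  assumes pv: "primitive v g" "locsq g" "v 0 = 0" and B: "\<And>x. \<bar>v x\<bar> \<le> B"
    and i: "integrable lborel \<Phi>"
    and m2: "\<And>x. 0 \<le> x \<Longrightarrow> (m2 has_real_derivative m2' x) (at x)" "continuous_on {0..} m2'" "(m2 \<longlongrightarrow> 0) at_top"
    and m3: "\<And>x. 0 \<le> x \<Longrightarrow> (m3 has_real_derivative m3' x) (at x)" "continuous_on {0..} m3'" "(m3 \<longlongrightarrow> 0) at_top"
    and m4: "\<And>x. 0 \<le> x \<Longrightarrow> (m4 has_real_derivative m4' x) (at x)" "continuous_on {0..} m4'" "(m4 \<longlongrightarrow> 0) at_top"
    and le: "\<And>x. 0 \<le> x \<Longrightarrow> m2' x * v x ^ 2 + 2 * m2 x * v x * g x + (m3' x * v x ^ 3 + 3 * m3 x * v x ^ 2 * g x)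
       + (m4' x * v x ^ 4 + 4 * m4 x * v x ^ 3 * g x) \<le> \<Phi> x"
  shows "0 \<le> (LINT x|lborel. indicator {0..} x * \<Phi> x)"
proof (rule LIMSEQ_le[OF _ integrable_Icc_tendsto[OF i]])
  let ?b = "\<lambda>n. m2 (real n) * v (real n) ^ 2 + m3 (real n) * v (real n) ^ 3 + m4 (real n) * v (real n) ^ 4"
  have z: "(\<lambda>n. m (real n) * v (real n) ^ k) \<longlonglongrightarrow> 0" if "(m \<longlongrightarrow> 0) at_top" for m :: "real \<Rightarrow> real" and k
  proof (rule metric_tendsto_imp_tendsto)
    have "(\<lambda>n. m (real n)) \<longlonglongrightarrow> 0" by (rule filterlim_compose[OF that filterlim_real_sequentially])
    from tendsto_mult_left[OF this, of "B ^ k"] show "(\<lambda>n. B ^ k * m (real n)) \<longlonglongrightarrow> 0" by simp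
    have "\<bar>v x\<bar> ^ k \<le> B ^ k" for x using B by (intro power_mono) auto
    moreover have "B \<ge> 0" using order_trans[OF abs_ge_zero B[of 0]] .
    ultimately show "\<forall>\<^sub>F n in sequentially. dist (m (real n) * v (real n) ^ k) 0 \<le> dist (B ^ k * m (real n)) 0"
      by (auto simp: abs_mult power_abs mult.commute[of "B ^ k"] intro!: always_eventually mult_left_mono)
  qed
  have "?b \<longlonglongrightarrow> 0 + 0 + 0" by (intro tendsto_add z m2(3) m3(3) m4(3))
  then show "?b \<longlonglongrightarrow> 0" by simp
  have "?b n \<le> integral {0..real n} \<Phi>" for n
  proof (rule has_integral_le)
    note pow = primitive_power_has_integral[OF pv(1,2), of 0 "real n"]
    have c: "continuous_on {0..real n} f" if "continuous_on {0..} f" for f :: "real \<Rightarrow> real"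
      by (rule continuous_on_subset[OF that]) auto
    have "((\<lambda>x. (m2' x * v x ^ 2 + real 2 * m2 x * v x ^ (2 - 1) * g x) + (m3' x * v x ^ 3 + real 3 * m3 x * v x ^ (3 - 1) * g x)
       + (m4' x * v x ^ 4 + real 4 * m4 x * v x ^ (4 - 1) * g x)) has_integral
       (m2 (real n) * v (real n) ^ 2 - m2 0 * v 0 ^ 2) + (m3 (real n) * v (real n) ^ 3 - m3 0 * v 0 ^ 3) + (m4 (real n) * v (real n) ^ 4 - m4 0 * v 0 ^ 4)) {0..real n}"
      by (intro has_integral_add pow m2 m3 m4 c) auto
    then show "((\<lambda>x. (m2' x * v x ^ 2 + real 2 * m2 x * v x ^ (2 - 1) * g x) + (m3' x * v x ^ 3 + real 3 * m3 x * v x ^ (3 - 1) * g x)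
       + (m4' x * v x ^ 4 + real 4 * m4 x * v x ^ (4 - 1) * g x)) has_integral ?b n) {0..real n}"
      using pv(3) by simp
    have "integrable lborel (\<lambda>x. indicat_real {0..real n} x * \<Phi> x)"
      using integrable_real_mult_indicator[OF _ i, of "{0..real n}"] by (simp add: mult.commute)
    then have "\<Phi> integrable_on {0..real n}" using LINT_Icc_has_integral by blast
    then show "(\<Phi> has_integral integral {0..real n} \<Phi>) {0..real n}" by (rule integrable_integral)
    fix x assume "x \<in> {0..real n}"
    then show "(m2' x * v x ^ 2 + real 2 * m2 x * v x ^ (2 - 1) * g x) + (m3' x * v x ^ 3 + real 3 * m3 x * v x ^ (3 - 1) * g x)
       + (m4' x * v x ^ 4 + real 4 * m4 x * v x ^ (4 - 1) * g x) \<le> \<Phi> x"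
      using le[of x] by simp
  qed
  then show "\<exists>N. \<forall>n\<ge>N. ?b n \<le> integral {0..real n} \<Phi>" by blast
qed

lemma locsq_reflect: assumes "locsq g" shows "locsq (\<lambda>x. g (- x))"
  unfolding locsq_def
proof (intro conjI allI)
  have [measurable]: "g \<in> borel_measurable borel" by (rule locsq_measurable[OF assms])
  show "(\<lambda>x. g (- x)) \<in> borel_measurable borel" by measurable
  fix L :: real
  have "sqint (\<lambda>y. indicator {-L..L} (0 - y) * g (0 - y))"
    by (rule sqint_reflect_shift(1)[OF locsq_sqint[OF assms, of L]])
  then show "sqint (\<lambda>x. indicator {-L..L} x * g (- x))"
    by (rule back_subst[of sqint]) (auto simp: indicator_def fun_eq_iff)
qed

lemma primitive_reflect:
  assumes "primitive v g" shows "primitive (\<lambda>x. - v (- x)) (\<lambda>x. g (- x))"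
  unfolding primitive_def
proof (intro allI impI)
  fix a b :: real assume "a \<le> b"
  then have "(g has_integral (v (-a) - v (-b))) {-b..-a}" using assms unfolding primitive_def by auto
  then have "((\<lambda>x. g (- x)) has_integral (v (-a) - v (-b))) {- (- a)..- (- b)}"
    by (rule has_integral_reflect_real[THEN iffD2])
  then show "((\<lambda>x. g (- x)) has_integral - v (- b) - - v (- a)) {a..b}" by simp
qed

text \<open>The map from v to -v(-x) carries the left half line to the right one, keeps the value 0
  at the origin and, by \<open>sym\<close>, leaves the density unchanged. So multipliers on r \<ge>
  0 are enough, and they may depend on r in a way that has no symmetric smooth extension.\<close>

lemma full_line_nonneg:
  fixes F :: "real \<Rightarrow> real \<Rightarrow> real \<Rightarrow> real"
  assumes pv: "primitive v g" "locsq g" "v 0 = 0" and B: "\<And>x. \<bar>v x\<bar> \<le> B"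
    and i: "integrable lborel (\<lambda>x. F x (v x) (g x))"
    and sym: "\<And>x y z. F (- x) (- y) z = F x y z"
    and m2: "\<And>x. 0 \<le> x \<Longrightarrow> (m2 has_real_derivative m2' x) (at x)" "continuous_on {0..} m2'" "(m2 \<longlongrightarrow> 0) at_top"
    and m3: "\<And>x. 0 \<le> x \<Longrightarrow> (m3 has_real_derivative m3' x) (at x)" "continuous_on {0..} m3'" "(m3 \<longlongrightarrow> 0) at_top"
    and m4: "\<And>x. 0 \<le> x \<Longrightarrow> (m4 has_real_derivative m4' x) (at x)" "continuous_on {0..} m4'" "(m4 \<longlongrightarrow> 0) at_top"
    and le: "\<And>x y z. 0 \<le> x \<Longrightarrow> \<bar>y\<bar> \<le> B \<Longrightarrow> m2' x * y ^ 2 + 2 * m2 x * y * z + (m3' x * y ^ 3 + 3 * m3 x * y ^ 2 * z)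
       + (m4' x * y ^ 4 + 4 * m4 x * y ^ 3 * z) \<le> F x y z"
  shows "0 \<le> (LINT x|lborel. F x (v x) (g x))"
proof -
  let ?\<Phi> = "\<lambda>x. F x (v x) (g x)" and ?\<Psi> = "\<lambda>x. F x (- v (- x)) (g (- x))"
  have eq: "?\<Psi> x = ?\<Phi> (- x)" for x using sym[of "-x" "v (-x)" "g (-x)"] by simp
  have i2: "integrable lborel ?\<Psi>"
    using lborel_integrable_real_affine[OF i, of "-1" 0] unfolding eq by simp
  have [measurable]: "?\<Phi> \<in> borel_measurable borel" using borel_measurable_integrable[OF i] by simp
  have 1: "0 \<le> (LINT x|lborel. indicator {0..} x * ?\<Phi> x)"
    by (rule half_line_nonneg[OF pv B i m2 m3 m4 le[OF _ B]])
  have 2: "0 \<le> (LINT x|lborel. indicator {0..} x * ?\<Psi> x)"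
    by (rule half_line_nonneg[OF primitive_reflect[OF pv(1)] locsq_reflect[OF pv(2)] _ _ i2 m2 m3 m4 le]) (use pv(3) B in auto)
  have "(LINT x|lborel. indicator {0..} x * ?\<Psi> x) = (LINT x|lborel. indicator {..0} x * ?\<Phi> x)"
    using lborel_integral_real_affine[of "-1" "\<lambda>x. indicator {..0} x * ?\<Phi> x" 0] unfolding eq by (simp add: indicator_def)
  moreover have "(LINT x|lborel. ?\<Phi> x) = (LINT x|lborel. indicator {0..} x * ?\<Phi> x + indicator {..0} x * ?\<Phi> x)"
  proof (rule integral_cong_AE)
    have "AE x in lborel. x \<noteq> (0::real)" by (rule AE_lborel_singleton)
    then show "AE x in lborel. ?\<Phi> x = indicator {0..} x * ?\<Phi> x + indicator {..0} x * ?\<Phi> x"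
      by eventually_elim (auto simp: indicator_def)
  qed measurable
  moreover have "integrable lborel (\<lambda>x. indicator S x * ?\<Phi> x)" if "S \<in> sets borel" for S
    using integrable_real_mult_indicator[OF _ i, of S] that by (simp add: mult.commute)
  ultimately show ?thesis using 1 2 by simp
qed

section \<open>The source term and the pointwise inequalities behind coercivity and the virial
  estimate\<close>

definition src :: "real \<Rightarrow> real \<Rightarrow> real \<Rightarrow> real" where
  "src r v a = r / (1 + r\<^sup>2) * a + deriv nonlin (kink r) / (1 + r\<^sup>2) * v + remainder r v / (1 + r\<^sup>2)"

lemma kink_jb: "kink r = r / jb r" by (simp add: kink_def jb_def)

lemma kink_sq: "(kink r)\<^sup>2 = 1 - 1 / (jb r)\<^sup>2"
proof -
  have "(jb r)\<^sup>2 \<noteq> 0" using jb_pos[of r] by simp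
  then show ?thesis by (simp add: kink_jb power_divide jb_sq field_simps)
qed

lemma kink_abs_le: "\<bar>kink r\<bar> \<le> 1"
  using jb_ge_abs[of r] jb_pos[of r] by (simp add: kink_jb)

lemma kink_continuous [continuous_intros]: "continuous_on S kink"
proof -
  have "continuous_on S (\<lambda>r. r / jb r)"
    by (intro continuous_intros ballI) (use jb_pos in \<open>simp add: less_imp_neq[symmetric]\<close>)
  then show ?thesis by (rule back_subst[of "continuous_on S"]) (auto simp: kink_jb)
qed

lemma kink_odd: "kink (- r) = - kink r" by (simp add: kink_def)

lemma kink_deriv: "(kink has_real_derivative 1 / jb x ^ 3) (at x)"
proof -
  have "((\<lambda>r. r / jb r) has_real_derivative (1 * jb x - x * (x / jb x)) / (jb x * jb x)) (at x)"
    by (rule DERIV_divide[OF DERIV_ident jb_deriv]) (use jb_pos[of x] in simp)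
  moreover have "(1 * jb x - x * (x / jb x)) / (jb x * jb x) = 1 / jb x ^ 3"
    using jb_pos[of x] jb_sq[of x] by (simp add: field_simps power2_eq_square power3_eq_cube)
  moreover have "kink = (\<lambda>r. r / jb r)" by (auto simp: kink_jb)
  ultimately show ?thesis by simp
qed

lemma src_alt: "src r v a = (r * a + (2 - 6 * (kink r)\<^sup>2) * v - 6 * kink r * v\<^sup>2 - 2 * v ^ 3) / (jb r)\<^sup>2"
  unfolding src_def deriv_nonlin remainder_eq jb_sq by (simp add: add_divide_distrib diff_divide_distrib left_diff_distrib)

text \<open>The coefficients in the next two proofs are those of the polynomial in a Bernstein basis of the interval,
  or in powers of \<open>r - 1\<close>.\<close>

lemma virial_poly:
  fixes r :: real assumes "0 \<le> r"
  shows "0 \<le> (1 - 1/500) * ((r + 1/10)\<^sup>2 * (15/4 * r^4 - 8 * r\<^sup>2 + 1/4 - 1/50 * (1 + r\<^sup>2)\<^sup>2) + (1 + r\<^sup>2) + 4 * r * (r + 1/10)) - 1" (is "0 \<le> ?Q")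
proof (cases "r \<le> 1")
  case True
  have "?Q = 1477/5000000 * (1 - r)^6 + 1117201/2500000 * r * (1 - r)^5 + 36846359/5000000 * r^2 * (1 - r)^4 + 29261759/1250000 * r^3 * (1 - r)^3 + 56225673/2500000 * r^4 * (1 - r)^2 + 3426603/1250000 * r^5 * (1 - r) + 287671/625000 * r^6"
    by (simp add: field_simps eval_nat_numeral)
  also have "\<dots> \<ge> 0" using True assms by (intro add_nonneg_nonneg mult_nonneg_nonneg) auto
  finally show ?thesis .
next
  case False
  have "?Q = 287671/625000 + 25449/1250000 * (r - 1) + 39219903/2500000 * (r - 1)^2 + 60430397/1250000 * (r - 1)^3 + 257869727/5000000 * (r - 1)^4 + 5769937/250000 * (r - 1)^5 + 186127/50000 * (r - 1)^6"
    by (simp add: field_simps eval_nat_numeral)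
  also have "\<dots> \<ge> 0" using False by (intro add_nonneg_nonneg mult_nonneg_nonneg) auto
  finally show ?thesis .
qed

lemma coercivity_poly:
  fixes q :: real assumes "0 \<le> q" "q \<le> 1"
  shows "9/16 * q^6 \<le> 99/200 * (2 - 3/200 - 6 * q + 3 * q\<^sup>2 + 9/4 * q^3 * (2 - q))"
proof -
  let ?P = "99/200 * (2 - 3/200 - 6 * q + 3 * q\<^sup>2 + 9/4 * q^3 * (2 - q)) - 9/16 * q^6"
  have "0 \<le> ?P"
  proof (cases "q \<le> 1/2")
    case True
    have "?P = 39303/625 * (1/2 - q)^6 + 176418/625 * q * (1/2 - q)^5 + 61479/125 * q^2 * (1/2 - q)^4 + 105039/250 * q^3 * (1/2 - q)^3 + 184437/1000 * q^4 * (1/2 - q)^2 + 104247/2500 * q^5 * (1/2 - q) + 44073/10000 * q^6"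
      by (simp add: field_simps eval_nat_numeral)
    also have "\<dots> \<ge> 0" using True assms by (intro add_nonneg_nonneg mult_nonneg_nonneg) auto
    finally show ?thesis .
  next
    case False
    have "?P = 44073/10000 * (1 - q)^6 + 6993/625 * (q - 1/2) * (1 - q)^5 + 31887/1000 * (q - 1/2)^2 * (1 - q)^4 + 23139/250 * (q - 1/2)^3 * (1 - q)^3 + 14904/125 * (q - 1/2)^4 * (1 - q)^2 + 34668/625 * (q - 1/2)^5 * (1 - q) + 1953/625 * (q - 1/2)^6"
      by (simp add: field_simps eval_nat_numeral)
    also have "\<dots> \<ge> 0" using False assms by (intro add_nonneg_nonneg mult_nonneg_nonneg) auto
    finally show ?thesis .
  qed
  then show ?thesis by simp
qed

lemma binary_form_nonneg:
  fixes A B b x z :: real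
  assumes "A > 0" "b\<^sup>2 \<le> A * B"
  shows "0 \<le> A * x\<^sup>2 - 2 * b * x * z + B * z\<^sup>2"
proof -
  have "0 \<le> (A * x - b * z)\<^sup>2 + (A * B - b\<^sup>2) * z\<^sup>2" using assms by simp
  also have "\<dots> = A * (A * x\<^sup>2 - 2 * b * x * z + B * z\<^sup>2)" by (simp add: algebra_simps power2_eq_square)
  finally show ?thesis using assms(1) by (simp add: zero_le_mult_iff)
qed

text \<open>Coercivity holds because the Riccati multiplier \<open>3/4 (1 - kink r)^3\<close> turns the quadratic part into a
  nonnegative form on \<open>r \<ge> 0\<close>.\<close>

definition coercivity_integrand :: "real \<Rightarrow> real \<Rightarrow> real \<Rightarrow> real" where
  "coercivity_integrand r y z = (1/2 - 1/200) * jb r * z\<^sup>2 + ((2 - 3 / (jb r)\<^sup>2 - 1/200) * y\<^sup>2 + 2 * kink r * y ^ 3 + 1/2 * y ^ 4) / jb r"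

lemma coercivity_integrand_lower:
  assumes r: "0 \<le> r" and y: "\<bar>y\<bar> \<le> 1/200"
  shows "- 9/4 * (1 - kink r)\<^sup>2 / jb r ^ 3 * y\<^sup>2 + 2 * (3/4 * (1 - kink r) ^ 3) * y * z \<le> coercivity_integrand r y z"
proof -
  define H u q p where "H = kink r" and "u = 1 / jb r" and "q = 1 - H" and "p = jb r"
  have p: "p > 0" using jb_pos by (simp add: p_def)
  have H: "0 \<le> H" "H \<le> 1" using kink_abs_le[of r] r jb_pos[of r] by (auto simp: H_def kink_jb)
  have q: "0 \<le> q" "q \<le> 1" using H by (auto simp: q_def)
  have u2: "u\<^sup>2 = q * (2 - q)" using kink_sq[of r] by (simp add: u_def q_def H_def power_divide algebra_simps power2_eq_square)
  \<comment> \<open>In the variables \<open>z\<close> and \<open>w\<close>, the difference of the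
    two sides is \<open>p\<close> times a form whose quadratic coefficients are polynomials in q = 1
    - H, because u^2 = q (2 - q).\<close>
  define w where "w = u * y"
  have pw: "y = p * w" using p by (simp add: w_def u_def p_def)
  \<comment> \<open>Of the 3/200, a part 1/200 is the gain built into
    \<open>coercivity_integrand\<close> and 1/100 is set aside for the cubic term 2 H y, where |y|
    \<le> 1/200. The last summand is the derivative of the multiplier.\<close>
  define b where "b = 2 - 3 * u\<^sup>2 - 3/200 + 9/4 * q\<^sup>2 * u\<^sup>2"
  have b: "b = 2 - 3/200 - 6 * q + 3 * q\<^sup>2 + 9/4 * q^3 * (2 - q)"
    unfolding b_def u2 by (simp add: algebra_simps power2_eq_square power3_eq_cube)
  have "(3/4 * q ^ 3)\<^sup>2 = 9/16 * q ^ 6" by (simp add: power_mult_distrib power_divide flip: power_mult)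
  also have "\<dots> \<le> 99/200 * b" unfolding b by (rule coercivity_poly[OF q])
  finally have "(3/4 * q ^ 3)\<^sup>2 \<le> 99/200 * b" .
  then have form: "0 \<le> 99/200 * z\<^sup>2 - 2 * (3/4 * q ^ 3) * z * w + b * w\<^sup>2"
    by (intro binary_form_nonneg) auto
  have "\<bar>H * y\<bar> \<le> 1 * (1/200)" unfolding abs_mult using H y by (intro mult_mono) auto
  then have "- (1/200) \<le> H * y" by (simp add: abs_le_iff)
  then have cub: "0 \<le> (2 * (H * y) + 1/100 + 1/2 * y\<^sup>2) * w\<^sup>2" by (intro mult_nonneg_nonneg) auto
  have "coercivity_integrand r y z - (- 9/4 * q\<^sup>2 / p ^ 3 * y\<^sup>2 + 2 * (3/4 * q ^ 3) * y * z)
     = p * ((99/200 * z\<^sup>2 - 2 * (3/4 * q ^ 3) * z * w + b * w\<^sup>2) + (2 * (H * y) + 1/100 + 1/2 * y\<^sup>2) * w\<^sup>2)"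
    unfolding coercivity_integrand_def b_def w_def u_def H_def[symmetric] p_def[symmetric] using p
    by (simp add: field_simps eval_nat_numeral)
  also have "\<dots> \<ge> 0" by (rule mult_nonneg_nonneg[OF less_imp_le[OF p] add_nonneg_nonneg[OF form cub]])
  finally show ?thesis by (simp add: q_def H_def p_def)
qed

lemma tendsto_zero_of_inverse_bound:
  fixes m :: "real \<Rightarrow> real"
  assumes "\<And>x. 1 \<le> x \<Longrightarrow> \<bar>m x\<bar> \<le> C / x"
  shows "(m \<longlongrightarrow> 0) at_top"
proof (rule metric_tendsto_imp_tendsto)
  show "((\<lambda>x. C / x) \<longlongrightarrow> 0) at_top"
    by (rule tendsto_divide_0[OF tendsto_const filterlim_at_top_imp_at_infinity[OF filterlim_ident]])
  show "\<forall>\<^sub>F x in at_top. dist (m x) 0 \<le> dist (C / x) 0"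
    using eventually_ge_at_top[of 1]
  proof eventually_elim
    case (elim x)
    have "C / x \<le> \<bar>C\<bar> / x" using elim by (intro divide_right_mono) auto
    then show ?case using assms[of x] elim by (simp add: dist_real_def)
  qed
qed

text \<open>The density of the flow of the virial functional, less the fraction 1/500 of the local
  terms that is to be gained.\<close>

definition virial_integrand :: "real \<Rightarrow> real \<Rightarrow> real \<Rightarrow> real" where
  "virial_integrand r y z = z\<^sup>2 - r * z * src r y z - 1/2 * y * src r y z - 1/500 * (z\<^sup>2 + y\<^sup>2) / (jb r)\<^sup>2"

text \<open>The terms \<open>y z\<close>, \<open>y\<^sup>2 z\<close>, \<open>y\<^sup>3 z\<close> of \<open>virial_integrand\<close> are integrated by parts through these
  multipliers; the last summand of \<open>virial_mult2\<close> is a Hardy multiplier, with \<open>1/10\<close> removing its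
  singularity at the origin.\<close>

definition virial_mult2 :: "real \<Rightarrow> real" where
  "virial_mult2 r = 7/4 * r / (1 + r\<^sup>2) - 3 * r / (1 + r\<^sup>2)\<^sup>2 + 1 / ((r + 1/10) * (1 + r\<^sup>2)\<^sup>2)"
definition virial_mult2' :: "real \<Rightarrow> real" where
  "virial_mult2' r = 7/4 * (1 - r\<^sup>2) / (1 + r\<^sup>2)\<^sup>2 - 3 * (1 - 3 * r\<^sup>2) / (1 + r\<^sup>2) ^ 3
     - 1 / ((r + 1/10)\<^sup>2 * (1 + r\<^sup>2)\<^sup>2) - 4 * r / ((r + 1/10) * (1 + r\<^sup>2) ^ 3)"
definition virial_mult3 :: "real \<Rightarrow> real" where "virial_mult3 r = 2 * r\<^sup>2 / jb r ^ 3"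
definition virial_mult3' :: "real \<Rightarrow> real" where "virial_mult3' r = 4 * r / jb r ^ 3 - 6 * r ^ 3 / jb r ^ 5"
definition virial_mult4 :: "real \<Rightarrow> real" where "virial_mult4 r = 1/2 * r / (1 + r\<^sup>2)"
definition virial_mult4' :: "real \<Rightarrow> real" where "virial_mult4' r = 1/2 * (1 - r\<^sup>2) / (1 + r\<^sup>2)\<^sup>2"

lemma one_plus_sq_pos: "1 + (r::real)\<^sup>2 > 0" "1 + (r::real)\<^sup>2 \<noteq> 0"
  using zero_le_power2[of r] by linarith+

text \<open>Inserting the source leaves z^2 with the weight 1/(1 + r^2) only. The multipliers
  reproduce the terms in y^2 z and y^3 z exactly, and those in y z up to the Hardy part. What
  remains is a quadratic form in \<open>z\<close> and u^2 y, nonnegative by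
  \<open>virial_poly\<close>, a cubic term that is small because \<open>y\<close> is, and a
  nonnegative quartic term.\<close>

lemma virial_integrand_lower:
  assumes r: "0 \<le> r" and y: "\<bar>y\<bar> \<le> 1/400"
  shows "virial_mult2' r * y ^ 2 + 2 * virial_mult2 r * y * z + (virial_mult3' r * y ^ 3 + 3 * virial_mult3 r * y ^ 2 * z)
       + (virial_mult4' r * y ^ 4 + 4 * virial_mult4 r * y ^ 3 * z) \<le> virial_integrand r y z"
proof -
  define u \<rho> where "u = 1 / jb r" and "\<rho> = 1 / (r + 1/10)"
  have u0: "u > 0" using jb_pos by (simp add: u_def)
  have u2: "1 / (1 + r\<^sup>2) = u\<^sup>2" by (simp add: u_def power_divide flip: jb_sq)
  \<comment> \<open>Even powers of \<open>r\<close> are eliminated through this relation, so that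
    comparing both sides becomes algebra in \<open>u\<close>, with \<open>r\<close> left only as a
    factor.\<close>
  have h: "r\<^sup>2 * u\<^sup>2 = 1 - u\<^sup>2"
    unfolding u2[symmetric] using one_plus_sq_pos(2)[of r] by (simp add: field_simps)
  have h3: "r\<^sup>2 * u ^ 4 = u\<^sup>2 - u ^ 4" "r\<^sup>2 * u ^ 6 = u ^ 4 - u ^ 6" "r ^ 4 * u ^ 6 = u\<^sup>2 - 2 * u ^ 4 + u ^ 6"
  proof -
    have "r\<^sup>2 * u ^ 4 = (r\<^sup>2 * u\<^sup>2) * u\<^sup>2" by (simp add: eval_nat_numeral)
    then show a: "r\<^sup>2 * u ^ 4 = u\<^sup>2 - u ^ 4" unfolding h by (simp add: algebra_simps eval_nat_numeral)
    have "r\<^sup>2 * u ^ 6 = (r\<^sup>2 * u\<^sup>2) * u ^ 4" by (simp add: eval_nat_numeral)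
    then show b: "r\<^sup>2 * u ^ 6 = u ^ 4 - u ^ 6" unfolding h by (simp add: algebra_simps eval_nat_numeral)
    have "r ^ 4 * u ^ 6 = (r\<^sup>2 * u\<^sup>2) * (r\<^sup>2 * u\<^sup>2) * u\<^sup>2" by (simp add: eval_nat_numeral)
    then show "r ^ 4 * u ^ 6 = u\<^sup>2 - 2 * u ^ 4 + u ^ 6" unfolding h by (simp add: algebra_simps eval_nat_numeral)
  qed
  have kk: "kink r = r * u" by (simp add: kink_jb u_def)
  have p2: "1 / (jb r)\<^sup>2 = u\<^sup>2" by (simp add: u_def power_divide)
  have S: "src r y z = (r * z + (2 - 6 * (r * u)\<^sup>2) * y - 6 * (r * u) * y\<^sup>2 - 2 * y ^ 3) * u\<^sup>2"
    unfolding src_alt kk p2[symmetric] by simp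
  have ru2: "(r * u)\<^sup>2 = 1 - u\<^sup>2" by (simp add: power_mult_distrib h)
  have F1: "virial_integrand r y z = (1 - r\<^sup>2 * u\<^sup>2 - 1/500 * u\<^sup>2) * z\<^sup>2 + (- (2 - 6 * (r * u)\<^sup>2) * r * u\<^sup>2 - 1/2 * r * u\<^sup>2) * (y * z)
     + (- 1/2 * (2 - 6 * (r * u)\<^sup>2) * u\<^sup>2 - 1/500 * u\<^sup>2) * y\<^sup>2 + 6 * r\<^sup>2 * u ^ 3 * (y\<^sup>2 * z) + 3 * r * u ^ 3 * y ^ 3
     + 2 * r * u\<^sup>2 * (y ^ 3 * z) + u\<^sup>2 * y ^ 4"
  proof -
    have f: "virial_integrand r y z = z\<^sup>2 - r * z * src r y z - 1/2 * y * src r y z - 1/500 * (z\<^sup>2 + y\<^sup>2) * u\<^sup>2"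
      unfolding virial_integrand_def p2[symmetric] by simp
    have e: "z\<^sup>2 - r * z * s - 1/2 * y * s - c * (z\<^sup>2 + y\<^sup>2) * u\<^sup>2 =
       (1 - r\<^sup>2 * u\<^sup>2 - c * u\<^sup>2) * z\<^sup>2 + (- (2 - 6 * (r * u)\<^sup>2) * r * u\<^sup>2 - 1/2 * r * u\<^sup>2) * (y * z)
     + (- 1/2 * (2 - 6 * (r * u)\<^sup>2) * u\<^sup>2 - c * u\<^sup>2) * y\<^sup>2 + 6 * r\<^sup>2 * u ^ 3 * (y\<^sup>2 * z) + 3 * r * u ^ 3 * y ^ 3
     + 2 * r * u\<^sup>2 * (y ^ 3 * z) + u\<^sup>2 * y ^ 4"
      if "s = (r * z + (2 - 6 * (r * u)\<^sup>2) * y - 6 * (r * u) * y\<^sup>2 - 2 * y ^ 3) * u\<^sup>2" for s c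
      unfolding that by (simp add: algebra_simps power2_eq_square power3_eq_cube eval_nat_numeral)
    show ?thesis by (rule trans[OF f e[where s="src r y z" and c="1/500", OF S]])
  qed
  have F2: "virial_integrand r y z = (1 - 1/500) * u\<^sup>2 * z\<^sup>2 + (7/2 * r * u\<^sup>2 - 6 * r * u ^ 4) * (y * z)
     + (2 * u\<^sup>2 - 3 * u ^ 4 - 1/500 * u\<^sup>2) * y\<^sup>2 + 6 * r\<^sup>2 * u ^ 3 * (y\<^sup>2 * z) + 3 * r * u ^ 3 * y ^ 3
     + 2 * r * u\<^sup>2 * (y ^ 3 * z) + u\<^sup>2 * y ^ 4"
    unfolding F1 ru2 h by (simp add: algebra_simps eval_nat_numeral)
  have u6: "1 / (1 + r\<^sup>2) ^ 3 = u ^ 6" "1 / (1 + r\<^sup>2) ^ 2 = u ^ 4"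
    using arg_cong[OF u2, of "\<lambda>x. x ^ 3"] arg_cong[OF u2, of "\<lambda>x. x ^ 2"] by (simp_all add: power_divide flip: power_mult)
  have m2: "virial_mult2 r = 7/4 * r * u\<^sup>2 - 3 * r * u ^ 4 + \<rho> * u ^ 4"
  proof -
    have "virial_mult2 r = 7/4 * r * (1 / (1 + r\<^sup>2)) - 3 * r * (1 / (1 + r\<^sup>2) ^ 2) + 1 / (r + 1/10) * (1 / (1 + r\<^sup>2) ^ 2)"
      unfolding virial_mult2_def by simp
    then show ?thesis unfolding u6 u2 \<rho>_def[symmetric] .
  qed
  have m2': "virial_mult2' r = 7/4 * (u ^ 4 - r\<^sup>2 * u ^ 4) - 3 * (u ^ 6 - 3 * (r\<^sup>2 * u ^ 6)) - \<rho>\<^sup>2 * u ^ 4 - 4 * r * \<rho> * u ^ 6"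
  proof -
    have "virial_mult2' r = 7/4 * (1 - r\<^sup>2) * (1 / (1 + r\<^sup>2) ^ 2) - 3 * (1 - 3 * r\<^sup>2) * (1 / (1 + r\<^sup>2) ^ 3)
       - (1 / (r + 1/10))\<^sup>2 * (1 / (1 + r\<^sup>2) ^ 2) - 4 * r * (1 / (r + 1/10)) * (1 / (1 + r\<^sup>2) ^ 3)"
      unfolding virial_mult2'_def by (simp add: power_divide)
    then show ?thesis unfolding u6 \<rho>_def[symmetric] by (simp add: algebra_simps diff_divide_distrib)
  qed
  have m2'': "virial_mult2' r = (2 * u\<^sup>2 - 3 * u ^ 4) - u ^ 6 * (15/4 * r ^ 4 - 8 * r\<^sup>2 + 1/4) - \<rho>\<^sup>2 * u ^ 4 - 4 * r * \<rho> * u ^ 6"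
  proof -
    have "u ^ 6 * (15/4 * r ^ 4 - 8 * r\<^sup>2 + 1/4) = 15/4 * (r ^ 4 * u ^ 6) - 8 * (r\<^sup>2 * u ^ 6) + 1/4 * u ^ 6" by (simp add: algebra_simps)
    then show ?thesis unfolding m2' h3 by (simp add: algebra_simps)
  qed
  have m3: "virial_mult3 r = 2 * r\<^sup>2 * u ^ 3" by (simp add: virial_mult3_def u_def power_divide)
  have m3': "virial_mult3' r = 4 * r * u ^ 3 - 6 * r * ((r * u)\<^sup>2) * u ^ 3"
    by (simp add: virial_mult3'_def u_def power_divide eval_nat_numeral)
  have m4: "virial_mult4 r = 1/2 * r * u\<^sup>2" unfolding u2[symmetric] virial_mult4_def by simp
  have m4': "virial_mult4' r = 1/2 * (u ^ 4 - r\<^sup>2 * u ^ 4)"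
  proof -
    have "virial_mult4' r = 1/2 * (1 - r\<^sup>2) * (1 / (1 + r\<^sup>2) ^ 2)" by (simp add: virial_mult4'_def)
    then show ?thesis unfolding u6 by (simp add: algebra_simps)
  qed
  \<comment> \<open>The last summand, (1 + r^2)^2 / 50, is a reserve: after scaling it is worth u^2
    y^2 / 50 and pays for the gain 1/500 and for the cubic error 5/400.\<close>
  define b where "b = 15/4 * r ^ 4 - 8 * r\<^sup>2 + 1/4 + \<rho>\<^sup>2 * (1 + r\<^sup>2) + 4 * r * \<rho> - 1/50 * (1 + r\<^sup>2)\<^sup>2"
  define w where "w = u\<^sup>2 * y"
  have R: "r + 1/10 > 0" using r by simp
  have "\<rho>\<^sup>2 \<le> (1 - 1/500) * b"
  proof -
    \<comment> \<open>\<open>virial_poly\<close> is the discriminant condition multiplied by (r +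
      1/10)^2; the factor \<open>\<rho>\<^sup>2\<close> undoes this.\<close>
    have "0 \<le> \<rho>\<^sup>2 * ((1 - 1/500) * ((r + 1/10)\<^sup>2 * (15/4 * r^4 - 8 * r\<^sup>2 + 1/4 - 1/50 * (1 + r\<^sup>2)\<^sup>2) + (1 + r\<^sup>2) + 4 * r * (r + 1/10)) - 1)"
      using virial_poly[OF r] by (intro mult_nonneg_nonneg) auto
    also have "\<dots> = (1 - 1/500) * ((\<rho> * (r + 1/10))\<^sup>2 * (15/4 * r^4 - 8 * r\<^sup>2 + 1/4 - 1/50 * (1 + r\<^sup>2)\<^sup>2) + \<rho>\<^sup>2 * (1 + r\<^sup>2) + 4 * r * \<rho> * (\<rho> * (r + 1/10))) - \<rho>\<^sup>2"
    proof -
      have "\<rho>\<^sup>2 * (k * (X\<^sup>2 * P + Y + 4 * r * X) - 1) = k * ((\<rho> * X)\<^sup>2 * P + \<rho>\<^sup>2 * Y + 4 * r * \<rho> * (\<rho> * X)) - \<rho>\<^sup>2" for k X P Y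
        by (simp add: algebra_simps power2_eq_square)
      then show ?thesis .
    qed
    also have "\<rho> * (r + 1/10) = 1" using R by (simp add: \<rho>_def)
    finally show ?thesis by (simp add: b_def algebra_simps)
  qed
  then have form: "0 \<le> (1 - 1/500) * z\<^sup>2 - 2 * \<rho> * z * w + b * w\<^sup>2" by (intro binary_form_nonneg) auto
  have H: "0 \<le> r * u" "r * u \<le> 1" using kink_abs_le[of r] r u0 unfolding kk by (auto simp: abs_le_iff)
  have sq: "(r * u)\<^sup>2 \<le> 1" using H by (simp add: power_le_one)
  \<comment> \<open>What is left of y^3 has the coefficient H (6 H^2 - 1) u^2, of absolute value at
    most 5 u^2; one factor \<open>y\<close>, at most 1/400, is spent to obtain 5/400.\<close>
  have cub: "- (5/400) * u\<^sup>2 * y\<^sup>2 \<le> (3 * r * u ^ 3 - virial_mult3' r) * y ^ 3"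
  proof -
    have e: "(3 * r * u ^ 3 - virial_mult3' r) * y ^ 3 = ((r * u) * (6 * (r * u)\<^sup>2 - 1) * y) * (u\<^sup>2 * y\<^sup>2)"
      unfolding m3' by (simp add: algebra_simps power2_eq_square power3_eq_cube)
    have "\<bar>6 * (r * u)\<^sup>2 - 1\<bar> \<le> 5" using sq zero_le_power2[of "r * u"] by linarith
    then have "\<bar>(r * u)\<bar> * \<bar>6 * (r * u)\<^sup>2 - 1\<bar> * \<bar>y\<bar> \<le> 1 * 5 * (1/400)" using H y by (intro mult_mono) auto
    then have "\<bar>(r * u) * (6 * (r * u)\<^sup>2 - 1) * y\<bar> \<le> 5/400" unfolding abs_mult by simp
    then have "- (5/400) \<le> (r * u) * (6 * (r * u)\<^sup>2 - 1) * y" using abs_le_D2 by fastforce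
    then have "- (5/400) * (u\<^sup>2 * y\<^sup>2) \<le> ((r * u) * (6 * (r * u)\<^sup>2 - 1) * y) * (u\<^sup>2 * y\<^sup>2)" by (intro mult_right_mono) auto
    then show ?thesis unfolding e by simp
  qed
  have qrt: "0 \<le> (u\<^sup>2 - virial_mult4' r) * y ^ 4"
  proof (rule mult_nonneg_nonneg)
    have "u \<le> 1" using jb_ge1[of r] by (simp add: u_def)
    then have "u ^ 4 \<le> u\<^sup>2" using u0 by (intro power_decreasing) auto
    moreover have "0 \<le> A - 1/2 * (B - (A - B))" if "B \<le> A" "0 \<le> A" for A B :: real
      using that by (simp add: field_simps)
    ultimately show "0 \<le> u\<^sup>2 - virial_mult4' r" unfolding m4' h3 using zero_le_power2[of u] by blast
  qed simp
  have b2: "b * u ^ 4 = u ^ 4 * (15/4 * r ^ 4 - 8 * r\<^sup>2 + 1/4) + \<rho>\<^sup>2 * u\<^sup>2 + 4 * r * \<rho> * u ^ 4 - 1/50"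
  proof -
    have one: "(1 + r\<^sup>2) * u\<^sup>2 = 1" using h by (simp add: algebra_simps)
    have "(1 + r\<^sup>2)\<^sup>2 * u ^ 4 = ((1 + r\<^sup>2) * u\<^sup>2)\<^sup>2" by (simp add: power_mult_distrib flip: power_mult)
    then have two: "(1 + r\<^sup>2)\<^sup>2 * u ^ 4 = 1" unfolding one by simp
    have three: "\<rho>\<^sup>2 * (1 + r\<^sup>2) * u ^ 4 = \<rho>\<^sup>2 * u\<^sup>2 * ((1 + r\<^sup>2) * u\<^sup>2)" by (simp add: algebra_simps eval_nat_numeral)
    have "b * u ^ 4 = u ^ 4 * (15/4 * r ^ 4 - 8 * r\<^sup>2 + 1/4) + \<rho>\<^sup>2 * (1 + r\<^sup>2) * u ^ 4 + 4 * r * \<rho> * u ^ 4 - 1/50 * ((1 + r\<^sup>2)\<^sup>2 * u ^ 4)"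
      unfolding b_def by (simp add: algebra_simps)
    then show ?thesis unfolding two three one by simp
  qed
  have "0 \<le> u\<^sup>2 * ((1 - 1/500) * z\<^sup>2 - 2 * \<rho> * z * w + b * w\<^sup>2)" using form by simp
  also have "\<dots> = (1 - 1/500) * u\<^sup>2 * z\<^sup>2 - 2 * \<rho> * u ^ 4 * (y * z) + u\<^sup>2 * (b * u ^ 4) * y\<^sup>2"
    unfolding w_def by (simp add: algebra_simps power2_eq_square eval_nat_numeral)
  finally have main: "0 \<le> (1 - 1/500) * u\<^sup>2 * z\<^sup>2 - 2 * \<rho> * u ^ 4 * (y * z)
      + (u ^ 6 * (15/4 * r ^ 4 - 8 * r\<^sup>2 + 1/4) + \<rho>\<^sup>2 * u ^ 4 + 4 * r * \<rho> * u ^ 6 - 1/50 * u\<^sup>2) * y\<^sup>2"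
    unfolding b2 by (simp add: algebra_simps eval_nat_numeral)
  have slack: "(1/500 + 5/400) * (u\<^sup>2 * y\<^sup>2) \<le> 1/50 * (u\<^sup>2 * y\<^sup>2)" by (intro mult_right_mono) auto
  have "virial_integrand r y z - (virial_mult2' r * y ^ 2 + 2 * virial_mult2 r * y * z + (virial_mult3' r * y ^ 3 + 3 * virial_mult3 r * y ^ 2 * z)
       + (virial_mult4' r * y ^ 4 + 4 * virial_mult4 r * y ^ 3 * z))
     = ((1 - 1/500) * u\<^sup>2 * z\<^sup>2 - 2 * \<rho> * u ^ 4 * (y * z)
      + (u ^ 6 * (15/4 * r ^ 4 - 8 * r\<^sup>2 + 1/4) + \<rho>\<^sup>2 * u ^ 4 + 4 * r * \<rho> * u ^ 6 - 1/50 * u\<^sup>2) * y\<^sup>2)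
      + (1/50 * (u\<^sup>2 * y\<^sup>2) - 1/500 * (u\<^sup>2 * y\<^sup>2)) + (3 * r * u ^ 3 - virial_mult3' r) * y ^ 3 + (u\<^sup>2 - virial_mult4' r) * y ^ 4"
    unfolding F2 m2 m2'' m3 m4 by (simp add: algebra_simps)
  moreover have "- (5/400) * (u\<^sup>2 * y\<^sup>2) \<le> (3 * r * u ^ 3 - virial_mult3' r) * y ^ 3" using cub by simp
  moreover have "T \<le> E" if "E - T = A + (1/50 * W - 1/500 * W) + C + D" "- (5/400) * W \<le> C" "0 \<le> A"
    "(1/500 + 5/400) * W \<le> 1/50 * W" "0 \<le> D" for T E A W C D :: real
    using that by argo
  ultimately show ?thesis using main slack qrt by blast
qed

lemma virial_mult_derivs:
  assumes "0 \<le> r"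
  shows "(virial_mult2 has_real_derivative virial_mult2' r) (at r)" "(virial_mult3 has_real_derivative virial_mult3' r) (at r)" "(virial_mult4 has_real_derivative virial_mult4' r) (at r)"
proof -
  have R: "r + 1/10 \<noteq> 0" using assms by simp
  note p = one_plus_sq_pos(2)[of r] and j = jb_pos[of r]
  have q: "((\<lambda>r::real. 1 + r\<^sup>2) has_real_derivative 2 * r) (at r)" by (auto intro!: derivative_eq_intros)
  have a: "((\<lambda>r. r / (1 + r\<^sup>2)) has_real_derivative (1 - r\<^sup>2) / (1 + r\<^sup>2)\<^sup>2) (at r)"
    by (rule DERIV_cong[OF DERIV_divide[OF DERIV_ident q p]]) (use p in \<open>simp add: power2_eq_square algebra_simps\<close>)
  have p2: "(1 + r\<^sup>2)\<^sup>2 \<noteq> 0" using p by simp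
  have q2: "((\<lambda>r::real. (1 + r\<^sup>2)\<^sup>2) has_real_derivative 4 * r * (1 + r\<^sup>2)) (at r)"
    by (rule DERIV_cong[OF DERIV_power[OF q, of 2]]) simp
  have b: "((\<lambda>r. r / (1 + r\<^sup>2)\<^sup>2) has_real_derivative (1 - 3 * r\<^sup>2) / (1 + r\<^sup>2) ^ 3) (at r)"
  proof -
    define Y where "Y = 1 + r\<^sup>2"
    have Y: "Y \<noteq> 0" using p by (simp add: Y_def)
    have "((\<lambda>r. r / (1 + r\<^sup>2)\<^sup>2) has_real_derivative (1 * Y\<^sup>2 - r * (4 * r * Y)) / (Y\<^sup>2 * Y\<^sup>2)) (at r)"
      using DERIV_divide[OF DERIV_ident q2 p2] by (simp add: Y_def mult_ac)
    moreover have "(1 * Y\<^sup>2 - r * (4 * r * Y)) / (Y\<^sup>2 * Y\<^sup>2) = (Y - 4 * r\<^sup>2) / Y ^ 3"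
      using Y by (simp add: field_simps eval_nat_numeral)
    ultimately show ?thesis by (simp add: Y_def)
  qed
  have c: "((\<lambda>r. 1 / ((r + 1/10) * (1 + r\<^sup>2)\<^sup>2)) has_real_derivative
      - 1 / ((r + 1/10)\<^sup>2 * (1 + r\<^sup>2)\<^sup>2) - 4 * r / ((r + 1/10) * (1 + r\<^sup>2) ^ 3)) (at r)"
  proof -
    define X Y where "X = r + 1/10" and "Y = 1 + r\<^sup>2"
    have XY: "X \<noteq> 0" "Y \<noteq> 0" using R p by (auto simp: X_def Y_def)
    have "((\<lambda>r. r + 1/10) has_real_derivative 1 + 0) (at r)" by (rule DERIV_add[OF DERIV_ident DERIV_const])
    from DERIV_mult[OF this q2] have d: "((\<lambda>r. (r + 1/10) * (1 + r\<^sup>2)\<^sup>2) has_real_derivative Y\<^sup>2 + 4 * r * Y * X) (at r)"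
      by (simp add: X_def Y_def)
    have "((\<lambda>r. 1 / ((r + 1/10) * (1 + r\<^sup>2)\<^sup>2)) has_real_derivative
       (0 * (X * Y\<^sup>2) - 1 * (Y\<^sup>2 + 4 * r * Y * X)) / ((X * Y\<^sup>2) * (X * Y\<^sup>2))) (at r)"
      using DERIV_divide[OF DERIV_const[of 1] d] R p2 by (simp add: X_def Y_def)
    moreover have "(0 * (X * Y\<^sup>2) - 1 * (Y\<^sup>2 + 4 * r * Y * X)) / ((X * Y\<^sup>2) * (X * Y\<^sup>2)) = - 1 / (X\<^sup>2 * Y\<^sup>2) - 4 * r / (X * Y ^ 3)"
      using XY by (simp add: field_simps eval_nat_numeral)
    ultimately show ?thesis by (simp add: X_def Y_def)
  qed
  show "(virial_mult2 has_real_derivative virial_mult2' r) (at r)"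
    using DERIV_add[OF DERIV_diff[OF DERIV_cmult[OF a, of "7/4"] DERIV_cmult[OF b, of 3]] c]
    unfolding virial_mult2_def[abs_def] virial_mult2'_def by (simp add: algebra_simps)
  have j3: "jb r ^ 3 \<noteq> 0" using j by simp
  have j': "((\<lambda>r. jb r ^ 3) has_real_derivative 3 * r * jb r) (at r)"
    by (rule DERIV_cong[OF DERIV_power[OF jb_deriv, of 3]]) (use j in \<open>simp add: power2_eq_square\<close>)
  have s': "((\<lambda>r::real. 2 * r\<^sup>2) has_real_derivative 4 * r) (at r)" by (auto intro!: derivative_eq_intros)
  show "(virial_mult3 has_real_derivative virial_mult3' r) (at r)"
    unfolding virial_mult3_def[abs_def] virial_mult3'_def
    by (rule DERIV_cong[OF DERIV_divide[OF s' j' j3]]) (use j in \<open>simp add: field_simps eval_nat_numeral\<close>)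
  show "(virial_mult4 has_real_derivative virial_mult4' r) (at r)"
    using DERIV_cmult[OF a, of "1/2"] unfolding virial_mult4_def[abs_def] virial_mult4'_def by simp
qed

lemma virial_mult_continuous: "continuous_on {0..} virial_mult2'" "continuous_on {0..} virial_mult3'" "continuous_on {0..} virial_mult4'"
proof -
  have j: "jb r \<noteq> 0" for r using jb_pos[of r] by simp
  have R: "r \<in> {0..} \<Longrightarrow> r + 1/10 \<noteq> (0::real)" for r by simp
  show "continuous_on {0..} virial_mult2'" unfolding virial_mult2'_def
    by (intro continuous_intros ballI; use one_plus_sq_pos(2) in force)
  show "continuous_on {0..} virial_mult3'" unfolding virial_mult3'_def by (intro continuous_intros ballI; use j in simp)
  show "continuous_on {0..} virial_mult4'" unfolding virial_mult4'_def by (intro continuous_intros ballI; use one_plus_sq_pos(2) in simp)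
qed

lemma virial_mult_tendsto: "(virial_mult2 \<longlongrightarrow> 0) at_top" "(virial_mult3 \<longlongrightarrow> 0) at_top" "(virial_mult4 \<longlongrightarrow> 0) at_top"
proof -
  have a: "\<bar>x / (1 + x\<^sup>2)\<bar> \<le> 1 / x" if "1 \<le> x" for x :: real
    using that one_plus_sq_pos(1)[of x] by (simp add: field_simps power2_eq_square)
  have a0: "((\<lambda>x::real. x / (1 + x\<^sup>2)) \<longlongrightarrow> 0) at_top" by (rule tendsto_zero_of_inverse_bound[OF a])
  have b0: "((\<lambda>x::real. 1 / (1 + x\<^sup>2)) \<longlongrightarrow> 0) at_top"
  proof (rule tendsto_zero_of_inverse_bound)
    fix x :: real assume x: "1 \<le> x"
    have "x \<le> 1 + x\<^sup>2" using zero_le_power2[of "x - 1/2"] by (simp add: power2_diff power_divide)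
    then show "\<bar>1 / (1 + x\<^sup>2)\<bar> \<le> 1 / x" using x one_plus_sq_pos(1)[of x] by (simp add: frac_le)
  qed
  have c0: "((\<lambda>x::real. 1 / (x + 1/10)) \<longlongrightarrow> 0) at_top"
    by (rule tendsto_zero_of_inverse_bound[of _ 1]) (auto simp: field_simps)
  have k0: "((\<lambda>x. 1 / jb x) \<longlongrightarrow> 0) at_top"
  proof (rule tendsto_zero_of_inverse_bound)
    fix x :: real assume x: "1 \<le> x"
    then show "\<bar>1 / jb x\<bar> \<le> 1 / x" using jb_ge_abs[of x] jb_pos[of x] by (simp add: frac_le)
  qed
  have "((\<lambda>x. 7/4 * (x / (1 + x\<^sup>2)) - 3 * (x / (1 + x\<^sup>2)) * (1 / (1 + x\<^sup>2)) + 1 / (x + 1/10) * (1 / (1 + x\<^sup>2)) * (1 / (1 + x\<^sup>2)))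
     \<longlongrightarrow> 7/4 * 0 - 3 * 0 * 0 + 0 * 0 * (0::real)) at_top"
    by (intro tendsto_intros a0 b0 c0)
  moreover have "7/4 * (x / (1 + x\<^sup>2)) - 3 * (x / (1 + x\<^sup>2)) * (1 / (1 + x\<^sup>2)) + 1 / (x + 1/10) * (1 / (1 + x\<^sup>2)) * (1 / (1 + x\<^sup>2)) = virial_mult2 x" for x
    unfolding virial_mult2_def by (simp add: power2_eq_square)
  ultimately show "(virial_mult2 \<longlongrightarrow> 0) at_top" by simp
  have v3: "\<bar>virial_mult3 x\<bar> \<le> 2 / x" if "1 \<le> x" for x
  proof -
    have "(kink x)\<^sup>2 \<le> 1" using kink_abs_le[of x] by (simp add: abs_square_le_1)
    then have "2 * (kink x)\<^sup>2 * (1 / jb x) \<le> 2 * 1 * (1 / x)"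
      using that jb_ge_abs[of x] jb_pos[of x] by (intro mult_mono divide_left_mono) auto
    moreover have "virial_mult3 x = 2 * (kink x)\<^sup>2 * (1 / jb x)" by (simp add: virial_mult3_def kink_jb power_divide power3_eq_cube power2_eq_square)
    moreover have "0 \<le> 2 * (kink x)\<^sup>2 * (1 / jb x)" using jb_pos[of x] by simp
    ultimately show ?thesis by simp
  qed
  show "(virial_mult3 \<longlongrightarrow> 0) at_top" by (rule tendsto_zero_of_inverse_bound[OF v3])
  have "((\<lambda>x. 1/2 * (x / (1 + x\<^sup>2))) \<longlongrightarrow> 1/2 * (0::real)) at_top" by (intro tendsto_intros a0)
  then show "(virial_mult4 \<longlongrightarrow> 0) at_top" unfolding virial_mult4_def by simp
qed

lemma coercivity_multiplier:
  "((\<lambda>r. 3/4 * (1 - kink r) ^ 3) has_real_derivative - 9/4 * (1 - kink r)\<^sup>2 / jb r ^ 3) (at r)"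
  "continuous_on S (\<lambda>r. - 9/4 * (1 - kink r)\<^sup>2 / jb r ^ 3)"
  "((\<lambda>r. 3/4 * (1 - kink r) ^ 3) \<longlongrightarrow> 0) at_top"
proof -
  have j: "jb r \<noteq> 0" for r using jb_pos[of r] by simp
  show "((\<lambda>r. 3/4 * (1 - kink r) ^ 3) has_real_derivative - 9/4 * (1 - kink r)\<^sup>2 / jb r ^ 3) (at r)"
    by (rule DERIV_cong[OF DERIV_cmult[OF DERIV_power[OF DERIV_diff[OF DERIV_const kink_deriv], where n=3]]]) simp
  show "continuous_on S (\<lambda>r. - 9/4 * (1 - kink r)\<^sup>2 / jb r ^ 3)" by (intro continuous_intros ballI; use j in simp)
  have b: "\<bar>1 - kink x\<bar> \<le> 1 / x" if x: "1 \<le> x" for x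
  proof -
    have k: "0 \<le> kink x" "kink x \<le> 1" using kink_abs_le[of x] x jb_pos[of x] by (auto simp: kink_jb)
    have "1 - kink x \<le> (1 - kink x) * (1 + kink x)" using k by (simp add: mult_le_cancel_left1)
    also have "\<dots> = 1 / (jb x)\<^sup>2" using kink_sq[of x] by (simp add: algebra_simps power2_eq_square)
    also have "\<dots> \<le> 1 / x"
    proof (rule divide_left_mono)
      have "x * 1 \<le> x * x" using x by (intro mult_left_mono) auto
      then show "x \<le> (jb x)\<^sup>2" unfolding jb_sq by (simp add: power2_eq_square)
    qed (use x jb_pos[of x] in auto)
    finally show ?thesis using k by simp
  qed
  have "((\<lambda>r. 3/4 * (1 - kink r) ^ 3) \<longlongrightarrow> 3/4 * 0 ^ 3) at_top"
    by (intro tendsto_intros tendsto_zero_of_inverse_bound[OF b])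
  then show "((\<lambda>r. 3/4 * (1 - kink r) ^ 3) \<longlongrightarrow> 0) at_top" by simp
qed

section \<open>Weighted norm, energy and estimates at a fixed time\<close>

definition state_norm_sq :: "(real \<Rightarrow> real) \<Rightarrow> (real \<Rightarrow> real) \<Rightarrow> (real \<Rightarrow> real) \<Rightarrow> real" where
  "state_norm_sq v g w = (norm2 (\<lambda>x. rv x * v x))\<^sup>2 + (norm2 (\<lambda>x. rw x * g x))\<^sup>2 + (norm2 (\<lambda>x. rw x * w x))\<^sup>2"

lemma state_norm_sq_nonneg: "0 \<le> state_norm_sq v g w" by (simp add: state_norm_sq_def)

lemma norm2_le_state_norm:
  "norm2 (\<lambda>x. rv x * v x) \<le> sqrt (state_norm_sq v g w)" "norm2 (\<lambda>x. rw x * g x) \<le> sqrt (state_norm_sq v g w)"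
  "norm2 (\<lambda>x. rw x * w x) \<le> sqrt (state_norm_sq v g w)"
  unfolding state_norm_sq_def by (intro real_le_rsqrt; simp)+

lemma norm2_prod_le_state_norm_sq:
  assumes "a \<le> sqrt (state_norm_sq v g w)" "b \<le> sqrt (state_norm_sq v g w)" "0 \<le> b"
  shows "a * b \<le> state_norm_sq v g w"
proof -
  have "a * b \<le> sqrt (state_norm_sq v g w) * sqrt (state_norm_sq v g w)" using assms state_norm_sq_nonneg by (intro mult_mono) auto
  then show ?thesis using state_norm_sq_nonneg[of v g w] by simp
qed

text \<open>Half of the quadratic, cubic and quartic coefficients of the expansion of the potential
  \<open>(1 - u\<^sup>2)\<^sup>2\<close> around the kink, divided by \<open>jb\<close>.\<close>

definition potential2 :: "real \<Rightarrow> real" where "potential2 x = (2 - 3 / (jb x)\<^sup>2) / jb x"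
definition potential3 :: "real \<Rightarrow> real" where "potential3 x = 2 * kink x / jb x"
definition potential4 :: "real \<Rightarrow> real" where "potential4 x = 1/2 / jb x"

text \<open>The energy relative to the kink; the expansion starts at second order because the kink
  is stationary. The trivial power \<open>v x ^ 0\<close> is kept so that each potential term is
  literally a value from \<open>global_power_identity\<close>.\<close>

definition energy :: "(real \<Rightarrow> real) \<Rightarrow> (real \<Rightarrow> real) \<Rightarrow> (real \<Rightarrow> real) \<Rightarrow> real" where
  "energy v g w = (pair jb w w + pair jb g g) / 2 + pair (\<lambda>x. potential2 x * v x ^ 0) v v
     + pair (\<lambda>x. potential3 x * v x ^ 1) v v + pair (\<lambda>x. potential4 x * v x ^ 2) v v"

lemma jb_ne [simp]: "jb x \<noteq> 0" using jb_pos[of x] by simp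

lemma inv_jb_le: "0 \<le> 1 / jb x" "1 / jb x \<le> 1" "1 / (jb x)\<^sup>2 \<le> 1 / jb x" "1 / (jb x)\<^sup>2 \<le> 1" "0 \<le> 1 / (jb x)\<^sup>2"
proof -
  show a: "0 \<le> 1 / jb x" "1 / jb x \<le> 1" using jb_ge1[of x] by auto
  have "(1 / jb x) * (1 / jb x) \<le> (1 / jb x) * 1" using a by (intro mult_left_mono) auto
  then show "1 / (jb x)\<^sup>2 \<le> 1 / jb x" by (simp add: power2_eq_square)
  then show "1 / (jb x)\<^sup>2 \<le> 1" using a by linarith
  show "0 \<le> 1 / (jb x)\<^sup>2" by simp
qed

lemma potential_continuous: "continuous_on S potential2" "continuous_on S potential3" "continuous_on S potential4"
  unfolding potential2_def potential3_def potential4_def by (intro continuous_intros ballI; simp)+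

lemma potential_bounds: "\<bar>potential2 x\<bar> \<le> 2 / jb x" "\<bar>potential3 x\<bar> \<le> 2 / jb x" "\<bar>potential4 x\<bar> \<le> 2 / jb x"
proof -
  have "\<bar>2 - 3 * e\<bar> \<le> 2" if "0 \<le> e" "e \<le> 1" for e :: real using that by (simp add: abs_le_iff)
  from this[OF inv_jb_le(5)[of x] inv_jb_le(4)[of x]] have "\<bar>2 - 3 / (jb x)\<^sup>2\<bar> \<le> 2" by simp
  then show "\<bar>potential2 x\<bar> \<le> 2 / jb x" unfolding potential2_def using jb_pos[of x] by (simp add: divide_right_mono)
  show "\<bar>potential3 x\<bar> \<le> 2 / jb x" unfolding potential3_def using jb_pos[of x] kink_abs_le[of x] by (simp add: abs_mult divide_right_mono)
  show "\<bar>potential4 x\<bar> \<le> 2 / jb x" 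
    using divide_right_mono[of "1/2" 2 "jb x"] jb_pos[of x] by (simp add: potential4_def)
qed

lemma integral_le_LINT:
  fixes f :: "real \<Rightarrow> real"
  assumes i: "integrable lborel f" and "\<And>x. 0 \<le> f x"
  shows "f integrable_on {a..b}" "integral {a..b} f \<le> (LINT x|lborel. (f x :: real))"
proof -
  have m: "integrable lborel (\<lambda>x. indicat_real {a..b} x * f x)"
    using integrable_real_mult_indicator[OF _ i, of "{a..b}"] by (simp add: mult.commute)
  note h = LINT_Icc_has_integral[OF m]
  show "f integrable_on {a..b}" using h by blast
  have "integral {a..b} f = (LINT x|lborel. indicat_real {a..b} x * f x)" using h by blast
  also have "\<dots> \<le> (LINT x|lborel. f x)"
    by (rule integral_mono[OF m i]) (use assms(2) in \<open>auto simp: indicator_def\<close>)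
  finally show "integral {a..b} f \<le> (LINT x|lborel. f x)" .
qed

lemma src_bound:
  assumes "\<bar>y\<bar> \<le> B"
  shows "(jb x)\<^sup>2 * \<bar>src x y z\<bar> \<le> jb x * \<bar>z\<bar> + (4 + 6 * B + 2 * B\<^sup>2) * \<bar>y\<bar>"
proof -
  have B: "B \<ge> 0" using assms by linarith
  have "(kink x)\<^sup>2 \<le> 1" using kink_abs_le[of x] by (simp add: abs_square_le_1)
  then have "\<bar>2 - 6 * (kink x)\<^sup>2\<bar> \<le> 4" using zero_le_power2[of "kink x"] by linarith
  then have 1: "\<bar>(2 - 6 * (kink x)\<^sup>2) * y\<bar> \<le> 4 * \<bar>y\<bar>" unfolding abs_mult by (intro mult_right_mono) auto
  have "\<bar>kink x\<bar> * \<bar>y\<bar> * \<bar>y\<bar> \<le> 1 * B * \<bar>y\<bar>" using kink_abs_le assms B by (intro mult_mono) auto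
  then have 2: "\<bar>6 * kink x * y\<^sup>2\<bar> \<le> 6 * B * \<bar>y\<bar>" by (simp add: abs_mult power2_eq_square)
  have "\<bar>y\<bar> * \<bar>y\<bar> * \<bar>y\<bar> \<le> B * B * \<bar>y\<bar>" using assms B by (intro mult_mono) auto
  then have 3: "\<bar>2 * y ^ 3\<bar> \<le> 2 * B\<^sup>2 * \<bar>y\<bar>" by (simp add: abs_mult power2_eq_square power3_eq_cube)
  have 4: "\<bar>x * z\<bar> \<le> jb x * \<bar>z\<bar>" unfolding abs_mult using jb_ge_abs by (intro mult_right_mono) auto
  have "(jb x)\<^sup>2 * \<bar>src x y z\<bar> = \<bar>x * z + (2 - 6 * (kink x)\<^sup>2) * y - 6 * kink x * y\<^sup>2 - 2 * y ^ 3\<bar>"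
    unfolding src_alt by (simp add: abs_mult)
  also have "\<dots> \<le> \<bar>x * z\<bar> + \<bar>(2 - 6 * (kink x)\<^sup>2) * y\<bar> + \<bar>6 * kink x * y\<^sup>2\<bar> + \<bar>2 * y ^ 3\<bar>" by linarith
  also have "\<dots> \<le> jb x * \<bar>z\<bar> + 4 * \<bar>y\<bar> + 6 * B * \<bar>y\<bar> + 2 * B\<^sup>2 * \<bar>y\<bar>" using 1 2 3 4 by linarith
  finally show ?thesis by (simp add: algebra_simps)
qed

lemma abs_mult_le_half_sum_squares: "\<bar>a * b\<bar> \<le> (a\<^sup>2 + b\<^sup>2) / (2 :: real)"
  using sum_squares_bound[of "\<bar>a\<bar>" "\<bar>b\<bar>"] by (simp add: abs_mult)

text \<open>One time slice. The derivative \<open>g\<close> is explicit and \<open>v\<close> is the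
  continuous representative, so that v(0) = 0, the form in which oddness is used, is
  meaningful.\<close>

locale kink_state =
  fixes v g w :: "real \<Rightarrow> real"
  assumes prim: "primitive v g" and v0: "v 0 = 0"
    and lv: "locsq v" and lg: "locsq g" and lw: "locsq w"
    and sv: "sqint (\<lambda>x. rv x * v x)" and sg: "sqint (\<lambda>x. rw x * g x)" and sw: "sqint (\<lambda>x. rw x * w x)"
begin

lemma meas [measurable]: "v \<in> borel_measurable borel" "g \<in> borel_measurable borel" "w \<in> borel_measurable borel"
  using lv lg lw by (auto intro: locsq_measurable)

lemma v_cont: "continuous_on S v" by (rule primitive_continuous[OF prim lg])

text \<open>Integrate 2 v v_r from the origin, where \<open>v\<close> vanishes. Since
  \<open>rv\<close> and \<open>rw\<close> have product 1, |2 v v_r| is at most the sum of the two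
  weighted squares in the norm.\<close>

lemma sup_bound: "(v x)\<^sup>2 \<le> state_norm_sq v g w"
proof -
  let ?h = "\<lambda>x. (rv x * v x)\<^sup>2 + (rw x * g x)\<^sup>2"
  have hi: "integrable lborel ?h" using sqint_integrable[OF sv] sqint_integrable[OF sg] by simp
  have hL: "(LINT x|lborel. ?h x) \<le> state_norm_sq v g w"
    using sqint_integrable[OF sv] sqint_integrable[OF sg] by (simp add: state_norm_sq_def norm2_sq)
  note hb = integral_le_LINT[OF hi]
  have pw: "\<bar>2 * v y * g y\<bar> \<le> ?h y" for y
  proof -
    have "(rv y * v y) * (rw y * g y) = (rv y * rw y) * (v y * g y)" by (simp add: mult_ac)
    then have e: "(rv y * v y) * (rw y * g y) = v y * g y" by (simp add: r_prod)
    show ?thesis using abs_mult_le_half_sum_squares[of "rv y * v y" "rw y * g y"] unfolding e by (simp add: abs_mult)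
  qed
  have pow: "((\<lambda>y. 2 * v y * g y) has_integral ((v b)\<^sup>2 - (v a)\<^sup>2)) {a..b}" if "a \<le> b" for a b
    using primitive_power_has_integral[OF prim lg that, of "\<lambda>_. 1" "\<lambda>_. 0" 2] by simp
  show ?thesis
  proof (cases "0 \<le> x")
    case True
    have "(v x)\<^sup>2 - (v 0)\<^sup>2 \<le> integral {0..x} ?h"
      by (rule has_integral_le[OF pow[OF True] integrable_integral[OF hb(1)]]) (use pw in \<open>auto simp: abs_le_iff\<close>)
    then show ?thesis using hb(2)[of 0 x] hL v0 by simp
  next
    case False
    then have "((\<lambda>y. - (2 * v y * g y)) has_integral - ((v 0)\<^sup>2 - (v x)\<^sup>2)) {x..0}" using pow[of x 0] by (intro has_integral_neg) auto
    from has_integral_le[OF this integrable_integral[OF hb(1)]] have "- ((v 0)\<^sup>2 - (v x)\<^sup>2) \<le> integral {x..0} ?h"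
      using pw by (auto simp: abs_le_iff)
    then show ?thesis using hb(2)[of x 0] hL v0 by simp
  qed
qed

lemma sup_bound': "\<bar>v x\<bar> \<le> sqrt (state_norm_sq v g w)"
  using sup_bound[of x] by (intro real_le_rsqrt) simp

definition G :: "real \<Rightarrow> real" where "G x = src x (v x) (g x)"

lemma G_split: "G x = x / (jb x)\<^sup>2 * g x + ((2 - 6 * (kink x)\<^sup>2) * v x - 6 * kink x * (v x)\<^sup>2 - 2 * v x ^ 3) / (jb x)\<^sup>2"
  unfolding G_def src_alt by (simp add: add_divide_distrib diff_divide_distrib)

lemma lG: "locsq G"
proof -
  have "locsq (\<lambda>x. x / (jb x)\<^sup>2 * g x + ((2 - 6 * (kink x)\<^sup>2) * v x - 6 * kink x * (v x)\<^sup>2 - 2 * v x ^ 3) / (jb x)\<^sup>2)"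
    by (intro locsq_add locsq_bdd_mult lg locsq_continuous continuous_intros v_cont ballI; simp)
  then show ?thesis by (simp add: G_split[abs_def])
qed

lemma G_meas [measurable]: "G \<in> borel_measurable borel" by (rule locsq_measurable[OF lG])

text \<open>\<open>rG\<close> is \<open>rv\<close> times jb^2, so \<open>src_bound\<close>
  multiplied by \<open>rv\<close> leaves exactly the weight \<open>rw\<close> on \<open>g\<close>
  and \<open>rv\<close> on \<open>v\<close>.\<close>

lemma sG:
  assumes B: "\<And>x. \<bar>v x\<bar> \<le> B"
  shows "sqint (\<lambda>x. rG x * G x)" "norm2 (\<lambda>x. rG x * G x) \<le> norm2 (\<lambda>x. rw x * g x) + (4 + 6 * B + 2 * B\<^sup>2) * norm2 (\<lambda>x. rv x * v x)"
proof -
  define K where "K = 4 + 6 * B + 2 * B\<^sup>2"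
  have B0: "B \<ge> 0" using order_trans[OF abs_ge_zero B[of 0]] .
  then have K: "K \<ge> 0" by (simp add: K_def)
  let ?h = "\<lambda>x. \<bar>rw x * g x\<bar> + K * \<bar>rv x * v x\<bar>"
  have a: "sqint (\<lambda>x. \<bar>rw x * g x\<bar>)" "sqint (\<lambda>x. \<bar>rv x * v x\<bar>)" using sg sv by (auto simp: sqint_def)
  have h: "sqint ?h" by (intro sqint_add sqint_cmult a)
  have rGm: "rG \<in> borel_measurable borel" by (rule borel_measurable_continuous_onI) (rule r_continuous)
  have le: "\<bar>rG x * G x\<bar> \<le> 1 * \<bar>?h x\<bar>" for x
  proof -
    have q: "rG x = rv x * (jb x)\<^sup>2" "rw x = rv x * jb x"
      using jb_pos[of x] by (auto simp: rG_def rv_def rw_def power2_eq_square field_simps)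
    have "\<bar>rG x * G x\<bar> = rv x * ((jb x)\<^sup>2 * \<bar>src x (v x) (g x)\<bar>)"
      unfolding q G_def using r_pos(2)[of x] by (simp add: abs_mult)
    also have "\<dots> \<le> rv x * (jb x * \<bar>g x\<bar> + K * \<bar>v x\<bar>)"
      unfolding K_def by (rule mult_left_mono[OF src_bound[OF B]]) (use r_pos(2)[of x] in simp)
    also have "\<dots> = ?h x" using r_pos(1,2)[of x] jb_pos[of x] unfolding q(2) by (simp add: abs_mult algebra_simps)
    finally show ?thesis using K by simp
  qed
  show "sqint (\<lambda>x. rG x * G x)"
    by (rule sqint_bound[OF h _ AE_I2[OF le]]) (use rGm in measurable)
  have "norm2 (\<lambda>x. rG x * G x) \<le> 1 * norm2 ?h"
    by (rule norm2_mono[OF h _ AE_I2[OF le]]) (use rGm in measurable)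
  also have "\<dots> \<le> norm2 (\<lambda>x. \<bar>rw x * g x\<bar>) + norm2 (\<lambda>x. K * \<bar>rv x * v x\<bar>)"
    using norm2_triangle[OF a(1) sqint_cmult[OF a(2), of K]] by simp
  also have "norm2 (\<lambda>x. \<bar>rw x * g x\<bar>) = norm2 (\<lambda>x. rw x * g x)" by (simp add: norm2_def)
  also have "norm2 (\<lambda>x. K * \<bar>rv x * v x\<bar>) \<le> K * norm2 (\<lambda>x. rv x * v x)"
    by (rule norm2_mono[OF sv sqint_measurable[OF sqint_cmult[OF a(2)]] AE_I2 K]) (use K in \<open>simp add: abs_mult\<close>)
  finally show "norm2 (\<lambda>x. rG x * G x) \<le> norm2 (\<lambda>x. rw x * g x) + (4 + 6 * B + 2 * B\<^sup>2) * norm2 (\<lambda>x. rv x * v x)"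
    by (simp add: K_def)
qed

lemma weighted_integrable:
  assumes "f \<in> borel_measurable borel" "h \<in> borel_measurable borel" "sqint (\<lambda>x. r1 x * f x)" "sqint (\<lambda>x. r2 x * h x)"
    "\<And>x. r1 x > 0" "\<And>x. r2 x > 0" "\<omega> \<in> borel_measurable borel" "\<And>x. \<bar>\<omega> x\<bar> \<le> B * (r1 x * r2 x)"
  shows "integrable lborel (\<lambda>x. \<omega> x * f x * h x)"
  by (rule weighted_sqint_integrable(1)[OF assms(1,2,7,3,4,5,6,8)])

lemma pair_integrable:
  assumes \<omega>: "\<omega> \<in> borel_measurable borel"
  shows "(\<And>x. \<bar>\<omega> x\<bar> \<le> B * jb x) \<Longrightarrow> integrable lborel (\<lambda>x. \<omega> x * w x * w x)"
    "(\<And>x. \<bar>\<omega> x\<bar> \<le> B * jb x) \<Longrightarrow> integrable lborel (\<lambda>x. \<omega> x * g x * g x)"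
    "(\<And>x. \<bar>\<omega> x\<bar> \<le> B * jb x) \<Longrightarrow> integrable lborel (\<lambda>x. \<omega> x * w x * g x)"
    "(\<And>x. \<bar>\<omega> x\<bar> \<le> B * (1 / jb x)) \<Longrightarrow> integrable lborel (\<lambda>x. \<omega> x * v x * v x)"
    "(\<And>x. \<bar>\<omega> x\<bar> \<le> B) \<Longrightarrow> integrable lborel (\<lambda>x. \<omega> x * v x * g x)"
    "(\<And>x. \<bar>\<omega> x\<bar> \<le> B) \<Longrightarrow> integrable lborel (\<lambda>x. \<omega> x * v x * w x)"
  using weighted_integrable[OF meas(3) meas(3) sw sw r_pos(1,1) \<omega>, of B] weighted_integrable[OF meas(2) meas(2) sg sg r_pos(1,1) \<omega>, of B]
    weighted_integrable[OF meas(3) meas(2) sw sg r_pos(1,1) \<omega>, of B] weighted_integrable[OF meas(1) meas(1) sv sv r_pos(2,2) \<omega>, of B]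
    weighted_integrable[OF meas(1) meas(2) sv sg r_pos(2,1) \<omega>, of B] weighted_integrable[OF meas(1) meas(3) sv sw r_pos(2,1) \<omega>, of B]
  by (simp_all add: r_prod)

lemma pair_G_integrable:
  assumes \<omega>: "\<omega> \<in> borel_measurable borel" and sG: "sqint (\<lambda>x. rG x * G x)"
  shows "(\<And>x. \<bar>\<omega> x\<bar> \<le> B * jb x) \<Longrightarrow> integrable lborel (\<lambda>x. \<omega> x * w x * G x)"
    "(\<And>x. \<bar>\<omega> x\<bar> \<le> B * jb x) \<Longrightarrow> integrable lborel (\<lambda>x. \<omega> x * g x * G x)"
    "(\<And>x. \<bar>\<omega> x\<bar> \<le> B) \<Longrightarrow> integrable lborel (\<lambda>x. \<omega> x * v x * G x)"
proof -
  have jj: "B * jb x \<le> B * (jb x)\<^sup>2" "B \<le> B * jb x" if "0 \<le> B" for x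
    using jb_ge1[of x] that by (auto simp: power2_eq_square mult_le_cancel_left1 intro!: mult_left_mono)
  have B1: "0 \<le> B" if "\<And>x. \<bar>\<omega> x\<bar> \<le> B * jb x"
  proof -
    have "0 \<le> B * jb 0" using order_trans[OF abs_ge_zero that[of 0]] .
    then show ?thesis by (simp add: jb_def)
  qed
  { assume b: "\<And>x. \<bar>\<omega> x\<bar> \<le> B * jb x"
    then have b': "\<bar>\<omega> x\<bar> \<le> B * (rw x * rG x)" for x using order_trans[OF b jj(1)[OF B1[OF b]]] by (simp add: r_prod)
    show "integrable lborel (\<lambda>x. \<omega> x * w x * G x)" by (rule weighted_integrable[OF meas(3) G_meas sw sG r_pos(1,3) \<omega> b'])
    show "integrable lborel (\<lambda>x. \<omega> x * g x * G x)" by (rule weighted_integrable[OF meas(2) G_meas sg sG r_pos(1,3) \<omega> b']) }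
  { assume b: "\<And>x. \<bar>\<omega> x\<bar> \<le> B"
    have "0 \<le> B" using order_trans[OF abs_ge_zero b[of 0]] .
    then have b': "\<bar>\<omega> x\<bar> \<le> B * (rv x * rG x)" for x using order_trans[OF b jj(2)] by (simp add: r_prod)
    show "integrable lborel (\<lambda>x. \<omega> x * v x * G x)" by (rule weighted_integrable[OF meas(1) G_meas sv sG r_pos(2,3) \<omega> b']) }
qed

lemma state_norm_sq_eq: "state_norm_sq v g w = pair (\<lambda>x. 1 / jb x) v v + pair jb g g + pair jb w w"
proof -
  have "(rv x * y)\<^sup>2 = 1 / jb x * y * y" "(rw x * y)\<^sup>2 = jb x * y * y" for x y
    using r_prod(1,6)[of x] by (simp_all add: power2_eq_square mult_ac)
  then show ?thesis unfolding state_norm_sq_def norm2_sq pair_def by simp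
qed

end

definition loc_weight :: "real \<Rightarrow> real" where "loc_weight x = 1 / (jb x)\<^sup>2"
definition loc_weight' :: "real \<Rightarrow> real" where "loc_weight' x = - 2 * x / jb x ^ 4"

lemma loc_weight_deriv: "(loc_weight has_real_derivative loc_weight' x) (at x)"
proof -
  have e: "loc_weight = (\<lambda>x. 1 / (1 + x\<^sup>2))" by (simp add: loc_weight_def jb_sq fun_eq_iff)
  have q: "((\<lambda>r::real. 1 + r\<^sup>2) has_real_derivative 2 * x) (at x)" by (auto intro!: derivative_eq_intros)
  have "((\<lambda>x. 1 / (1 + x\<^sup>2)) has_real_derivative (0 * (1 + x\<^sup>2) - 1 * (2 * x)) / ((1 + x\<^sup>2) * (1 + x\<^sup>2))) (at x)"
    by (rule DERIV_divide[OF DERIV_const q one_plus_sq_pos(2)])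
  moreover have "jb x ^ 4 = (1 + x\<^sup>2) * (1 + x\<^sup>2)" unfolding jb_sq[symmetric] by (simp add: eval_nat_numeral)
  ultimately show ?thesis unfolding e loc_weight'_def by simp
qed

lemma loc_weight_continuous: "continuous_on S loc_weight" "continuous_on S loc_weight'"
  unfolding loc_weight_def loc_weight'_def by (intro continuous_intros ballI; simp)+

lemma loc_weight_measurable [measurable]: "loc_weight \<in> borel_measurable borel" "loc_weight' \<in> borel_measurable borel"
  by (rule borel_measurable_continuous_onI, rule loc_weight_continuous)+

text \<open>The bound of \<open>loc_weight'\<close> by \<open>loc_weight\<close> keeps the terms
  that arise from differentiating the weight within the local energy itself.\<close>

lemma loc_weight_bounds: "0 \<le> loc_weight x" "loc_weight x \<le> 1 / jb x" "loc_weight x \<le> 1" "\<bar>loc_weight' x\<bar> \<le> 2 * loc_weight x" "loc_weight x \<le> jb x"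
proof -
  show a: "0 \<le> loc_weight x" "loc_weight x \<le> 1 / jb x" "loc_weight x \<le> 1" unfolding loc_weight_def by (rule inv_jb_le)+
  show "loc_weight x \<le> jb x" using a(3) jb_ge1[of x] by linarith
  have "\<bar>x\<bar> * 1 \<le> jb x * jb x" using jb_ge_abs[of x] jb_ge1[of x] by (intro mult_mono) auto
  then have "\<bar>x\<bar> \<le> (jb x)\<^sup>2" by (simp add: power2_eq_square)
  then have "2 * \<bar>x\<bar> / jb x ^ 4 \<le> 2 * (jb x)\<^sup>2 / jb x ^ 4" by (intro divide_right_mono) auto
  moreover have "2 * (jb x)\<^sup>2 / jb x ^ 4 = 2 * loc_weight x" by (simp add: loc_weight_def eval_nat_numeral)
  ultimately show "\<bar>loc_weight' x\<bar> \<le> 2 * loc_weight x" unfolding loc_weight'_def using jb_pos[of x] by (simp add: abs_mult)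
qed

lemma pair_abs_le:
  assumes "integrable lborel (\<lambda>x. \<omega> x * f x * h x)" "integrable lborel K" "\<And>x. \<bar>\<omega> x * f x * h x\<bar> \<le> K x"
  shows "\<bar>pair \<omega> f h\<bar> \<le> (LINT x|lborel. K x)"
proof -
  have "\<bar>pair \<omega> f h\<bar> \<le> (LINT x|lborel. \<bar>\<omega> x * f x * h x\<bar>)" unfolding pair_def by (rule integral_abs_bound)
  also have "\<dots> \<le> (LINT x|lborel. K x)" by (rule integral_mono) (use assms in auto)
  finally show ?thesis .
qed

lemma pair_zero [simp]: "pair (\<lambda>_. 0) f h = 0" by (simp add: pair_def)

definition local_energy :: "(real \<Rightarrow> real) \<Rightarrow> (real \<Rightarrow> real) \<Rightarrow> (real \<Rightarrow> real) \<Rightarrow> real" where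
  "local_energy v g w = pair loc_weight w w + pair loc_weight g g + pair loc_weight v v"

context kink_state
begin

lemma potential_integrable:
  assumes v1: "\<And>x. \<bar>v x\<bar> \<le> 1" and c: "continuous_on UNIV \<kappa>" and b: "\<And>x. \<bar>\<kappa> x\<bar> \<le> 2 / jb x"
  shows "integrable lborel (\<lambda>x. \<kappa> x * v x ^ k * v x * v x)" "\<bar>pair (\<lambda>x. \<kappa> x * v x ^ k) v v\<bar> \<le> 2 * pair (\<lambda>x. 1 / jb x) v v"
proof -
  have [measurable]: "\<kappa> \<in> borel_measurable borel" by (rule borel_measurable_continuous_onI[OF c])
  have le: "\<bar>\<kappa> x * v x ^ k\<bar> \<le> 2 * (1 / jb x)" for x
  proof -
    have "\<bar>\<kappa> x\<bar> * \<bar>v x\<bar> ^ k \<le> (2 / jb x) * 1" using b v1 jb_pos[of x] by (intro mult_mono power_le_one) auto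
    then show ?thesis by (simp add: abs_mult power_abs)
  qed
  show i: "integrable lborel (\<lambda>x. \<kappa> x * v x ^ k * v x * v x)"
    by (rule pair_integrable(4)[OF _ le]) measurable
  have j: "integrable lborel (\<lambda>x. 1 / jb x * v x * v x)"
    by (rule pair_integrable(4)[where B=1]) (use inv_jb_le(1) in auto)
  have "\<bar>pair (\<lambda>x. \<kappa> x * v x ^ k) v v\<bar> \<le> (LINT x|lborel. 2 * (1 / jb x * v x * v x))"
  proof (rule pair_abs_le[OF i])
    show "integrable lborel (\<lambda>x. 2 * (1 / jb x * v x * v x))" by (rule integrable_mult_right) (rule j)
    fix x
    have "\<bar>\<kappa> x * v x ^ k\<bar> * (\<bar>v x\<bar> * \<bar>v x\<bar>) \<le> 2 * (1 / jb x) * (\<bar>v x\<bar> * \<bar>v x\<bar>)" using le by (intro mult_right_mono) auto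
    then show "\<bar>\<kappa> x * v x ^ k * v x * v x\<bar> \<le> 2 * (1 / jb x * v x * v x)" by (simp add: abs_mult)
  qed
  also have "\<dots> = 2 * pair (\<lambda>x. 1 / jb x) v v" unfolding pair_def by (simp only: integral_mult_right_zero)
  finally show "\<bar>pair (\<lambda>x. \<kappa> x * v x ^ k) v v\<bar> \<le> 2 * pair (\<lambda>x. 1 / jb x) v v" .
qed

lemma basic_ints:
  "integrable lborel (\<lambda>x. 1 / jb x * v x * v x)" "integrable lborel (\<lambda>x. jb x * g x * g x)" "integrable lborel (\<lambda>x. jb x * w x * w x)"
  "integrable lborel (\<lambda>x. loc_weight x * v x * v x)" "integrable lborel (\<lambda>x. loc_weight x * g x * g x)" "integrable lborel (\<lambda>x. loc_weight x * w x * w x)"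
proof -
  show "integrable lborel (\<lambda>x. 1 / jb x * v x * v x)" by (rule pair_integrable(4)[where B=1]) (use inv_jb_le(1) in auto)
  have j: "\<bar>jb x\<bar> \<le> 1 * jb x" for x using jb_pos[of x] by simp
  show "integrable lborel (\<lambda>x. jb x * g x * g x)" "integrable lborel (\<lambda>x. jb x * w x * w x)"
    by (rule pair_integrable(2)[OF jb_measurable j], rule pair_integrable(1)[OF jb_measurable j])
  have k: "\<bar>loc_weight x\<bar> \<le> 1 * (1 / jb x)" "\<bar>loc_weight x\<bar> \<le> 1 * jb x" for x using loc_weight_bounds(1,2,5)[of x] by simp_all
  show "integrable lborel (\<lambda>x. loc_weight x * v x * v x)" by (rule pair_integrable(4)[OF loc_weight_measurable(1) k(1)])
  show "integrable lborel (\<lambda>x. loc_weight x * g x * g x)" by (rule pair_integrable(2)[OF loc_weight_measurable(1) k(2)])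
  show "integrable lborel (\<lambda>x. loc_weight x * w x * w x)" by (rule pair_integrable(1)[OF loc_weight_measurable(1) k(2)])
qed

lemma pair_nonneg: "0 \<le> pair (\<lambda>x. 1 / jb x) v v" "0 \<le> pair jb g g" "0 \<le> pair jb w w"
  "0 \<le> pair loc_weight v v" "0 \<le> pair loc_weight g g" "0 \<le> pair loc_weight w w"
  unfolding pair_def using inv_jb_le(1) jb_pos loc_weight_bounds(1)
  by (auto intro!: Bochner_Integration.integral_nonneg simp: mult.assoc less_imp_le)

lemma local_energy_nonneg: "0 \<le> local_energy v g w" unfolding local_energy_def using pair_nonneg by simp

lemma local_energy_le_state_norm_sq: "local_energy v g w \<le> state_norm_sq v g w"
proof -
  have "pair loc_weight v v \<le> pair (\<lambda>x. 1 / jb x) v v" unfolding pair_def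
  proof (rule integral_mono[OF basic_ints(4) basic_ints(1)])
    fix x show "loc_weight x * v x * v x \<le> 1 / jb x * v x * v x"
      using mult_right_mono[OF loc_weight_bounds(2)[of x], of "v x * v x"] by (simp add: mult.assoc)
  qed
  moreover have "pair loc_weight g g \<le> pair jb g g" unfolding pair_def
    by (rule integral_mono[OF basic_ints(5) basic_ints(2)]) (simp add: mult.assoc mult_right_mono loc_weight_bounds(5))
  moreover have "pair loc_weight w w \<le> pair jb w w" unfolding pair_def
    by (rule integral_mono[OF basic_ints(6) basic_ints(3)]) (simp add: mult.assoc mult_right_mono loc_weight_bounds(5))
  ultimately show ?thesis unfolding local_energy_def state_norm_sq_eq by linarith
qed

text \<open>Each of the three potential terms is at most twice the weighted square of
  \<open>v\<close>, whence the factor 6.\<close>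

lemma energy_upper:
  assumes v1: "\<And>x. \<bar>v x\<bar> \<le> 1" shows "energy v g w \<le> 6 * state_norm_sq v g w"
proof -
  have "\<bar>pair (\<lambda>x. potential2 x * v x ^ 0) v v\<bar> \<le> 2 * pair (\<lambda>x. 1 / jb x) v v"
    "\<bar>pair (\<lambda>x. potential3 x * v x ^ 1) v v\<bar> \<le> 2 * pair (\<lambda>x. 1 / jb x) v v"
    "\<bar>pair (\<lambda>x. potential4 x * v x ^ 2) v v\<bar> \<le> 2 * pair (\<lambda>x. 1 / jb x) v v"
    by (rule potential_integrable(2)[OF v1 potential_continuous(1) potential_bounds(1)] potential_integrable(2)[OF v1 potential_continuous(2) potential_bounds(2)]
        potential_integrable(2)[OF v1 potential_continuous(3) potential_bounds(3)])+
  note this[THEN abs_le_D1]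
  moreover have "(W + X) / 2 + a + b + c \<le> 6 * (Y + X + W)"
    if "a \<le> 2 * Y" "b \<le> 2 * Y" "c \<le> 2 * Y" "0 \<le> W" "0 \<le> X" for W X a b c Y :: real
    using that by argo
  ultimately show ?thesis unfolding energy_def state_norm_sq_eq using pair_nonneg(2,3) by blast
qed

text \<open>The part of the energy in \<open>v\<close> and \<open>g\<close>, less 1/200 of their
  norm, has the density \<open>coercivity_integrand\<close>; only the quadratic multiplier of
  \<open>full_line_nonneg\<close> is used, the others being 0. The part in \<open>w\<close> has the
  coefficient 1/2 and is harmless.\<close>

lemma energy_coercive:
  assumes v200: "\<And>x. \<bar>v x\<bar> \<le> 1/200" shows "1/200 * state_norm_sq v g w \<le> energy v g w"
proof -
  have v1: "\<bar>v x\<bar> \<le> 1" for x using v200[of x] by simp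
  note k2 = potential_integrable(1)[OF v1 potential_continuous(1) potential_bounds(1), of 0] and k3 = potential_integrable(1)[OF v1 potential_continuous(2) potential_bounds(2), of 1]
    and k4 = potential_integrable(1)[OF v1 potential_continuous(3) potential_bounds(3), of 2]
  let ?T = "\<lambda>x. (1/2 - 1/200) * (jb x * g x * g x) + potential2 x * v x ^ 0 * v x * v x + potential3 x * v x ^ 1 * v x * v x
     + potential4 x * v x ^ 2 * v x * v x - 1/200 * (1 / jb x * v x * v x)"
  have eq: "coercivity_integrand x (v x) (g x) = ?T x" for x
    unfolding coercivity_integrand_def potential2_def potential3_def potential4_def by (simp add: field_simps power2_eq_square eval_nat_numeral)
  have i: "integrable lborel ?T"
    using k2 k3 k4 basic_ints(1,2) by (intro Bochner_Integration.integrable_add Bochner_Integration.integrable_diff integrable_mult_right) auto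
  have "0 \<le> (LINT x|lborel. coercivity_integrand x (v x) (g x))"
  proof (rule full_line_nonneg[OF prim lg v0 v200])
    show "integrable lborel (\<lambda>x. coercivity_integrand x (v x) (g x))" unfolding eq by (rule i)
    have jbm: "jb (- x) = jb x" for x by (simp add: jb_def)
    show "coercivity_integrand (- x) (- y) z = coercivity_integrand x y z" for x y z
      unfolding coercivity_integrand_def kink_odd jbm by simp
    show "((\<lambda>r. 3/4 * (1 - kink r) ^ 3) has_real_derivative - 9/4 * (1 - kink x)\<^sup>2 / jb x ^ 3) (at x)" for x by (rule coercivity_multiplier)
    show "continuous_on {0..} (\<lambda>r. - 9/4 * (1 - kink r)\<^sup>2 / jb r ^ 3)" by (rule coercivity_multiplier)
    show "((\<lambda>r. 3/4 * (1 - kink r) ^ 3) \<longlongrightarrow> 0) at_top" by (rule coercivity_multiplier)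
    show "((\<lambda>_. 0) has_real_derivative 0) (at x)" "((\<lambda>_. 0) has_real_derivative 0) (at x)" for x :: real by simp_all
    show "- 9/4 * (1 - kink x)\<^sup>2 / jb x ^ 3 * y ^ 2 + 2 * (3/4 * (1 - kink x) ^ 3) * y * z + (0 * y ^ 3 + 3 * 0 * y ^ 2 * z)
       + (0 * y ^ 4 + 4 * 0 * y ^ 3 * z) \<le> coercivity_integrand x y z" if "0 \<le> x" "\<bar>y\<bar> \<le> 1/200" for x y z
      using coercivity_integrand_lower[OF that, of z] by simp
  qed simp_all
  also have "(LINT x|lborel. coercivity_integrand x (v x) (g x)) = (1/2 - 1/200) * pair jb g g + pair (\<lambda>x. potential2 x * v x ^ 0) v v
     + pair (\<lambda>x. potential3 x * v x ^ 1) v v + pair (\<lambda>x. potential4 x * v x ^ 2) v v - 1/200 * pair (\<lambda>x. 1 / jb x) v v"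
  proof -
    have a: "integrable lborel (\<lambda>x. (1/2 - 1/200) * (jb x * g x * g x))" "integrable lborel (\<lambda>x. 1/200 * (1 / jb x * v x * v x))"
      using basic_ints(1,2) by (intro integrable_mult_right; simp)+
    show ?thesis unfolding eq pair_def
      by (simp only: Bochner_Integration.integral_diff Bochner_Integration.integral_add Bochner_Integration.integrable_add
          Bochner_Integration.integrable_diff integral_mult_right_zero a k2 k3 k4)
  qed
  finally have 0: "0 \<le> \<dots>" .
  have "1/200 * (Y + X + W) \<le> (W + X) / 2 + a + b + c" if "0 \<le> (1/2 - 1/200) * X + a + b + c - 1/200 * Y" "0 \<le> W" for W X Y a b c :: real
    using that by argo
  from this[OF 0 pair_nonneg(3)] show ?thesis unfolding state_norm_sq_eq energy_def .
qed

text \<open>The weights \<beta> = -x and \<gamma> = -1/2 encode the multiplier -r v_r - v/2. In the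
  flow the two contributions of w^2 cancel and those of g^2 add up to coefficient 1, which is the
  purpose of the summand v/2.\<close>

lemma virial_lower:
  assumes v400: "\<And>x. \<bar>v x\<bar> \<le> 1/400"
  shows "1/500 * (pair loc_weight g g + pair loc_weight v v) \<le> quad_flow (\<lambda>_. 0) (\<lambda>_. 0) (\<lambda>x. - x) (\<lambda>_. - 1) (\<lambda>_. - 1/2) (\<lambda>_. 0) v g w G"
proof -
  note sGG = sG(1)[OF v400]
  have x: "\<bar>x\<bar> \<le> 1 * jb x" for x using jb_ge_abs[of x] by simp
  have o: "\<bar>1\<bar> \<le> 1 * jb x" for x using jb_ge1[of x] by simp
  have i1: "integrable lborel (\<lambda>x. 1 * g x * g x)" "integrable lborel (\<lambda>x. 1 * w x * w x)"
    by (rule pair_integrable(2)[OF _ o], simp) (rule pair_integrable(1)[OF _ o], simp)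
  have i2: "integrable lborel (\<lambda>x. x * g x * G x)" by (rule pair_G_integrable(2)[OF _ sGG x]) simp
  have i3: "integrable lborel (\<lambda>x. 1 * v x * G x)" by (rule pair_G_integrable(3)[OF _ sGG, of _ 1]) auto
  let ?T = "\<lambda>x. 1 * g x * g x - x * g x * G x - 1/2 * (1 * v x * G x) - 1/500 * (loc_weight x * g x * g x + loc_weight x * v x * v x)"
  have eq: "virial_integrand x (v x) (g x) = ?T x" for x
    unfolding virial_integrand_def G_def[symmetric] loc_weight_def by (simp add: power2_eq_square add_divide_distrib distrib_left)
  have i4: "integrable lborel (\<lambda>x. 1/2 * (1 * v x * G x))" "integrable lborel (\<lambda>x. loc_weight x * g x * g x + loc_weight x * v x * v x)"
      "integrable lborel (\<lambda>x. 1/500 * (loc_weight x * g x * g x + loc_weight x * v x * v x))"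
    using i3 basic_ints(4,5) by simp_all
  have i: "integrable lborel ?T"
    by (intro Bochner_Integration.integrable_add Bochner_Integration.integrable_diff i1 i2 i4)
  have "0 \<le> (LINT x|lborel. virial_integrand x (v x) (g x))"
  proof (rule full_line_nonneg[OF prim lg v0 v400 _ _ virial_mult_derivs(1) virial_mult_continuous(1) virial_mult_tendsto(1) virial_mult_derivs(2) virial_mult_continuous(2) virial_mult_tendsto(2)
        virial_mult_derivs(3) virial_mult_continuous(3) virial_mult_tendsto(3) virial_integrand_lower])
    show "integrable lborel (\<lambda>x. virial_integrand x (v x) (g x))" unfolding eq by (rule i)
    have jbm: "jb (- x) = jb x" for x by (simp add: jb_def)
    show "virial_integrand (- x) (- y) z = virial_integrand x y z" for x y z
    proof -
      have "- x * z + (2 - 6 * (- H)\<^sup>2) * - y - 6 * - H * (- y)\<^sup>2 - 2 * (- y) ^ 3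
         = - (x * z + (2 - 6 * H\<^sup>2) * y - 6 * H * y\<^sup>2 - 2 * y ^ 3)" for H
        by (simp add: power3_eq_cube algebra_simps)
      then have "src (- x) (- y) z = - src x y z" unfolding src_alt kink_odd jbm by (simp only: minus_divide_left)
      then show ?thesis unfolding virial_integrand_def jbm by simp
    qed
  qed
  also have "(LINT x|lborel. virial_integrand x (v x) (g x)) = pair (\<lambda>_. 1) g g - pair (\<lambda>x. x) g G - 1/2 * pair (\<lambda>_. 1) v G - 1/500 * (pair loc_weight g g + pair loc_weight v v)"
    unfolding eq pair_def
    by (simp only: Bochner_Integration.integral_diff Bochner_Integration.integral_add Bochner_Integration.integrable_add
          Bochner_Integration.integrable_diff integral_mult_right_zero i1 i2 i3 i4 basic_ints)
  finally have 0: "0 \<le> \<dots>" .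
  have neg: "pair (\<lambda>_. c) f h = c * pair (\<lambda>_. 1) f h" "pair (\<lambda>x. - x) f h = - pair (\<lambda>x. x) f h" for f h c
    unfolding pair_def by (simp_all add: mult.assoc)
  have "quad_flow (\<lambda>_. 0) (\<lambda>_. 0) (\<lambda>x. - x) (\<lambda>_. - 1) (\<lambda>_. - 1/2) (\<lambda>_. 0) v g w G
     = pair (\<lambda>_. 1) g g - pair (\<lambda>x. x) g G - 1/2 * pair (\<lambda>_. 1) v G"
    unfolding quad_flow_def neg(1)[of "-1"] neg(1)[of "-1/2"] neg(2) pair_zero by (simp add: field_simps)
  then show ?thesis using 0 by linarith
qed

lemma G_bound:
  assumes v1: "\<And>x. \<bar>v x\<bar> \<le> 1" shows "\<bar>G x\<bar> \<le> \<bar>g x\<bar> + 12 * \<bar>v x\<bar>"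
proof -
  \<comment> \<open>The 12 is the constant 4 + 6 B + 2 B^2 of \<open>src_bound\<close> at B =
    1.\<close>
  have "(jb x)\<^sup>2 * \<bar>G x\<bar> \<le> jb x * \<bar>g x\<bar> + 12 * \<bar>v x\<bar>" using src_bound[OF v1, of x x "g x"] by (simp add: G_def)
  also have "\<dots> \<le> (jb x)\<^sup>2 * \<bar>g x\<bar> + (jb x)\<^sup>2 * (12 * \<bar>v x\<bar>)"
  proof (rule add_mono)
    have "jb x * 1 \<le> jb x * jb x" using jb_ge1[of x] by (intro mult_left_mono) auto
    then show "jb x * \<bar>g x\<bar> \<le> (jb x)\<^sup>2 * \<bar>g x\<bar>" by (intro mult_right_mono) (auto simp: power2_eq_square)
    have "1 \<le> (jb x)\<^sup>2" by (simp add: jb_sq)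
    then show "12 * \<bar>v x\<bar> \<le> (jb x)\<^sup>2 * (12 * \<bar>v x\<bar>)" by (simp add: mult_le_cancel_right1)
  qed
  finally have "(jb x)\<^sup>2 * \<bar>G x\<bar> \<le> (jb x)\<^sup>2 * (\<bar>g x\<bar> + 12 * \<bar>v x\<bar>)" by (simp add: distrib_left)
  then show ?thesis using jb_pos[of x] by simp
qed

text \<open>By \<open>G_bound\<close>, |v G| is at most |v g| + 12 v^2 and |w G| at most |w g| + 12
  |w v|; splitting the products into squares gives the constants 13 and 7 with room to
  spare.\<close>

lemma loc_weight_pair_bounds:
  assumes v1: "\<And>x. \<bar>v x\<bar> \<le> 1"
  shows "\<bar>pair loc_weight v G\<bar> \<le> 13 * (pair loc_weight g g + pair loc_weight v v)" "\<bar>pair loc_weight' v g\<bar> \<le> pair loc_weight g g + pair loc_weight v v"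
    "\<bar>pair loc_weight w G\<bar> \<le> 7 * local_energy v g w" "\<bar>pair loc_weight' w g\<bar> \<le> local_energy v g w" "\<bar>pair loc_weight v w\<bar> \<le> local_energy v g w"
proof -
  note sGG = sG(1)[OF v1]
  have b: "\<bar>loc_weight x\<bar> \<le> 1 * jb x" "\<bar>loc_weight x\<bar> \<le> 1" "\<bar>loc_weight' x\<bar> \<le> 2" "\<bar>loc_weight' x\<bar> \<le> 2 * jb x" for x
    using loc_weight_bounds[of x] by simp_all
  let ?A = "\<lambda>x. loc_weight x * g x * g x + loc_weight x * v x * v x" and ?L = "\<lambda>x. loc_weight x * w x * w x + loc_weight x * g x * g x + loc_weight x * v x * v x"
  have A: "integrable lborel ?A" "(LINT x|lborel. ?A x) = pair loc_weight g g + pair loc_weight v v"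
    using basic_ints(4-6) by (simp_all add: pair_def)
  have L: "integrable lborel ?L" "(LINT x|lborel. ?L x) = local_energy v g w"
    using basic_ints(4-6) by (simp_all add: pair_def local_energy_def)
  have ab: "2 * (\<bar>a\<bar> * \<bar>b\<bar>) \<le> a * a + b * b" for a b :: real using sum_squares_bound[of "\<bar>a\<bar>" "\<bar>b\<bar>"] by (simp add: power2_eq_square)
  have q: "loc_weight x * y \<le> loc_weight x * z" if "y \<le> z" for x y z using that loc_weight_bounds(1) by (intro mult_left_mono) auto
  have q': "\<bar>loc_weight' x\<bar> * y \<le> loc_weight x * z" if "2 * y \<le> z" "0 \<le> y" for x y z
  proof -
    have "\<bar>loc_weight' x\<bar> * y \<le> 2 * loc_weight x * y" using that loc_weight_bounds(4) by (intro mult_right_mono) auto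
    also have "\<dots> \<le> loc_weight x * z" using q[OF that(1), of x] by simp
    finally show ?thesis .
  qed
  have "\<bar>pair loc_weight v G\<bar> \<le> (LINT x|lborel. 13 * ?A x)"
  proof (rule pair_abs_le[OF pair_G_integrable(3)[OF loc_weight_measurable(1) sGG b(2)]])
    fix x
    have "\<bar>v x\<bar> * \<bar>G x\<bar> \<le> \<bar>v x\<bar> * (\<bar>g x\<bar> + 12 * \<bar>v x\<bar>)" using G_bound[OF v1] by (intro mult_left_mono) auto
    also have "\<dots> = \<bar>v x\<bar> * \<bar>g x\<bar> + 12 * (v x * v x)" by (simp add: distrib_left)
    also have "\<dots> \<le> 13 * (g x * g x + v x * v x)"
      using ab[of "v x" "g x"] zero_le_square[of "g x"] zero_le_square[of "v x"] by argo
    finally have "loc_weight x * (\<bar>v x\<bar> * \<bar>G x\<bar>) \<le> loc_weight x * (13 * (g x * g x + v x * v x))" by (rule q)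
    then show "\<bar>loc_weight x * v x * G x\<bar> \<le> 13 * ?A x" using loc_weight_bounds(1)[of x] by (simp add: abs_mult algebra_simps)
  qed (rule integrable_mult_right, rule A(1))
  also have "\<dots> = 13 * (pair loc_weight g g + pair loc_weight v v)" using A(2) by (simp only: integral_mult_right_zero)
  finally show "\<bar>pair loc_weight v G\<bar> \<le> 13 * (pair loc_weight g g + pair loc_weight v v)" .
  have "\<bar>pair loc_weight' v g\<bar> \<le> (LINT x|lborel. ?A x)"
  proof (rule pair_abs_le[OF pair_integrable(5)[OF loc_weight_measurable(2) b(3)] A(1)])
    fix x
    have "\<bar>loc_weight' x\<bar> * (\<bar>v x\<bar> * \<bar>g x\<bar>) \<le> loc_weight x * (v x * v x + g x * g x)" by (rule q'[OF ab]) simp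
    then show "\<bar>loc_weight' x * v x * g x\<bar> \<le> ?A x" by (simp add: abs_mult algebra_simps)
  qed
  then show "\<bar>pair loc_weight' v g\<bar> \<le> pair loc_weight g g + pair loc_weight v v" using A(2) by simp
  have "\<bar>pair loc_weight w G\<bar> \<le> (LINT x|lborel. 7 * ?L x)"
  proof (rule pair_abs_le[OF pair_G_integrable(1)[OF loc_weight_measurable(1) sGG b(1)]])
    fix x
    have "\<bar>w x\<bar> * \<bar>G x\<bar> \<le> \<bar>w x\<bar> * (\<bar>g x\<bar> + 12 * \<bar>v x\<bar>)" using G_bound[OF v1] by (intro mult_left_mono) auto
    also have "\<dots> = \<bar>w x\<bar> * \<bar>g x\<bar> + 12 * (\<bar>w x\<bar> * \<bar>v x\<bar>)" by (simp add: distrib_left)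
    also have "\<dots> \<le> 7 * (w x * w x + g x * g x + v x * v x)"
      using ab[of "w x" "g x"] ab[of "w x" "v x"] zero_le_square[of "g x"] zero_le_square[of "v x"] zero_le_square[of "w x"] by argo
    finally have "loc_weight x * (\<bar>w x\<bar> * \<bar>G x\<bar>) \<le> loc_weight x * (7 * (w x * w x + g x * g x + v x * v x))" by (rule q)
    then show "\<bar>loc_weight x * w x * G x\<bar> \<le> 7 * ?L x" using loc_weight_bounds(1)[of x] by (simp add: abs_mult algebra_simps)
  qed (rule integrable_mult_right, rule L(1))
  also have "\<dots> = 7 * local_energy v g w" using L(2) by (simp only: integral_mult_right_zero)
  finally show "\<bar>pair loc_weight w G\<bar> \<le> 7 * local_energy v g w" .
  have "\<bar>pair loc_weight' w g\<bar> \<le> (LINT x|lborel. ?L x)"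
  proof (rule pair_abs_le[OF pair_integrable(3)[OF loc_weight_measurable(2) b(4)] L(1)])
    fix x
    have "2 * (\<bar>w x\<bar> * \<bar>g x\<bar>) \<le> w x * w x + g x * g x + v x * v x" using ab[of "w x" "g x"] zero_le_square[of "v x"] by linarith
    then have "\<bar>loc_weight' x\<bar> * (\<bar>w x\<bar> * \<bar>g x\<bar>) \<le> loc_weight x * (w x * w x + g x * g x + v x * v x)" by (rule q') simp
    then show "\<bar>loc_weight' x * w x * g x\<bar> \<le> ?L x" by (simp add: abs_mult algebra_simps)
  qed
  then show "\<bar>pair loc_weight' w g\<bar> \<le> local_energy v g w" using L(2) by simp
  have "\<bar>pair loc_weight v w\<bar> \<le> (LINT x|lborel. ?L x)"
  proof (rule pair_abs_le[OF pair_integrable(6)[OF loc_weight_measurable(1) b(2)] L(1)])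
    fix x
    have "\<bar>v x\<bar> * \<bar>w x\<bar> \<le> w x * w x + g x * g x + v x * v x"
      using ab[of "v x" "w x"] zero_le_square[of "v x"] zero_le_square[of "g x"] zero_le_square[of "w x"] mult_nonneg_nonneg[of "\<bar>v x\<bar>" "\<bar>w x\<bar>"] by linarith
    then have "loc_weight x * (\<bar>v x\<bar> * \<bar>w x\<bar>) \<le> loc_weight x * (w x * w x + g x * g x + v x * v x)" by (rule q)
    then show "\<bar>loc_weight x * v x * w x\<bar> \<le> ?L x" using loc_weight_bounds(1)[of x] by (simp add: abs_mult algebra_simps)
  qed
  then show "\<bar>pair loc_weight v w\<bar> \<le> local_energy v g w" using L(2) by simp
qed

text \<open>The multiplier v/(1+r^2) gains w^2 at the price of g^2 and v^2. The 15 collects 13 from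
  the source, 1 from the derivative of the weight and 1 from the term in g^2.\<close>

lemma second_virial_lower:
  assumes v1: "\<And>x. \<bar>v x\<bar> \<le> 1"
  shows "pair loc_weight w w - 15 * (pair loc_weight g g + pair loc_weight v v) \<le> quad_flow (\<lambda>_. 0) (\<lambda>_. 0) (\<lambda>_. 0) (\<lambda>_. 0) loc_weight loc_weight' v g w G"
proof -
  have "W - 15 * (X + Y) \<le> W - X - a + b" if "\<bar>b\<bar> \<le> 13 * (X + Y)" "\<bar>a\<bar> \<le> X + Y" "0 \<le> Y" for W X Y a b :: real
    using that(1)[THEN abs_le_D2] that(2)[THEN abs_le_D1] that(3) by argo
  from this[OF loc_weight_pair_bounds(1,2)[OF v1] pair_nonneg(4)] show ?thesis unfolding quad_flow_def by simp
qed

text \<open>The pairing of \<open>w\<close> with x g is bounded because |x| \<le> \<open>jb\<close>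
  = rw^2, and that of \<open>w\<close> with \<open>v\<close> because \<open>rw\<close> and
  \<open>rv\<close> have product 1. So a norm bound for all time bounds both functionals for all
  time.\<close>

lemma quad_form_bounds:
  "\<bar>quad_form (\<lambda>_. 0) (\<lambda>x. - x) (\<lambda>_. - 1/2) v g w\<bar> \<le> 2 * state_norm_sq v g w" "\<bar>quad_form (\<lambda>_. 0) (\<lambda>_. 0) loc_weight v g w\<bar> \<le> state_norm_sq v g w"
proof -
  have 1: "\<bar>pair (\<lambda>x. - x) w g\<bar> \<le> 1 * (norm2 (\<lambda>x. rw x * w x) * norm2 (\<lambda>x. rw x * g x))"
    by (rule weighted_sqint_integrable(2)[OF meas(3,2) _ sw sg r_pos(1,1)]) (use jb_ge_abs in \<open>auto simp: r_prod\<close>)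
  have 2: "\<bar>pair (\<lambda>_. - 1/2) w v\<bar> \<le> 1 * (norm2 (\<lambda>x. rw x * w x) * norm2 (\<lambda>x. rv x * v x))"
    by (rule weighted_sqint_integrable(2)[OF meas(3,1) _ sw sv r_pos(1,2)]) (auto simp: r_prod)
  have 3: "\<bar>pair loc_weight w v\<bar> \<le> 1 * (norm2 (\<lambda>x. rw x * w x) * norm2 (\<lambda>x. rv x * v x))"
    by (rule weighted_sqint_integrable(2)[OF meas(3,1) _ sw sv r_pos(1,2)]) (use loc_weight_bounds(1,3) in \<open>auto simp: r_prod\<close>)
  note n = norm2_prod_le_state_norm_sq[OF norm2_le_state_norm(3)[of w v g] norm2_le_state_norm(2)] norm2_prod_le_state_norm_sq[OF norm2_le_state_norm(3)[of w v g] norm2_le_state_norm(1)]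
  have n1: "norm2 (\<lambda>x. rw x * w x) * norm2 (\<lambda>x. rw x * g x) \<le> state_norm_sq v g w" "norm2 (\<lambda>x. rw x * w x) * norm2 (\<lambda>x. rv x * v x) \<le> state_norm_sq v g w"
    by (rule n; simp)+
  show "\<bar>quad_form (\<lambda>_. 0) (\<lambda>x. - x) (\<lambda>_. - 1/2) v g w\<bar> \<le> 2 * state_norm_sq v g w" unfolding quad_form_def using 1 2 n1 by simp
  show "\<bar>quad_form (\<lambda>_. 0) (\<lambda>_. 0) loc_weight v g w\<bar> \<le> state_norm_sq v g w" unfolding quad_form_def using 3 n1 by simp
qed

text \<open>The weight is doubled because the quadratic form halves its first two terms, and the
  extra pairing is the derivative of the term in v^2. The constant is 18 = 2 (7 + 1 + 1).\<close>

lemma local_energy_growth: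
  assumes v1: "\<And>x. \<bar>v x\<bar> \<le> 1"
  shows "\<bar>quad_flow (\<lambda>x. 2 * loc_weight x) (\<lambda>x. 2 * loc_weight' x) (\<lambda>_. 0) (\<lambda>_. 0) (\<lambda>_. 0) (\<lambda>_. 0) v g w G
     + pair (\<lambda>x. real (Suc (Suc 0)) * loc_weight x * v x ^ 0) v w\<bar> \<le> 18 * local_energy v g w"
proof -
  have p2: "pair (\<lambda>x. 2 * f x) a b = 2 * pair f a b" for f a b unfolding pair_def by (simp add: mult.assoc)
  have "quad_flow (\<lambda>x. 2 * loc_weight x) (\<lambda>x. 2 * loc_weight' x) (\<lambda>_. 0) (\<lambda>_. 0) (\<lambda>_. 0) (\<lambda>_. 0) v g w G
     + pair (\<lambda>x. real (Suc (Suc 0)) * loc_weight x * v x ^ 0) v w = 2 * pair loc_weight w G - 2 * pair loc_weight' w g + 2 * pair loc_weight v w"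
    unfolding quad_flow_def p2 pair_zero using p2[of loc_weight v w] by simp
  then show ?thesis using loc_weight_pair_bounds(3-5)[OF v1] by linarith
qed

text \<open>With \<alpha> = \<open>jb\<close> the first-order part of the source, times
  \<open>jb\<close>, equals the derivative of \<open>jb\<close> times \<open>g\<close> and cancels
  the flux term; the rest of the source, times \<open>jb\<close>, is minus the derivative of the
  potential in \<open>v\<close>.\<close>

lemma energy_flux_zero:
  assumes v1: "\<And>x. \<bar>v x\<bar> \<le> B"
  shows "quad_flow jb (\<lambda>x. x / jb x) (\<lambda>_. 0) (\<lambda>_. 0) (\<lambda>_. 0) (\<lambda>_. 0) v g w G
    + pair (\<lambda>x. real (Suc (Suc 0)) * potential2 x * v x ^ 0) v w + pair (\<lambda>x. real (Suc (Suc 1)) * potential3 x * v x ^ 1) v w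
    + pair (\<lambda>x. real (Suc (Suc 2)) * potential4 x * v x ^ 2) v w = 0"
proof -
  note sGG = sG(1)[OF v1]
  have i1: "integrable lborel (\<lambda>x. jb x * w x * G x)" by (rule pair_G_integrable(1)[OF jb_measurable sGG, of 1]) (use jb_pos in \<open>simp add: less_imp_le\<close>)
  have [measurable]: "(\<lambda>x. x / jb x) \<in> borel_measurable borel" by measurable
  have i2: "integrable lborel (\<lambda>x. x / jb x * w x * g x)"
  proof (rule pair_integrable(3)[where B=1])
    fix x show "\<bar>x / jb x\<bar> \<le> 1 * jb x" using kink_abs_le[of x] jb_ge1[of x] unfolding kink_jb by linarith
  qed measurable
  have i3: "integrable lborel (\<lambda>x. real N * \<kappa> x * v x ^ k * v x * w x)"
    if c: "continuous_on UNIV \<kappa>" and b: "\<And>x. \<bar>\<kappa> x\<bar> \<le> 2 / jb x" for N \<kappa> k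
  proof (rule pair_integrable(6)[where B="real N * (2 * B ^ k)"])
    show "(\<lambda>x. real N * \<kappa> x * v x ^ k) \<in> borel_measurable borel" using borel_measurable_continuous_onI[OF c] by simp
    fix x
    have "2 / jb x \<le> 2" using inv_jb_le(2)[of x] by simp
    then have "\<bar>\<kappa> x\<bar> * \<bar>v x\<bar> ^ k \<le> 2 * B ^ k" using order_trans[OF b] v1 by (intro mult_mono power_mono) auto
    then have "real N * (\<bar>\<kappa> x\<bar> * \<bar>v x\<bar> ^ k) \<le> real N * (2 * B ^ k)" by (intro mult_left_mono) auto
    then show "\<bar>real N * \<kappa> x * v x ^ k\<bar> \<le> real N * (2 * B ^ k)" by (simp add: abs_mult power_abs mult.assoc)
  qed
  note k2 = i3[OF potential_continuous(1) potential_bounds(1), of "Suc (Suc 0)" 0] and k3 = i3[OF potential_continuous(2) potential_bounds(2), of "Suc (Suc 1)" 1]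
    and k4 = i3[OF potential_continuous(3) potential_bounds(3), of "Suc (Suc 2)" 2]
  have pt: "jb x * w x * G x - x / jb x * w x * g x + real (Suc (Suc 0)) * potential2 x * v x ^ 0 * v x * w x
     + real (Suc (Suc 1)) * potential3 x * v x ^ 1 * v x * w x + real (Suc (Suc 2)) * potential4 x * v x ^ 2 * v x * w x = 0" for x
  proof -
    define p H where "p = jb x" and "H = kink x"
    have p: "p \<noteq> 0" by (simp add: p_def)
    \<comment> \<open>Expresses the quadratic potential through H, so that it becomes -f'(H)/2
      divided by \<open>jb\<close>.\<close>
    have H2: "3 / p\<^sup>2 = 3 - 3 * H\<^sup>2" using kink_sq[of x] by (simp add: p_def H_def)
    have k: "potential2 x = (3 * H\<^sup>2 - 1) / p" "potential3 x = 2 * H / p" "potential4 x = 1/2 / p"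
      unfolding potential2_def potential3_def potential4_def p_def[symmetric] H_def[symmetric] H2 by simp_all
    have "jb x * G x = (x * g x + (2 - 6 * H\<^sup>2) * v x - 6 * H * (v x)\<^sup>2 - 2 * v x ^ 3) / p"
      unfolding G_def src_alt p_def[symmetric] H_def[symmetric] using p by (simp add: power2_eq_square)
    moreover have "jb x * w x * G x = w x * (jb x * G x)" by simp
    ultimately have e: "jb x * w x * G x = w x * ((x * g x + (2 - 6 * H\<^sup>2) * v x - 6 * H * (v x)\<^sup>2 - 2 * v x ^ 3) / p)"
      by (simp only:)
    show ?thesis unfolding e unfolding k p_def[symmetric] using p by (simp add: field_simps power2_eq_square power3_eq_cube)
  qed
  have "pair jb w G - pair (\<lambda>x. x / jb x) w g + pair (\<lambda>x. real (Suc (Suc 0)) * potential2 x * v x ^ 0) v w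
    + pair (\<lambda>x. real (Suc (Suc 1)) * potential3 x * v x ^ 1) v w + pair (\<lambda>x. real (Suc (Suc 2)) * potential4 x * v x ^ 2) v w
    = (LINT x|lborel. jb x * w x * G x - x / jb x * w x * g x + real (Suc (Suc 0)) * potential2 x * v x ^ 0 * v x * w x
     + real (Suc (Suc 1)) * potential3 x * v x ^ 1 * v x * w x + real (Suc (Suc 2)) * potential4 x * v x ^ 2 * v x * w x)"
    unfolding pair_def
    by (simp only: Bochner_Integration.integral_diff Bochner_Integration.integral_add Bochner_Integration.integrable_add
          Bochner_Integration.integrable_diff i1 i2 k2 k3 k4)
  also have "\<dots> = 0" unfolding pt by simp
  finally show ?thesis unfolding quad_flow_def by simp
qed

lemma local_integral_bound:
  assumes "R > 0"
  shows "(LINT x:{-R..R}|lborel. (w x)\<^sup>2 + (g x)\<^sup>2 + (v x)\<^sup>2) \<le> (1 + R\<^sup>2) * local_energy v g w"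
proof -
  let ?L = "\<lambda>x. loc_weight x * w x * w x + loc_weight x * g x * g x + loc_weight x * v x * v x"
  have L: "integrable lborel ?L" "(LINT x|lborel. ?L x) = local_energy v g w"
    using basic_ints(4-6) by (simp_all add: pair_def local_energy_def)
  have L': "integrable lborel (\<lambda>x. (1 + R\<^sup>2) * ?L x)" using L(1) by simp
  have le: "indicat_real {-R..R} x * ((w x)\<^sup>2 + (g x)\<^sup>2 + (v x)\<^sup>2) \<le> (1 + R\<^sup>2) * ?L x" for x
  proof -
    have eq: "?L x = loc_weight x * ((w x)\<^sup>2 + (g x)\<^sup>2 + (v x)\<^sup>2)" by (simp add: algebra_simps power2_eq_square)
    have "indicat_real {-R..R} x \<le> (1 + R\<^sup>2) * loc_weight x"
    proof (cases "x \<in> {-R..R}")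
      case True
      then have "x\<^sup>2 \<le> R\<^sup>2" by (intro power2_le_iff_abs_le[THEN iffD2]) (use assms in auto)
      then have "1 \<le> (1 + R\<^sup>2) / (1 + x\<^sup>2)" using one_plus_sq_pos(1)[of x] by simp
      then show ?thesis using True by (simp add: loc_weight_def jb_sq)
    qed (simp add: loc_weight_bounds(1))
    then have "indicat_real {-R..R} x * ((w x)\<^sup>2 + (g x)\<^sup>2 + (v x)\<^sup>2) \<le> (1 + R\<^sup>2) * loc_weight x * ((w x)\<^sup>2 + (g x)\<^sup>2 + (v x)\<^sup>2)"
      by (rule mult_right_mono) simp
    then show ?thesis unfolding eq by (simp add: mult.assoc)
  qed
  have "(LINT x:{-R..R}|lborel. (w x)\<^sup>2 + (g x)\<^sup>2 + (v x)\<^sup>2) \<le> (LINT x|lborel. (1 + R\<^sup>2) * ?L x)"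
    unfolding set_lebesgue_integral_def
  proof (rule integral_mono[OF _ L'])
    show "integrable lborel (\<lambda>x. indicat_real {-R..R} x *\<^sub>R ((w x)\<^sup>2 + (g x)\<^sup>2 + (v x)\<^sup>2))"
      by (rule Bochner_Integration.integrable_bound[OF L'])
         (use le in \<open>auto intro!: AE_I2 intro: order_trans[OF _ abs_ge_self]\<close>)
  qed (use le in simp)
  also have "\<dots> = (1 + R\<^sup>2) * local_energy v g w" using L(2) by (simp only: integral_mult_right_zero)
  finally show ?thesis .
qed

text \<open>Split at |x| = R. Inside, the local weight is at least 1/(1 + R^2); outside, the extra
  decay 1/|x| gains a factor 1/R against the weight 1 / \<open>jb\<close> of the norm.\<close>

lemma weighted_integral_bound:
  assumes R: "R \<ge> 1"
  shows "(LINT x|lborel. min 1 (1 / \<bar>x\<bar>) / sqrt (1 + x\<^sup>2) * (v x)\<^sup>2) \<le> (1 + R\<^sup>2) * local_energy v g w + state_norm_sq v g w / R"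
proof -
  let ?K = "\<lambda>x. (1 + R\<^sup>2) * (loc_weight x * v x * v x) + 1 / R * (1 / jb x * v x * v x)"
  have K: "integrable lborel ?K" by (intro Bochner_Integration.integrable_add integrable_mult_right basic_ints)
  have le: "min 1 (1 / \<bar>x\<bar>) / sqrt (1 + x\<^sup>2) * (v x)\<^sup>2 \<le> ?K x" for x
  proof -
    have j: "sqrt (1 + x\<^sup>2) = jb x" by (simp add: jb_def)
    \<comment> \<open>At \<open>x = 0\<close> division by zero makes the left weight 0 instead of 1.
      This concerns a single point, and the bound holds there as well.\<close>
    have "min 1 (1 / \<bar>x\<bar>) / jb x \<le> (1 + R\<^sup>2) * loc_weight x + 1 / R * (1 / jb x)"
    proof (cases "\<bar>x\<bar> \<le> R")
      case True
      then have "x\<^sup>2 \<le> R\<^sup>2" by (intro power2_le_iff_abs_le[THEN iffD2]) (use R in auto)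
      then have "1 \<le> (1 + R\<^sup>2) * loc_weight x" using one_plus_sq_pos(1)[of x] by (simp add: loc_weight_def jb_sq)
      moreover have "min 1 (1 / \<bar>x\<bar>) / jb x \<le> 1 / jb x" using jb_pos[of x] by (intro divide_right_mono) auto
      moreover have "1 / jb x \<le> 1" by (rule inv_jb_le)
      moreover have "0 \<le> 1 / R * (1 / jb x)" using R jb_pos[of x] by simp
      ultimately show ?thesis by linarith
    next
      case False
      then have "1 / \<bar>x\<bar> \<le> 1 / R" using R by (intro divide_left_mono) auto
      then have "min 1 (1 / \<bar>x\<bar>) \<le> 1 / R" by simp
      then have "min 1 (1 / \<bar>x\<bar>) / jb x \<le> 1 / R / jb x" using jb_pos[of x] by (intro divide_right_mono) auto
      moreover have "0 \<le> (1 + R\<^sup>2) * loc_weight x" using loc_weight_bounds(1)[of x] by simp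
      ultimately show ?thesis by simp
    qed
    then have "min 1 (1 / \<bar>x\<bar>) / jb x * (v x)\<^sup>2 \<le> ((1 + R\<^sup>2) * loc_weight x + 1 / R * (1 / jb x)) * (v x)\<^sup>2"
      by (rule mult_right_mono) simp
    then show ?thesis unfolding j by (simp add: algebra_simps power2_eq_square)
  qed
  have nn: "0 \<le> min 1 (1 / \<bar>x\<bar>) / sqrt (1 + x\<^sup>2) * (v x)\<^sup>2" for x by simp
  have "(LINT x|lborel. min 1 (1 / \<bar>x\<bar>) / sqrt (1 + x\<^sup>2) * (v x)\<^sup>2) \<le> (LINT x|lborel. ?K x)"
  proof (rule integral_mono[OF _ K le])
    show "integrable lborel (\<lambda>x. min 1 (1 / \<bar>x\<bar>) / sqrt (1 + x\<^sup>2) * (v x)\<^sup>2)"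
    proof (rule Bochner_Integration.integrable_bound[OF K])
      show "AE x in lborel. norm (min 1 (1 / \<bar>x\<bar>) / sqrt (1 + x\<^sup>2) * (v x)\<^sup>2) \<le> norm (?K x)"
        using le nn by (intro AE_I2) (smt (verit) real_norm_def)
    qed measurable
  qed
  also have "\<dots> = (1 + R\<^sup>2) * pair loc_weight v v + 1 / R * pair (\<lambda>x. 1 / jb x) v v"
    unfolding pair_def
    by (subst Bochner_Integration.integral_add) ((rule integrable_mult_right, rule basic_ints)+, simp only: integral_mult_right_zero)
  also have "\<dots> \<le> (1 + R\<^sup>2) * local_energy v g w + 1 / R * state_norm_sq v g w"
    using pair_nonneg R by (intro add_mono mult_left_mono) (auto simp: local_energy_def state_norm_sq_eq)
  finally show ?thesis by simp
qed

end

section \<open>Curves of states\<close>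

lemma norm2_diff_le:
  assumes "sqint f" "sqint h" shows "\<bar>norm2 f - norm2 h\<bar> \<le> norm2 (\<lambda>x. f x - h x)"
proof -
  have "norm2 f \<le> norm2 (\<lambda>x. f x - h x) + norm2 h" "norm2 h \<le> norm2 (\<lambda>x. h x - f x) + norm2 f"
    using norm2_triangle[OF sqint_diff[OF assms] assms(2)] norm2_triangle[OF sqint_diff[OF assms(2,1)] assms(1)] by simp_all
  then show ?thesis using norm2_minus[of h f] by linarith
qed

lemma locnorm_le:
  assumes s: "sqint (\<lambda>x. rw x * f x)" and c: "continuous_on UNIV c" "\<And>x. \<bar>c x\<bar> \<le> 1" and f: "locsq f"
  shows "locnorm L (\<lambda>x. c x * f x) \<le> norm2 (\<lambda>x. rw x * f x)"
proof -
  have "norm2 (\<lambda>x. indicator {-L..L} x * (c x * f x)) \<le> 1 * norm2 (\<lambda>x. rw x * f x)"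
  proof (rule norm2_mono[OF s sqint_measurable[OF locsq_sqint[OF locsq_bdd_mult[OF f c(1)]]] AE_I2])
    fix x :: real
    have "\<bar>c x\<bar> * \<bar>f x\<bar> \<le> rw x * \<bar>f x\<bar>" using c(2)[of x] jb_ge1[of x] by (intro mult_right_mono) (auto simp: rw_def intro: order_trans)
    then show "\<bar>indicator {-L..L} x * (c x * f x)\<bar> \<le> 1 * \<bar>rw x * f x\<bar>"
      using r_pos(1)[of x] by (auto simp: indicator_def abs_mult)
  qed simp
  then show ?thesis by (simp add: locnorm_def)
qed

lemma locnorm_sup_bound':
  assumes f: "locsq f" and "\<And>x. \<bar>f x\<bar> \<le> e"
  shows "locnorm L f \<le> e * sqrt (2 * \<bar>L\<bar>)"
proof -
  have "locnorm L f \<le> locnorm \<bar>L\<bar> f" by (rule locnorm_mono[OF f]) simp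
  also have "\<dots> \<le> e * sqrt (2 * \<bar>L\<bar>)"
    by (rule locnorm_sup_bound[OF locsq_measurable[OF f] assms(2)]) (use order_trans[OF abs_ge_zero assms(2)] in auto)
  finally show ?thesis .
qed

text \<open>The source is linear in the derivative, so this part is removed exactly. The remaining
  difference is a polynomial in the two values that is divisible by y - y', with a quotient bounded
  in terms of \<open>B\<close>.\<close>

lemma src_lipschitz:
  assumes B: "\<bar>y\<bar> \<le> B" "\<bar>y'\<bar> \<le> B"
  shows "\<bar>src x y z - src x y' z' - x / (jb x)\<^sup>2 * (z - z')\<bar> \<le> (4 + 12 * B + 6 * B\<^sup>2) * \<bar>y - y'\<bar>"
proof -
  have B0: "B \<ge> 0" using B(1) by linarith
  define q where "q = (2 - 6 * (kink x)\<^sup>2) - 6 * kink x * (y + y') - 2 * (y\<^sup>2 + y * y' + y'\<^sup>2)"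
  have k: "(kink x)\<^sup>2 \<le> 1" using kink_abs_le[of x] by (simp add: abs_square_le_1)
  have e: "src x y z - src x y' z' - x / (jb x)\<^sup>2 * (z - z') = q * (y - y') / (jb x)\<^sup>2"
    unfolding src_alt q_def diff_divide_distrib[symmetric] times_divide_eq_left
    by (simp add: field_simps power2_eq_square power3_eq_cube)
  have 1: "\<bar>2 - 6 * (kink x)\<^sup>2\<bar> \<le> 4" using k zero_le_power2[of "kink x"] by (intro abs_leI) linarith+
  have "\<bar>kink x\<bar> * \<bar>y + y'\<bar> \<le> 1 * (2 * B)" using B kink_abs_le[of x] by (intro mult_mono) auto
  then have 2: "\<bar>6 * kink x * (y + y')\<bar> \<le> 12 * B" by (simp add: abs_mult)
  have m: "\<bar>a * b\<bar> \<le> B\<^sup>2" if "\<bar>a\<bar> \<le> B" "\<bar>b\<bar> \<le> B" for a b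
    using mult_mono[OF that] B0 by (simp add: abs_mult power2_eq_square)
  have 3: "\<bar>y\<^sup>2 + y * y' + y'\<^sup>2\<bar> \<le> 3 * B\<^sup>2"
    using m[OF B(1,1)] m[OF B] m[OF B(2,2)] unfolding power2_eq_square by linarith
  have "\<bar>a - b - 2 * c\<bar> \<le> 4 + P + 2 * R" if "\<bar>a\<bar> \<le> 4" "\<bar>b\<bar> \<le> P" "\<bar>c\<bar> \<le> R" for a b c P R :: real
    using that by linarith
  from this[OF 1 2 3] have q: "\<bar>q\<bar> \<le> 4 + 12 * B + 6 * B\<^sup>2" unfolding q_def by simp
  have "\<bar>q * (y - y') / (jb x)\<^sup>2\<bar> \<le> \<bar>q * (y - y')\<bar> * 1"
    using mult_left_mono[OF inv_jb_le(4)[of x], of "\<bar>q * (y - y')\<bar>"] by (simp add: abs_mult)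
  also have "\<dots> \<le> (4 + 12 * B + 6 * B\<^sup>2) * \<bar>y - y'\<bar>" using mult_right_mono[OF q, of "\<bar>y - y'\<bar>"] by (simp add: abs_mult)
  finally show ?thesis unfolding e .
qed

lemma kink_state_diff:
  assumes "kink_state v g w" "kink_state v' g' w'"
  shows "kink_state (\<lambda>x. v x - v' x) (\<lambda>x. g x - g' x) (\<lambda>x. w x - w' x)"
proof -
  interpret a: kink_state v g w by fact
  interpret b: kink_state v' g' w' by fact
  show ?thesis
  proof
    show "primitive (\<lambda>x. v x - v' x) (\<lambda>x. g x - g' x)"
      unfolding primitive_def
    proof (intro allI impI)
      fix p q :: real assume "p \<le> q"
      then have "((\<lambda>x. g x - g' x) has_integral (v q - v p) - (v' q - v' p)) {p..q}"
        using a.prim b.prim unfolding primitive_def by (intro has_integral_diff) auto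
      then show "((\<lambda>x. g x - g' x) has_integral (v q - v' q) - (v p - v' p)) {p..q}" by (simp add: algebra_simps)
    qed
    show "sqint (\<lambda>x. rv x * (v x - v' x))" "sqint (\<lambda>x. rw x * (g x - g' x))" "sqint (\<lambda>x. rw x * (w x - w' x))"
      using sqint_diff[OF a.sv b.sv] sqint_diff[OF a.sg b.sg] sqint_diff[OF a.sw b.sw] by (simp_all add: right_diff_distrib)
  qed (use a.v0 b.v0 in \<open>simp_all add: locsq_diff a.lv a.lg a.lw b.lv b.lg b.lw\<close>)
qed

lemma continuous_of_lipschitz:
  fixes f :: "real \<Rightarrow> real"
  assumes lip: "\<And>s t. 0 \<le> s \<Longrightarrow> s \<le> t \<Longrightarrow> \<bar>f t - f s\<bar> \<le> t - s"
  shows "continuous_on {0..} f"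
  unfolding continuous_on_iff
proof (intro ballI allI impI)
  fix x d :: real assume x: "x \<in> {0..}" and d: "d > 0"
  have "\<bar>f y - f x\<bar> \<le> \<bar>y - x\<bar>" if "0 \<le> y" for y
    using lip[of x y] lip[of y x] that x by (cases "x \<le> y") auto
  then show "\<exists>\<delta>>0. \<forall>y\<in>{0..}. dist y x < \<delta> \<longrightarrow> dist (f y) (f x) < d"
    using d by (intro exI[of _ d]) (auto simp: dist_real_def intro: le_less_trans)
qed

text \<open>A form of Barbalat's lemma. The integrals over [0, t] increase to a supremum; once they
  are within h^2 of it, a value f(t) \<ge> 2 h is impossible, because the Lipschitz bound would
  force an integral of at least h^2 over [t, t + h].\<close>

lemma tendsto_zero_of_lipschitz_integral:
  fixes f :: "real \<Rightarrow> real"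
  assumes f0: "\<And>t. t \<ge> 0 \<Longrightarrow> 0 \<le> f t" and lip: "\<And>s t. 0 \<le> s \<Longrightarrow> s \<le> t \<Longrightarrow> \<bar>f t - f s\<bar> \<le> t - s"
    and C: "\<And>t. t \<ge> 0 \<Longrightarrow> integral {0..t} f \<le> C"
  shows "(f \<longlongrightarrow> 0) at_top"
proof (rule tendstoI)
  fix e :: real assume e: "e > 0"
  define h where "h = e / 2"
  have h: "h > 0" using e by (simp add: h_def)
  have cont: "continuous_on {0..} f" by (rule continuous_of_lipschitz[OF lip])
  have int: "f integrable_on {a..b}" if "0 \<le> a" for a b
    by (rule integrable_continuous_real, rule continuous_on_subset[OF cont]) (use that in auto)
  have add: "integral {0..a} f + integral {a..b} f = integral {0..b} f" if "0 \<le> a" "a \<le> b" for a b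
    by (rule Henstock_Kurzweil_Integration.integral_combine) (use that int in auto)
  have nn: "0 \<le> integral {a..b} f" if "0 \<le> a" for a b
    by (rule Henstock_Kurzweil_Integration.integral_nonneg[OF int[OF that]]) (use f0 that in auto)
  have bd: "bdd_above ((\<lambda>t. integral {0..t} f) ` {0..})" using C by (intro bdd_aboveI2) auto
  define S where "S = (SUP t\<in>{0..}. integral {0..t} f)"
  have "S - h * h < S" using h by simp
  then obtain t0 where t0: "t0 \<ge> 0" "S - h * h < integral {0..t0} f"
    unfolding S_def using less_cSUP_iff[OF _ bd] by auto
  have "\<bar>f t\<bar> < e" if t: "t \<ge> t0" for t
  proof -
    have t': "0 \<le> t" using t t0 by simp
    have "f t - h \<le> f x" if "x \<in> {t..t + h}" for x
      using lip[OF t', of x, THEN abs_le_D2] that by auto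
    then have "integral {t..t + h} (\<lambda>_. f t - h) \<le> integral {t..t + h} f"
      using t' by (intro integral_le int) auto
    then have "h * (f t - h) \<le> integral {t..t + h} f" using h by simp
    moreover have "integral {0..t + h} f \<le> S"
      unfolding S_def by (rule cSUP_upper[OF _ bd]) (use t' h in auto)
    moreover have "integral {0..t0} f \<le> integral {0..t} f" using add[OF t0(1) t] nn[OF t0(1), of t] by linarith
    ultimately have "h * (f t - h) < h * h" using t0(2) add[OF t', of "t + h"] h by linarith
    then have "f t - h < h" using h by simp
    then show ?thesis using f0[OF t'] by (simp add: h_def)
  qed
  then show "\<forall>\<^sub>F t in at_top. dist (f t) 0 < e" unfolding eventually_at_top_linorder dist_real_def by auto
qed

text \<open>An energy solution rewritten with the continuous representative \<open>V\<close> and an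
  explicit space derivative \<open>g\<close>, so that differences at two times no longer involve a
  chosen weak derivative.\<close>

locale kink_curve =
  fixes V g w :: "real \<Rightarrow> real \<Rightarrow> real"
  assumes st: "\<And>t. t \<ge> 0 \<Longrightarrow> kink_state (V t) (g t) (w t)"
    and cont: "\<And>t. t \<ge> 0 \<Longrightarrow> ((\<lambda>s. state_norm_sq (\<lambda>x. V s x - V t x) (\<lambda>x. g s x - g t x) (\<lambda>x. w s x - w t x)) \<longlongrightarrow> 0) (at t within {0..})"
    and e1: "\<And>t \<phi>. t \<ge> 0 \<Longrightarrow> test_function \<phi> \<Longrightarrow>
      ((\<lambda>s. LINT x|lborel. V s x * \<phi> x) has_real_derivative (LINT x|lborel. w t x * \<phi> x)) (at t within {0..})"
    and e2: "\<And>t \<phi>. t \<ge> 0 \<Longrightarrow> test_function \<phi> \<Longrightarrow>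
      ((\<lambda>s. LINT x|lborel. w s x * \<phi> x) has_real_derivative
        (LINT x|lborel. - g t x * deriv \<phi> x + src x (V t x) (g t x) * \<phi> x)) (at t within {0..})"
begin

abbreviation "nr t \<equiv> state_norm_sq (V t) (g t) (w t)"
abbreviation "nd s t \<equiv> state_norm_sq (\<lambda>x. V s x - V t x) (\<lambda>x. g s x - g t x) (\<lambda>x. w s x - w t x)"
abbreviation "S \<equiv> \<lambda>t. kink_state.G (V t) (g t)"

lemma diff_state: "s \<ge> 0 \<Longrightarrow> t \<ge> 0 \<Longrightarrow> kink_state (\<lambda>x. V s x - V t x) (\<lambda>x. g s x - g t x) (\<lambda>x. w s x - w t x)"
  using kink_state_diff[OF st st] by simp

lemma sqrt_cont: "t \<ge> 0 \<Longrightarrow> ((\<lambda>s. sqrt (nd s t)) \<longlongrightarrow> 0) (at t within {0..})"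
  using tendsto_real_sqrt[OF cont] by simp

lemma ev_nonneg: "\<forall>\<^sub>F s in at t within {0..}. 0 \<le> (s::real)"
  by (auto simp: eventually_at_filter)

lemma squeeze0:
  fixes f :: "real \<Rightarrow> real"
  assumes "t \<ge> 0" "\<And>s. s \<ge> 0 \<Longrightarrow> 0 \<le> f s" "\<And>s. s \<ge> 0 \<Longrightarrow> f s \<le> C * sqrt (nd s t)"
  shows "(f \<longlongrightarrow> 0) (at t within {0..})"
proof (rule tendsto_sandwich[where f="\<lambda>_. 0" and h="\<lambda>s. C * sqrt (nd s t)"])
  show "((\<lambda>s. C * sqrt (nd s t)) \<longlongrightarrow> 0) (at t within {0..})" using tendsto_mult_left[OF sqrt_cont[OF assms(1)], of C] by simp
qed (use assms eventually_mono[OF ev_nonneg] in auto)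

lemma norm2_cont:
  assumes s: "\<And>t. t \<ge> 0 \<Longrightarrow> sqint (F t)" and "\<And>s t. s \<ge> 0 \<Longrightarrow> t \<ge> 0 \<Longrightarrow> norm2 (\<lambda>x. F s x - F t x) \<le> sqrt (nd s t)"
  shows "continuous_on {0..} (\<lambda>t. norm2 (F t))"
  unfolding continuous_on_def
proof
  fix t :: real assume t: "t \<in> {0..}"
  then have t: "0 \<le> t" by simp
  have "((\<lambda>s. \<bar>norm2 (F s) - norm2 (F t)\<bar>) \<longlongrightarrow> 0) (at t within {0..})"
  proof (rule squeeze0[OF t])
    fix s :: real assume "s \<ge> 0"
    then show "\<bar>norm2 (F s) - norm2 (F t)\<bar> \<le> 1 * sqrt (nd s t)"
      using order_trans[OF norm2_diff_le[OF s s] assms(2)] t by simp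
  qed simp
  then show "((\<lambda>t. norm2 (F t)) \<longlongrightarrow> norm2 (F t)) (at t within {0..})"
    by (simp add: LIM_zero_iff tendsto_rabs_zero_iff)
qed

lemma nr_cont: "continuous_on {0..} nr"
proof -
  have "continuous_on {0..} (\<lambda>t. norm2 (\<lambda>x. rv x * V t x))"
    by (rule norm2_cont[OF kink_state.sv[OF st]]) (use norm2_le_state_norm(1) in \<open>auto simp: right_diff_distrib[symmetric]\<close>)
  moreover have "continuous_on {0..} (\<lambda>t. norm2 (\<lambda>x. rw x * g t x))"
    by (rule norm2_cont[OF kink_state.sg[OF st]]) (use norm2_le_state_norm(2) in \<open>auto simp: right_diff_distrib[symmetric]\<close>)
  moreover have "continuous_on {0..} (\<lambda>t. norm2 (\<lambda>x. rw x * w t x))"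
    by (rule norm2_cont[OF kink_state.sw[OF st]]) (use norm2_le_state_norm(3) in \<open>auto simp: right_diff_distrib[symmetric]\<close>)
  ultimately show ?thesis unfolding state_norm_sq_def by (intro continuous_intros)
qed

lemma nr_bounded: "\<exists>M\<ge>0. \<forall>t\<in>{0..T}. nr t \<le> M"
proof -
  have "continuous_on {0..T} nr" by (rule continuous_on_subset[OF nr_cont]) auto
  then have "bounded (nr ` {0..T})" by (intro compact_imp_bounded compact_continuous_image) auto
  then obtain M where "\<forall>t\<in>{0..T}. \<bar>nr t\<bar> \<le> M" by (auto simp: bounded_iff)
  then show ?thesis by (intro exI[of _ "max M 0"]) (auto simp: abs_le_iff intro: max.coboundedI1)
qed

lemma V_sup: "t \<ge> 0 \<Longrightarrow> nr t \<le> M \<Longrightarrow> \<bar>V t x\<bar> \<le> sqrt M"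
  using kink_state.sup_bound'[OF st, of t x] by (meson order_trans real_sqrt_le_mono)

text \<open>The difference of two sources is a bounded multiple of the difference of derivatives,
  small in L^2, plus a remainder that \<open>src_lipschitz\<close> and the supremum bound make
  uniformly small.\<close>

lemma src_cont:
  assumes t: "t \<ge> 0" shows "((\<lambda>s. locnorm L (\<lambda>x. S s x - S t x)) \<longlongrightarrow> 0) (at t within {0..})"
proof -
  define B where "B = sqrt (nr t) + 1"
  define K where "K = 4 + 12 * B + 6 * B\<^sup>2"
  have B0: "B \<ge> 0" "K \<ge> 0" using state_norm_sq_nonneg by (simp_all add: B_def K_def)
  \<comment> \<open>Distance less than 1 keeps \<open>V s\<close> below the bound \<open>B\<close>
    chosen at time \<open>t\<close>, so that one Lipschitz constant \<open>K\<close> serves all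
    nearby times.\<close>
  have ev: "\<forall>\<^sub>F s in at t within {0..}. 0 \<le> s \<and> sqrt (nd s t) < 1"
    by (rule eventually_conj[OF ev_nonneg order_tendstoD(2)[OF sqrt_cont[OF t]]]) simp
  have le: "locnorm L (\<lambda>x. S s x - S t x) \<le> (1 + K * sqrt (2 * \<bar>L\<bar>)) * sqrt (nd s t)" if s: "0 \<le> s" "sqrt (nd s t) < 1" for s
  proof -
    interpret d: kink_state "\<lambda>x. V s x - V t x" "\<lambda>x. g s x - g t x" "\<lambda>x. w s x - w t x" by (rule diff_state[OF s(1) t])
    interpret a: kink_state "V s" "g s" "w s" by (rule st[OF s(1)])
    interpret b: kink_state "V t" "g t" "w t" by (rule st[OF t])
    let ?c = "\<lambda>x::real. x / (jb x)\<^sup>2"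
    let ?r = "\<lambda>x. (S s x - S t x) - ?c x * (g s x - g t x)"
    have c: "continuous_on UNIV ?c" "\<bar>?c x\<bar> \<le> 1" for x
    proof -
      show "continuous_on UNIV ?c" by (intro continuous_intros ballI; simp)
      have "\<bar>kink x\<bar> * (1 / jb x) \<le> 1 * 1" using kink_abs_le[of x] inv_jb_le(1,2)[of x] by (intro mult_mono) auto
      then show "\<bar>?c x\<bar> \<le> 1" using jb_pos[of x] by (simp add: kink_jb power2_eq_square abs_mult)
    qed
    have l1: "locsq (\<lambda>x. ?c x * (g s x - g t x))" by (rule locsq_bdd_mult[OF d.lg c(1)])
    have lr: "locsq ?r" by (intro locsq_diff a.lG b.lG l1)
    have r: "\<bar>?r x\<bar> \<le> K * sqrt (nd s t)" for x
    proof -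
      have "\<bar>V t x\<bar> \<le> B" using b.sup_bound'[of x] by (simp add: B_def)
      moreover have "\<bar>V s x\<bar> \<le> B" using b.sup_bound'[of x] d.sup_bound'[of x] s(2) unfolding B_def by linarith
      ultimately have "\<bar>?r x\<bar> \<le> K * \<bar>V s x - V t x\<bar>" unfolding a.G_def b.G_def K_def by (intro src_lipschitz)
      also have "\<dots> \<le> K * sqrt (nd s t)" by (intro mult_left_mono d.sup_bound' B0)
      finally show ?thesis .
    qed
    have "locnorm L (\<lambda>x. S s x - S t x) = locnorm L (\<lambda>x. ?c x * (g s x - g t x) + ?r x)" by simp
    also have "\<dots> \<le> locnorm L (\<lambda>x. ?c x * (g s x - g t x)) + locnorm L ?r" by (rule locnorm_triangle[OF l1 lr])
    also have "\<dots> \<le> sqrt (nd s t) + K * sqrt (nd s t) * sqrt (2 * \<bar>L\<bar>)"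
      by (intro add_mono locnorm_sup_bound'[OF lr r] order_trans[OF locnorm_le[OF d.sg c d.lg] norm2_le_state_norm(2)])
    finally show ?thesis by (simp add: algebra_simps)
  qed
  show ?thesis
  proof (rule tendsto_sandwich[where f="\<lambda>_. 0" and h="\<lambda>s. (1 + K * sqrt (2 * \<bar>L\<bar>)) * sqrt (nd s t)"])
    show "((\<lambda>s. (1 + K * sqrt (2 * \<bar>L\<bar>)) * sqrt (nd s t)) \<longlongrightarrow> 0) (at t within {0..})"
      using tendsto_mult_left[OF sqrt_cont[OF t], of "1 + K * sqrt (2 * \<bar>L\<bar>)"] by simp
  qed (use eventually_mono[OF ev] le in auto)
qed

text \<open>Continuity of \<open>nr\<close> bounds the norm on every [0, T]; the supremum bound
  turns this into bounds for \<open>V\<close> and then for the source.\<close>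

sublocale energy_wave V g w S
proof
  fix T L :: real
  obtain M where M: "M \<ge> 0" "\<And>t. t \<in> {0..T} \<Longrightarrow> nr t \<le> M" using nr_bounded[of T] by blast
  note n = norm2_le_state_norm[THEN order_trans, OF real_sqrt_le_mono[OF M(2)]]
  have VM: "\<bar>V t x\<bar> \<le> sqrt M" if "t \<in> {0..T}" for t x using V_sup[OF _ M(2)[OF that]] that by simp
  show "\<exists>B. \<forall>t\<in>{0..T}. \<forall>x\<in>{-L..L}. \<bar>V t x\<bar> \<le> B" using VM by blast
  show "\<exists>M. \<forall>t\<in>{0..T}. \<forall>x. \<bar>V t x\<bar> \<le> M" using VM by blast
  show nb: "\<exists>M. \<forall>t\<in>{0..T}. norm2 (\<lambda>x. rw x * w t x) \<le> M" "\<exists>M. \<forall>t\<in>{0..T}. norm2 (\<lambda>x. rw x * g t x) \<le> M"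
    "\<exists>M. \<forall>t\<in>{0..T}. norm2 (\<lambda>x. rv x * V t x) \<le> M" using n by blast+
  show "\<exists>M. \<forall>t\<in>{0..T}. norm2 (\<lambda>x. rG x * S t x) \<le> M"
  proof (intro exI ballI)
    fix t assume t: "t \<in> {0..T}"
    then interpret kink_state "V t" "g t" "w t" by (intro st) simp
    have "norm2 (\<lambda>x. rG x * S t x) \<le> norm2 (\<lambda>x. rw x * g t x) + (4 + 6 * sqrt M + 2 * (sqrt M)\<^sup>2) * norm2 (\<lambda>x. rv x * V t x)"
      by (rule sG(2)[OF VM[OF t]])
    also have "\<dots> \<le> sqrt M + (4 + 6 * sqrt M + 2 * (sqrt M)\<^sup>2) * sqrt M"
      using M(1) by (intro add_mono mult_left_mono n[OF t]) auto
    finally show "norm2 (\<lambda>x. rG x * S t x) \<le> sqrt M + (4 + 6 * sqrt M + 2 * (sqrt M)\<^sup>2) * sqrt M" .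
  qed
next
  fix t L :: real assume t: "t \<ge> 0"
  have one: "continuous_on UNIV (\<lambda>_::real. 1::real)" "\<And>x::real. \<bar>1::real\<bar> \<le> 1" by auto
  show "((\<lambda>s. locnorm L (\<lambda>x. V s x - V t x)) \<longlongrightarrow> 0) (at t within {0..})"
  proof (rule squeeze0[OF t])
    fix s :: real assume s: "s \<ge> 0"
    interpret d: kink_state "\<lambda>x. V s x - V t x" "\<lambda>x. g s x - g t x" "\<lambda>x. w s x - w t x" by (rule diff_state[OF s t])
    show "locnorm L (\<lambda>x. V s x - V t x) \<le> sqrt (2 * \<bar>L\<bar>) * sqrt (nd s t)"
      using locnorm_sup_bound'[OF d.lv d.sup_bound'] by (simp add: mult.commute)
  qed simp
  show "((\<lambda>s. locnorm L (\<lambda>x. g s x - g t x)) \<longlongrightarrow> 0) (at t within {0..})"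
  proof (rule squeeze0[OF t])
    fix s :: real assume s: "s \<ge> 0"
    interpret d: kink_state "\<lambda>x. V s x - V t x" "\<lambda>x. g s x - g t x" "\<lambda>x. w s x - w t x" by (rule diff_state[OF s t])
    show "locnorm L (\<lambda>x. g s x - g t x) \<le> 1 * sqrt (nd s t)"
      using order_trans[OF locnorm_le[OF d.sg one d.lg] norm2_le_state_norm(2)] by simp
  qed simp
  show "((\<lambda>s. locnorm L (\<lambda>x. w s x - w t x)) \<longlongrightarrow> 0) (at t within {0..})"
  proof (rule squeeze0[OF t])
    fix s :: real assume s: "s \<ge> 0"
    interpret d: kink_state "\<lambda>x. V s x - V t x" "\<lambda>x. g s x - g t x" "\<lambda>x. w s x - w t x" by (rule diff_state[OF s t])
    show "locnorm L (\<lambda>x. w s x - w t x) \<le> 1 * sqrt (nd s t)"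
      using order_trans[OF locnorm_le[OF d.sw one d.lw] norm2_le_state_norm(3)] by simp
  qed simp
  show "((\<lambda>s. locnorm L (\<lambda>x. S s x - S t x)) \<longlongrightarrow> 0) (at t within {0..})" by (rule src_cont[OF t])
next
  fix t :: real assume t: "t \<ge> 0"
  interpret kink_state "V t" "g t" "w t" by (rule st[OF t])
  show "locsq (V t)" "locsq (g t)" "locsq (w t)" "locsq (S t)" "primitive (V t) (g t)" by (rule lv lg lw lG prim)+
  show "sqint (\<lambda>x. rw x * w t x)" "sqint (\<lambda>x. rw x * g t x)" "sqint (\<lambda>x. rv x * V t x)" by (rule sw sg sv)+
  show "sqint (\<lambda>x. rG x * S t x)" by (rule sG(1)[OF sup_bound'])
  fix \<phi> assume p: "test_function \<phi>"
  show "((\<lambda>s. LINT x|lborel. V s x * \<phi> x) has_real_derivative (LINT x|lborel. w t x * \<phi> x)) (at t within {0..})"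
    by (rule e1[OF t p])
  show "((\<lambda>s. LINT x|lborel. w s x * \<phi> x) has_real_derivative
        (LINT x|lborel. - g t x * deriv \<phi> x + S t x * \<phi> x)) (at t within {0..})"
    using e2[OF t p] unfolding G_def .
qed

section \<open>Conservation of energy, stability and decay\<close>

lemma energy_conservation:
  assumes "b \<ge> 0"
  shows "energy (V b) (g b) (w b) = energy (V 0) (g 0) (w 0)"
proof -
  let ?I = "\<lambda>t. quad_flow jb (\<lambda>x. x / jb x) (\<lambda>_. 0) (\<lambda>_. 0) (\<lambda>_. 0) (\<lambda>_. 0) (V t) (g t) (w t) (S t)
    + pair (\<lambda>x. real (Suc (Suc 0)) * potential2 x * V t x ^ 0) (V t) (w t) + pair (\<lambda>x. real (Suc (Suc 1)) * potential3 x * V t x ^ 1) (V t) (w t)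
    + pair (\<lambda>x. real (Suc (Suc 2)) * potential4 x * V t x ^ 2) (V t) (w t)"
  let ?QE = "\<lambda>t. quad_form jb (\<lambda>_. 0) (\<lambda>_. 0) (V t) (g t) (w t)"
  have 1: "((\<lambda>t. quad_flow jb (\<lambda>x. x / jb x) (\<lambda>_. 0) (\<lambda>_. 0) (\<lambda>_. 0) (\<lambda>_. 0) (V t) (g t) (w t) (S t)) has_integral ?QE b - ?QE 0) {0..b}"
  proof (rule global_identity[where C=1])
    show "(jb has_real_derivative x / jb x) (at x)" for x by (rule jb_deriv)
    show "continuous_on UNIV (\<lambda>x. x / jb x)" by (intro continuous_intros ballI; simp)
    show "\<bar>jb x\<bar> \<le> 1 * jb x" for x using jb_pos[of x] by simp
    show "\<bar>x / jb x\<bar> \<le> 1" for x using kink_abs_le[of x] by (simp add: kink_jb)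
  qed (use assms jb_pos in \<open>auto simp: less_imp_le\<close>)
  note p = global_power_identity[OF potential_continuous(1) potential_bounds(1) order_refl assms, of 0]
    global_power_identity[OF potential_continuous(2) potential_bounds(2) order_refl assms, of 1]
    global_power_identity[OF potential_continuous(3) potential_bounds(3) order_refl assms, of 2]
  note I = has_integral_add[OF has_integral_add[OF has_integral_add[OF 1 p(1)] p(2)] p(3)]
  have z: "?I t = 0" if "t \<in> {0..b}" for t
  proof -
    interpret kink_state "V t" "g t" "w t" using that by (intro st) simp
    show ?thesis by (rule energy_flux_zero[OF sup_bound'])
  qed
  have "(?I has_integral 0) {0..b}" by (rule has_integral_eq[rotated, OF has_integral_0]) (use z in simp)
  from has_integral_unique[OF I this] show ?thesis by (simp add: energy_def quad_form_def)
qed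

text \<open>If the norm reached \<open>d\<close>, it would equal \<open>d\<close> at some time by
  continuity. At that time the solution is small enough for coercivity, so d/200 would be at most
  the conserved energy, hence at most 6 times the initial norm.\<close>

lemma small_for_all_time:
  assumes init: "6 * nr 0 < d / 200" and d: "d \<le> (1/200)\<^sup>2" and t: "t \<ge> 0"
  shows "nr t < d"
proof (rule ccontr)
  assume "\<not> nr t < d"
  moreover have "nr 0 \<le> d" using init state_norm_sq_nonneg[of "V 0" "g 0" "w 0"] by linarith
  moreover have "continuous_on {0..t} nr" by (rule continuous_on_subset[OF nr_cont]) auto
  ultimately obtain s where s: "0 \<le> s" "nr s = d" using IVT'[of nr 0 d t] t by auto
  have d0: "0 \<le> d" using s(2) state_norm_sq_nonneg[of "V s" "g s" "w s"] by simp
  have sq: "sqrt d \<le> 1/200" using d by (intro real_le_lsqrt) auto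
  have V: "\<bar>V s x\<bar> \<le> 1/200" for x using V_sup[OF s(1), of d x] s(2) sq by simp
  have "6 * nr 0 < 1 * d" using init d0 by simp
  then have "sqrt (nr 0) \<le> 1" using d by (simp add: power2_eq_square)
  then have V0: "\<bar>V 0 x\<bar> \<le> 1" for x using V_sup[of 0 "nr 0" x] by linarith
  have "d / 200 \<le> energy (V s) (g s) (w s)" using kink_state.energy_coercive[OF st[OF s(1)] V] s(2) by simp
  also have "\<dots> = energy (V 0) (g 0) (w 0)" by (rule energy_conservation[OF s(1)])
  also have "\<dots> \<le> 6 * nr 0" by (rule kink_state.energy_upper[OF st V0]) simp
  finally show False using init by simp
qed

text \<open>The threshold makes |V| at most 1/400, as the virial inequality demands. It also
  normalises the growth bound and the time integral of the local energy so that both are at most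
  1.\<close>

lemma local_energy_tendsto_zero:
  assumes small: "\<And>t. t \<ge> 0 \<Longrightarrow> nr t \<le> (1/400)\<^sup>2"
  shows "((\<lambda>t. local_energy (V t) (g t) (w t)) \<longlongrightarrow> 0) at_top"
proof (rule tendsto_zero_of_lipschitz_integral)
  let ?l = "\<lambda>t. local_energy (V t) (g t) (w t)"
  have V400: "\<bar>V t x\<bar> \<le> 1/400" if "t \<ge> 0" for t x using V_sup[OF that small[OF that], of x] by simp
  have V1: "\<bar>V t x\<bar> \<le> 1" if "t \<ge> 0" for t x using V400[OF that, of x] by simp
  \<comment> \<open>With the factor 18 of \<open>local_energy_growth\<close> this makes the
    Lipschitz constant in time equal to 1.\<close>
  have ll: "18 * ?l t \<le> 1" if "t \<ge> 0" for t
    using kink_state.local_energy_le_state_norm_sq[OF st[OF that]] small[OF that] by (simp add: power2_eq_square)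
  show "0 \<le> ?l t" if "t \<ge> 0" for t by (rule kink_state.local_energy_nonneg[OF st[OF that]])
  have gwC: "\<bar>loc_weight x\<bar> \<le> 2 * jb x" "\<bar>loc_weight x\<bar> \<le> 2" "\<bar>loc_weight' x\<bar> \<le> 2" "\<bar>2 * loc_weight x\<bar> \<le> 4 * jb x" "\<bar>2 * loc_weight' x\<bar> \<le> 4" "\<bar>loc_weight x\<bar> \<le> 1 / jb x" for x
    using loc_weight_bounds[of x] jb_ge1[of x] by auto
  have jbC: "0 \<le> jb x" for x using jb_pos[of x] by simp
  show lip: "\<bar>?l t - ?l s\<bar> \<le> t - s" if st': "0 \<le> s" "s \<le> t" for s t
  proof -
    have 1: "((\<lambda>t. quad_flow (\<lambda>x. 2 * loc_weight x) (\<lambda>x. 2 * loc_weight' x) (\<lambda>_. 0) (\<lambda>_. 0) (\<lambda>_. 0) (\<lambda>_. 0) (V t) (g t) (w t) (S t)) has_integral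
      quad_form (\<lambda>x. 2 * loc_weight x) (\<lambda>_. 0) (\<lambda>_. 0) (V t) (g t) (w t) - quad_form (\<lambda>x. 2 * loc_weight x) (\<lambda>_. 0) (\<lambda>_. 0) (V s) (g s) (w s)) {s..t}"
      by (rule global_identity[where C=4, OF _ _ gwC(4,5) _ _ _ _ _ _ _ _ st'])
         (auto intro!: derivative_eq_intros loc_weight_deriv continuous_intros loc_weight_continuous simp: jbC)
    have 2: "((\<lambda>t. pair (\<lambda>x. real (Suc (Suc 0)) * loc_weight x * V t x ^ 0) (V t) (w t)) has_integral
      pair (\<lambda>x. loc_weight x * V t x ^ 0) (V t) (V t) - pair (\<lambda>x. loc_weight x * V s x ^ 0) (V s) (V s)) {s..t}"
      by (rule global_power_identity[OF loc_weight_continuous(1) gwC(6) st'])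
    have p2: "pair (\<lambda>x. 2 * f x) a b = 2 * pair f a b" for f a b unfolding pair_def by (simp add: mult.assoc)
    have q: "quad_form (\<lambda>x. 2 * loc_weight x) (\<lambda>_. 0) (\<lambda>_. 0) v g' w' + pair (\<lambda>x. loc_weight x * v x ^ 0) v v = local_energy v g' w'" for v g' w'
      by (simp add: quad_form_def local_energy_def p2)
    let ?D = "\<lambda>t. quad_flow (\<lambda>x. 2 * loc_weight x) (\<lambda>x. 2 * loc_weight' x) (\<lambda>_. 0) (\<lambda>_. 0) (\<lambda>_. 0) (\<lambda>_. 0) (V t) (g t) (w t) (S t)
       + pair (\<lambda>x. real (Suc (Suc 0)) * loc_weight x * V t x ^ 0) (V t) (w t)"
    have 3: "(?D has_integral ?l t - ?l s) {s..t}" 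
      using has_integral_add[OF 1 2] unfolding q[symmetric] by (simp add: algebra_simps)
    have D1: "\<bar>?D r\<bar> \<le> 1" if "r \<in> {s..t}" for r
      using order_trans[OF kink_state.local_energy_growth[OF st V1] ll] that st' by simp
    have "norm (?l t - ?l s) \<le> 1 * measure lborel {s..t}"
      by (rule has_integral_bound_real[OF _ _ 3, of 1 "{}"]) (use D1 in auto)
    then show ?thesis using st' by simp
  qed
  show "integral {0..T} ?l \<le> 1" if T: "T \<ge> 0" for T
  proof -
    let ?D1 = "\<lambda>t. quad_flow (\<lambda>_. 0) (\<lambda>_. 0) (\<lambda>x. - x) (\<lambda>_. - 1) (\<lambda>_. - 1/2) (\<lambda>_. 0) (V t) (g t) (w t) (S t)"
    let ?D2 = "\<lambda>t. quad_flow (\<lambda>_. 0) (\<lambda>_. 0) (\<lambda>_. 0) (\<lambda>_. 0) loc_weight loc_weight' (V t) (g t) (w t) (S t)"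
    let ?Q1 = "\<lambda>t. quad_form (\<lambda>_. 0) (\<lambda>x. - x) (\<lambda>_. - 1/2) (V t) (g t) (w t)"
    let ?Q2 = "\<lambda>t. quad_form (\<lambda>_. 0) (\<lambda>_. 0) loc_weight (V t) (g t) (w t)"
    have 1: "(?D1 has_integral ?Q1 T - ?Q1 0) {0..T}"
      by (rule global_identity[where C=1, OF _ _ _ _ _ _ _ _ _ _ _ _ order_refl T])
         (use jb_ge_abs jbC in \<open>auto intro!: derivative_eq_intros\<close>)
    have 2: "(?D2 has_integral ?Q2 T - ?Q2 0) {0..T}"
      by (rule global_identity[where C=2, OF _ _ _ _ _ _ _ _ loc_weight_deriv loc_weight_continuous(2) gwC(2,3) order_refl T]) (simp_all add: jbC)
    \<comment> \<open>The factor 1/8000 balances the two functionals: the virial gain 1/500 =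
      16/8000 exceeds the loss 15/8000 of the second one by 1/8000, which is also its gain for w^2.
      Hence 8000 times the sum dominates the full local energy.\<close>
    have 3: "((\<lambda>t. ?D1 t + 1/8000 * ?D2 t) has_integral (?Q1 T - ?Q1 0) + 1/8000 * (?Q2 T - ?Q2 0)) {0..T}"
      by (rule has_integral_add[OF 1 has_integral_mult_right[OF 2]])
    have D: "?l t \<le> 8000 * (?D1 t + 1/8000 * ?D2 t)" if "t \<in> {0..T}" for t
    proof -
      have t: "t \<ge> 0" using that by simp
      interpret kink_state "V t" "g t" "w t" by (rule st[OF t])
      show ?thesis using virial_lower[OF V400[OF t]] second_virial_lower[OF V1[OF t]] pair_nonneg(4,5) unfolding local_energy_def by argo
    qed
    have Q: "\<bar>?Q1 t\<bar> \<le> 2 * (1/400)\<^sup>2" "\<bar>?Q2 t\<bar> \<le> (1/400)\<^sup>2" if "t \<ge> 0" for t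
      using kink_state.quad_form_bounds[OF st[OF that]] small[OF that] by linarith+
    have "continuous_on {0..T} ?l" by (rule continuous_on_subset[OF continuous_of_lipschitz[OF lip]]) auto
    then have "(?l has_integral integral {0..T} ?l) {0..T}" by (intro integrable_integral integrable_continuous_real)
    from has_integral_le[OF this has_integral_mult_right[OF 3, of 8000] D]
    have "integral {0..T} ?l \<le> 8000 * ((?Q1 T - ?Q1 0) + 1/8000 * (?Q2 T - ?Q2 0))" .
    moreover have "8000 * ((a - b) + 1/8000 * (c - d)) \<le> 1"
      if "\<bar>a\<bar> \<le> 2 * (1/400)\<^sup>2" "\<bar>b\<bar> \<le> 2 * (1/400)\<^sup>2" "\<bar>c\<bar> \<le> (1/400)\<^sup>2" "\<bar>d\<bar> \<le> (1/400)\<^sup>2" for a b c d :: real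
    proof -
      have "8000 * ((a - b) + 1/8000 * (c - d)) = 8000 * (a - b) + (c - d)" by simp
      also have "\<dots> \<le> 1" using that[THEN abs_le_D1] that[THEN abs_le_D2] unfolding power2_eq_square by argo
      finally show ?thesis .
    qed
    note this[OF Q(1)[OF T] Q(1)[OF order_refl] Q(2)[OF T] Q(2)[OF order_refl]]
    ultimately show ?thesis by linarith
  qed
qed

end

section \<open>Energy solutions\<close>

lemma locally_integrable_mult_test:
  assumes f: "locally_integrable f" and k: "continuous_on UNIV k" "\<And>x. \<bar>x\<bar> > L \<Longrightarrow> k x = 0"
  shows "integrable lborel (\<lambda>x. f x * k x)"
proof -
  have [measurable]: "f \<in> borel_measurable borel" "k \<in> borel_measurable borel"
    using locally_integrable_measurable[OF f] borel_measurable_continuous_onI[OF k(1)] .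
  have "compact (k ` {-L..L})" by (intro compact_continuous_image continuous_on_subset[OF k(1)]) auto
  then obtain B where B: "\<And>x. x \<in> {-L..L} \<Longrightarrow> \<bar>k x\<bar> \<le> B" using compact_imp_bounded by (fastforce simp: bounded_iff)
  have i: "integrable lborel (\<lambda>x. B * (indicat_real {-L..L} x * f x))"
    using f unfolding locally_integrable_def set_integrable_def by simp
  show ?thesis
  proof (rule Bochner_Integration.integrable_bound[OF i _ AE_I2])
    fix x
    show "norm (f x * k x) \<le> norm (B * (indicat_real {-L..L} x * f x))"
    proof (cases "\<bar>x\<bar> \<le> L")
      case True
      then have x: "x \<in> {-L..L}" by auto
      from mult_right_mono[OF B[OF x], of "\<bar>f x\<bar>"] show ?thesis
        using order_trans[OF abs_ge_zero B[OF x]] x by (simp add: abs_mult mult.commute)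
    qed (simp add: k(2))
  qed measurable
qed

lemma locally_integrable_diff:
  "locally_integrable f \<Longrightarrow> locally_integrable h \<Longrightarrow> locally_integrable (\<lambda>x. f x - h x)"
  by (auto simp: locally_integrable_def)

lemma has_weak_derivative_diff:
  assumes "has_weak_derivative u g" "has_weak_derivative u' g'"
  shows "has_weak_derivative (\<lambda>x. u x - u' x) (\<lambda>x. g x - g' x)"
  unfolding has_weak_derivative_def
proof (intro conjI allI impI)
  have l: "locally_integrable u" "locally_integrable g" "locally_integrable u'" "locally_integrable g'"
    using assms by (simp_all add: has_weak_derivative_def)
  then show "locally_integrable (\<lambda>x. u x - u' x)" "locally_integrable (\<lambda>x. g x - g' x)"
    by (simp_all add: locally_integrable_diff)
  fix \<phi> assume p: "test_function \<phi>"
  from test_function_deriv[OF p] obtain L where L: "continuous_on UNIV (deriv \<phi>)" "continuous_on UNIV \<phi>"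
    "\<And>x. \<bar>x\<bar> > L \<Longrightarrow> \<phi> x = 0" "\<And>x. \<bar>x\<bar> > L \<Longrightarrow> deriv \<phi> x = 0" by metis
  have "(LINT r|lborel. (u r - u' r) * deriv \<phi> r) = (LINT r|lborel. u r * deriv \<phi> r) - (LINT r|lborel. u' r * deriv \<phi> r)"
    unfolding left_diff_distrib
    by (rule Bochner_Integration.integral_diff) (rule locally_integrable_mult_test[OF _ L(1,4)], use l in simp_all)+
  also have "\<dots> = - (LINT r|lborel. g r * \<phi> r) - - (LINT r|lborel. g' r * \<phi> r)"
    using assms p by (simp add: has_weak_derivative_def)
  also have "(LINT r|lborel. (g r - g' r) * \<phi> r) = (LINT r|lborel. g r * \<phi> r) - (LINT r|lborel. g' r * \<phi> r)"
    unfolding left_diff_distrib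
    by (rule Bochner_Integration.integral_diff) (rule locally_integrable_mult_test[OF _ L(2,3)], use l in simp_all)+
  then have "- (LINT r|lborel. g r * \<phi> r) - - (LINT r|lborel. g' r * \<phi> r) = - (LINT r|lborel. (g r - g' r) * \<phi> r)" by simp
  finally show "(LINT r|lborel. (u r - u' r) * deriv \<phi> r) = - (LINT r|lborel. (g r - g' r) * \<phi> r)" .
qed

text \<open>The difference is a weak derivative of 0, so it integrates to 0 against every test
  function.\<close>

lemma has_weak_derivative_unique:
  assumes "has_weak_derivative u g" "has_weak_derivative u g'"
  shows "AE x in lborel. g x = g' x"
proof -
  have d: "has_weak_derivative (\<lambda>x. u x - u x) (\<lambda>x. g x - g' x)" by (rule has_weak_derivative_diff[OF assms])
  have "AE x in lborel. g x - g' x = 0"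
  proof (rule AE_zero_of_test_functions)
    show "(LINT x|lborel. (g x - g' x) * \<phi> x) = 0" if "test_function \<phi>" for \<phi>
      using d that by (simp add: has_weak_derivative_def)
  qed (use d in \<open>simp add: has_weak_derivative_def\<close>)
  then show ?thesis by simp
qed

lemma has_weak_derivative_weak_deriv: "has_weak_derivative u g \<Longrightarrow> has_weak_derivative u (weak_deriv u)"
  unfolding weak_deriv_def by (rule someI[of "has_weak_derivative u"])

lemma has_weak_derivative_measurable:
  assumes "has_weak_derivative u g" shows "u \<in> borel_measurable borel" "g \<in> borel_measurable borel"
  using assms by (auto simp: has_weak_derivative_def intro: locally_integrable_measurable)

lemma energy_density_eq:
  "energy_density u w x = (rw x * w x)\<^sup>2 + (rw x * weak_deriv u x)\<^sup>2 + (rv x * u x)\<^sup>2"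
proof -
  have j: "sqrt (1 + x\<^sup>2) = jb x" "1 + x\<^sup>2 = (jb x)\<^sup>2" by (simp_all add: jb_def)
  have r: "(rw x)\<^sup>2 = jb x" "(rv x)\<^sup>2 = 1 / jb x" using r_prod(1,6)[of x] by (simp_all add: power2_eq_square)
  show ?thesis unfolding energy_density_def j power_mult_distrib r using jb_pos[of x] by (simp add: field_simps power2_eq_square)
qed

text \<open>\<open>weak_deriv\<close> is a choice made for each function separately; in particular
  its value at a difference is not literally the difference of its values. Almost everywhere
  uniqueness allows any weak derivative in the norm.\<close>

lemma energy_norm_sq_eq:
  assumes wd: "has_weak_derivative u g" and s: "sqint (\<lambda>x. rv x * u x)" "sqint (\<lambda>x. rw x * g x)" "sqint (\<lambda>x. rw x * w x)"
    and w: "w \<in> borel_measurable borel"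
  shows "energy_norm_sq u w = state_norm_sq u g w"
proof -
  note [measurable] = has_weak_derivative_measurable[OF wd] has_weak_derivative_measurable[OF has_weak_derivative_weak_deriv[OF wd]] w
    borel_measurable_continuous_onI[OF r_continuous(1)] borel_measurable_continuous_onI[OF r_continuous(2)]
  have "energy_norm_sq u w = (LINT x|lborel. (rw x * w x)\<^sup>2 + (rw x * g x)\<^sup>2 + (rv x * u x)\<^sup>2)"
    unfolding energy_norm_sq_def energy_density_eq
    by (rule integral_cong_AE)
       (use has_weak_derivative_unique[OF has_weak_derivative_weak_deriv[OF wd] wd] in \<open>auto intro: AE_mp\<close>)
  also have "\<dots> = state_norm_sq u g w" using s[THEN sqint_integrable] by (simp add: state_norm_sq_def norm2_sq)
  finally show ?thesis .
qed

text \<open>The energy density is a sum of three weighted squares, each dominated by the integrable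
  sum. The continuous positive weights are then divided out locally.\<close>

lemma energy_space_sqint:
  assumes "(u, w) \<in> energy_space"
  shows "has_weak_derivative u (weak_deriv u)" "sqint (\<lambda>x. rv x * u x)" "sqint (\<lambda>x. rw x * weak_deriv u x)"
    "sqint (\<lambda>x. rw x * w x)" "locsq u" "locsq (weak_deriv u)" "locsq w"
proof -
  show wd: "has_weak_derivative u (weak_deriv u)"
    using assms has_weak_derivative_weak_deriv unfolding energy_space_def by blast
  have w: "w \<in> borel_measurable borel" and i: "integrable lborel (energy_density u w)"
    using assms by (auto simp: energy_space_def)
  note [measurable] = has_weak_derivative_measurable[OF wd] w
    borel_measurable_continuous_onI[OF r_continuous(1)] borel_measurable_continuous_onI[OF r_continuous(2)]
  have le: "sqint h" if [measurable]: "h \<in> borel_measurable borel" and h: "\<And>x. (h x)\<^sup>2 \<le> energy_density u w x" for h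
    unfolding sqint_def
  proof
    show "integrable lborel (\<lambda>x. (h x)\<^sup>2)"
      by (rule Bochner_Integration.integrable_bound[OF i]) (use h in \<open>auto intro!: AE_I2 order_trans[OF h]\<close>)
  qed measurable
  show s: "sqint (\<lambda>x. rv x * u x)" "sqint (\<lambda>x. rw x * weak_deriv u x)" "sqint (\<lambda>x. rw x * w x)"
    by (rule le, measurable, simp add: energy_density_eq)+
  have c: "continuous_on UNIV (\<lambda>x. 1 / rw x)" "continuous_on UNIV (\<lambda>x. 1 / rv x)"
    using r_pos by (auto intro!: continuous_intros simp: less_imp_neq[THEN not_sym])
  have z: "rw x \<noteq> 0" "rv x \<noteq> 0" for x using r_pos[of x] by auto
  show "locsq u" "locsq (weak_deriv u)" "locsq w"
    using locsq_bdd_mult[OF sqint_imp_locsq[OF s(1)] c(2)] locsq_bdd_mult[OF sqint_imp_locsq[OF s(2)] c(1)]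
      locsq_bdd_mult[OF sqint_imp_locsq[OF s(3)] c(1)] by (simp_all add: z)
qed

lemma AE_lborel_uminus:
  fixes u v :: "real \<Rightarrow> real"
  assumes [measurable]: "u \<in> borel_measurable borel" "v \<in> borel_measurable borel" and "AE x in lborel. u x = v x"
  shows "AE x in lborel. u (- x) = v (- x)"
proof -
  have "AE x in distr lborel borel uminus. u x = v x" unfolding lborel_distr_uminus by (rule assms(3))
  then show ?thesis by (subst (asm) AE_distr_iff) auto
qed

text \<open>Oddness holds only almost everywhere. For the continuous representative the set where
  v(x) + v(-x) = 0 is closed and of full measure, hence contains the origin, and this gives v(0) =
  0.\<close>

lemma energy_space_kink_state:
  assumes e: "(u, w) \<in> energy_space"
  obtains v where "AE x in lborel. v x = u x" "kink_state v (weak_deriv u) w"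
proof -
  note s = energy_space_sqint[OF e]
  obtain v where v: "primitive v (weak_deriv u)" "AE x in lborel. u x = v x"
    by (rule weak_derivative_primitive[OF s(1,5,6)])
  have vc: "continuous_on UNIV v" by (rule primitive_continuous[OF v(1) s(6)])
  have m [measurable]: "u \<in> borel_measurable borel" "v \<in> borel_measurable borel"
    using s(5) vc by (auto intro: locsq_measurable borel_measurable_continuous_onI)
  have "AE x in lborel. u (- x) = - u x" using e by (auto simp: energy_space_def)
  then have "AE x in lborel. x \<in> {x. v x + v (- x) = 0}"
    using v(2) AE_lborel_uminus[OF m v(2)] by eventually_elim simp
  moreover have "closed {x. v x + v (- x) = 0}"
    by (intro closed_Collect_eq continuous_intros vc continuous_on_compose2[OF vc]) auto
  ultimately have "0 \<in> {x. v x + v (- x) = 0}" by (intro mem_closed_if_AE_lebesgue AE_completion) auto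
  then have v0: "v 0 = 0" by simp
  have sv: "sqint (\<lambda>x. rv x * v x)"
  proof (rule sqint_bound[OF s(2), where C=1])
    show "(\<lambda>x. rv x * v x) \<in> borel_measurable borel" using borel_measurable_continuous_onI[OF r_continuous(2)] by measurable
    show "AE x in lborel. \<bar>rv x * v x\<bar> \<le> 1 * \<bar>rv x * u x\<bar>" using v(2) by eventually_elim simp
  qed
  have "kink_state v (weak_deriv u) w"
    by (standard; fact v(1) v0 s(3,4,6,7) sv locsq_continuous[OF vc])
  moreover have "AE x in lborel. v x = u x" using v(2) by eventually_elim simp
  ultimately show thesis using that by blast
qed

lemma state_norm_sq_cong_AE:
  assumes "AE x in lborel. v x = v' x" "v \<in> borel_measurable borel" "v' \<in> borel_measurable borel"
  shows "state_norm_sq v g w = state_norm_sq v' g w"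
proof -
  note [measurable] = assms(2,3) borel_measurable_continuous_onI[OF r_continuous(2)]
  have "(LINT x|lborel. (rv x * v x)\<^sup>2) = (LINT x|lborel. (rv x * v' x)\<^sup>2)"
    by (rule integral_cong_AE) (use assms(1) in \<open>auto intro: AE_mp\<close>)
  then show ?thesis unfolding state_norm_sq_def norm2_sq by simp
qed

text \<open>The norm and both weak equations see the functions through integrals only, so at each
  time \<open>v1 t\<close> can be exchanged for its continuous representative.\<close>

lemma energy_solution_kink_curve:
  assumes sol: "energy_solution v1 v2"
  obtains V where "kink_curve V (\<lambda>t. weak_deriv (v1 t)) v2" "\<And>t. t \<ge> 0 \<Longrightarrow> AE x in lborel. V t x = v1 t x"
    "energy_norm_sq (v1 0) (v2 0) = state_norm_sq (V 0) (weak_deriv (v1 0)) (v2 0)"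
proof -
  let ?g = "\<lambda>t. weak_deriv (v1 t)"
  have es: "(v1 t, v2 t) \<in> energy_space" if "t \<ge> 0" for t using sol that by (simp add: energy_solution_def)
  note s = energy_space_sqint[OF es]
  have "\<forall>t. \<exists>v. t \<ge> 0 \<longrightarrow> (AE x in lborel. v x = v1 t x) \<and> kink_state v (?g t) (v2 t)"
    using energy_space_kink_state[OF es] by metis
  then obtain V where V: "\<And>t. t \<ge> 0 \<Longrightarrow> AE x in lborel. V t x = v1 t x"
    "\<And>t. t \<ge> 0 \<Longrightarrow> kink_state (V t) (?g t) (v2 t)" by metis
  have m: "V t \<in> borel_measurable borel" "v1 t \<in> borel_measurable borel" "v2 t \<in> borel_measurable borel"
    "?g t \<in> borel_measurable borel" if "t \<ge> 0" for t
    using kink_state.meas[OF V(2)[OF that]] locsq_measurable[OF s(5)[OF that]] by simp_all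
  have nd: "energy_norm_sq (\<lambda>x. v1 t x - v1 t' x) (\<lambda>x. v2 t x - v2 t' x)
     = state_norm_sq (\<lambda>x. V t x - V t' x) (\<lambda>x. ?g t x - ?g t' x) (\<lambda>x. v2 t x - v2 t' x)" if t: "t \<ge> 0" "t' \<ge> 0" for t t'
  proof -
    note [measurable] = m[OF t(1)] m[OF t(2)]
    have "energy_norm_sq (\<lambda>x. v1 t x - v1 t' x) (\<lambda>x. v2 t x - v2 t' x)
      = state_norm_sq (\<lambda>x. v1 t x - v1 t' x) (\<lambda>x. ?g t x - ?g t' x) (\<lambda>x. v2 t x - v2 t' x)"
      by (rule energy_norm_sq_eq[OF has_weak_derivative_diff[OF s(1)[OF t(1)] s(1)[OF t(2)]]])
         (simp_all add: right_diff_distrib sqint_diff s(2-4) t)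
    also have "\<dots> = state_norm_sq (\<lambda>x. V t x - V t' x) (\<lambda>x. ?g t x - ?g t' x) (\<lambda>x. v2 t x - v2 t' x)"
      by (rule state_norm_sq_cong_AE) (use V(1)[OF t(1)] V(1)[OF t(2)] in \<open>auto elim: eventually_elim2\<close>)
    finally show ?thesis .
  qed
  have int_eq: "(LINT x|lborel. V t x * \<phi> x) = (LINT x|lborel. v1 t x * \<phi> x)" if t: "t \<ge> 0" and [measurable]: "\<phi> \<in> borel_measurable borel" for t \<phi>
  proof -
    note [measurable] = m[OF t]
    show ?thesis by (rule integral_cong_AE) (use V(1)[OF t] in \<open>auto elim: eventually_mono\<close>)
  qed
  have test_m: "\<phi> \<in> borel_measurable borel" "deriv \<phi> \<in> borel_measurable borel" if "test_function \<phi>" for \<phi>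
    using test_function_deriv[OF that] borel_measurable_continuous_onI by metis+
  have "kink_curve V ?g v2"
  proof (rule kink_curve.intro)
    fix t :: real assume t: "t \<ge> 0"
    note [measurable] = m[OF t]
    show "kink_state (V t) (?g t) (v2 t)" by (rule V(2)[OF t])
    have "((\<lambda>s. energy_norm_sq (\<lambda>x. v1 s x - v1 t x) (\<lambda>x. v2 s x - v2 t x)) \<longlongrightarrow> 0) (at t within {0..})"
      using sol t by (simp add: energy_solution_def)
    moreover have "\<forall>\<^sub>F s in at t within {0..}. energy_norm_sq (\<lambda>x. v1 s x - v1 t x) (\<lambda>x. v2 s x - v2 t x)
      = state_norm_sq (\<lambda>x. V s x - V t x) (\<lambda>x. ?g s x - ?g t x) (\<lambda>x. v2 s x - v2 t x)"
      unfolding eventually_at_filter by (intro always_eventually allI impI nd) (use t in auto)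
    ultimately show "((\<lambda>s. state_norm_sq (\<lambda>x. V s x - V t x) (\<lambda>x. ?g s x - ?g t x) (\<lambda>x. v2 s x - v2 t x)) \<longlongrightarrow> 0) (at t within {0..})"
      by (rule Lim_transform_eventually)
    fix \<phi> assume p: "test_function \<phi>"
    note [measurable] = test_m[OF p]
    have "((\<lambda>s. LINT x|lborel. v1 s x * \<phi> x) has_real_derivative (LINT x|lborel. v2 t x * \<phi> x)) (at t within {0..})"
      using sol t p by (simp add: energy_solution_def)
    then show "((\<lambda>s. LINT x|lborel. V s x * \<phi> x) has_real_derivative (LINT x|lborel. v2 t x * \<phi> x)) (at t within {0..})"
      by (rule has_field_derivative_transform_within[OF _ zero_less_one]) (use t int_eq in auto)
    have "((\<lambda>s. LINT x|lborel. v2 s x * \<phi> x) has_real_derivative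
        (LINT x|lborel. - ?g t x * deriv \<phi> x + src x (v1 t x) (?g t x) * \<phi> x)) (at t within {0..})"
      using sol t p by (simp add: energy_solution_def src_def)
    also have "(LINT x|lborel. - ?g t x * deriv \<phi> x + src x (v1 t x) (?g t x) * \<phi> x)
      = (LINT x|lborel. - ?g t x * deriv \<phi> x + src x (V t x) (?g t x) * \<phi> x)"
    proof (rule integral_cong_AE)
      have [measurable]: "kink \<in> borel_measurable borel" by (rule borel_measurable_continuous_onI[OF kink_continuous])
      show "(\<lambda>x. - ?g t x * deriv \<phi> x + src x (v1 t x) (?g t x) * \<phi> x) \<in> borel_measurable lborel"
        "(\<lambda>x. - ?g t x * deriv \<phi> x + src x (V t x) (?g t x) * \<phi> x) \<in> borel_measurable lborel"
        unfolding src_alt by measurable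
    qed (use V(1)[OF t] in \<open>auto elim: eventually_mono\<close>)
    finally show "((\<lambda>s. LINT x|lborel. v2 s x * \<phi> x) has_real_derivative
        (LINT x|lborel. - ?g t x * deriv \<phi> x + src x (V t x) (?g t x) * \<phi> x)) (at t within {0..})" .
  qed
  moreover have "energy_norm_sq (v1 0) (v2 0) = state_norm_sq (V 0) (?g 0) (v2 0)"
    using energy_norm_sq_eq[OF s(1-4)[OF order_refl] m(3)] state_norm_sq_cong_AE[OF V(1) m(1,2)] by simp
  ultimately show thesis using that V(1) by blast
qed

theorem theorem2p1:
  "\<exists>\<delta>>0. \<forall>v1 v2 :: real \<Rightarrow> real \<Rightarrow> real.
     energy_solution v1 v2 \<and> energy_norm_sq (v1 0) (v2 0) < \<delta> \<longrightarrow>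
       (\<forall>R>0. ((\<lambda>t. LINT r:{-R..R}|lborel.
                  (v2 t r)^2 + (weak_deriv (v1 t) r)^2 + (v1 t r)^2) \<longlongrightarrow> 0) at_top) \<and>
       ((\<lambda>t. LINT r|lborel. min 1 (1 / \<bar>r\<bar>) / sqrt (1 + r^2) * (v1 t r)^2) \<longlongrightarrow> 0) at_top"
proof (intro exI[of _ "(1/400)\<^sup>2 / 1200"] conjI allI impI)
  fix v1 v2 :: "real \<Rightarrow> real \<Rightarrow> real"
  assume *: "energy_solution v1 v2 \<and> energy_norm_sq (v1 0) (v2 0) < (1/400)\<^sup>2 / 1200"
  let ?g = "\<lambda>t. weak_deriv (v1 t)"
  obtain V where cv: "kink_curve V ?g v2" "\<And>t. t \<ge> 0 \<Longrightarrow> AE x in lborel. V t x = v1 t x"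
    "energy_norm_sq (v1 0) (v2 0) = state_norm_sq (V 0) (?g 0) (v2 0)"
    using * energy_solution_kink_curve by blast
  interpret kink_curve V ?g v2 by (rule cv(1))
  let ?l = "\<lambda>t. local_energy (V t) (?g t) (v2 t)"
  \<comment> \<open>This is where the bound on the data comes from:
    \<open>small_for_all_time\<close> with d = (1/400)^2 asks for 6 times the initial norm to be
    below d/200, that is, for an initial norm below d/1200.\<close>
  have small: "nr t < (1/400)\<^sup>2" if "t \<ge> 0" for t
    by (rule small_for_all_time[OF _ _ that]) (use * cv(3) in \<open>simp_all add: power2_eq_square\<close>)
  have l0: "(?l \<longlongrightarrow> 0) at_top" by (rule local_energy_tendsto_zero) (use small less_imp_le in blast)
  have m: "V t \<in> borel_measurable borel" "v1 t \<in> borel_measurable borel" "v2 t \<in> borel_measurable borel"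
    "?g t \<in> borel_measurable borel" if "t \<ge> 0" for t
  proof -
    show "V t \<in> borel_measurable borel" "v2 t \<in> borel_measurable borel" "?g t \<in> borel_measurable borel"
      by (rule kink_state.meas[OF st[OF that]])+
    show "v1 t \<in> borel_measurable borel" using * that by (auto simp: energy_solution_def energy_space_def)
  qed
  have ev: "\<forall>\<^sub>F t in at_top. (t::real) \<ge> 0" by (rule eventually_ge_at_top)
  show "((\<lambda>t. LINT r:{-R..R}|lborel. (v2 t r)^2 + (?g t r)^2 + (v1 t r)^2) \<longlongrightarrow> 0) at_top" if R: "R > 0" for R
  proof (rule tendsto_sandwich[OF always_eventually eventually_mono[OF ev] tendsto_const])
    show "((\<lambda>t. (1 + R\<^sup>2) * ?l t) \<longlongrightarrow> 0) at_top" using tendsto_mult_left[OF l0, of "1 + R\<^sup>2"] by simp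
    fix t :: real assume t: "t \<ge> 0"
    note [measurable] = m[OF t]
    have "(LINT r:{-R..R}|lborel. (v2 t r)^2 + (?g t r)^2 + (v1 t r)^2) = (LINT r:{-R..R}|lborel. (v2 t r)^2 + (?g t r)^2 + (V t r)^2)"
      unfolding set_lebesgue_integral_def
      by (rule integral_cong_AE) (use cv(2)[OF t] in \<open>auto elim: eventually_mono\<close>)
    then show "(LINT r:{-R..R}|lborel. (v2 t r)^2 + (?g t r)^2 + (v1 t r)^2) \<le> (1 + R\<^sup>2) * ?l t"
      using kink_state.local_integral_bound[OF st[OF t] R] by simp
  qed (auto simp: set_lebesgue_integral_def intro!: Bochner_Integration.integral_nonneg)
  show "((\<lambda>t. LINT r|lborel. min 1 (1 / \<bar>r\<bar>) / sqrt (1 + r^2) * (v1 t r)^2) \<longlongrightarrow> 0) at_top"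
  proof (rule tendstoI)
    fix e :: real assume e: "e > 0"
    \<comment> \<open>Chosen so that 1/R \<le> e/2: the tail beyond R costs at most half of
      \<open>e\<close>, and for this fixed R the local energy eventually costs less than the other
      half.\<close>
    define R where "R = 1 + 2 / e"
    have R: "R \<ge> 1" using e by (simp add: R_def)
    have "((\<lambda>t. (1 + R\<^sup>2) * ?l t) \<longlongrightarrow> 0) at_top" using tendsto_mult_left[OF l0, of "1 + R\<^sup>2"] by simp
    then have "\<forall>\<^sub>F t in at_top. (1 + R\<^sup>2) * ?l t < e / 2" by (rule order_tendstoD) (use e in simp)
    then show "\<forall>\<^sub>F t in at_top. dist (LINT r|lborel. min 1 (1 / \<bar>r\<bar>) / sqrt (1 + r^2) * (v1 t r)^2) 0 < e"
      using ev
    proof eventually_elim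
      case (elim t)
      note [measurable] = m[OF elim(2)]
      have eq: "(LINT r|lborel. min 1 (1 / \<bar>r\<bar>) / sqrt (1 + r^2) * (v1 t r)^2) = (LINT r|lborel. min 1 (1 / \<bar>r\<bar>) / sqrt (1 + r^2) * (V t r)^2)"
        by (rule integral_cong_AE) (use cv(2)[OF elim(2)] in \<open>auto elim: eventually_mono\<close>)
      have "nr t \<le> 1" using small[OF elim(2)] by (simp add: power2_eq_square)
      then have "nr t / R \<le> 1 / R" using R by (intro divide_right_mono) auto
      also have "1 / R \<le> e / 2" using e by (simp add: R_def field_simps)
      finally have "(LINT r|lborel. min 1 (1 / \<bar>r\<bar>) / sqrt (1 + r^2) * (V t r)^2) < e"
        using kink_state.weighted_integral_bound[OF st[OF elim(2)] R] elim(1) by linarith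
      moreover have "0 \<le> (LINT r|lborel. min 1 (1 / \<bar>r\<bar>) / sqrt (1 + r^2) * (V t r)^2)"
        by (rule Bochner_Integration.integral_nonneg) simp
      ultimately show ?case unfolding eq by simp
    qed
  qed
qed simp

end
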